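(* Let $n\ge 1$ and let $G$ be a connected Lie group locally isomorphic to $SO(3,2n)$. Let $K_1$ be the analytic subgroup of $G$ corresponding to the ideal $\mathfrak{so}(3)$ of the maximal compactly embedded subalgebra $\mathfrak k\cong\mathfrak{so}(3)\oplus\mathfrak{so}(2n)$ of $\mathfrak g$. Then no irreducible square integrable representation of $G$ has an admissible restriction to $K_1$.
   Context: Groups are connected noncompact simple matrix Lie groups. Irreducible square integrable representations are the irreducible unitary representations whose matrix coefficients are square integrable with respect to a Haar measure on $G$. A unitary representation of $G$ has admissible restriction to a closed subgroup if its restriction is a discrete Hilbert sum of irreducible unitary representations of the subgroup, each occurring with finite multiplicity. The ideal $\mathfrak{so}(3)$ is the one coming from the first three coordinates (the factor "$SO(3)$" of $SO(3)\times SO(2n)$). *)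

theory Defs
  imports "HOL-Analysis.Analysis" "HOL-Algebra.Generated_Groups"
begin

subsection \<open>Matrix Lie groups and their Lie algebras\<close>

text \<open>The products \<open>*\<close> and \<open>^\<close>, and hence the library's \<open>exp\<close>, are componentwise on
  the type of matrices, so the matrix exponential is defined from its power series in \<open>**\<close>.\<close>

definition mexp :: "'a::real_normed_field^'m^'m \<Rightarrow> 'a^'m^'m" where
  "mexp X = (\<Sum>k. (1 / fact k) *\<^sub>R (((**) X ^^ k) (mat 1)))"

definition GL :: "('a::real_normed_field^'m^'m) monoid" where
  "GL = \<lparr>carrier = {A. invertible A}, monoid.mult = (**), one = mat 1\<rparr>"

definition matrix_lie_group :: "('a::real_normed_field^'m^'m) set \<Rightarrow> bool" where
  "matrix_lie_group G \<longleftrightarrow> subgroup G GL \<and> closedin (top_of_set (carrier GL)) G"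

definition lie_algebra :: "('a::real_normed_field^'m^'m) set \<Rightarrow> ('a^'m^'m) set" where
  "lie_algebra G = {X. \<forall>t::real. mexp (t *\<^sub>R X) \<in> G}"

definition lie_subalgebra :: "('a::real_normed_field^'m^'m) set \<Rightarrow> ('a^'m^'m) set \<Rightarrow> bool" where
  "lie_subalgebra \<gg> \<hh> \<longleftrightarrow>
     \<hh> \<subseteq> \<gg> \<and> subspace \<hh> \<and> (\<forall>X\<in>\<hh>. \<forall>Y\<in>\<hh>. X ** Y - Y ** X \<in> \<hh>)"

text \<open>The connected Lie subgroup with Lie algebra \<open>\<hh>\<close> is generated by the exponentials.\<close>

definition analytic_subgroup :: "('a::real_normed_field^'m^'m) set \<Rightarrow> ('a^'m^'m) set" where
  "analytic_subgroup \<hh> = generate GL (mexp ` \<hh>)"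

text \<open>\<open>\<hh>\<close> is compactly embedded in \<open>\<gg>\<close> if the analytic subgroup of \<open>Int(\<gg>)\<close> with Lie
  algebra \<open>ad\<^sub>\<gg>(\<hh>)\<close> is compact. Since \<open>exp (ad X) = Ad (exp X)\<close>, this subgroup consists of the
  restrictions to \<open>\<gg>\<close> of the maps \<open>Ad a\<close>, with \<open>a\<close> in the analytic subgroup of \<open>\<hh>\<close>. Its
  topology is that of pointwise convergence, i.e. the product topology of the function type.\<close>

definition compactly_embedded :: "('a::real_normed_field^'m^'m) set \<Rightarrow> ('a^'m^'m) set \<Rightarrow> bool" where
  "compactly_embedded \<gg> \<hh> \<longleftrightarrow> lie_subalgebra \<gg> \<hh> \<and>
     compact ((\<lambda>a. \<lambda>Y\<in>\<gg>. a ** Y ** matrix_inv a) ` analytic_subgroup \<hh>)"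

definition maximal_compactly_embedded ::
    "('a::real_normed_field^'m^'m) set \<Rightarrow> ('a^'m^'m) set \<Rightarrow> bool" where
  "maximal_compactly_embedded \<gg> \<kk> \<longleftrightarrow> compactly_embedded \<gg> \<kk> \<and>
     (\<forall>\<hh>. compactly_embedded \<gg> \<hh> \<and> \<kk> \<subseteq> \<hh> \<longrightarrow> \<hh> = \<kk>)"

text \<open>A local isomorphism is a homeomorphism between neighbourhoods of the identities which,
  like its inverse, is multiplicative wherever this makes sense. Between Lie groups such a map
  is automatically analytic near the identity. Outside the neighbourhood, \<open>f\<close> is arbitrary.\<close>

definition local_isomorphism ::
    "('a::real_normed_field^'m^'m) set \<Rightarrow> ('b::real_normed_field^'l^'l) set \<Rightarrow>
     ('a^'m^'m \<Rightarrow> 'b^'l^'l) \<Rightarrow> bool" where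
  "local_isomorphism G H f \<longleftrightarrow> (\<exists>U V g.
     openin (top_of_set G) U \<and> mat 1 \<in> U \<and> openin (top_of_set H) V \<and> mat 1 \<in> V \<and>
     homeomorphism U V f g \<and>
     (\<forall>x\<in>U. \<forall>y\<in>U. x ** y \<in> U \<longrightarrow> f (x ** y) = f x ** f y) \<and>
     (\<forall>x\<in>V. \<forall>y\<in>V. x ** y \<in> V \<longrightarrow> g (x ** y) = g x ** g y))"

text \<open>The differential at the identity of a local homomorphism \<open>f\<close>, as a map of Lie algebras.\<close>

definition lie_differential ::
    "('a::real_normed_field^'m^'m \<Rightarrow> 'b::real_normed_field^'l^'l) \<Rightarrow> 'a^'m^'m \<Rightarrow> 'b^'l^'l" where
  "lie_differential f X =
     (THE Y. \<forall>\<^sub>F t::real in at 0. f (mexp (t *\<^sub>R X)) = mexp (t *\<^sub>R Y))"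

subsection \<open>The group \<open>SO(p,q)\<close>, with \<open>p = CARD('p)\<close> and \<open>q = CARD('q)\<close>\<close>

definition signature_form :: "real^('p::finite + 'q::finite)^('p + 'q)" where
  "signature_form = (\<chi> i j. if i = j then (case i of Inl _ \<Rightarrow> 1 | Inr _ \<Rightarrow> -1) else 0)"

definition SO_group :: "(real^('p::finite + 'q::finite)^('p + 'q)) set" where
  "SO_group = {A. transpose A ** signature_form ** A = signature_form \<and> det A = 1}"

text \<open>The block diagonal subalgebra \<open>so(p) \<oplus> so(q)\<close> of \<open>so(p,q)\<close>, and its ideal \<open>so(p)\<close>.\<close>

definition so_blocks :: "(real^('p::finite + 'q::finite)^('p + 'q)) set" where
  "so_blocks = {X \<in> lie_algebra SO_group.
     \<forall>i j. X $ Inl i $ Inr j = 0 \<and> X $ Inr j $ Inl i = 0}"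

definition so_first_block :: "(real^('p::finite + 'q::finite)^('p + 'q)) set" where
  "so_first_block = {X \<in> so_blocks. \<forall>i j. X $ Inr i $ Inr j = 0}"

subsection \<open>Complex Hilbert spaces\<close>

text \<open>The norm, metric and real inner product are those underlying the Hermitian inner product,
  which is linear in its first argument; positivity is inherited from the real inner product.\<close>

class complex_hilbert_space = real_inner + complete_space +
  fixes scaleC :: "complex \<Rightarrow> 'a \<Rightarrow> 'a"
    and cinner :: "'a \<Rightarrow> 'a \<Rightarrow> complex"
  assumes scaleC_add_right: "scaleC a (x + y) = scaleC a x + scaleC a y"
    and scaleC_add_left: "scaleC (a + b) x = scaleC a x + scaleC b x"
    and scaleC_scaleC: "scaleC a (scaleC b x) = scaleC (a * b) x"
    and scaleC_of_real: "scaleC (complex_of_real r) x = r *\<^sub>R x"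
    and cinner_add_left: "cinner (x + y) z = cinner x z + cinner y z"
    and cinner_scaleC_left: "cinner (scaleC a x) y = a * cinner x y"
    and cinner_commute: "cinner x y = cnj (cinner y x)"
    and Re_cinner: "Re (cinner x y) = x \<bullet> y"

definition complex_subspace :: "'h::complex_hilbert_space set \<Rightarrow> bool" where
  "complex_subspace W \<longleftrightarrow> subspace W \<and> (\<forall>a. \<forall>x\<in>W. scaleC a x \<in> W)"

definition complex_linear_on ::
    "'h::complex_hilbert_space set \<Rightarrow> ('h \<Rightarrow> 'h) \<Rightarrow> bool" where
  "complex_linear_on W T \<longleftrightarrow> (\<forall>x\<in>W. \<forall>y\<in>W. T (x + y) = T x + T y) \<and>
     (\<forall>a. \<forall>x\<in>W. T (scaleC a x) = scaleC a (T x))"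

subsection \<open>Unitary representations\<close>

definition unitary :: "('h::complex_hilbert_space \<Rightarrow> 'h) \<Rightarrow> bool" where
  "unitary T \<longleftrightarrow> complex_linear_on UNIV T \<and> surj T \<and> (\<forall>x y. cinner (T x) (T y) = cinner x y)"

definition unitary_rep ::
    "('a::real_normed_field^'m^'m) set \<Rightarrow>
     ('a^'m^'m \<Rightarrow> 'h::complex_hilbert_space \<Rightarrow> 'h) \<Rightarrow> bool" where
  "unitary_rep G \<pi> \<longleftrightarrow> (\<forall>a\<in>G. unitary (\<pi> a)) \<and>
     (\<forall>a\<in>G. \<forall>b\<in>G. \<pi> (a ** b) = \<pi> a \<circ> \<pi> b) \<and>
     (\<forall>v. continuous_on G (\<lambda>a. \<pi> a v))"

definition closed_invariant ::
    "('a::real_normed_field^'m^'m) set \<Rightarrow>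
     ('a^'m^'m \<Rightarrow> 'h::complex_hilbert_space \<Rightarrow> 'h) \<Rightarrow> 'h set \<Rightarrow> bool" where
  "closed_invariant K \<pi> W \<longleftrightarrow> complex_subspace W \<and> closed W \<and> (\<forall>a\<in>K. \<pi> a ` W \<subseteq> W)"

definition irreducible_on ::
    "('a::real_normed_field^'m^'m) set \<Rightarrow>
     ('a^'m^'m \<Rightarrow> 'h::complex_hilbert_space \<Rightarrow> 'h) \<Rightarrow> 'h set \<Rightarrow> bool" where
  "irreducible_on K \<pi> W \<longleftrightarrow> closed_invariant K \<pi> W \<and> W \<noteq> {0} \<and>
     (\<forall>W'. closed_invariant K \<pi> W' \<and> W' \<subseteq> W \<longrightarrow> W' = {0} \<or> W' = W)"

definition irreducible_unitary_rep ::
    "('a::real_normed_field^'m^'m) set \<Rightarrow>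
     ('a^'m^'m \<Rightarrow> 'h::complex_hilbert_space \<Rightarrow> 'h) \<Rightarrow> bool" where
  "irreducible_unitary_rep G \<pi> \<longleftrightarrow> unitary_rep G \<pi> \<and> irreducible_on G \<pi> UNIV"

definition haar_measure ::
    "('a::real_normed_field^'m^'m) set \<Rightarrow> ('a^'m^'m) measure \<Rightarrow> bool" where
  "haar_measure G \<mu> \<longleftrightarrow> sets \<mu> = sets (restrict_space borel G) \<and>
     (\<forall>a\<in>G. distr \<mu> \<mu> ((**) a) = \<mu>) \<and>
     (\<forall>C. C \<subseteq> G \<and> compact C \<longrightarrow> emeasure \<mu> C < \<infinity>) \<and>
     emeasure \<mu> G \<noteq> 0"

definition square_integrable_rep ::
    "('a::real_normed_field^'m^'m) set \<Rightarrow>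
     ('a^'m^'m \<Rightarrow> 'h::complex_hilbert_space \<Rightarrow> 'h) \<Rightarrow> bool" where
  "square_integrable_rep G \<pi> \<longleftrightarrow> (\<exists>\<mu>. haar_measure G \<mu> \<and>
     (\<forall>v w. integrable \<mu> (\<lambda>a. (cmod (cinner (\<pi> a v) w))\<^sup>2)))"

definition equivalent_on ::
    "('a::real_normed_field^'m^'m) set \<Rightarrow>
     ('a^'m^'m \<Rightarrow> 'h::complex_hilbert_space \<Rightarrow> 'h) \<Rightarrow> 'h set \<Rightarrow> 'h set \<Rightarrow> bool" where
  "equivalent_on K \<pi> W W' \<longleftrightarrow> (\<exists>T. bij_betw T W W' \<and> complex_linear_on W T \<and>
     (\<forall>x\<in>W. \<forall>y\<in>W. cinner (T x) (T y) = cinner x y) \<and>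
     (\<forall>a\<in>K. \<forall>x\<in>W. T (\<pi> a x) = \<pi> a (T x)))"

text \<open>\<open>\<W>\<close> is the set of summands of a Hilbert sum decomposition of the restriction to \<open>K\<close>.
  Distinct summands may be equivalent; the last condition bounds the multiplicity of each
  irreducible representation that occurs.\<close>

definition admissible_restriction ::
    "('a::real_normed_field^'m^'m) set \<Rightarrow>
     ('a^'m^'m \<Rightarrow> 'h::complex_hilbert_space \<Rightarrow> 'h) \<Rightarrow> bool" where
  "admissible_restriction K \<pi> \<longleftrightarrow> (\<exists>\<W>.
     (\<forall>W\<in>\<W>. irreducible_on K \<pi> W) \<and>
     (\<forall>W\<in>\<W>. \<forall>W'\<in>\<W>. W \<noteq> W' \<longrightarrow> (\<forall>x\<in>W. \<forall>y\<in>W'. cinner x y = 0)) \<and>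
     closure (span (\<Union>\<W>)) = UNIV \<and>
     (\<forall>W\<in>\<W>. finite {W' \<in> \<W>. equivalent_on K \<pi> W W'}))"

end

theory Submission
  imports Defs "HOL-Computational_Algebra.Fundamental_Theorem_Algebra"
begin

text \<open>The representation is restricted to a subgroup locally isomorphic to \<open>SO(3,1)\<close>, with Lie
  algebra spanned by \<open>L\<^sub>1, L\<^sub>2, L\<^sub>3\<close> (the ideal \<open>so(3)\<close>) and three boosts \<open>B\<^sub>1, B\<^sub>2, B\<^sub>3\<close>; the group
  \<open>SO(3,1)\<close> has no discrete series. Smoothing by \<open>K\<^sub>1\<close>-finite test functions yields a space of
  differentiable vectors and in it a highest weight vector for \<open>so(3)\<close>. If the restriction to \<open>K\<^sub>1\<close>
  were admissible, the space of highest weight vectors of a given weight would be finite-dimensional,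
  so it would contain a joint eigenvector of the two Casimir operators of \<open>so(3,1)\<close>. The coefficients
  of \<open>exp (t B\<^sub>3)\<close> on the \<open>K\<^sub>1\<close>-type it generates then satisfy an explicit system of differential
  equations, which excludes decay faster than \<open>exp (-t)\<close>. On the other hand, square integrability
  forces this decay: for large \<open>t\<close>, a compact set \<open>C\<close> has about \<open>exp (2t)\<close> disjoint translates
  \<open>k exp (t B\<^sub>3) C\<close> with \<open>k \<in> K\<^sub>1\<close>, and these translates escape to infinity.\<close>

section \<open>Complex Hilbert spaces\<close>

text \<open>The Casimir operators of \<open>so(3,1)\<close> are not central for
  \<open>so(3,2n)\<close>, so irreducibility of the representation yields no eigenvector for them.
  Both, however, act on the highest weight spaces of \<open>so(3)\<close>, and this is the one place
  where admissibility enters. The rate \<open>exp (-t)\<close> is the threshold because Haar measure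
  of \<open>SO(3,1)\<close> grows like \<open>exp (2t)\<close>. A coefficient that is square
  integrable on \<open>G\<close> need not be so on the subgroup; the decay is therefore obtained
  pointwise, by smearing over a compact neighbourhood of the identity in \<open>G\<close>. The test
  functions must be differentiable, finite under \<open>K\<^sub>1\<close> and compactly supported in
  \<open>G\<close>, which is closed among invertible matrices but not among all matrices.
  Polynomials times a flat cutoff in a \<open>K\<^sub>1\<close>-invariant quadratic form meet the
  first two demands; a cutoff in the modulus of the determinant, constant along all translations in
  use, meets the third. \<open>G\<close> is known only through a local isomorphism, so after the
  transport of \<open>so(3,1)\<close> the argument uses its brackets and linear independence
  alone.\<close>

instance complex_hilbert_space \<subseteq> banach ..

lemma cinner_add_right: "cinner x (y + z) = cinner x y + cinner x (z::'h::complex_hilbert_space)"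
  by (metis cinner_add_left cinner_commute complex_cnj_add)

lemma cinner_scaleC_right: "cinner x (scaleC a y) = cnj a * cinner x (y::'h::complex_hilbert_space)"
  by (metis cinner_commute cinner_scaleC_left complex_cnj_mult)

lemma Im_cinner: "Im (cinner x y) = x \<bullet> scaleC \<i> (y::'h::complex_hilbert_space)"
proof -
  have "Re (cinner x (scaleC \<i> y)) = Im (cinner x y)"
    by (simp add: cinner_scaleC_right)
  then show ?thesis by (simp add: Re_cinner)
qed

lemma scaleC_scaleR: "scaleC a (r *\<^sub>R x) = r *\<^sub>R scaleC a (x::'h::complex_hilbert_space)"
  by (metis mult.commute scaleC_of_real scaleC_scaleC)

lemma scaleC_one [simp]: "scaleC 1 x = (x::'h::complex_hilbert_space)"
  using scaleC_of_real[of 1 x] by simp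

lemma scaleC_zero_left [simp]: "scaleC 0 x = (0::'h::complex_hilbert_space)"
  using scaleC_of_real[of 0 x] by simp

lemma scaleC_zero_right [simp]: "scaleC a 0 = (0::'h::complex_hilbert_space)"
  by (metis add_cancel_right_right scaleC_add_right)

lemma scaleC_minus_right: "scaleC a (- x) = - scaleC a (x::'h::complex_hilbert_space)"
  using scaleC_add_right[of a x "- x"] by (simp add: eq_neg_iff_add_eq_0 add.commute)

lemma scaleC_minus_left: "scaleC (- a) x = - scaleC a (x::'h::complex_hilbert_space)"
  using scaleC_add_left[of a "- a" x] by (simp add: eq_neg_iff_add_eq_0 add.commute)

lemma scaleC_diff_right: "scaleC a (x - y) = scaleC a x - scaleC a (y::'h::complex_hilbert_space)"
  using scaleC_add_right[of a x "- y"] by (simp add: scaleC_minus_right)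

lemma scaleC_diff_left: "scaleC (a - b) x = scaleC a x - scaleC b (x::'h::complex_hilbert_space)"
  using scaleC_add_left[of a "- b" x] by (simp add: scaleC_minus_left)

lemma scaleC_sum_right: "scaleC a (sum f A) = (\<Sum>i\<in>A. scaleC a (f i :: 'h::complex_hilbert_space))"
  by (induction A rule: infinite_finite_induct) (auto simp: scaleC_add_right)

lemma cinner_real_scaleR_left: "cinner (r *\<^sub>R x) y = of_real r * cinner x (y::'h::complex_hilbert_space)"
  by (metis cinner_scaleC_left scaleC_of_real)

lemma cinner_real_scaleR_right: "cinner x (r *\<^sub>R y) = of_real r * cinner x (y::'h::complex_hilbert_space)"
  by (metis cinner_scaleC_right complex_cnj_complex_of_real scaleC_of_real)

lemma cinner_self: "cinner x x = complex_of_real ((norm (x::'h::complex_hilbert_space))\<^sup>2)"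
proof (rule complex_eqI)
  show "Re (cinner x x) = Re (complex_of_real ((norm x)\<^sup>2))"
    by (simp add: Re_cinner dot_square_norm)
  have "Im (cinner x x) = - Im (cinner x x)"
    by (subst cinner_commute) simp
  then show "Im (cinner x x) = Im (complex_of_real ((norm x)\<^sup>2))" by simp
qed

lemma norm_scaleC: "norm (scaleC a x) = cmod a * norm (x::'h::complex_hilbert_space)"
proof -
  have "complex_of_real ((norm (scaleC a x))\<^sup>2) = a * cnj a * complex_of_real ((norm x)\<^sup>2)"
    by (simp add: cinner_self[symmetric] cinner_scaleC_left cinner_scaleC_right ac_simps del: of_real_power)
  also have "\<dots> = complex_of_real ((cmod a * norm x)\<^sup>2)"
    by (simp add: complex_norm_square[symmetric] power_mult_distrib)
  finally have "(norm (scaleC a x))\<^sup>2 = (cmod a * norm x)\<^sup>2" by (simp only: of_real_eq_iff)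
  then show ?thesis by (simp add: power2_eq_iff_nonneg)
qed

text \<open>Multiplying \<open>x\<close> by a unit scalar makes the inner product real and
  nonnegative; the real Cauchy-Schwarz inequality then applies.\<close>

lemma cinner_bound: "cmod (cinner x y) \<le> norm x * norm (y::'h::complex_hilbert_space)"
proof -
  define c where "c = cinner x y"
  show ?thesis
  proof (cases "c = 0")
    case False
    define u where "u = cnj c / of_real (cmod c)"
    have "cmod u = 1" using False by (simp add: u_def norm_divide)
    have "cinner (scaleC u x) y = of_real (cmod c)"
      using False by (simp add: u_def cinner_scaleC_left c_def[symmetric] complex_norm_square
        power2_eq_square field_simps flip: of_real_mult)
        (metis complex_norm_square mult.commute power2_eq_square of_real_mult)
    then have "cmod c = scaleC u x \<bullet> y" by (metis Re_cinner Re_complex_of_real)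
    also have "\<dots> \<le> norm (scaleC u x) * norm y" by (rule norm_cauchy_schwarz)
    finally show ?thesis using \<open>cmod u = 1\<close> by (simp add: norm_scaleC c_def)
  qed (simp add: c_def)
qed

interpretation cinner: bounded_bilinear "cinner :: 'h::complex_hilbert_space \<Rightarrow> 'h \<Rightarrow> complex"
proof
  show "\<exists>K. \<forall>a b. norm (cinner (a::'h) b) \<le> norm a * norm b * K"
    by (intro exI[of _ 1]) (simp add: cinner_bound)
qed (simp_all add: cinner_add_left cinner_add_right cinner_real_scaleR_left cinner_real_scaleR_right scaleR_conv_of_real)

interpretation scaleC: bounded_bilinear "scaleC :: complex \<Rightarrow> 'h \<Rightarrow> 'h::complex_hilbert_space"
proof
  show "\<exists>K. \<forall>a b. norm (scaleC a (b::'h)) \<le> norm a * norm b * K"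
    by (intro exI[of _ 1]) (simp add: norm_scaleC)
  show "scaleC (r *\<^sub>R a) b = r *\<^sub>R scaleC a (b::'h)" for r a b
    by (metis scaleC_of_real scaleC_scaleC scaleR_conv_of_real)
qed (simp_all add: scaleC_add_left scaleC_add_right scaleC_scaleR)

lemma cinner_eq_zero_iff: "cinner x x = 0 \<longleftrightarrow> x = (0::'h::complex_hilbert_space)"
  by (simp add: cinner_self)

lemma complex_subspace_0: "complex_subspace W \<Longrightarrow> 0 \<in> W"
  and complex_subspace_add: "complex_subspace W \<Longrightarrow> x \<in> W \<Longrightarrow> y \<in> W \<Longrightarrow> x + y \<in> W"
  and complex_subspace_scaleC: "complex_subspace W \<Longrightarrow> x \<in> W \<Longrightarrow> scaleC a x \<in> W"
  and complex_subspace_diff: "complex_subspace W \<Longrightarrow> x \<in> W \<Longrightarrow> y \<in> W \<Longrightarrow> x - y \<in> W"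
  and complex_subspace_minus: "complex_subspace W \<Longrightarrow> x \<in> W \<Longrightarrow> - x \<in> W"
  and complex_subspace_scaleR: "complex_subspace W \<Longrightarrow> x \<in> W \<Longrightarrow> r *\<^sub>R x \<in> W"
  unfolding complex_subspace_def
  by (auto intro: subspace_0 subspace_add subspace_diff subspace_neg subspace_scale)

lemma complex_subspace_sum:
  "complex_subspace W \<Longrightarrow> (\<And>i. i \<in> A \<Longrightarrow> f i \<in> W) \<Longrightarrow> sum f A \<in> W"
  unfolding complex_subspace_def by (auto intro: subspace_sum)

lemma complex_subspaceI:
  assumes "0 \<in> W" "\<And>x y. x \<in> W \<Longrightarrow> y \<in> W \<Longrightarrow> x + y \<in> W" "\<And>a x. x \<in> W \<Longrightarrow> scaleC a x \<in> W"
  shows "complex_subspace W"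
  unfolding complex_subspace_def subspace_def using assms by (metis scaleC_of_real)

subsection \<open>Orthogonal projections and the Riesz representation\<close>

text \<open>A minimizing sequence for the distance is Cauchy by the parallelogram law. In this real
  form the result serves both the Riesz representation and, through real and imaginary parts, the
  complex projection.\<close>

lemma orthogonal_projection_exists:
  fixes W :: "'h::{real_inner,complete_space} set"
  assumes W: "subspace W" "closed W"
  shows "\<exists>p\<in>W. \<forall>w\<in>W. (x - p) \<bullet> w = 0"
proof -
  define d where "d = (INF w\<in>W. (norm (x - w))\<^sup>2)"
  have ne: "W \<noteq> {}" using subspace_0[OF W(1)] by auto
  have bdd: "bdd_below ((\<lambda>w. (norm (x - w))\<^sup>2) ` W)" by (auto intro!: bdd_belowI2[of _ 0])
  have d_le: "d \<le> (norm (x - w))\<^sup>2" if "w \<in> W" for w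
    unfolding d_def by (rule cINF_lower[OF bdd that])
  have "\<exists>w\<in>W. (norm (x - w))\<^sup>2 < d + 1 / real (Suc n)" for n
    using cINF_less_iff[OF ne bdd, of "d + 1 / real (Suc n)"] by (simp add: d_def)
  then obtain w where w: "\<And>n. w n \<in> W" "\<And>n. (norm (x - w n))\<^sup>2 < d + 1 / real (Suc n)" by metis
  have para: "(norm (w m - w n))\<^sup>2 \<le> 2 / real (Suc m) + 2 / real (Suc n)" for m n
  proof -
    have mid: "(1/2) *\<^sub>R (w m + w n) \<in> W" using W w by (intro subspace_scale subspace_add) auto
    have "(norm (w m - w n))\<^sup>2 = 2 * (norm (x - w m))\<^sup>2 + 2 * (norm (x - w n))\<^sup>2
        - 4 * (norm (x - (1/2) *\<^sub>R (w m + w n)))\<^sup>2"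
      unfolding power2_norm_eq_inner by (simp add: algebra_simps inner_commute)
    also have "\<dots> \<le> 2 * (d + 1 / real (Suc m)) + 2 * (d + 1 / real (Suc n)) - 4 * d"
      by (intro diff_mono add_mono mult_left_mono less_imp_le[OF w(2)] d_le[OF mid]) auto
    finally show ?thesis by (simp add: algebra_simps)
  qed
  have "Cauchy w"
  proof (rule metric_CauchyI)
    fix e :: real assume "e > 0"
    then obtain N where N: "4 / e\<^sup>2 < real N" using reals_Archimedean2 by blast
    have "dist (w m) (w n) < e" if "m \<ge> N" "n \<ge> N" for m n
    proof -
      have b: "2 / real (Suc k) < e\<^sup>2 / 2" if "k \<ge> N" for k
      proof -
        have "4 / e\<^sup>2 < real (Suc k)" using N that by linarith
        then show ?thesis using \<open>e > 0\<close> by (simp add: field_simps)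
      qed
      have "(norm (w m - w n))\<^sup>2 < e\<^sup>2" using para[of m n] b[OF that(1)] b[OF that(2)] by linarith
      then show ?thesis using \<open>e > 0\<close> by (simp add: dist_norm power2_less_imp_less)
    qed
    then show "\<exists>M. \<forall>m\<ge>M. \<forall>n\<ge>M. dist (w m) (w n) < e" by blast
  qed
  then obtain p where p: "w \<longlonglongrightarrow> p" using Cauchy_convergent_iff convergent_def by blast
  have pW: "p \<in> W" using closed_sequentially[OF W(2)] w(1) p by blast
  have "(\<lambda>n. (norm (x - w n))\<^sup>2) \<longlonglongrightarrow> (norm (x - p))\<^sup>2" by (intro tendsto_intros p)
  moreover have "(\<lambda>n. d + 1 / real (Suc n)) \<longlonglongrightarrow> d + 0"
    by (intro tendsto_intros LIMSEQ_Suc lim_1_over_n)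
  ultimately have pd: "(norm (x - p))\<^sup>2 \<le> d"
    using w(2) by (intro LIMSEQ_le[where X="\<lambda>n. (norm (x - w n))\<^sup>2"]) (auto intro: less_imp_le)
  have "(x - p) \<bullet> u = 0" if u: "u \<in> W" for u
  proof (cases "u = 0")
    case False
    \<comment> \<open>The minimizer along the line \<open>p + t u\<close>; there the squared
      distance drops by the square of the inner product over \<open>u \<bullet> u\<close>.\<close>
    define t where "t = ((x - p) \<bullet> u) / (u \<bullet> u)"
    have "p + t *\<^sub>R u \<in> W" using W pW u by (intro subspace_add subspace_scale)
    then have "(norm (x - p))\<^sup>2 \<le> (norm (x - (p + t *\<^sub>R u)))\<^sup>2" by (rule order_trans[OF pd d_le])
    also have "\<dots> = (norm (x - p))\<^sup>2 - 2 * t * ((x - p) \<bullet> u) + t * t * (u \<bullet> u)"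
      unfolding power2_norm_eq_inner by (simp add: algebra_simps inner_commute)
    finally have "0 \<le> - 2 * t * ((x - p) \<bullet> u) + t * t * (u \<bullet> u)" by simp
    also have "\<dots> = - (((x - p) \<bullet> u)\<^sup>2 / (u \<bullet> u))"
      using False by (simp add: t_def power2_eq_square field_simps)
    finally have "((x - p) \<bullet> u)\<^sup>2 / (u \<bullet> u) \<le> 0" by simp
    moreover have "u \<bullet> u > 0" using False by simp
    ultimately have "((x - p) \<bullet> u)\<^sup>2 \<le> 0" by (simp add: divide_le_0_iff)
    then show ?thesis by simp
  qed simp
  then show ?thesis using pW by blast
qed

text \<open>The orthogonal complement of the kernel is a line, spanned by the residual
  \<open>z - p\<close> of any \<open>z\<close> outside the kernel.\<close>

lemma riesz_representation:
  fixes \<phi> :: "'h::{real_inner,complete_space} \<Rightarrow> real"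
  assumes "bounded_linear \<phi>"
  shows "\<exists>y. \<forall>w. \<phi> w = y \<bullet> w"
proof (cases "\<forall>w. \<phi> w = 0")
  case True then show ?thesis by (intro exI[of _ 0]) simp
next
  case False
  interpret \<phi>: bounded_linear \<phi> by fact
  obtain z where z: "\<phi> z \<noteq> 0" using False by blast
  define W where "W = {w. \<phi> w = 0}"
  have "subspace W" unfolding W_def subspace_def by (auto simp: \<phi>.add \<phi>.scaleR)
  moreover have "closed W" unfolding W_def
    by (intro closed_Collect_eq continuous_intros linear_continuous_on \<phi>.bounded_linear_axioms)
  ultimately obtain p where p: "p \<in> W" "\<And>w. w \<in> W \<Longrightarrow> (z - p) \<bullet> w = 0"
    using orthogonal_projection_exists by blast
  define u where "u = z - p"
  have u: "\<phi> u = \<phi> z" using p(1) by (simp add: u_def \<phi>.diff W_def)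
  then have "u \<noteq> 0" using z by auto
  have "\<phi> w = ((\<phi> u / (u \<bullet> u)) *\<^sub>R u) \<bullet> w" for w
  proof -
    have "w - (\<phi> w / \<phi> u) *\<^sub>R u \<in> W" using u z by (simp add: W_def \<phi>.diff \<phi>.scaleR)
    then have "u \<bullet> (w - (\<phi> w / \<phi> u) *\<^sub>R u) = 0" using p(2) by (simp add: u_def)
    then show ?thesis using u z \<open>u \<noteq> 0\<close> by (simp add: inner_diff_right field_simps)
  qed
  then show ?thesis by blast
qed

definition proj :: "'h::complex_hilbert_space set \<Rightarrow> 'h \<Rightarrow> 'h" where
  "proj W x = (SOME p. p \<in> W \<and> (\<forall>w\<in>W. cinner (x - p) w = 0))"

lemma
  fixes W :: "'h::complex_hilbert_space set"
  assumes W: "complex_subspace W" "closed W"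
  shows proj_in: "proj W x \<in> W" and proj_orth: "w \<in> W \<Longrightarrow> cinner (x - proj W x) w = 0"
proof -
  obtain p where p: "p \<in> W" "\<And>w. w \<in> W \<Longrightarrow> (x - p) \<bullet> w = 0"
    using orthogonal_projection_exists[of W x] W unfolding complex_subspace_def by blast
  \<comment> \<open>Real orthogonality to \<open>w\<close> and to \<open>\<i> w\<close>, both in
    \<open>W\<close>, amounts to complex orthogonality to \<open>w\<close>.\<close>
  have "cinner (x - p) w = 0" if "w \<in> W" for w
    using p(2)[OF that] p(2)[OF complex_subspace_scaleC[OF W(1) that]]
    by (simp add: complex_eq_iff Re_cinner Im_cinner)
  with p(1) have "\<exists>p. p \<in> W \<and> (\<forall>w\<in>W. cinner (x - p) w = 0)" by blast
  from someI_ex[OF this] show "proj W x \<in> W" "w \<in> W \<Longrightarrow> cinner (x - proj W x) w = 0"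
    unfolding proj_def by blast+
qed

lemma proj_unique:
  assumes W: "complex_subspace W" "closed W" and "p \<in> W" "\<And>w. w \<in> W \<Longrightarrow> cinner (x - p) w = 0"
  shows "proj W x = p"
proof -
  have m: "proj W x - p \<in> W" using proj_in[OF W] assms(3) by (rule complex_subspace_diff[OF W(1)])
  have "cinner (proj W x - p) (proj W x - p) = cinner (x - p) (proj W x - p) - cinner (x - proj W x) (proj W x - p)"
    by (simp add: cinner.diff_left)
  also have "\<dots> = 0" using assms(4)[OF m] proj_orth[OF W m] by simp
  finally show ?thesis by (simp add: cinner_eq_zero_iff)
qed

lemma proj_add:
  assumes W: "complex_subspace W" "closed W"
  shows "proj W (x + y) = proj W x + proj W y"
proof (rule proj_unique[OF W])
  show "proj W x + proj W y \<in> W" by (intro complex_subspace_add proj_in W)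
  fix w assume w: "w \<in> W"
  have "cinner (x + y - (proj W x + proj W y)) w = cinner (x - proj W x) w + cinner (y - proj W y) w"
    by (simp add: cinner.diff_left cinner.add_left)
  then show "cinner (x + y - (proj W x + proj W y)) w = 0" by (simp add: proj_orth[OF W w])
qed

lemma proj_scaleC:
  assumes W: "complex_subspace W" "closed W"
  shows "proj W (scaleC a x) = scaleC a (proj W x)"
proof (rule proj_unique[OF W])
  show "scaleC a (proj W x) \<in> W" by (intro complex_subspace_scaleC proj_in W)
  show "cinner (scaleC a x - scaleC a (proj W x)) w = 0" if w: "w \<in> W" for w
    by (simp add: proj_orth[OF W w] cinner_scaleC_left flip: scaleC_diff_right)
qed

lemma cinner_proj: "complex_subspace W \<Longrightarrow> closed W \<Longrightarrow> cinner (proj W x) (proj W y) = cinner (proj W x) y"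
  using proj_orth[of W "proj W x" y] proj_in[of W x]
  by (metis cinner.diff_right cinner_commute complex_cnj_zero eq_iff_diff_eq_0)

lemma cinner_proj_left: "complex_subspace W \<Longrightarrow> closed W \<Longrightarrow> cinner (proj W x) y = cinner x (proj W y)"
  by (metis cinner_proj cinner_commute)


subsection \<open>Eigenvectors in finite-dimensional invariant subspaces\<close>

text \<open>Gaussian elimination: equation \<open>l\<close> is solved for an unknown
  \<open>k\<close> with nonzero coefficient, and the induction treats the remaining equations and
  unknowns.\<close>

lemma homogeneous_system_nontrivial:
  fixes a :: "'i \<Rightarrow> 'l \<Rightarrow> complex"
  assumes "finite L" "finite I" "card L < card I"
  shows "\<exists>c. (\<exists>i\<in>I. c i \<noteq> 0) \<and> (\<forall>l\<in>L. (\<Sum>i\<in>I. c i * a i l) = 0)"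
  using assms
proof (induction L arbitrary: I a rule: finite_induct)
  case empty
  then show ?case by (intro exI[of _ "\<lambda>_. 1"]) (auto simp: card_gt_0_iff)
next
  case (insert l L)
  show ?case
  proof (cases "\<forall>i\<in>I. a i l = 0")
    case True
    have "card L < card I" using insert.prems insert.hyps by simp
    from insert.IH[OF insert.prems(1) this, of a] show ?thesis
      using True by (auto intro!: exI)
  next
    case False
    then obtain k where k: "k \<in> I" "a k l \<noteq> 0" by blast
    define J where "J = I - {k}"
    have J: "finite J" "card L < card J" "k \<notin> J" "I = insert k J"
      using insert.prems insert.hyps k by (auto simp: J_def)
    obtain c where c: "\<exists>i\<in>J. c i \<noteq> 0"
        "\<And>l'. l' \<in> L \<Longrightarrow> (\<Sum>i\<in>J. c i * (a i l' - a i l / a k l * a k l')) = 0"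
      using insert.IH[OF J(1,2), of "\<lambda>i l'. a i l' - a i l / a k l * a k l'"] by blast
    define e where "e = - (\<Sum>i\<in>J. c i * (a i l / a k l))"
    define c' where "c' = c(k := e)"
    have s: "(\<Sum>i\<in>I. c' i * a i l') = e * a k l' + (\<Sum>i\<in>J. c i * a i l')" for l'
    proof -
      have "(\<Sum>i\<in>J. c' i * a i l') = (\<Sum>i\<in>J. c i * a i l')"
        using J(3) by (intro sum.cong) (auto simp: c'_def)
      then show ?thesis using J by (simp add: c'_def)
    qed
    have "(\<Sum>i\<in>I. c' i * a i l') = 0" if "l' \<in> insert l L" for l'
    proof (cases "l' = l")
      case True
      then show ?thesis using k(2) by (simp add: s e_def sum_distrib_right)
    next
      case False
      then have "l' \<in> L" using that by simp
      have "(\<Sum>i\<in>J. c i * (a i l' - a i l / a k l * a k l'))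
          = (\<Sum>i\<in>J. c i * a i l') + e * a k l'"
        by (simp add: e_def sum_distrib_right right_diff_distrib sum_subtractf mult.assoc)
      with c(2)[OF \<open>l' \<in> L\<close>] show ?thesis by (simp add: s add.commute)
    qed
    moreover have "\<exists>i\<in>I. c' i \<noteq> 0" using c(1) J by (auto simp: c'_def)
    ultimately show ?thesis by blast
  qed
qed

text \<open>Dimension at most \<open>N\<close>, phrased for arbitrary sets: any \<open>N + 1\<close>
  members, repetitions allowed, are linearly dependent over the complex numbers. No basis has to be
  chosen, and subsets inherit the bound.\<close>

definition findim :: "nat \<Rightarrow> 'h::complex_hilbert_space set \<Rightarrow> bool" where
  "findim N S \<longleftrightarrow> (\<forall>h. (\<forall>i\<le>N. h i \<in> S) \<longrightarrow>
     (\<exists>c. (\<exists>i\<le>N. c i \<noteq> 0) \<and> (\<Sum>i\<le>N. scaleC (c i) (h i)) = 0))"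

lemma findim_spanI:
  assumes "finite L" "\<And>x. x \<in> S \<Longrightarrow> \<exists>a. x = (\<Sum>l\<in>L. scaleC (a l) (b l))"
  shows "findim (card L) (S :: 'h::complex_hilbert_space set)"
  unfolding findim_def
proof (intro allI impI)
  fix h :: "nat \<Rightarrow> 'h" assume "\<forall>i\<le>card L. h i \<in> S"
  then have "\<forall>i. \<exists>a. i \<le> card L \<longrightarrow> h i = (\<Sum>l\<in>L. scaleC (a l) (b l))" using assms(2) by blast
  then obtain a where a: "\<And>i. i \<le> card L \<Longrightarrow> h i = (\<Sum>l\<in>L. scaleC (a i l) (b l))" by metis
  obtain c where c: "\<exists>i\<le>card L. c i \<noteq> 0" "\<And>l. l \<in> L \<Longrightarrow> (\<Sum>i\<le>card L. c i * a i l) = 0"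
    using homogeneous_system_nontrivial[OF assms(1), of "{..card L}" a] by auto
  have "(\<Sum>i\<le>card L. scaleC (c i) (h i)) = (\<Sum>i\<le>card L. \<Sum>l\<in>L. scaleC (c i * a i l) (b l))"
    by (intro sum.cong) (auto simp: a scaleC_sum_right scaleC_scaleC)
  also have "\<dots> = (\<Sum>l\<in>L. scaleC (\<Sum>i\<le>card L. c i * a i l) (b l))"
    by (subst sum.swap) (simp add: scaleC.sum_left)
  also have "\<dots> = 0" using c(2) by simp
  finally show "\<exists>c. (\<exists>i\<le>card L. c i \<noteq> 0) \<and> (\<Sum>i\<le>card L. scaleC (c i) (h i)) = 0"
    using c(1) by blast
qed

text \<open>Functionals that separate the points of \<open>S\<close> embed it into a coordinate
  space, so their number bounds the dimension.\<close>

lemma findim_functionalsI: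
  assumes S: "complex_subspace S" and L: "finite L"
    and inj: "\<And>x. x \<in> S \<Longrightarrow> (\<And>l. l \<in> L \<Longrightarrow> cinner x (u l) = 0) \<Longrightarrow> x = 0"
  shows "findim (card L) (S :: 'h::complex_hilbert_space set)"
  unfolding findim_def
proof (intro allI impI)
  fix h :: "nat \<Rightarrow> 'h" assume h: "\<forall>i\<le>card L. h i \<in> S"
  obtain c where c: "\<exists>i\<le>card L. c i \<noteq> 0" "\<And>l. l \<in> L \<Longrightarrow> (\<Sum>i\<le>card L. c i * cinner (h i) (u l)) = 0"
    using homogeneous_system_nontrivial[OF L, of "{..card L}" "\<lambda>i l. cinner (h i) (u l)"] by auto
  have "(\<Sum>i\<le>card L. scaleC (c i) (h i)) = 0"
    using c(2) h by (intro inj complex_subspace_sum[OF S] complex_subspace_scaleC[OF S])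
      (auto simp: cinner.sum_left cinner_scaleC_left)
  with c(1) show "\<exists>c. (\<exists>i\<le>card L. c i \<noteq> 0) \<and> (\<Sum>i\<le>card L. scaleC (c i) (h i)) = 0" by blast
qed

lemma findim_mono: "findim N S \<Longrightarrow> T \<subseteq> S \<Longrightarrow> findim N T"
  unfolding findim_def by blast

lemma complex_linear_on_sum:
  assumes S: "complex_subspace S" and A: "complex_linear_on S A" and f: "\<And>i. i \<in> I \<Longrightarrow> f i \<in> S"
  shows "A (\<Sum>i\<in>I. scaleC (c i) (f i)) = (\<Sum>i\<in>I. scaleC (c i) (A (f i)))"
  using f
proof (induction I rule: infinite_finite_induct)
  case (insert i I)
  have "A (scaleC (c i) (f i) + (\<Sum>i\<in>I. scaleC (c i) (f i)))
      = A (scaleC (c i) (f i)) + A (\<Sum>i\<in>I. scaleC (c i) (f i))"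
  proof -
    have "scaleC (c i) (f i) \<in> S" "(\<Sum>i\<in>I. scaleC (c i) (f i)) \<in> S"
      using insert.prems by (auto intro!: complex_subspace_sum[OF S] complex_subspace_scaleC[OF S])
    then show ?thesis using A unfolding complex_linear_on_def by blast
  qed
  moreover have "A (scaleC (c i) (f i)) = scaleC (c i) (A (f i))"
    using A insert.prems unfolding complex_linear_on_def by blast
  ultimately show ?case using insert by simp
next
  have "A 0 = 0" using A complex_subspace_0[OF S] unfolding complex_linear_on_def
    by (metis scaleC_zero_left)
  { case empty show ?case using \<open>A 0 = 0\<close> by simp }
  { case (infinite I) then show ?case using \<open>A 0 = 0\<close> by simp }
qed

text \<open>Divide a shortest dependence among \<open>x, A x, A (A x), ...\<close> by a linear
  factor with root \<open>r\<close>, which the fundamental theorem of algebra provides. The quotient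
  applied to \<open>x\<close> is an eigenvector, nonzero by minimality.\<close>

lemma eigenvector_exists:
  fixes S :: "'h::complex_hilbert_space set"
  assumes S: "complex_subspace S" and A: "complex_linear_on S A" and AS: "\<And>x. x \<in> S \<Longrightarrow> A x \<in> S"
    and fin: "findim N S" and x: "x \<in> S" "x \<noteq> 0"
  shows "\<exists>\<mu>. \<exists>y\<in>S. y \<noteq> 0 \<and> A y = scaleC \<mu> y"
proof -
  have xS: "(A ^^ i) x \<in> S" for i by (induction i) (auto simp: x AS)
  define P where "P n \<longleftrightarrow> (\<exists>c. c n \<noteq> 0 \<and> (\<Sum>i\<le>n. scaleC (c i) ((A ^^ i) x)) = 0)" for n
  have "\<exists>n. P n"
  proof -
    obtain c where c: "\<exists>i\<le>N. c i \<noteq> 0" "(\<Sum>i\<le>N. scaleC (c i) ((A ^^ i) x)) = 0"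
      using fin xS unfolding findim_def by metis
    define n where "n = Max {i. i \<le> N \<and> c i \<noteq> 0}"
    have n: "n \<le> N" "c n \<noteq> 0" using Max_in[of "{i. i \<le> N \<and> c i \<noteq> 0}"] c(1) by (auto simp: n_def)
    have z: "c i = 0" if "n < i" "i \<le> N" for i
      using Max_ge[of "{i. i \<le> N \<and> c i \<noteq> 0}" i] that unfolding n_def by fastforce
    have "(\<Sum>i\<le>N. scaleC (c i) ((A ^^ i) x)) = (\<Sum>i\<le>n. scaleC (c i) ((A ^^ i) x))"
      using n z by (intro sum.mono_neutral_right) auto
    then show ?thesis using c n unfolding P_def by auto
  qed
  define n where "n = (LEAST n. P n)"
  have "P n" unfolding n_def using \<open>\<exists>n. P n\<close> by (rule LeastI_ex)
  then obtain c where c: "c n \<noteq> 0" "(\<Sum>i\<le>n. scaleC (c i) ((A ^^ i) x)) = 0" unfolding P_def by blast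
  have "n \<noteq> 0"
  proof
    assume "n = 0"
    then have "scaleC (c 0) x = 0" "c 0 \<noteq> 0" using c by auto
    then show False using x by (metis norm_scaleC norm_eq_zero mult_eq_0_iff)
  qed
  then obtain k where k: "n = Suc k" using not0_implies_Suc by blast
  define p where "p = Poly (map c [0..<Suc n])"
  have cp: "coeff p i = (if i \<le> n then c i else 0)" for i
    by (auto simp: p_def nth_default_def simp del: upt_Suc)
  have "degree p = n" using c(1) by (intro antisym degree_le le_degree) (auto simp: cp)
  then have "\<not> constant (poly p)" using k by (simp add: constant_degree)
  then obtain r where "poly p r = 0" using fundamental_theorem_of_algebra by blast
  then obtain q where q: "p = [:- r, 1:] * q" unfolding poly_eq_0_iff_dvd by (elim dvdE)
  have "q \<noteq> 0" using q \<open>degree p = n\<close> k by auto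
  then have "degree p = Suc (degree q)" unfolding q by (subst degree_mult_eq) auto
  then have dq: "degree q = k" using \<open>degree p = n\<close> k by simp
  have pc: "coeff p 0 = - r * coeff q 0" "coeff p (Suc i) = coeff q i - r * coeff q (Suc i)" for i
    unfolding q by (simp_all add: coeff_pCons)
  define y where "y = (\<Sum>i\<le>k. scaleC (coeff q i) ((A ^^ i) x))"
  have "y \<in> S" unfolding y_def by (intro complex_subspace_sum complex_subspace_scaleC S xS)
  moreover have "y \<noteq> 0"
  proof
    assume "y = 0"
    moreover have "coeff q k \<noteq> 0" using dq \<open>q \<noteq> 0\<close> by auto
    ultimately have "P k" unfolding P_def y_def by blast
    then show False using k not_less_Least[of k P] by (simp add: n_def)
  qed
  moreover have "A y = scaleC r y"
  proof -
    have qS: "coeff q (Suc k) = 0" using dq by (simp add: coeff_eq_0)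
    have "A y = (\<Sum>i\<le>k. scaleC (coeff q i) ((A ^^ Suc i) x))"
      unfolding y_def by (subst complex_linear_on_sum[OF S A xS]) simp
    moreover have "(\<Sum>i\<le>n. scaleC (coeff p i) ((A ^^ i) x))
        = scaleC (coeff p 0) x + (\<Sum>i\<le>k. scaleC (coeff p (Suc i)) ((A ^^ Suc i) x))"
      unfolding k by (subst sum.atMost_Suc_shift) simp
    moreover have "(\<Sum>i\<le>k. scaleC (coeff p (Suc i)) ((A ^^ Suc i) x))
       = (\<Sum>i\<le>k. scaleC (coeff q i) ((A ^^ Suc i) x)) - scaleC r (\<Sum>i\<le>k. scaleC (coeff q (Suc i)) ((A ^^ Suc i) x))"
      by (simp add: pc scaleC_diff_left sum_subtractf scaleC_sum_right scaleC_scaleC)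
    moreover have "scaleC (coeff q 0) x + (\<Sum>i\<le>k. scaleC (coeff q (Suc i)) ((A ^^ Suc i) x)) = y"
    proof -
      have "scaleC (coeff q 0) x + (\<Sum>i\<le>k. scaleC (coeff q (Suc i)) ((A ^^ Suc i) x))
         = (\<Sum>i\<le>Suc k. scaleC (coeff q i) ((A ^^ i) x))"
        by (subst sum.atMost_Suc_shift) simp
      then show ?thesis by (simp add: y_def qS)
    qed
    moreover have "(\<Sum>i\<le>n. scaleC (coeff p i) ((A ^^ i) x)) = 0"
      using c(2) by (simp add: cp)
    moreover have "scaleC (coeff p 0) x = - scaleC r (scaleC (coeff q 0) x)"
      by (simp add: pc scaleC_minus_left scaleC_scaleC)
    moreover have "u = scaleC r y"
      if "u = X" "P = a + T" "T = X - scaleC r Y" "b + Y = y" "P = 0" "a = - scaleC r b" for u X P a T Y b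
      using that by (auto simp: scaleC_add_right algebra_simps)
    ultimately show ?thesis by blast
  qed
  ultimately show ?thesis by blast
qed

section \<open>Decay of solutions of the radial equations\<close>

text \<open>Once a unit factor removes the oscillation, the value at \<open>t\<close> is minus the
  integral of the inhomogeneity from \<open>t\<close> to infinity, so it inherits the exponential
  rate of \<open>h\<close>.\<close>

lemma decay_step:
  fixes \<psi> :: "real \<Rightarrow> complex"
  assumes d: "\<And>t. t > 0 \<Longrightarrow> (\<psi> has_vector_derivative (\<i> * of_real \<theta> * \<psi> t + h t)) (at t)"
    and \<psi>0: "(\<psi> \<longlongrightarrow> 0) at_top"
    and r: "r \<ge> 0" and h: "((\<lambda>t. exp ((r + 1) * t) *\<^sub>R h t) \<longlongrightarrow> 0) at_top"
  shows "((\<lambda>t. exp ((r + 1) * t) *\<^sub>R \<psi> t) \<longlongrightarrow> 0) at_top"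
proof (rule tendstoI)
  fix e :: real assume e: "e > 0"
  define zt where "zt t = cis (- \<theta> * t) * \<psi> t" for t
  have nzt: "norm (zt t) = norm (\<psi> t)" for t by (simp add: zt_def norm_mult)
  have cis': "((\<lambda>t. cis (- \<theta> * t)) has_vector_derivative (- \<i> * of_real \<theta> * cis (- \<theta> * t))) (at t)" for t
  proof -
    have "((\<lambda>z. exp (- \<i> * of_real \<theta> * z)) has_field_derivative
        (- \<i> * of_real \<theta> * exp (- \<i> * of_real \<theta> * of_real t))) (at (of_real t))"
      by (auto intro!: derivative_eq_intros)
    from has_vector_derivative_real_field[OF this] show ?thesis
      by (simp add: cis_conv_exp mult.assoc)
  qed
  have dzt: "(zt has_vector_derivative (cis (- \<theta> * t) * h t)) (at t)" if "t > 0" for t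
    unfolding zt_def
    by (rule has_vector_derivative_eq_rhs[OF has_vector_derivative_mult[OF cis' d[OF that]]])
      (simp add: algebra_simps)
  obtain T where T: "\<And>t. t \<ge> T \<Longrightarrow> norm (exp ((r + 1) * t) *\<^sub>R h t) < e / 2"
    using tendstoD[OF h, of "e/2"] e unfolding eventually_at_top_linorder by auto
  define T' where "T' = max T 1"
  have hb: "norm (h t) \<le> e / 2 * exp (- ((r + 1) * t))" if "t \<ge> T'" for t
  proof -
    have "exp ((r + 1) * t) * norm (h t) \<le> e / 2" using T[of t] that by (simp add: T'_def)
    then have "exp (- ((r + 1) * t)) * (exp ((r + 1) * t) * norm (h t)) \<le> exp (- ((r + 1) * t)) * (e / 2)"
      by (intro mult_left_mono) auto
    moreover have "exp (- ((r + 1) * t)) * (exp ((r + 1) * t) * norm (h t)) = norm (h t)"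
      by (simp only: mult.assoc[symmetric] exp_add[symmetric]) simp
    ultimately show ?thesis by (simp only: mult.commute[of "e / 2"])
  qed
  \<comment> \<open>The primitive of the majorant of the derivative that tends to 0 at
    infinity.\<close>
  define G where "G t = - (e / 2) / (r + 1) * exp (- ((r + 1) * t))" for t
  have dG: "(G has_vector_derivative e / 2 * exp (- ((r + 1) * t))) (at t)" for t
  proof -
    have "(G has_real_derivative - (e / 2) / (r + 1) * (exp (- ((r + 1) * t)) * - (r + 1))) (at t)"
      unfolding G_def by (intro derivative_eq_intros refl) auto
    also have "- (e / 2) / (r + 1) * (exp (- ((r + 1) * t)) * - (r + 1)) = e / 2 * exp (- ((r + 1) * t))"
      using r by (simp only: times_divide_eq_left times_divide_eq_right mult_minus_left mult_minus_right)
        (auto simp: divide_simps)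
    finally show ?thesis by (simp add: has_real_derivative_iff_has_vector_derivative)
  qed
  have bound: "norm (zt s - zt t) \<le> G s - G t" if "T' \<le> t" "t < s" for s t
  proof (rule differentiable_bound_general[OF that(2)])
    have pos: "x > 0" if "x \<ge> t" for x using that \<open>T' \<le> t\<close> by (simp add: T'_def)
    show "continuous_on {t..s} zt"
      by (intro continuous_at_imp_continuous_on ballI has_vector_derivative_continuous[OF dzt] pos) auto
    show "continuous_on {t..s} G"
      by (intro continuous_at_imp_continuous_on ballI has_vector_derivative_continuous[OF dG])
    fix x assume x: "t < x" "x < s"
    show "(zt has_vector_derivative (cis (- \<theta> * x) * h x)) (at x)" using dzt pos x by simp
    show "(G has_vector_derivative e / 2 * exp (- ((r + 1) * x))) (at x)" by (rule dG)
    show "norm (cis (- \<theta> * x) * h x) \<le> e / 2 * exp (- ((r + 1) * x))"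
      using hb[of x] x that by (simp add: norm_mult)
  qed
  have lim: "norm (zt t) \<le> - G t" if t: "T' \<le> t" for t
  proof -
    have "(zt \<longlongrightarrow> 0) at_top"
      using \<psi>0 by (subst tendsto_norm_zero_iff[symmetric]) (simp add: nzt tendsto_norm_zero)
    then have l1: "((\<lambda>s. norm (zt s - zt t)) \<longlongrightarrow> norm (0 - zt t)) at_top" by (intro tendsto_intros)
    have "filterlim (\<lambda>s. (r + 1) * s) at_top at_top"
      using r by (intro filterlim_tendsto_pos_mult_at_top[OF tendsto_const]) (auto simp: filterlim_ident)
    then have "((\<lambda>s. exp (- ((r + 1) * s))) \<longlongrightarrow> 0) at_top"
      by (intro filterlim_compose[OF exp_at_bot]) (simp add: filterlim_uminus_at_top)
    then have "((\<lambda>s. G s - G t) \<longlongrightarrow> - (e / 2) / (r + 1) * 0 - G t) at_top"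
      unfolding G_def by (intro tendsto_intros)
    then have l2: "((\<lambda>s. G s - G t) \<longlongrightarrow> - G t) at_top" by simp
    have "\<forall>\<^sub>F s in at_top. norm (zt s - zt t) \<le> G s - G t"
      using eventually_gt_at_top[of t] by eventually_elim (use bound t in auto)
    from tendsto_le[OF trivial_limit_at_top_linorder l2 l1 this] show ?thesis by simp
  qed
  have "dist (exp ((r + 1) * t) *\<^sub>R \<psi> t) 0 < e" if "t \<ge> T'" for t
  proof -
    have "exp ((r + 1) * t) * norm (\<psi> t) \<le> exp ((r + 1) * t) * - G t"
      using lim[OF that] nzt by (intro mult_left_mono) auto
    also have "\<dots> = e / 2 / (r + 1)" by (simp add: G_def exp_minus)
    also have "\<dots> \<le> e / 2 / 1" using e r by (intro divide_left_mono) auto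
    also have "\<dots> < e" using e by simp
    finally show ?thesis by (simp add: dist_norm)
  qed
  then show "\<forall>\<^sub>F t in at_top. dist (exp ((r + 1) * t) *\<^sub>R \<psi> t) 0 < e"
    unfolding eventually_at_top_linorder by blast
qed

lemma exp_le_4_sinh: "exp t \<le> 4 * sinh t" if "t \<ge> 1" for t :: real
proof -
  have "exp t \<ge> 2" using exp_ge_add_one_self[of t] that by linarith
  moreover have "exp (- t) \<le> 1" using that by simp
  ultimately have "2 * exp (- t) \<le> exp t" by linarith
  then show ?thesis by (simp add: sinh_field_def)
qed

text \<open>The complex energy \<open>g1\<^sup>2 - K g\<^sup>2\<close> is constant for
  \<open>t \<ge> 0\<close>. It tends to 0, since decay of \<open>g\<close> and of \<open>K g\<close>
  forces decay of \<open>g1\<close>, and at 0 it is the square of \<open>g1 0\<close>.\<close>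

lemma no_decaying_oscillator:
  fixes g g1 g2 :: "real \<Rightarrow> complex"
  assumes d1: "\<And>t. (g has_vector_derivative g1 t) (at t)"
    and d2: "\<And>t. (g1 has_vector_derivative g2 t) (at t)"
    and ode: "\<And>t. t > 0 \<Longrightarrow> g2 t = K * g t"
    and g0: "g 0 = 0" and lim: "(g \<longlongrightarrow> 0) at_top"
  shows "g1 0 = 0"
proof -
  define U where "U t = (g1 t)\<^sup>2 - K * (g t)\<^sup>2" for t
  have cont: "continuous_on S g" "continuous_on S g1" for S
    by (intro continuous_at_imp_continuous_on ballI has_vector_derivative_continuous[OF d1]
        has_vector_derivative_continuous[OF d2])+
  have dU: "(U has_vector_derivative 0) (at t)" if "t > 0" for t
  proof -
    have "(U has_vector_derivative (g1 t * g2 t + g2 t * g1 t) - K * (g t * g1 t + g1 t * g t)) (at t)"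
      unfolding U_def power2_eq_square
      by (intro has_vector_derivative_diff has_vector_derivative_mult[OF d2 d2]
            has_vector_derivative_mult_right has_vector_derivative_mult[OF d1 d1])
    then show ?thesis using ode[OF that] by (simp add: algebra_simps)
  qed
  have Uc: "U t = U 0" if "t \<ge> 0" for t
  proof (cases "t = 0")
    case False
    then have t: "0 < t" using that by simp
    have "norm (U t - U 0) \<le> (\<lambda>_. 0) t - (\<lambda>_. 0) (0::real)"
    proof (rule differentiable_bound_general[OF t])
      show "continuous_on {0..t} U" unfolding U_def by (intro continuous_intros cont)
      show "continuous_on {0..t} (\<lambda>_. 0::real)" by simp
      show "(U has_vector_derivative 0) (at x)" if "0 < x" "x < t" for x using dU that by simp
      show "((\<lambda>_. 0::real) has_vector_derivative 0) (at x)" for x by simp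
      show "norm (0::complex) \<le> 0" by simp
    qed
    then show ?thesis by simp
  qed simp
  \<comment> \<open>Taylor's formula on a unit interval: \<open>g1 t\<close> differs from
    \<open>g (t + 1) - g t\<close> by at most a bound for the second derivative.\<close>
  have diff: "norm (g (t + 1) - g t - g1 t) \<le> norm K * (\<epsilon> * 1)" if t: "t > 0" and \<epsilon>: "\<And>s. s \<ge> t \<Longrightarrow> norm (g s) \<le> \<epsilon>" for t \<epsilon>
  proof -
    have e0: "\<epsilon> \<ge> 0" using \<epsilon>[of t] norm_ge_zero[of "g t"] by linarith
    have g1b: "norm (g1 s - g1 t) \<le> norm K * \<epsilon>" if s: "t \<le> s" "s \<le> t + 1" for s
    proof (cases "s = t")
      case True then show ?thesis using e0 by simp
    next
      case False
      then have ts: "t < s" using s by simp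
      have "norm (g1 s - g1 t) \<le> (\<lambda>x. norm K * \<epsilon> * x) s - (\<lambda>x. norm K * \<epsilon> * x) t"
      proof (rule differentiable_bound_general[OF ts])
        show "continuous_on {t..s} g1" by (rule cont)
        show "continuous_on {t..s} (\<lambda>x. norm K * \<epsilon> * x)" by (intro continuous_intros)
        show "(g1 has_vector_derivative g2 x) (at x)" for x by (rule d2)
        show "((\<lambda>x. norm K * \<epsilon> * x) has_vector_derivative norm K * \<epsilon>) (at x)" for x
          by (auto intro!: derivative_eq_intros simp flip: has_real_derivative_iff_has_vector_derivative)
        show "norm (g2 x) \<le> norm K * \<epsilon>" if "t < x" "x < s" for x
          using ode[of x] \<epsilon>[of x] that t by (simp add: norm_mult mult_left_mono)
      qed
      also have "\<dots> = norm K * \<epsilon> * (s - t)" by (simp add: algebra_simps)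
      also have "\<dots> \<le> norm K * \<epsilon> * 1" using s e0 by (intro mult_left_mono) auto
      finally show ?thesis by simp
    qed
    define w where "w s = g s - s *\<^sub>R g1 t" for s
    have "norm (w (t + 1) - w t) \<le> (\<lambda>x. norm K * \<epsilon> * x) (t + 1) - (\<lambda>x. norm K * \<epsilon> * x) t"
    proof (rule differentiable_bound_general[of t "t+1"])
      show "continuous_on {t..t+1} w" unfolding w_def by (intro continuous_intros cont)
      show "continuous_on {t..t+1} (\<lambda>x. norm K * \<epsilon> * x)" by (intro continuous_intros)
      show "(w has_vector_derivative g1 x - 1 *\<^sub>R g1 t) (at x)" for x
        unfolding w_def by (auto intro!: derivative_eq_intros d1)
      show "((\<lambda>x. norm K * \<epsilon> * x) has_vector_derivative norm K * \<epsilon>) (at x)" for x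
        by (auto intro!: derivative_eq_intros simp flip: has_real_derivative_iff_has_vector_derivative)
      show "norm (g1 x - 1 *\<^sub>R g1 t) \<le> norm K * \<epsilon>" if "t < x" "x < t + 1" for x
        using g1b[of x] that by simp
    qed auto
    then show ?thesis by (simp add: w_def algebra_simps)
  qed
  have lim1: "(g1 \<longlongrightarrow> 0) at_top"
  proof (rule tendstoI)
    fix e :: real assume e: "e > 0"
    define \<epsilon> where "\<epsilon> = e / (2 * (norm K + 3))"
    have "norm K + 3 > 0" using norm_ge_zero[of K] by linarith
    then have \<epsilon>: "\<epsilon> > 0" using e by (simp add: \<epsilon>_def)
    obtain T where T: "\<And>t. t \<ge> T \<Longrightarrow> norm (g t) < \<epsilon>"
      using tendstoD[OF lim \<epsilon>] unfolding eventually_at_top_linorder by auto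
    have "dist (g1 t) 0 < e" if t: "t \<ge> max T 1" for t
    proof -
      have "norm (g1 t) = norm ((g (t + 1) - g t) - (g (t + 1) - g t - g1 t))" by simp
      also have "\<dots> \<le> norm (g (t + 1) - g t) + norm (g (t + 1) - g t - g1 t)" by (rule norm_triangle_ineq4)
      also have "\<dots> \<le> norm (g (t + 1) - g t - g1 t) + norm (g (t + 1)) + norm (g t)"
        using norm_triangle_ineq4[of "g (t + 1)" "g t"] by linarith
      also have "\<dots> \<le> norm K * (\<epsilon> * 1) + \<epsilon> + \<epsilon>"
      proof (intro add_mono diff)
        show "0 < t" using t by simp
        show "norm (g s) \<le> \<epsilon>" if "s \<ge> t" for s using T[of s] t that by simp
        show "norm (g (t + 1)) \<le> \<epsilon>" "norm (g t) \<le> \<epsilon>" using T[of t] T[of "t + 1"] t by auto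
      qed
      also have "\<dots> = \<epsilon> * (norm K + 2)" by (simp add: algebra_simps)
      also have "\<dots> < \<epsilon> * (2 * (norm K + 3))"
      proof (rule mult_strict_left_mono[OF _ \<epsilon>])
        have "0 \<le> norm K" by simp
        then have "0 < 4 + norm K" by linarith
        then show "norm K + 2 < 2 * (norm K + 3)" by simp
      qed
      also have "\<dots> = e"
      proof -
        have "norm K + 3 \<noteq> 0" using norm_ge_zero[of K] by linarith
        then show ?thesis by (simp add: \<epsilon>_def)
      qed
      finally show ?thesis by (simp add: dist_norm)
    qed
    then show "\<forall>\<^sub>F t in at_top. dist (g1 t) 0 < e" unfolding eventually_at_top_linorder by blast
  qed
  have "(U \<longlongrightarrow> 0\<^sup>2 - K * 0\<^sup>2) at_top" unfolding U_def by (intro tendsto_intros lim lim1)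
  moreover have "(U \<longlongrightarrow> U 0) at_top"
    using Uc unfolding eventually_at_top_linorder by (intro tendsto_eventually) (meson eventually_at_top_linorderI)
  ultimately have "0\<^sup>2 - K * 0\<^sup>2 = U 0" by (rule tendsto_unique[OF trivial_limit_at_top_linorder])
  then have "U 0 = 0" by simp
  then show ?thesis by (simp add: U_def g0)
qed


text \<open>In the application \<open>f n\<close> is the normalized diagonal coefficient at the
  \<open>n\<close>-th weight vector, of weight \<open>m n\<close>, in a
  \<open>K\<^sub>1\<close>-type of dimension \<open>d + 1\<close>; \<open>ode1\<close> and
  \<open>ode2\<close> are the eigenvalue equations of the operators \<open>C\<close> and
  \<open>Q\<close> of \<open>lorentz_module\<close> in radial form. With
  \<open>\<psi> n = sinh t * f n\<close> the first becomes a system whose coupling is of order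
  \<open>exp (-t)\<close>, and this improves the decay of \<open>\<psi> n\<close> until
  \<open>exp (m n * t) * \<psi> n t\<close> tends to 0. The sum of these products satisfies an
  equation with constant coefficients, vanishes at 0 and at infinity, and has initial slope
  \<open>d + 1\<close>.\<close>

lemma no_decaying_solution:
  fixes f f1 f2 :: "nat \<Rightarrow> real \<Rightarrow> complex" and d :: nat and \<theta> :: real and \<beta> :: complex
  defines "c \<equiv> \<lambda>n. real n * (real d - real n + 1)" and "m \<equiv> \<lambda>n. (real d - 2 * real n) / 2"
  assumes d1: "\<And>n t. n \<le> d \<Longrightarrow> (f n has_vector_derivative f1 n t) (at t)"
    and d2: "\<And>n t. n \<le> d \<Longrightarrow> (f1 n has_vector_derivative f2 n t) (at t)"
    and f0: "\<And>n. n \<le> d \<Longrightarrow> f n 0 = 1"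
    and lim: "\<And>n. n \<le> d \<Longrightarrow> ((\<lambda>t. exp t *\<^sub>R f n t) \<longlongrightarrow> 0) at_top"
    and ode1: "\<And>n t. n \<le> d \<Longrightarrow> t > 0 \<Longrightarrow> \<i> * of_real \<theta> * f n t * of_real (sinh t) = of_real (m n * sinh t) * f1 n t
      + of_real (c n / 2) * (f (n - 1) t - of_real (cosh t) * f n t)
      + of_real (c (Suc n) / 2) * (of_real (cosh t) * f n t - f (Suc n) t)"
    and ode2: "\<And>n t. n \<le> d \<Longrightarrow> t > 0 \<Longrightarrow> \<beta> * f n t * of_real ((sinh t)\<^sup>2) = of_real ((sinh t)\<^sup>2) * f2 n t
      + of_real (2 * cosh t * sinh t) * f1 n t
      + of_real (c n * cosh t) * (f (n - 1) t - of_real (cosh t) * f n t)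
      - of_real (c (Suc n)) * (f n t - of_real (cosh t) * f (Suc n) t)
      - of_real (m n * (sinh t)\<^sup>2) * f n t"
  shows False
proof -
  define \<psi> where "\<psi> n t = sinh t *\<^sub>R f n t" for n t
  define \<psi>1 where "\<psi>1 n t = cosh t *\<^sub>R f n t + sinh t *\<^sub>R f1 n t" for n t
  define \<psi>2 where "\<psi>2 n t = sinh t *\<^sub>R f n t + (2 * cosh t) *\<^sub>R f1 n t + sinh t *\<^sub>R f2 n t" for n t
  have c_edge [simp]: "c 0 = 0" "c (Suc d) = 0" by (simp_all add: c_def)
  have cm: "c (Suc n) - c n = 2 * m n" for n by (simp add: c_def m_def algebra_simps)
  have sc: "(sinh has_real_derivative cosh t) (at t)" "(cosh has_real_derivative sinh t) (at t)" for t :: real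
    by (auto intro!: derivative_eq_intros)
  have d\<psi>: "(\<psi> n has_vector_derivative \<psi>1 n t) (at t)" if "n \<le> d" for n t
    unfolding \<psi>_def \<psi>1_def
    by (rule has_vector_derivative_eq_rhs[OF has_vector_derivative_scaleR[OF sc(1) d1[OF that]]])
      (simp add: add.commute)
  have d\<psi>1: "(\<psi>1 n has_vector_derivative \<psi>2 n t) (at t)" if "n \<le> d" for n t
    unfolding \<psi>1_def \<psi>2_def
    by (rule has_vector_derivative_eq_rhs[OF has_vector_derivative_add[OF
         has_vector_derivative_scaleR[OF sc(2) d1[OF that]] has_vector_derivative_scaleR[OF sc(1) d2[OF that]]]])
      (simp add: scaleR_conv_of_real algebra_simps)
  have \<psi>lim: "(\<psi> n \<longlongrightarrow> 0) at_top" if "n \<le> d" for n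
  proof -
    have "((\<lambda>t. exp t *\<^sub>R f n t) \<longlongrightarrow> 0) at_top" by (rule lim[OF that])
    then show ?thesis
    proof (rule Lim_null_comparison[rotated, OF tendsto_norm_zero])
      have "norm (\<psi> n t) \<le> norm (exp t *\<^sub>R f n t)" if "t \<ge> 0" for t
      proof -
        have "sinh t \<le> exp t"
          using exp_gt_zero[of "- t"] exp_gt_zero[of t] by (simp add: sinh_field_def del: exp_gt_zero)
        then have "\<bar>sinh t\<bar> \<le> exp t" using that by simp
        then show ?thesis by (simp add: \<psi>_def mult_right_mono)
      qed
      then show "\<forall>\<^sub>F t in at_top. norm (\<psi> n t) \<le> norm (exp t *\<^sub>R f n t)"
        unfolding eventually_at_top_linorder by blast
    qed
  qed
  \<comment> \<open>The division by \<open>sinh t\<close> is what gains a factor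
    \<open>exp (-t)\<close> in each round of the induction below.\<close>
  define h where "h n t = (c (Suc n) *\<^sub>R \<psi> (Suc n) t - c n *\<^sub>R \<psi> (n - 1) t) /\<^sub>R (2 * sinh t)" for n t
  have \<psi>ode: "m n *\<^sub>R \<psi>1 n t = \<i> * of_real \<theta> * \<psi> n t + h n t" if "n \<le> d" "t > 0" for n t
  proof -
    have s: "sinh t \<noteq> 0" using that by simp
    have h: "h n t = of_real (c (Suc n) / 2) * f (Suc n) t - of_real (c n / 2) * f (n - 1) t"
      using s by (simp add: h_def \<psi>_def scaleR_conv_of_real field_simps)
    have "m n *\<^sub>R \<psi>1 n t = of_real (m n * sinh t) * f1 n t
        + of_real ((c (Suc n) - c n) / 2) * of_real (cosh t) * f n t"
      by (simp add: \<psi>1_def cm scaleR_conv_of_real algebra_simps)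
    also have "\<dots> = \<i> * of_real \<theta> * f n t * of_real (sinh t) + h n t"
      unfolding ode1[OF that] h by (simp add: algebra_simps diff_divide_distrib)
    finally show ?thesis by (simp add: \<psi>_def scaleR_conv_of_real mult_ac)
  qed
  \<comment> \<open>Induction on the rate \<open>r\<close>: the neighbours of
    \<open>\<psi> n\<close> have weight at least \<open>m n - 1\<close>, so the previous rate is
    known for them, and \<open>decay_step\<close> adds one. For weights that are not positive only
    \<open>r = 0\<close> is claimed.\<close>
  have decay: "\<forall>n\<le>d. m n > real r - 1 \<and> (m n > 0 \<or> r = 0) \<longrightarrow> ((\<lambda>t. exp (real r * t) *\<^sub>R \<psi> n t) \<longlongrightarrow> 0) at_top" for r
  proof (induction r)
    case 0
    then show ?case using \<psi>lim by simp
  next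
    case (Suc r)
    show ?case
    proof (intro allI impI, elim conjE disjE)
      fix n assume n: "n \<le> d" "m n > real (Suc r) - 1" "m n > 0"
      then have mr: "m n > real r" by simp
      have nb: "((\<lambda>t. exp (real r * t) *\<^sub>R \<psi> k t) \<longlongrightarrow> 0) at_top" if "k \<le> d" "m k \<ge> m n - 1" for k
      proof -
        have "m k > 0 \<or> r = 0" using that mr by (cases r) auto
        moreover have "m k > real r - 1" using that mr by linarith
        ultimately show ?thesis using Suc.IH that(1) by blast
      qed
      have nbc: "((\<lambda>t. exp (real r * t) *\<^sub>R c (Suc n) *\<^sub>R \<psi> (Suc n) t) \<longlongrightarrow> 0) at_top"
      proof (cases "n = d")
        case False
        then have "((\<lambda>t. c (Suc n) *\<^sub>R exp (real r * t) *\<^sub>R \<psi> (Suc n) t) \<longlongrightarrow> c (Suc n) *\<^sub>R 0) at_top"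
          using n by (intro tendsto_intros nb) (auto simp: m_def)
        then show ?thesis by (simp add: mult.commute)
      qed simp
      have nbc': "((\<lambda>t. exp (real r * t) *\<^sub>R c n *\<^sub>R \<psi> (n - 1) t) \<longlongrightarrow> 0) at_top"
      proof -
        have "((\<lambda>t. c n *\<^sub>R exp (real r * t) *\<^sub>R \<psi> (n - 1) t) \<longlongrightarrow> c n *\<^sub>R 0) at_top"
        proof (intro tendsto_intros nb)
          have "real (n - 1) \<le> real n" by simp
          then show "m n - 1 \<le> m (n - 1)" unfolding m_def diff_divide_distrib by simp
        qed (use n in simp)
        then show ?thesis by (simp add: mult.commute)
      qed
      define H where "H t = exp (real r * t) *\<^sub>R c (Suc n) *\<^sub>R \<psi> (Suc n) t - exp (real r * t) *\<^sub>R c n *\<^sub>R \<psi> (n - 1) t" for t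
      have H: "(H \<longlongrightarrow> 0) at_top" unfolding H_def using tendsto_diff[OF nbc nbc'] by simp
      define h' where "h' t = h n t /\<^sub>R m n" for t
      have hlim: "((\<lambda>t. exp ((real r + 1) * t) *\<^sub>R h' t) \<longlongrightarrow> 0) at_top"
      proof (rule Lim_null_comparison)
        show "((\<lambda>t. 2 / m n * norm (H t)) \<longlongrightarrow> 0) at_top"
          using tendsto_mult[OF tendsto_const tendsto_norm_zero[OF H], of "2 / m n"] by simp
        have "norm (exp ((real r + 1) * t) *\<^sub>R h' t) \<le> 2 / m n * norm (H t)" if t: "t \<ge> 1" for t
        proof -
          have sp: "sinh t > 0" using t by simp
          have "exp ((real r + 1) * t) *\<^sub>R h' t = (exp t / (2 * sinh t * m n)) *\<^sub>R H t"
          proof -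
            define D where "D = c (Suc n) *\<^sub>R \<psi> (Suc n) t - c n *\<^sub>R \<psi> (n - 1) t"
            have "H t = exp (real r * t) *\<^sub>R D" by (simp only: H_def D_def scaleR_diff_right)
            moreover have "h' t = (inverse (m n) * inverse (2 * sinh t)) *\<^sub>R D"
              by (simp only: h'_def h_def D_def scaleR_scaleR)
            moreover have "exp ((real r + 1) * t) = exp t * exp (real r * t)"
              by (simp add: algebra_simps flip: exp_add)
            moreover have "a * b * (inverse p * inverse (2 * q)) = a / (2 * q * p) * b" for a b p q :: real
              by (simp add: field_simps)
            ultimately show ?thesis by (simp only: scaleR_scaleR)
          qed
          then have "norm (exp ((real r + 1) * t) *\<^sub>R h' t) = exp t / (2 * sinh t * m n) * norm (H t)"
            using sp n(3) by simp
          also have "\<dots> \<le> 2 / m n * norm (H t)"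
            using exp_le_4_sinh[OF t] sp n(3) by (intro mult_right_mono) (auto simp: field_simps)
          finally show ?thesis .
        qed
        then show "\<forall>\<^sub>F t in at_top. norm (exp ((real r + 1) * t) *\<^sub>R h' t) \<le> 2 / m n * norm (H t)"
          unfolding eventually_at_top_linorder by blast
      qed
      have "(\<psi> n has_vector_derivative (\<i> * of_real (\<theta> / m n) * \<psi> n t + h' t)) (at t)" if t: "t > 0" for t
      proof -
        have "\<psi>1 n t = (m n *\<^sub>R \<psi>1 n t) /\<^sub>R m n" using n(3) by simp
        also have "\<dots> = \<i> * of_real (\<theta> / m n) * \<psi> n t + h' t"
          unfolding \<psi>ode[OF n(1) t] h'_def by (simp add: scaleR_add_right scaleR_conv_of_real field_simps add_divide_distrib)
        finally show ?thesis using d\<psi>[OF n(1), of t] by simp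
      qed
      from decay_step[OF this \<psi>lim[OF n(1)] _ hlim]
      show "((\<lambda>t. exp (real (Suc r) * t) *\<^sub>R \<psi> n t) \<longlongrightarrow> 0) at_top" by (simp add: add.commute)
    qed simp
  qed
  define g where "g t = (\<Sum>n\<le>d. exp (m n * t) *\<^sub>R \<psi> n t)" for t
  define g1 where "g1 t = (\<Sum>n\<le>d. exp (m n * t) *\<^sub>R (\<psi>1 n t + m n *\<^sub>R \<psi> n t))" for t
  define g2 where "g2 t = (\<Sum>n\<le>d. exp (m n * t) *\<^sub>R (\<psi>2 n t + (2 * m n) *\<^sub>R \<psi>1 n t + (m n)\<^sup>2 *\<^sub>R \<psi> n t))" for t
  have de: "((\<lambda>t. exp (a * t)) has_real_derivative exp (a * t) * a) (at t)" for a t :: real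
    by (rule DERIV_chain2[OF DERIV_exp]) (rule DERIV_cmult_Id)
  have dg: "(g has_vector_derivative g1 t) (at t)" for t
    unfolding g_def g1_def
  proof (rule has_vector_derivative_sum)
    fix n assume "n \<in> {..d}"
    then show "((\<lambda>t. exp (m n * t) *\<^sub>R \<psi> n t) has_vector_derivative
        exp (m n * t) *\<^sub>R (\<psi>1 n t + m n *\<^sub>R \<psi> n t)) (at t)"
      by (intro has_vector_derivative_eq_rhs[OF has_vector_derivative_scaleR[OF de d\<psi>]])
        (auto simp: scaleR_add_right)
  qed
  have dg1: "(g1 has_vector_derivative g2 t) (at t)" for t
    unfolding g1_def g2_def
  proof (rule has_vector_derivative_sum)
    fix n assume "n \<in> {..d}"
    then have n: "n \<le> d" by simp
    have *: "((\<lambda>t. \<psi>1 n t + m n *\<^sub>R \<psi> n t) has_vector_derivative \<psi>2 n t + m n *\<^sub>R \<psi>1 n t) (at t)"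
      by (intro has_vector_derivative_add d\<psi>1[OF n]
          bounded_linear.has_vector_derivative[OF bounded_linear_scaleR_right d\<psi>[OF n]])
    show "((\<lambda>t. exp (m n * t) *\<^sub>R (\<psi>1 n t + m n *\<^sub>R \<psi> n t)) has_vector_derivative
        exp (m n * t) *\<^sub>R (\<psi>2 n t + (2 * m n) *\<^sub>R \<psi>1 n t + (m n)\<^sup>2 *\<^sub>R \<psi> n t)) (at t)"
      by (rule has_vector_derivative_eq_rhs[OF has_vector_derivative_scaleR[OF de *]])
        (simp add: scaleR_conv_of_real algebra_simps power2_eq_square)
  qed
  have glim: "(g \<longlongrightarrow> 0) at_top"
    unfolding g_def
  proof (rule tendsto_null_sum)
    fix n assume "n \<in> {..d}"
    then have n: "n \<le> d" by simp
    show "((\<lambda>t. exp (m n * t) *\<^sub>R \<psi> n t) \<longlongrightarrow> 0) at_top"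
    proof (rule Lim_null_comparison)
      \<comment> \<open>For positive \<open>m n\<close> this satisfies
        \<open>r - 1 < m n \<le> r\<close>, the largest rate that \<open>decay\<close> offers;
        otherwise it is 0.\<close>
      define r where "r = nat \<lceil>m n\<rceil>"
      have mr: "m n \<le> real r" by (simp add: r_def real_nat_ceiling_ge)
      have mr': "m n > real r - 1" if "m n > 0"
        using that unfolding r_def by linarith
      have "((\<lambda>t. exp (real r * t) *\<^sub>R \<psi> n t) \<longlongrightarrow> 0) at_top"
      proof (cases "m n > 0")
        case True
        then show ?thesis using mr' decay n by blast
      next
        case False
        then show ?thesis using \<psi>lim[OF n] by (simp add: r_def)
      qed
      then show "((\<lambda>t. norm (exp (real r * t) *\<^sub>R \<psi> n t)) \<longlongrightarrow> 0) at_top" by (rule tendsto_norm_zero)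
      have "norm (exp (m n * t) *\<^sub>R \<psi> n t) \<le> norm (exp (real r * t) *\<^sub>R \<psi> n t)" if "t \<ge> 0" for t
        using that mr by (auto intro!: mult_right_mono)
      then show "\<forall>\<^sub>F t in at_top. norm (exp (m n * t) *\<^sub>R \<psi> n t) \<le> norm (exp (real r * t) *\<^sub>R \<psi> n t)"
        unfolding eventually_at_top_linorder by blast
    qed
  qed
  \<comment> \<open>With \<open>J = d / 2\<close> the last term is \<open>J (J + 1)\<close>. The
    identity \<open>c n = J (J + 1) - m n - (m n)\<^sup>2\<close> is what makes \<open>K\<close>
    independent of \<open>n\<close>.\<close>
  define K where "K = 1 + \<beta> + 2 * (\<i> * of_real \<theta>) + of_real (real d / 2 * (real d / 2 + 1))"
  have gode: "g2 t = K * g t" if t: "t > 0" for t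
  proof -
    define s where "s = sinh t"
    define C where "C = cosh t"
    have s: "s > 0" "C\<^sup>2 = s\<^sup>2 + 1" using t by (simp_all add: s_def C_def cosh_square_eq)
    have sC: "C + s = exp t" "C - s = exp (- t)" by (simp_all add: s_def C_def cosh_plus_sinh cosh_minus_sinh)
    define E where "E n = exp (m n * t)" for n
    \<comment> \<open>After multiplication by \<open>sinh t\<close>, each summand satisfies the
      equation for \<open>g\<close> up to \<open>k (Suc n) - k n\<close>. These errors telescope,
      and \<open>k\<close> vanishes at \<open>0\<close> and \<open>Suc d\<close> because
      \<open>c\<close> does.\<close>
    define k where "k n = of_real (c n * E (n - 1)) * f (n - 1) t - of_real (c n * E n) * f n t" for n
    have key: "of_real s * (of_real (E n) * (\<psi>2 n t + (2 * m n) *\<^sub>R \<psi>1 n t + (m n)\<^sup>2 *\<^sub>R \<psi> n t))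
       = of_real s * (K * (of_real (E n) * \<psi> n t)) + (k (Suc n) - k n)" if n: "n \<le> d" for n
    proof -
      have E2: "E (Suc k) = E k * (C - s)" for k
      proof -
        have "m (Suc k) * t = m k * t + - t" by (simp add: m_def field_simps)
        then show ?thesis unfolding E_def sC by (simp only: exp_add)
      qed
      have E1: "c n * E (n - 1) = c n * E n * (C + s)"
      proof (cases n)
        case (Suc k)
        have "(C - s) * (C + s) = 1" using s by (simp add: algebra_simps power2_eq_square)
        then show ?thesis by (simp add: Suc E2 mult.assoc)
      qed simp
      define cc where "cc = complex_of_real (c n)"
      define M where "M = complex_of_real (m n)"
      define J where "J = complex_of_real (real d / 2 * (real d / 2 + 1))"
      define S where "S = complex_of_real s"
      define Ch where "Ch = complex_of_real C"
      have c': "complex_of_real (c (Suc n)) = cc + 2 * M"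
      proof -
        have "c (Suc n) = c n + 2 * m n" using cm[of n] by simp
        then show ?thesis by (simp add: cc_def M_def)
      qed
      have h5: "cc = J - M - M\<^sup>2"
        unfolding cc_def J_def M_def of_real_diff[symmetric] of_real_power[symmetric] of_real_eq_iff
        by (simp add: c_def m_def power2_eq_square field_simps)
      have h3: "Ch\<^sup>2 = S\<^sup>2 + 1"
        using s(2) unfolding Ch_def S_def of_real_power[symmetric] by simp
      have h1: "2 * (\<i> * of_real \<theta>) * f n t * S = 2 * M * S * f1 n t + cc * (f (n - 1) t - Ch * f n t)
          + (cc + 2 * M) * (Ch * f n t - f (Suc n) t)"
      proof -
        have c'2: "complex_of_real (c (Suc n) / 2) = cc / 2 + M" using c' by (simp add: field_simps)
        have "2 * (\<i> * of_real \<theta> * f n t * S) = 2 * (M * S * f1 n t + cc / 2 * (f (n - 1) t - Ch * f n t)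
            + (cc / 2 + M) * (Ch * f n t - f (Suc n) t))"
          unfolding c'2[symmetric] using ode1[OF n t] by (simp add: S_def Ch_def s_def C_def M_def cc_def)
        then show ?thesis by (simp only: distrib_left distrib_right) (simp add: algebra_simps)
      qed
      have h2: "\<beta> * f n t * S\<^sup>2 = S\<^sup>2 * f2 n t + 2 * Ch * S * f1 n t + cc * Ch * (f (n - 1) t - Ch * f n t)
          - (cc + 2 * M) * (f n t - Ch * f (Suc n) t) - M * S\<^sup>2 * f n t"
        using ode2[OF n t] by (simp add: c' S_def Ch_def s_def C_def M_def cc_def)
      have main: "S * (S * f n t + 2 * Ch * f1 n t + S * f2 n t + 2 * M * (Ch * f n t + S * f1 n t) + M\<^sup>2 * (S * f n t))
         = S * ((1 + \<beta> + 2 * (\<i> * of_real \<theta>) + J) * (S * f n t))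
           + (cc + 2 * M) * (f n t - (Ch - S) * f (Suc n) t) - cc * ((Ch + S) * f (n - 1) t - f n t)"
        using h1 h2 h3 h5 by algebra
      have "k (Suc n) - k n = of_real (E n) * ((cc + 2 * M) * (f n t - (Ch - S) * f (Suc n) t) - cc * ((Ch + S) * f (n - 1) t - f n t))"
        unfolding k_def E1 by (simp add: E2 c' cc_def[symmetric] S_def Ch_def algebra_simps)
      moreover have "of_real s * (of_real (E n) * (\<psi>2 n t + (2 * m n) *\<^sub>R \<psi>1 n t + (m n)\<^sup>2 *\<^sub>R \<psi> n t))
        = of_real (E n) * (S * (S * f n t + 2 * Ch * f1 n t + S * f2 n t + 2 * M * (Ch * f n t + S * f1 n t) + M\<^sup>2 * (S * f n t)))"
        by (simp add: \<psi>_def \<psi>1_def \<psi>2_def s_def[symmetric] C_def[symmetric] S_def Ch_def M_def scaleR_conv_of_real mult_ac)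
      moreover have "of_real s * (K * (of_real (E n) * \<psi> n t))
         = of_real (E n) * (S * ((1 + \<beta> + 2 * (\<i> * of_real \<theta>) + J) * (S * f n t)))"
        by (simp add: \<psi>_def s_def[symmetric] S_def K_def J_def scaleR_conv_of_real mult_ac)
      moreover have "A = B + kk" if "kk = e * (Q - R)" "A = e * P" "B = e * P'" "P = P' + Q - R"
        for A B kk e P P' Q R :: complex
        unfolding that by (simp add: algebra_simps)
      ultimately show ?thesis using main by metis
    qed
    have "of_real s * g2 t = (\<Sum>n\<le>d. of_real s * (of_real (E n) * (\<psi>2 n t + (2 * m n) *\<^sub>R \<psi>1 n t + (m n)\<^sup>2 *\<^sub>R \<psi> n t)))"
      by (simp add: g2_def E_def scaleR_conv_of_real sum_distrib_left)
    also have "\<dots> = (\<Sum>n\<le>d. of_real s * (K * (of_real (E n) * \<psi> n t)) + (k (Suc n) - k n))"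
      by (intro sum.cong) (auto simp only: key atMost_iff)
    also have "\<dots> = of_real s * (K * g t) + (\<Sum>n\<le>d. k (Suc n) - k n)"
      by (simp add: sum.distrib g_def E_def scaleR_conv_of_real sum_distrib_left)
    also have "(\<Sum>n\<le>d. k (Suc n) - k n) = k (Suc d) - k 0"
      using sum_lessThan_telescope[of k "Suc d"] by (simp add: lessThan_Suc_atMost)
    also have "\<dots> = 0" by (simp add: k_def)
    finally show ?thesis using s by simp
  qed
  have "g1 0 = 0"
    by (rule no_decaying_oscillator[OF dg dg1 gode _ glim]) (auto simp: g_def \<psi>_def)
  \<comment> \<open>At 0 only the derivative of \<open>sinh\<close> survives, and each of the
    \<open>d + 1\<close> values \<open>f n 0 = 1\<close> contributes 1.\<close>
  moreover have "g1 0 = of_nat (Suc d)" by (simp add: g1_def \<psi>_def \<psi>1_def f0)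
  ultimately show False by (simp del: of_nat_Suc)
qed

section \<open>Modules over so(3) and so(3,1)\<close>

declare cinner.zero_left [simp] cinner.zero_right [simp]

definition operator_on :: "'h::complex_hilbert_space set \<Rightarrow> ('h \<Rightarrow> 'h) \<Rightarrow> bool" where
  "operator_on Y T \<longleftrightarrow> complex_linear_on Y T \<and> (\<forall>x\<in>Y. T x \<in> Y)"

lemma
  assumes "operator_on Y T"
  shows operator_on_in: "x \<in> Y \<Longrightarrow> T x \<in> Y"
    and operator_on_add: "x \<in> Y \<Longrightarrow> y \<in> Y \<Longrightarrow> T (x + y) = T x + T y"
    and operator_on_scaleC: "x \<in> Y \<Longrightarrow> T (scaleC a x) = scaleC a (T x)"
  using assms by (auto simp: operator_on_def complex_linear_on_def)

lemma
  assumes T: "operator_on Y T" and Y: "complex_subspace Y"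
  shows operator_on_minus: "x \<in> Y \<Longrightarrow> T (- x) = - T x"
    and operator_on_scaleR: "x \<in> Y \<Longrightarrow> T (r *\<^sub>R x) = r *\<^sub>R T x"
    and operator_on_diff: "x \<in> Y \<Longrightarrow> y \<in> Y \<Longrightarrow> T (x - y) = T x - T y"
    and operator_on_zero: "T 0 = 0"
proof -
  show r: "T (r *\<^sub>R x) = r *\<^sub>R T x" if "x \<in> Y" for r x
    using operator_on_scaleC[OF T that, of "of_real r"] by (simp add: scaleC_of_real)
  show m: "T (- x) = - T x" if "x \<in> Y" for x using r[OF that, of "-1"] by simp
  show "T (x - y) = T x - T y" if "x \<in> Y" "y \<in> Y" for x y
    using operator_on_add[OF T that(1), of "- y"] m[OF that(2)] complex_subspace_minus[OF Y that(2)] by simp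
  show "T 0 = 0" using r[OF complex_subspace_0[OF Y], of 0] by simp
qed

text \<open>In the application \<open>Y\<close> is a space of differentiable vectors. The
  commutation relations are oriented as rewrite rules that move \<open>L1\<close> outermost, then
  \<open>L2\<close>.\<close>

locale su2_module =
  fixes Y :: "'h::complex_hilbert_space set" and L1 L2 L3 :: "'h \<Rightarrow> 'h"
  assumes Y: "complex_subspace Y"
    and L_op: "operator_on Y L1" "operator_on Y L2" "operator_on Y L3"
    and L_skew: "\<And>x y. x \<in> Y \<Longrightarrow> y \<in> Y \<Longrightarrow> cinner (L1 x) y = - cinner x (L1 y)"
      "\<And>x y. x \<in> Y \<Longrightarrow> y \<in> Y \<Longrightarrow> cinner (L2 x) y = - cinner x (L2 y)"
      "\<And>x y. x \<in> Y \<Longrightarrow> y \<in> Y \<Longrightarrow> cinner (L3 x) y = - cinner x (L3 y)"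
    and L_comm: "\<And>x. x \<in> Y \<Longrightarrow> L2 (L1 x) = L1 (L2 x) - L3 x"
      "\<And>x. x \<in> Y \<Longrightarrow> L3 (L1 x) = L1 (L3 x) + L2 x"
      "\<And>x. x \<in> Y \<Longrightarrow> L3 (L2 x) = L2 (L3 x) - L1 x"
begin

lemmas Y_closed [simp, intro] = complex_subspace_0[OF Y] complex_subspace_add[OF Y]
  complex_subspace_scaleC[OF Y] complex_subspace_diff[OF Y] complex_subspace_minus[OF Y]
  complex_subspace_scaleR[OF Y]

lemmas L_in [simp, intro] = L_op[THEN operator_on_in]
lemmas L_lin [simp] = L_op[THEN operator_on_add] L_op[THEN operator_on_scaleC]
  operator_on_minus[OF L_op(1) Y] operator_on_minus[OF L_op(2) Y] operator_on_minus[OF L_op(3) Y]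
  operator_on_scaleR[OF L_op(1) Y] operator_on_scaleR[OF L_op(2) Y] operator_on_scaleR[OF L_op(3) Y]
  operator_on_diff[OF L_op(1) Y] operator_on_diff[OF L_op(2) Y] operator_on_diff[OF L_op(3) Y]
  operator_on_zero[OF L_op(1) Y] operator_on_zero[OF L_op(2) Y] operator_on_zero[OF L_op(3) Y]

text \<open>The hermitian generators \<open>\<i> L\<^sub>k\<close> in ladder form: \<open>Jp\<close>
  and \<open>Jm\<close> are the first plus and minus \<open>\<i>\<close> times the second, and they
  raise and lower eigenvalues of \<open>J3\<close> by 1.\<close>

definition J3 where "J3 x = scaleC \<i> (L3 x)"
definition Jp where "Jp x = scaleC \<i> (L1 x) - L2 x"
definition Jm where "Jm x = scaleC \<i> (L1 x) + L2 x"

lemmas J_defs = J3_def Jp_def Jm_def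

lemma scaleC_one_add: "scaleC a z + z = scaleC (a + 1) z" "z + scaleC a z = scaleC (1 + a) z" "scaleC a z - z = scaleC (a - 1) (z :: 'h)"
  by (simp_all add: scaleC_add_left scaleC_diff_left)

lemmas scaleC_simps = scaleC_add_right scaleC_diff_right scaleC_minus_right scaleC_minus_left scaleC_scaleC

lemma J_in [simp, intro]: "x \<in> Y \<Longrightarrow> J3 x \<in> Y" "x \<in> Y \<Longrightarrow> Jp x \<in> Y" "x \<in> Y \<Longrightarrow> Jm x \<in> Y"
  by (auto simp: J_defs)

lemma J_op: "operator_on Y J3" "operator_on Y Jp" "operator_on Y Jm"
  unfolding operator_on_def complex_linear_on_def
  by (auto simp: J_defs scaleC_simps mult.commute)

lemmas J_lin [simp] = J_op[THEN operator_on_add] J_op[THEN operator_on_scaleC]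
  operator_on_minus[OF J_op(1) Y] operator_on_minus[OF J_op(2) Y] operator_on_minus[OF J_op(3) Y]
  operator_on_scaleR[OF J_op(1) Y] operator_on_scaleR[OF J_op(2) Y] operator_on_scaleR[OF J_op(3) Y]
  operator_on_diff[OF J_op(1) Y] operator_on_diff[OF J_op(2) Y] operator_on_diff[OF J_op(3) Y]
  operator_on_zero[OF J_op(1) Y] operator_on_zero[OF J_op(2) Y] operator_on_zero[OF J_op(3) Y]

lemma J_adj:
  assumes "x \<in> Y" "y \<in> Y"
  shows "cinner (J3 x) y = cinner x (J3 y)" "cinner (Jm x) y = cinner x (Jp y)" "cinner (Jp x) y = cinner x (Jm y)"
  using assms
  by (simp_all add: J_defs cinner_scaleC_left cinner_scaleC_right L_skew cinner.add_left cinner.add_right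
      cinner.diff_left cinner.diff_right)

lemma J_comm:
  assumes "x \<in> Y"
  shows "J3 (Jp x) = Jp (J3 x) + Jp x" "J3 (Jm x) = Jm (J3 x) - Jm x" "Jp (Jm x) = Jm (Jp x) + 2 *\<^sub>R J3 x"
  using assms by (simp_all add: J_defs scaleC_simps L_comm scaleR_2)

lemma L_from_J:
  assumes "x \<in> Y"
  shows "L1 x = scaleC (- \<i> / 2) (Jp x + Jm x)" "L2 x = scaleC (1/2) (Jm x - Jp x)" "L3 x = scaleC (- \<i>) (J3 x)"
proof -
  have half: "scaleC (1/2) z + scaleC (1/2) z = z" for z :: 'h
    by (simp flip: scaleC_add_left)
  show "L1 x = scaleC (- \<i> / 2) (Jp x + Jm x)" "L2 x = scaleC (1/2) (Jm x - Jp x)" "L3 x = scaleC (- \<i>) (J3 x)"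
    using assms by (simp_all add: J_defs scaleC_simps half)
qed

text \<open>Zero is included, so this is a subspace; its dimension is the multiplicity in
  \<open>Y\<close> of the irreducible type of dimension \<open>d + 1\<close>.\<close>

definition hw :: "nat \<Rightarrow> 'h set" where
  "hw d = {x \<in> Y. Jp x = 0 \<and> J3 x = scaleC (of_nat d / 2) x}"

definition wt :: "'h \<Rightarrow> nat \<Rightarrow> 'h" where "wt x n = (Jm ^^ n) x"

text \<open>The factor with which \<open>Jp\<close> returns the \<open>n\<close>-th weight vector to
  the preceding one; it vanishes at the two ends \<open>n = 0\<close> and \<open>n = d + 1\<close>
  of the string.\<close>

definition cf :: "nat \<Rightarrow> nat \<Rightarrow> real" where "cf d n = real n * (real d - real n + 1)"

lemma hw_subspace: "complex_subspace (hw d)"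
  by (rule complex_subspaceI) (auto simp: hw_def scaleC_add_right scaleC_scaleC mult.commute)

lemma wt_0 [simp]: "wt x 0 = x" and wt_Suc: "wt x (Suc n) = Jm (wt x n)"
  by (simp_all add: wt_def)

lemma wt_in [simp, intro]: "x \<in> Y \<Longrightarrow> wt x n \<in> Y"
  by (induction n) (auto simp: wt_Suc)

lemma weight_J3:
  assumes "x \<in> Y" "J3 x = scaleC \<mu> x"
  shows "J3 (wt x n) = scaleC (\<mu> - of_nat n) (wt x n)"
proof (induction n)
  case (Suc n)
  have "J3 (wt x (Suc n)) = Jm (scaleC (\<mu> - of_nat n) (wt x n)) - Jm (wt x n)"
    using assms(1) by (simp add: wt_Suc J_comm Suc.IH)
  also have "\<dots> = scaleC (\<mu> - of_nat n - 1) (wt x (Suc n))"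
    using assms(1) by (simp add: wt_Suc scaleC_one_add)
  finally show ?case by (simp add: diff_diff_eq add.commute)
qed (use assms in simp)

lemma weight_Jp:
  assumes "x \<in> Y" "Jp x = 0" "J3 x = scaleC \<mu> x"
  shows "Jp (wt x (Suc n)) = scaleC (of_nat (Suc n) * (2 * \<mu> - of_nat n)) (wt x n)"
proof (induction n)
  case 0
  then show ?case using assms by (simp add: wt_Suc J_comm scaleC_scaleC scaleR_2 flip: scaleC_add_left)
next
  case (Suc n)
  have "Jp (wt x (Suc (Suc n))) = Jm (Jp (wt x (Suc n))) + 2 *\<^sub>R J3 (wt x (Suc n))"
    using assms(1) by (simp add: wt_Suc J_comm)
  also have "Jm (Jp (wt x (Suc n))) = scaleC (of_nat (Suc n) * (2 * \<mu> - of_nat n)) (wt x (Suc n))"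
    unfolding Suc.IH using assms(1) by (simp add: wt_Suc)
  also have "2 *\<^sub>R J3 (wt x (Suc n)) = scaleC (2 * (\<mu> - of_nat (Suc n))) (wt x (Suc n))"
    by (simp only: weight_J3[OF assms(1,3)] scaleR_2 mult_2 scaleC_add_left)
  finally have "Jp (wt x (Suc (Suc n)))
      = scaleC (of_nat (Suc n) * (2 * \<mu> - of_nat n) + 2 * (\<mu> - of_nat (Suc n))) (wt x (Suc n))"
    by (simp only: scaleC_add_left)
  also have "of_nat (Suc n) * (2 * \<mu> - of_nat n) + 2 * (\<mu> - of_nat (Suc n)) = of_nat (Suc (Suc n)) * (2 * \<mu> - of_nat (Suc n))"
    by (simp add: algebra_simps)
  finally show ?case .
qed

text \<open>Along the string \<open>wt x n\<close> the squared norms are multiplied by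
  \<open>(n + 1) (2 \<mu> - n)\<close>, which eventually would be negative. So the string ends, and
  its last nonzero vector can only have index \<open>n = 2 \<mu>\<close>.\<close>

lemma highest_weight_integral:
  assumes x: "x \<in> Y" "x \<noteq> 0" "Jp x = 0" "J3 x = scaleC \<mu> x"
  shows "\<exists>d. \<mu> = of_nat d / 2"
proof -
  have "\<mu> * cinner x x = cnj \<mu> * cinner x x"
    using J_adj(1)[OF x(1) x(1)] by (simp add: x(4) cinner_scaleC_left cinner_scaleC_right)
  then have "\<mu> = cnj \<mu>" using x(2) by (simp add: cinner_eq_zero_iff)
  then have "\<mu> = of_real (Re \<mu>)" by (auto simp: complex_eq_iff)
  then obtain r where r: "\<mu> = of_real r" by blast
  have N: "(norm (wt x (Suc n)))\<^sup>2 = real (Suc n) * (2 * r - real n) * (norm (wt x n))\<^sup>2" for n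
  proof -
    have "complex_of_real ((norm (wt x (Suc n)))\<^sup>2) = cinner (wt x n) (Jp (wt x (Suc n)))"
      using x(1) by (simp add: wt_Suc J_adj cinner_self[symmetric] del: of_real_power)
    also have "\<dots> = complex_of_real (real (Suc n) * (2 * r - real n) * (norm (wt x n))\<^sup>2)"
      unfolding weight_Jp[OF x(1,3,4)] cinner_scaleC_right cinner_self by (simp add: r)
    finally show ?thesis by (simp only: of_real_eq_iff)
  qed
  have "\<exists>n. wt x n = 0"
  proof (rule ccontr)
    assume "\<nexists>n. wt x n = 0"
    then have p: "(norm (wt x n))\<^sup>2 > 0" for n by simp
    obtain n where "2 * r < real n" using reals_Archimedean2 by blast
    then have "real (Suc n) * (2 * r - real n) * (norm (wt x n))\<^sup>2 < 0"
      using p[of n] by (simp add: mult_pos_neg mult_neg_pos)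
    then show False using N[of n] p[of "Suc n"] by linarith
  qed
  define k where "k = (LEAST n. wt x n = 0)"
  have k: "wt x k = 0" unfolding k_def by (rule LeastI_ex) fact
  then have "k \<noteq> 0" using x(2) by (intro notI) simp
  then obtain d where d: "k = Suc d" using not0_implies_Suc by blast
  have "wt x d \<noteq> 0" using not_less_Least[of d "\<lambda>n. wt x n = 0"] d by (auto simp: k_def)
  then have "2 * r = real d" using N[of d] k d by simp
  then have "complex_of_real (2 * r) = of_nat d" by simp
  then show ?thesis by (intro exI[of _ d]) (simp add: r mult.commute)
qed

text \<open>Raise an eigenvector of \<open>J3\<close> until it vanishes. It does vanish, because the
  raised vectors have different weights, hence are orthogonal, and lie in a finite-dimensional
  space.\<close>

lemma highest_weight_exists:
  assumes S: "complex_subspace S" "S \<subseteq> Y" "\<And>x. x \<in> S \<Longrightarrow> J3 x \<in> S" "\<And>x. x \<in> S \<Longrightarrow> Jp x \<in> S"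
    and fin: "findim N S" and x: "x \<in> S" "x \<noteq> 0"
  shows "\<exists>d. \<exists>y\<in>hw d. y \<noteq> 0"
proof -
  have "complex_linear_on S J3" using S(2) J_op(1) unfolding operator_on_def complex_linear_on_def by blast
  from eigenvector_exists[OF S(1) this S(3) fin x]
  obtain \<mu> z where z: "z \<in> S" "z \<noteq> 0" "J3 z = scaleC \<mu> z" by blast
  have kS: "(Jp ^^ k) z \<in> S" for k by (induction k) (auto simp: z S)
  then have kY: "(Jp ^^ k) z \<in> Y" for k using S(2) by blast
  have kw: "J3 ((Jp ^^ k) z) = scaleC (\<mu> + of_nat k) ((Jp ^^ k) z)" for k
  proof (induction k)
    case (Suc k)
    have "J3 ((Jp ^^ Suc k) z) = Jp (scaleC (\<mu> + of_nat k) ((Jp ^^ k) z)) + Jp ((Jp ^^ k) z)"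
      using kY[of k] by (simp add: J_comm Suc.IH)
    then show ?case using kY[of k] by (simp add: scaleC_one_add add_ac)
  qed (use z in simp)
  have orth: "cinner ((Jp ^^ k) z) ((Jp ^^ l) z) = 0" if "k \<noteq> l" for k l
  proof -
    have "\<mu> * cinner z z = cnj \<mu> * cinner z z"
      using J_adj(1)[OF kY[of 0] kY[of 0]] by (simp add: z(3) cinner_scaleC_left cinner_scaleC_right)
    then have "\<mu> = cnj \<mu>" using z(2) by (simp add: cinner_eq_zero_iff)
    then have \<mu>: "cnj \<mu> = \<mu>" by (rule sym)
    have "(of_nat k - of_nat l) * cinner ((Jp ^^ k) z) ((Jp ^^ l) z) = 0"
      using J_adj(1)[OF kY[of k] kY[of l]] unfolding kw
      by (simp add: cinner_scaleC_left cinner_scaleC_right \<mu> algebra_simps)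
    then show ?thesis using that by simp
  qed
  have "\<exists>k. (Jp ^^ k) z = 0"
  proof (rule ccontr)
    assume nz: "\<nexists>k. (Jp ^^ k) z = 0"
    obtain c where c: "\<exists>i\<le>N. c i \<noteq> 0" "(\<Sum>i\<le>N. scaleC (c i) ((Jp ^^ i) z)) = 0"
      using fin kS unfolding findim_def by metis
    then obtain k where k: "k \<le> N" "c k \<noteq> 0" by blast
    have "0 = cinner (\<Sum>i\<le>N. scaleC (c i) ((Jp ^^ i) z)) ((Jp ^^ k) z)" by (simp add: c(2))
    also have "\<dots> = (\<Sum>i\<le>N. if i = k then c k * cinner ((Jp ^^ k) z) ((Jp ^^ k) z) else 0)"
      unfolding cinner.sum_left by (intro sum.cong) (auto simp: cinner_scaleC_left orth)
    also have "\<dots> = c k * cinner ((Jp ^^ k) z) ((Jp ^^ k) z)" using k by simp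
    finally show False using k nz by (simp add: cinner_eq_zero_iff)
  qed
  define k where "k = (LEAST k. (Jp ^^ k) z = 0)"
  have k0: "(Jp ^^ k) z = 0" unfolding k_def by (rule LeastI_ex) fact
  then have "k \<noteq> 0" using z(2) by (intro notI) simp
  then obtain l where l: "k = Suc l" using not0_implies_Suc by blast
  define y where "y = (Jp ^^ l) z"
  have "y \<noteq> 0" using not_less_Least[of l "\<lambda>k. (Jp ^^ k) z = 0"] l unfolding k_def[symmetric] y_def by simp
  moreover have "Jp y = 0" using k0 unfolding l y_def by simp
  ultimately have y: "y \<in> Y" "y \<noteq> 0" "Jp y = 0" "J3 y = scaleC (\<mu> + of_nat l) y"
    using kY[of l] kw[of l] unfolding y_def by blast+
  from highest_weight_integral[OF this] obtain d where d: "\<mu> + of_nat l = of_nat d / 2" by blast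
  have "y \<in> hw d" using y unfolding d hw_def by blast
  then show ?thesis using y(2) by blast
qed

context
  fixes d x assumes x: "x \<in> hw d"
begin

lemma hw_Y: "x \<in> Y" and hw_Jp: "Jp x = 0" and hw_J3: "J3 x = scaleC (of_nat d / 2) x"
  using x by (auto simp: hw_def)

lemma J3_wt: "J3 (wt x n) = scaleC (of_real ((real d - 2 * real n) / 2)) (wt x n)"
  unfolding weight_J3[OF hw_Y hw_J3] by (simp add: diff_divide_distrib)

lemma Jp_wt: "Jp (wt x n) = cf d n *\<^sub>R wt x (n - 1)"
proof (cases n)
  case (Suc k)
  show ?thesis unfolding Suc weight_Jp[OF hw_Y hw_Jp hw_J3]
    by (simp add: cf_def flip: scaleC_of_real)
qed (simp add: hw_Jp cf_def)

lemma norm_wt_Suc: "(norm (wt x (Suc n)))\<^sup>2 = cf d (Suc n) * (norm (wt x n))\<^sup>2"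
proof -
  have "complex_of_real ((norm (wt x (Suc n)))\<^sup>2) = cinner (wt x n) (Jp (wt x (Suc n)))"
    using hw_Y by (simp add: wt_Suc J_adj cinner_self[symmetric] del: of_real_power)
  also have "\<dots> = complex_of_real (cf d (Suc n) * (norm (wt x n))\<^sup>2)"
    unfolding Jp_wt by (simp add: cinner_real_scaleR_right cinner_self)
  finally show ?thesis by (simp only: of_real_eq_iff)
qed

lemma wt_vanish: "n > d \<Longrightarrow> wt x n = 0"
proof (induction n)
  case (Suc n)
  show ?case
  proof (cases "n = d")
    case True
    then show ?thesis using norm_wt_Suc[of n] by (simp add: cf_def)
  next
    case False
    then have "wt x n = 0" using Suc by simp
    then show ?thesis using norm_wt_Suc[of n] by simp
  qed
qed simp

lemma wt_nonzero: "x \<noteq> 0 \<Longrightarrow> n \<le> d \<Longrightarrow> wt x n \<noteq> 0"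
proof (induction n)
  case (Suc n)
  then show ?case using norm_wt_Suc[of n] by (auto simp: cf_def)
qed simp

end

lemma wt_orth:
  assumes "x \<in> hw d" "y \<in> hw d" "n \<noteq> k"
  shows "cinner (wt x n) (wt y k) = 0"
proof -
  have "cinner (J3 (wt x n)) (wt y k) = cinner (wt x n) (J3 (wt y k))"
    using assms by (intro J_adj wt_in) (auto simp: hw_def)
  then have "(complex_of_real ((real d - 2 * real n) / 2) - complex_of_real ((real d - 2 * real k) / 2)) * cinner (wt x n) (wt y k) = 0"
    unfolding J3_wt[OF assms(1)] J3_wt[OF assms(2)] cinner_scaleC_left cinner_scaleC_right by (simp add: algebra_simps)
  moreover have "complex_of_real ((real d - 2 * real n) / 2) \<noteq> complex_of_real ((real d - 2 * real k) / 2)"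
    using assms(3) by (simp only: of_real_eq_iff) simp
  ultimately show ?thesis by simp
qed

end

text \<open>\<open>A t\<close> stands for the operator of \<open>exp (t B3)\<close>. The assumptions
  \<open>A_L1\<close> and \<open>A_L2\<close> express
  \<open>Ad (exp (-t B3)) L1 = cosh t L1 - sinh t B2\<close> and its analogue for \<open>L2\<close>,
  in weak form because \<open>A t\<close> is not assumed to map \<open>Y\<close> into
  itself.\<close>

locale lorentz_module = su2_module Y L1 L2 L3
  for Y :: "'h::complex_hilbert_space set" and L1 L2 L3 +
  fixes B1 B2 B3 :: "'h \<Rightarrow> 'h" and A :: "real \<Rightarrow> 'h \<Rightarrow> 'h"
  assumes B_op: "operator_on Y B1" "operator_on Y B2" "operator_on Y B3"
    and B_skew: "\<And>x y. x \<in> Y \<Longrightarrow> y \<in> Y \<Longrightarrow> cinner (B1 x) y = - cinner x (B1 y)"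
      "\<And>x y. x \<in> Y \<Longrightarrow> y \<in> Y \<Longrightarrow> cinner (B2 x) y = - cinner x (B2 y)"
      "\<And>x y. x \<in> Y \<Longrightarrow> y \<in> Y \<Longrightarrow> cinner (B3 x) y = - cinner x (B3 y)"
    and BL_comm:
      "\<And>x. x \<in> Y \<Longrightarrow> B1 (L1 x) = L1 (B1 x)" "\<And>x. x \<in> Y \<Longrightarrow> B1 (L2 x) = L2 (B1 x) + B3 x"
      "\<And>x. x \<in> Y \<Longrightarrow> B1 (L3 x) = L3 (B1 x) - B2 x" "\<And>x. x \<in> Y \<Longrightarrow> B2 (L1 x) = L1 (B2 x) - B3 x"
      "\<And>x. x \<in> Y \<Longrightarrow> B2 (L2 x) = L2 (B2 x)" "\<And>x. x \<in> Y \<Longrightarrow> B2 (L3 x) = L3 (B2 x) + B1 x"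
      "\<And>x. x \<in> Y \<Longrightarrow> B3 (L1 x) = L1 (B3 x) + B2 x" "\<And>x. x \<in> Y \<Longrightarrow> B3 (L2 x) = L2 (B3 x) - B1 x"
      "\<And>x. x \<in> Y \<Longrightarrow> B3 (L3 x) = L3 (B3 x)"
    and B_comm: "\<And>x. x \<in> Y \<Longrightarrow> B2 (B1 x) = B1 (B2 x) + L3 x"
      "\<And>x. x \<in> Y \<Longrightarrow> B3 (B1 x) = B1 (B3 x) - L2 x" "\<And>x. x \<in> Y \<Longrightarrow> B3 (B2 x) = B2 (B3 x) + L1 x"
    and A_op: "\<And>t. operator_on UNIV (A t)" and A_0: "\<And>x. A 0 x = x"
    and A_deriv: "\<And>x y t. x \<in> Y \<Longrightarrow> y \<in> Y \<Longrightarrow>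
      ((\<lambda>t. cinner (A t x) y) has_vector_derivative cinner (A t (B3 x)) y) (at t)"
    and A_L1: "\<And>x y t. x \<in> Y \<Longrightarrow> y \<in> Y \<Longrightarrow>
      - cinner (A t x) (L1 y) = cinner (A t (cosh t *\<^sub>R L1 x - sinh t *\<^sub>R B2 x)) y"
    and A_L2: "\<And>x y t. x \<in> Y \<Longrightarrow> y \<in> Y \<Longrightarrow>
      - cinner (A t x) (L2 y) = cinner (A t (cosh t *\<^sub>R L2 x + sinh t *\<^sub>R B1 x)) y"
    and hw_fin: "\<And>d. \<exists>N. findim N (hw d)"
begin

lemmas B_in [simp, intro] = B_op[THEN operator_on_in]
lemmas B_lin [simp] = B_op[THEN operator_on_add] B_op[THEN operator_on_scaleC]
  operator_on_minus[OF B_op(1) Y] operator_on_minus[OF B_op(2) Y] operator_on_minus[OF B_op(3) Y]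
  operator_on_scaleR[OF B_op(1) Y] operator_on_scaleR[OF B_op(2) Y] operator_on_scaleR[OF B_op(3) Y]
  operator_on_diff[OF B_op(1) Y] operator_on_diff[OF B_op(2) Y] operator_on_diff[OF B_op(3) Y]
  operator_on_zero[OF B_op(1) Y] operator_on_zero[OF B_op(2) Y] operator_on_zero[OF B_op(3) Y]

text \<open>These rewrite every word in the operators to a Poincare-Birkhoff-Witt normal form.\<close>

lemmas pbw = L_comm BL_comm B_comm

definition C where "C x = L1 (B1 x) + L2 (B2 x) + L3 (B3 x)"
text \<open>Not central: the second Casimir operator is \<open>Q\<close> minus the sum of the
  squares of the \<open>L\<^sub>k\<close>. That sum is a scalar on each irreducible type of
  \<open>so(3)\<close>, so \<open>Q\<close>, which commutes with the \<open>L\<^sub>k\<close>, does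
  the same service.\<close>

definition Q where "Q x = B1 (B1 x) + B2 (B2 x) + B3 (B3 x)"

lemma CQ_op: "operator_on Y C" "operator_on Y Q"
  unfolding operator_on_def complex_linear_on_def by (auto simp: C_def Q_def scaleC_add_right)

lemmas CQ_in [simp, intro] = CQ_op[THEN operator_on_in]

lemma C_L: assumes "x \<in> Y" shows "C (L1 x) = L1 (C x)" "C (L2 x) = L2 (C x)" "C (L3 x) = L3 (C x)"
  using assms by (simp_all add: C_def pbw algebra_simps)

lemma Q_L: assumes "x \<in> Y" shows "Q (L1 x) = L1 (Q x)" "Q (L2 x) = L2 (Q x)" "Q (L3 x) = L3 (Q x)"
  using assms by (simp_all add: Q_def pbw algebra_simps)

lemma C_B: assumes "x \<in> Y" shows "C (B1 x) = B1 (C x)" "C (B2 x) = B2 (C x)" "C (B3 x) = B3 (C x)"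
  using assms by (simp_all add: C_def pbw algebra_simps)

lemma C_Q: "x \<in> Y \<Longrightarrow> C (Q x) = Q (C x)"
  by (simp add: Q_def C_B CQ_op(1)[THEN operator_on_add])

text \<open>\<open>L\<^sub>k\<close> and \<open>B\<^sub>k\<close> are skew and commute, so each
  product is symmetric. Hence the eigenvalue \<open>\<theta>\<close> of \<open>C\<close> is real, as
  \<open>decay_step\<close> requires for a pure oscillation.\<close>

lemma C_sym: "x \<in> Y \<Longrightarrow> y \<in> Y \<Longrightarrow> cinner (C x) y = cinner x (C y)"
  by (simp add: C_def cinner.add_left cinner.add_right L_skew B_skew BL_comm)

lemma CQ_J:
  assumes "x \<in> Y"
  shows "C (J3 x) = J3 (C x)" "C (Jp x) = Jp (C x)" "C (Jm x) = Jm (C x)"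
    "Q (J3 x) = J3 (Q x)" "Q (Jp x) = Jp (Q x)" "Q (Jm x) = Jm (Q x)"
  using assms
  by (simp_all add: J_defs C_L Q_L CQ_op[THEN operator_on_add] CQ_op[THEN operator_on_scaleC]
      operator_on_diff[OF CQ_op(1) Y] operator_on_diff[OF CQ_op(2) Y])

lemma CQ_hw: "x \<in> hw d \<Longrightarrow> C x \<in> hw d" "x \<in> hw d \<Longrightarrow> Q x \<in> hw d"
  by (auto simp: hw_def CQ_J[symmetric] CQ_op[THEN operator_on_scaleC]
      operator_on_zero[OF CQ_op(1) Y] operator_on_zero[OF CQ_op(2) Y])

text \<open>\<open>C\<close> commutes with \<open>Q\<close>, so it preserves an eigenspace of
  \<open>Q\<close> inside the finite-dimensional space \<open>hw d\<close>.\<close>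

lemma joint_eigenvector:
  assumes "x0 \<in> hw d" "x0 \<noteq> 0"
  shows "\<exists>x\<in>hw d. \<exists>\<theta> \<beta>. x \<noteq> 0 \<and> C x = scaleC (of_real \<theta>) x \<and> Q x = scaleC \<beta> x"
proof -
  obtain N where N: "findim N (hw d)" using hw_fin by blast
  have lin: "complex_linear_on S C" "complex_linear_on S Q" if "S \<subseteq> Y" for S
    using CQ_op that unfolding operator_on_def complex_linear_on_def by blast+
  have hwY: "hw d \<subseteq> Y" by (auto simp: hw_def)
  obtain \<beta> x1 where x1: "x1 \<in> hw d" "x1 \<noteq> 0" "Q x1 = scaleC \<beta> x1"
    using eigenvector_exists[OF hw_subspace lin(2)[OF hwY] CQ_hw(2) N assms] by blast
  define E where "E = {x \<in> hw d. Q x = scaleC \<beta> x}"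
  have E: "complex_subspace E" "E \<subseteq> hw d"
    by (rule complex_subspaceI)
      (use hwY in \<open>auto simp: E_def complex_subspace_0[OF hw_subspace] complex_subspace_add[OF hw_subspace]
        complex_subspace_scaleC[OF hw_subspace] operator_on_zero[OF CQ_op(2) Y] subset_iff
        CQ_op[THEN operator_on_add] CQ_op[THEN operator_on_scaleC] scaleC_add_right scaleC_scaleC mult.commute\<close>)
  have CE: "C x \<in> E" if "x \<in> E" for x
    using that hwY by (auto simp: E_def CQ_hw subset_iff CQ_op[THEN operator_on_scaleC] simp flip: C_Q)
  have "E \<subseteq> Y" using E(2) hwY by blast
  from eigenvector_exists[OF E(1) lin(1)[OF this] CE findim_mono[OF N E(2)], of x1] x1
  obtain \<mu> x where x: "x \<in> E" "x \<noteq> 0" "C x = scaleC \<mu> x" by (auto simp: E_def)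
  have "x \<in> Y" using x(1) \<open>E \<subseteq> Y\<close> by blast
  then have "\<mu> * cinner x x = cnj \<mu> * cinner x x"
    using C_sym[of x x] by (simp add: x(3) cinner_scaleC_left cinner_scaleC_right)
  then have "\<mu> = cnj \<mu>" using x(2) by (simp add: cinner_eq_zero_iff)
  then have "\<mu> = of_real (Re \<mu>)" by (auto simp: complex_eq_iff)
  then have "C x = scaleC (of_real (Re \<mu>)) x" using x(3) by simp
  then show ?thesis using x(1,2) unfolding E_def by blast
qed

definition Bp where "Bp x = B1 x + scaleC \<i> (B2 x)"
definition Bm where "Bm x = B1 x - scaleC \<i> (B2 x)"

lemma Bpm_in [simp, intro]: "x \<in> Y \<Longrightarrow> Bp x \<in> Y" "x \<in> Y \<Longrightarrow> Bm x \<in> Y"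
  by (auto simp: Bp_def Bm_def)

lemma Jp_Bm: "x \<in> Y \<Longrightarrow> Jp (Bm x) = Bm (Jp x) + 2 *\<^sub>R B3 x"
  by (simp add: J_defs Bm_def scaleC_simps pbw scaleR_2)

text \<open>The outermost factors are \<open>B3\<close>, which acts on coefficients as the
  derivative in \<open>t\<close>, and \<open>Bp\<close>, \<open>Bm\<close>, which
  \<open>F_ladder\<close> converts into rotations.\<close>

lemma C_ladder:
  assumes "x \<in> Y"
  shows "scaleC \<i> (C x) = B3 (J3 x) + (1/2) *\<^sub>R (Bm (Jp x) + Bp (Jm x))"
proof -
  have "Bm (Jp x) + Bp (Jm x) = 2 *\<^sub>R (scaleC \<i> (L1 (B1 x)) + scaleC \<i> (L2 (B2 x)))"
    using assms by (simp add: J_defs Bm_def Bp_def scaleC_simps pbw scaleR_2)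
  moreover have "B3 (J3 x) = scaleC \<i> (L3 (B3 x))" using assms by (simp add: J_defs pbw)
  ultimately show ?thesis by (simp add: C_def scaleC_simps)
qed

lemma Q_ladder: "x \<in> Y \<Longrightarrow> Q x = B3 (B3 x) + Bp (Bm x) - J3 x"
  by (simp add: Q_def J_defs Bm_def Bp_def scaleC_simps pbw)

abbreviation F where "F y z t \<equiv> cinner (A t y) z"

lemma F_lin: "F (x + y) z t = F x z t + F y z t" "F (scaleC a x) z t = a * F x z t"
  "F (r *\<^sub>R x) z t = of_real r * F x z t" "F (x - y) z t = F x z t - F y z t"
  using operator_on_add[OF A_op[of t], of x y] operator_on_scaleC[OF A_op[of t], of x a]
    operator_on_scaleC[OF A_op[of t], of x "of_real r"] operator_on_add[OF A_op[of t], of "x - y" y]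
  by (auto simp: cinner.add_left cinner_scaleC_left scaleC_of_real cinner_real_scaleR_left)

text \<open>Solving \<open>A_L1\<close> and \<open>A_L2\<close> for the boosts expresses them by
  rotations acting on the two sides of the coefficient; the price is a factor
  \<open>sinh t\<close>.\<close>

lemma F_ladder:
  assumes "y \<in> Y" "z \<in> Y"
  shows "of_real (sinh t) * F (Bm y) z t = F y (Jp z) t - of_real (cosh t) * F (Jm y) z t"
    and "of_real (sinh t) * F (Bp y) z t = of_real (cosh t) * F (Jp y) z t - F y (Jm z) t"
  using A_L1[OF assms, of t] A_L2[OF assms, of t] assms
  by (simp_all add: J_defs Bm_def Bp_def F_lin cinner.add_right cinner.diff_right cinner_scaleC_right
      algebra_simps) (simp_all add: complex_eq_iff algebra_simps)

text \<open>The equations for \<open>C\<close> and \<open>Q\<close> involve diagonal coefficients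
  only: \<open>F_ladder\<close> distributes raising and lowering over both arguments, so the two
  arguments always reach the same weight.\<close>

lemma decay_contradiction:
  assumes x0: "x0 \<in> hw d" "x0 \<noteq> 0"
    and decay: "\<And>x y n. x \<in> hw d \<Longrightarrow> y \<in> Y \<Longrightarrow> ((\<lambda>t. exp t *\<^sub>R cinner (A t y) (wt x n)) \<longlongrightarrow> 0) at_top"
  shows False
proof -
  obtain x \<theta> \<beta> where x: "x \<in> hw d" "x \<noteq> 0" and \<theta>: "C x = scaleC (of_real \<theta>) x" and \<beta>: "Q x = scaleC \<beta> x"
    using joint_eigenvector[OF x0] by blast
  have xY: "x \<in> Y" using x by (simp add: hw_def)
  define v where "v = wt x"
  have vY [simp]: "v n \<in> Y" for n using xY by (simp add: v_def)
  have vJm: "Jm (v n) = v (Suc n)" for n by (simp add: v_def wt_Suc)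
  have vJp: "Jp (v n) = cf d n *\<^sub>R v (n - 1)" for n using Jp_wt[OF x(1)] by (simp add: v_def)
  define m where "m n = (real d - 2 * real n) / 2" for n
  have vJ3: "J3 (v n) = m n *\<^sub>R v n" for n
    using J3_wt[OF x(1), of n] unfolding v_def m_def scaleC_of_real .
  have vC: "C (v n) = scaleC (of_real \<theta>) (v n)" for n
  proof (induction n)
    case (Suc n) then show ?case by (simp add: CQ_J flip: vJm)
  qed (simp add: v_def \<theta>)
  have vQ: "Q (v n) = scaleC \<beta> (v n)" for n
  proof (induction n)
    case (Suc n) then show ?case by (simp add: CQ_J flip: vJm)
  qed (simp add: v_def \<beta>)
  have vJmJp: "Jm (Jp (v n)) = cf d n *\<^sub>R v n" for n
    by (cases n) (simp_all add: vJp vJm cf_def)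
  have vJpJm: "Jp (Jm (v n)) = cf d (Suc n) *\<^sub>R v n" for n
    by (simp add: vJp vJm)
  have vJpS: "Jp (v (Suc n)) = cf d (Suc n) *\<^sub>R v n" for n by (simp add: vJp)
  define N where "N n = complex_of_real ((norm (v n))\<^sup>2)" for n
  have N0: "N n \<noteq> 0" if "n \<le> d" for n using wt_nonzero[OF x that] by (simp add: N_def v_def)
  have NS: "N (Suc n) = of_real (cf d (Suc n)) * N n" for n
    using norm_wt_Suc[OF x(1), of n] unfolding N_def v_def of_real_mult[symmetric] by simp
  define f where "f n t = F (v n) (v n) t / N n" for n t
  define f1 where "f1 n t = F (B3 (v n)) (v n) t / N n" for n t
  define f2 where "f2 n t = F (B3 (B3 (v n))) (v n) t / N n" for n t
  \<comment> \<open>Valid also at \<open>n = d + 1\<close>, where \<open>v n\<close> and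
    \<open>N n\<close> are both 0.\<close>
  have G: "F (v n) (v n) t = f n t * N n" for n t
    by (cases "v n = 0") (simp_all add: f_def N_def)
  have GS: "F (v (Suc n)) (v (Suc n)) t = of_real (cf d (Suc n)) * f (Suc n) t * N n" for n t
    unfolding G NS by simp
  have GP: "F (Jp (v n)) (Jp (v n)) t = of_real (cf d n) * f (n - 1) t * N n" for n t
    by (cases n) (simp_all add: vJp F_lin cinner_real_scaleR_right G NS cf_def)
  show False
  proof (rule no_decaying_solution[of d f f1 f2 \<theta> \<beta>], goal_cases)
    case (1 n t)
    show ?case unfolding f_def f1_def
      by (rule bounded_linear.has_vector_derivative[OF bounded_linear_divide A_deriv]) simp_all
  next
    case (2 n t)
    show ?case unfolding f1_def f2_def
      by (rule bounded_linear.has_vector_derivative[OF bounded_linear_divide A_deriv]) simp_all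
  next
    case (3 n)
    then show ?case using N0[of n] by (simp add: f_def A_0 cinner_self N_def)
  next
    case (4 n)
    have "((\<lambda>t. exp t *\<^sub>R F (v n) (v n) t / N n) \<longlongrightarrow> 0 / N n) at_top"
      using N0[OF 4] decay[OF x(1) vY[of n], of n] by (intro tendsto_divide tendsto_const) (simp_all add: v_def)
    then show ?case by (simp add: f_def scaleR_conv_of_real)
  next
    case (5 n t)
    have "of_real (sinh t) * (\<i> * of_real \<theta> * F (v n) (v n) t) = of_real (sinh t) * F (scaleC \<i> (C (v n))) (v n) t"
      by (simp add: vC F_lin)
    also have "\<dots> = of_real (m n * sinh t) * F (B3 (v n)) (v n) t
        + (1/2) * (of_real (sinh t) * F (Bm (Jp (v n))) (v n) t) + (1/2) * (of_real (sinh t) * F (Bp (Jm (v n))) (v n) t)"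
      by (simp add: C_ladder F_lin vJ3 algebra_simps)
    also have "\<dots> = of_real (m n * sinh t) * F (B3 (v n)) (v n) t
        + (1/2) * (F (Jp (v n)) (Jp (v n)) t - of_real (cosh t) * (of_real (cf d n) * F (v n) (v n) t))
        + (1/2) * (of_real (cosh t) * (of_real (cf d (Suc n)) * F (v n) (v n) t) - F (v (Suc n)) (v (Suc n)) t)"
      by (simp add: F_ladder vJmJp vJpS vJm F_lin del: of_real_mult)
    also have "\<dots> = (of_real (m n * sinh t) * f1 n t + of_real (cf d n / 2) * (f (n - 1) t - of_real (cosh t) * f n t)
        + of_real (cf d (Suc n) / 2) * (of_real (cosh t) * f n t - f (Suc n) t)) * N n"
      unfolding GP GS G using N0[OF 5(1)] by (simp add: f1_def NS field_simps)
    finally have "(\<i> * of_real \<theta> * f n t * of_real (sinh t)) * N n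
      = (of_real (m n * sinh t) * f1 n t + of_real (cf d n / 2) * (f (n - 1) t - of_real (cosh t) * f n t)
        + of_real (cf d (Suc n) / 2) * (of_real (cosh t) * f n t - f (Suc n) t)) * N n"
      unfolding G by (simp only: mult_ac)
    then show ?case using N0[OF 5(1)] unfolding m_def cf_def mult_right_cancel[OF N0[OF 5(1)]] by simp
  next
    case (6 n t)
    have "of_real ((sinh t)\<^sup>2) * (\<beta> * F (v n) (v n) t) = of_real ((sinh t)\<^sup>2) * F (Q (v n)) (v n) t"
      by (simp add: vQ F_lin)
    also have "\<dots> = of_real ((sinh t)\<^sup>2) * F (B3 (B3 (v n))) (v n) t
        + of_real (sinh t) * (of_real (sinh t) * F (Bp (Bm (v n))) (v n) t) - of_real (m n * (sinh t)\<^sup>2) * F (v n) (v n) t"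
      by (simp add: Q_ladder F_lin vJ3 algebra_simps power2_eq_square)
    \<comment> \<open>\<open>Bp\<close> is converted first. Moving the resulting \<open>Jp\<close>
      past \<open>Bm\<close> leaves \<open>2 B3\<close>, and the two remaining occurrences of
      \<open>Bm\<close> absorb the other factor \<open>sinh t\<close> in the next step.\<close>
    also have "of_real (sinh t) * (of_real (sinh t) * F (Bp (Bm (v n))) (v n) t)
        = of_real (cosh t) * (of_real (sinh t) * F (Bm (Jp (v n))) (v n) t + 2 * of_real (sinh t) * F (B3 (v n)) (v n) t)
          - of_real (sinh t) * F (Bm (v n)) (Jm (v n)) t"
      by (simp add: F_ladder(2) Jp_Bm F_lin algebra_simps)
    also have "\<dots> = of_real (cosh t) * (F (Jp (v n)) (Jp (v n)) t - of_real (cosh t) * (of_real (cf d n) * F (v n) (v n) t)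
          + 2 * of_real (sinh t) * F (B3 (v n)) (v n) t)
          - (of_real (cf d (Suc n)) * F (v n) (v n) t - of_real (cosh t) * F (v (Suc n)) (v (Suc n)) t)"
      by (simp add: F_ladder(1) vJmJp vJpJm F_lin cinner_real_scaleR_right) (simp add: vJm)
    finally have fin: "of_real ((sinh t)\<^sup>2) * (\<beta> * F (v n) (v n) t) =
      of_real ((sinh t)\<^sup>2) * F (B3 (B3 (v n))) (v n) t
        + (of_real (cosh t) * (F (Jp (v n)) (Jp (v n)) t - of_real (cosh t) * (of_real (cf d n) * F (v n) (v n) t)
          + 2 * of_real (sinh t) * F (B3 (v n)) (v n) t)
          - (of_real (cf d (Suc n)) * F (v n) (v n) t - of_real (cosh t) * F (v (Suc n)) (v (Suc n)) t))
        - of_real (m n * (sinh t)\<^sup>2) * F (v n) (v n) t" .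
    have "of_real ((sinh t)\<^sup>2) * (\<beta> * f n t) * N n
      = (of_real ((sinh t)\<^sup>2) * f2 n t + (of_real (cosh t) * (of_real (cf d n) * f (n - 1) t
            - of_real (cosh t) * (of_real (cf d n) * f n t) + 2 * of_real (sinh t) * f1 n t)
          - (of_real (cf d (Suc n)) * f n t - of_real (cosh t) * (of_real (cf d (Suc n)) * f (Suc n) t)))
          - of_real (m n * (sinh t)\<^sup>2) * f n t) * N n"
    proof -
      have "F (B3 (v n)) (v n) t = f1 n t * N n" "F (B3 (B3 (v n))) (v n) t = f2 n t * N n"
        using N0[OF 6(1)] by (simp_all add: f1_def f2_def)
      with fin show ?thesis unfolding GP GS G NS by (simp only: ring_distribs mult_ac)
    qed
    then show ?case unfolding m_def cf_def mult_right_cancel[OF N0[OF 6(1)]] by (simp add: algebra_simps)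
  qed
qed

end

section \<open>The matrix exponential\<close>

text \<open>Matrices carry no ring structure for \<open>**\<close> in the library; this copy of the type, with the
  operator norm, makes the general theory of \<open>exp\<close> in Banach algebras available for \<open>mexp\<close>.\<close>

typedef (overloaded) ('a, 'm) sqm = "UNIV :: (('a::{real_normed_field,euclidean_space})^'m^'m) set"
  morphisms mat_of Sqm ..

setup_lifting type_definition_sqm

lemma matrix_add_rdistrib': "((B + C) ** A) = (B ** A) + (C ** (A :: 'a::semiring_1^'m^'m))"
  by (vector matrix_matrix_mult_def sum.distrib[symmetric] field_simps)

lemma matrix_mult_zero [simp]: "(0 :: 'a::semiring_1^'m^'m) ** A = 0" "A ** (0 :: 'a::semiring_1^'m^'m) = 0"
  by (vector matrix_matrix_mult_def)+

instantiation sqm :: ("{real_normed_field,euclidean_space}", finite) real_algebra_1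
begin
lift_definition zero_sqm :: "('a,'b) sqm" is 0 .
lift_definition one_sqm :: "('a,'b) sqm" is "mat 1" .
lift_definition plus_sqm :: "('a,'b) sqm \<Rightarrow> ('a,'b) sqm \<Rightarrow> ('a,'b) sqm" is "(+)" .
lift_definition minus_sqm :: "('a,'b) sqm \<Rightarrow> ('a,'b) sqm \<Rightarrow> ('a,'b) sqm" is "(-)" .
lift_definition uminus_sqm :: "('a,'b) sqm \<Rightarrow> ('a,'b) sqm" is "uminus" .
lift_definition times_sqm :: "('a,'b) sqm \<Rightarrow> ('a,'b) sqm \<Rightarrow> ('a,'b) sqm" is "(**)" .
lift_definition scaleR_sqm :: "real \<Rightarrow> ('a,'b) sqm \<Rightarrow> ('a,'b) sqm" is "scaleR" .
instance
proof
  have "mat 1 \<noteq> (0 :: 'a^'b^'b)" by (auto simp: vec_eq_iff mat_def)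
  then show "(0 :: ('a,'b) sqm) \<noteq> 1" by transfer metis
qed (transfer; simp add: matrix_mul_assoc matrix_add_ldistrib matrix_add_rdistrib' algebra_simps
      scalar_matrix_assoc matrix_scalar_ac)+
end

instantiation sqm :: ("{real_normed_field,euclidean_space}", finite) real_normed_algebra_1
begin
lift_definition norm_sqm :: "('a,'b) sqm \<Rightarrow> real" is "\<lambda>A. onorm ((*v) A)" .
definition "sgn_sqm (x :: ('a,'b) sqm) = x /\<^sub>R norm x"
definition "dist_sqm (x :: ('a,'b) sqm) y = norm (x - y)"
definition [code del]: "uniformity_sqm = (INF e\<in>{0<..}. principal {(x :: ('a,'b) sqm, y). dist x y < e})"
definition [code del]: "open_sqm (U :: ('a,'b) sqm set) = (\<forall>x\<in>U. eventually (\<lambda>(x', y). x' = x \<longrightarrow> y \<in> U) uniformity)"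
instance
proof
  fix x y :: "('a,'b) sqm" and r :: real
  have bl: "bounded_linear ((*v) (A :: 'a^'b^'b))" for A by simp
  show "dist x y = norm (x - y)" by (rule dist_sqm_def)
  show "sgn x = x /\<^sub>R norm x" by (rule sgn_sqm_def)
  show "uniformity = (INF e\<in>{0<..}. principal {(x :: ('a,'b) sqm, y). dist x y < e})" by (rule uniformity_sqm_def)
  show "open U = (\<forall>x\<in>U. eventually (\<lambda>(x', y). x' = x \<longrightarrow> y \<in> U) uniformity)" for U :: "('a,'b) sqm set"
    by (rule open_sqm_def)
  show "norm x = 0 \<longleftrightarrow> x = 0"
  proof transfer
    fix A :: "'a^'b^'b"
    have "A = 0" if "\<forall>v. A *v v = 0"
      using that by (metis matrix_eq matrix_vector_mult_0)
    then show "onorm ((*v) A) = 0 \<longleftrightarrow> A = 0" by (auto simp: onorm_eq_0[OF bl])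
  qed
  show "norm (x + y) \<le> norm x + norm y"
  proof transfer
    fix A B :: "'a^'b^'b"
    have "(*v) (A + B) = (\<lambda>v. A *v v + B *v v)" by (simp add: fun_eq_iff matrix_vector_mult_add_rdistrib)
    then show "onorm ((*v) (A + B)) \<le> onorm ((*v) A) + onorm ((*v) B)" using onorm_triangle[OF bl bl] by simp
  qed
  show "norm (r *\<^sub>R x) = \<bar>r\<bar> * norm x"
  proof transfer
    fix A :: "'a^'b^'b" and r :: real
    have "(*v) (r *\<^sub>R A) = (\<lambda>v. r *\<^sub>R (A *v v))"
      by (auto simp: fun_eq_iff vec_eq_iff matrix_vector_mult_def scaleR_sum_right)
    then show "onorm ((*v) (r *\<^sub>R A)) = \<bar>r\<bar> * onorm ((*v) A)" by (simp add: onorm_scaleR[OF bl])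
  qed
  show "norm (x * y) \<le> norm x * norm y"
    by transfer (use onorm_compose[OF bl bl] in \<open>simp add: o_def matrix_vector_mul_assoc\<close>)
  show "norm (1 :: ('a,'b) sqm) = 1"
  proof transfer
    have "(*v) (mat 1 :: 'a^'b^'b) = (\<lambda>v. v)" by (simp add: fun_eq_iff)
    then show "onorm ((*v) (mat 1 :: 'a^'b^'b)) = 1" by (simp add: onorm_id)
  qed
qed
end

lemma norm_entry_le: "norm (A $ i $ j) \<le> onorm ((*v) (A :: 'a::{real_normed_field,euclidean_space}^'m^'m))"
proof -
  have "norm (A $ i $ j) = norm ((A *v axis j 1) $ i)"
    by (simp add: matrix_vector_mult_def axis_def if_distrib sum.delta cong: if_cong)
  also have "\<dots> \<le> norm (A *v axis j 1)" by (rule Finite_Cartesian_Product.norm_nth_le)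
  also have "\<dots> \<le> onorm ((*v) A) * norm (axis j (1::'a))" by (rule onorm) simp
  also have "norm (axis j (1::'a) :: 'a^'m) = 1"
  proof -
    have "(norm ((axis j (1::'a) :: 'a^'m) $ i))\<^sup>2 = (if i = j then 1 else 0)" for i by (simp add: axis_def)
    then show ?thesis by (simp add: norm_vec_def L2_set_def)
  qed
  finally show ?thesis by simp
qed

lemma norm_matrix_le: "norm (A :: 'a::real_normed_vector^'m^'m) \<le> (\<Sum>i\<in>UNIV. \<Sum>j\<in>UNIV. norm (A $ i $ j))"
proof -
  have v: "norm (w :: 'b::real_normed_vector^'m) \<le> (\<Sum>i\<in>UNIV. norm (w $ i))" for w
    unfolding norm_vec_def by (rule L2_set_le_sum) simp
  show ?thesis by (rule order_trans[OF v sum_mono[OF v]])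
qed

lemma bounded_linear_mat_of: "bounded_linear (mat_of :: ('a::{real_normed_field,euclidean_space},'m::finite) sqm \<Rightarrow> _)"
proof
  show "\<exists>K. \<forall>x. norm (mat_of x) \<le> norm (x :: ('a,'m) sqm) * K"
  proof (intro exI allI)
    fix x :: "('a,'m) sqm"
    have "norm (mat_of x) \<le> (\<Sum>i\<in>(UNIV::'m set). \<Sum>j\<in>(UNIV::'m set). norm x)"
      by (rule order_trans[OF norm_matrix_le]) (intro sum_mono, simp add: norm_sqm.rep_eq norm_entry_le)
    then show "norm (mat_of x) \<le> norm x * (of_nat (CARD('m)) * of_nat (CARD('m)))" by (simp add: mult_ac)
  qed
qed (simp_all add: plus_sqm.rep_eq scaleR_sqm.rep_eq)

lemma Sqm_simps: "Sqm (A ** B) = Sqm A * Sqm B" "Sqm (A + B) = Sqm A + Sqm B" "Sqm (r *\<^sub>R A) = r *\<^sub>R Sqm A"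
    "Sqm (A - B) = Sqm A - Sqm B" "Sqm (- A) = - Sqm A" "Sqm (mat 1) = 1" "Sqm 0 = 0"
  by (simp_all add: mat_of_inject[symmetric] Sqm_inverse times_sqm.rep_eq plus_sqm.rep_eq scaleR_sqm.rep_eq
      minus_sqm.rep_eq uminus_sqm.rep_eq one_sqm.rep_eq zero_sqm.rep_eq)

lemma bounded_linear_Sqm: "bounded_linear (Sqm :: _ \<Rightarrow> ('a::{real_normed_field,euclidean_space},'m::finite) sqm)"
proof -
  have "linear (Sqm :: _ \<Rightarrow> ('a,'m) sqm)"
    by (intro linearI Sqm_simps)
  then show ?thesis by (simp add: linear_conv_bounded_linear)
qed

instance sqm :: ("{real_normed_field,euclidean_space}", finite) banach
proof
  fix X :: "nat \<Rightarrow> ('a,'b) sqm" assume "Cauchy X"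
  then have "Cauchy (\<lambda>n. mat_of (X n))" by (rule bounded_linear.Cauchy[OF bounded_linear_mat_of])
  then obtain L where "(\<lambda>n. mat_of (X n)) \<longlonglongrightarrow> L" using Cauchy_convergent_iff convergent_def by blast
  from bounded_linear.tendsto[OF bounded_linear_Sqm this] show "convergent X"
    by (auto simp: mat_of_inverse convergent_def)
qed

lemma mat_of_power: "mat_of (x ^ k) = ((**) (mat_of x) ^^ k) (mat 1)"
  by (induction k) (auto simp: one_sqm.rep_eq times_sqm.rep_eq)

lemma mexp_eq: "mexp X = mat_of (exp (Sqm X))"
proof -
  have "mat_of (exp (Sqm X)) = (\<Sum>k. mat_of (Sqm X ^ k /\<^sub>R fact k))"
    unfolding exp_def by (rule bounded_linear.suminf[OF bounded_linear_mat_of]) (rule summable_exp_generic)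
  also have "\<dots> = mexp X"
    by (simp add: mexp_def scaleR_sqm.rep_eq mat_of_power Sqm_inverse divide_inverse)
  finally show ?thesis by simp
qed

lemma bounded_bilinear_matrix_mult:
  "bounded_bilinear ((**) :: ('a::{real_normed_field,euclidean_space}^'m^'m) \<Rightarrow> ('a^'m^'m) \<Rightarrow> ('a^'m^'m))"
proof -
  obtain K where K: "\<And>x :: ('a,'m) sqm. norm (mat_of x) \<le> norm x * K"
    using bounded_linear.nonneg_bounded[OF bounded_linear_mat_of] by blast
  obtain M where M: "M \<ge> 0" "\<And>A. norm (Sqm A :: ('a,'m) sqm) \<le> norm A * M"
    using bounded_linear.nonneg_bounded[OF bounded_linear_Sqm] by blast
  have K0: "0 \<le> K" using order_trans[OF norm_ge_zero K[of 1]] by simp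
  show ?thesis
  proof
    show "\<exists>K. \<forall>A B. norm ((A :: 'a^'m^'m) ** (B :: 'a^'m^'m)) \<le> norm A * norm B * K"
    proof (intro exI allI)
      fix A B :: "'a^'m^'m"
      have "norm (A ** B) = norm (mat_of (Sqm A * Sqm B))" by (simp add: times_sqm.rep_eq Sqm_inverse)
      also have "\<dots> \<le> norm (Sqm A * Sqm B) * K" by (rule K)
      also have "\<dots> \<le> (norm A * M) * (norm B * M) * K"
        by (intro mult_right_mono K0 order_trans[OF norm_mult_ineq mult_mono] M mult_nonneg_nonneg norm_ge_zero)
      finally show "norm (A ** B) \<le> norm A * norm B * (M * M * K)" by (simp only: mult_ac)
    qed
  qed (simp_all add: matrix_add_ldistrib matrix_add_rdistrib' scalar_matrix_assoc matrix_scalar_ac)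
qed

interpretation matmul: bounded_bilinear
  "(**) :: ('a::{real_normed_field,euclidean_space}^'m^'m) \<Rightarrow> ('a^'m^'m) \<Rightarrow> ('a^'m^'m)"
  by (rule bounded_bilinear_matrix_mult)

lemmas matmul_assoc = matrix_mul_assoc[symmetric]

lemma mexp_0 [simp]: "mexp (0 :: 'a::{real_normed_field,euclidean_space}^'m^'m) = mat 1"
  by (simp add: mexp_eq Sqm_simps one_sqm.rep_eq)

lemma mexp_add_scaleR: "mexp ((s + t) *\<^sub>R X) = mexp (s *\<^sub>R X) ** mexp (t *\<^sub>R X)"
  for X :: "'a::{real_normed_field,euclidean_space}^'m^'m"
proof -
  have "exp (s *\<^sub>R Sqm X + t *\<^sub>R Sqm X) = exp (s *\<^sub>R Sqm X) * exp (t *\<^sub>R Sqm X)"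
    by (rule exp_add_commuting) (simp add: mult.commute)
  then show ?thesis by (simp add: mexp_eq Sqm_simps scaleR_add_left times_sqm.rep_eq)
qed

lemma mexp_minus: "mexp X ** mexp (- X) = mat 1" "mexp (- X) ** mexp X = mat 1"
  for X :: "'a::{real_normed_field,euclidean_space}^'m^'m"
  using mexp_add_scaleR[of 1 "-1" X] mexp_add_scaleR[of "-1" 1 X] by simp_all

lemma mexp_deriv: "((\<lambda>t. mexp (t *\<^sub>R X)) has_vector_derivative (X ** mexp (t *\<^sub>R X))) (at t within S)"
  for X :: "'a::{real_normed_field,euclidean_space}^'m^'m"
proof -
  have "((\<lambda>t. exp (t *\<^sub>R Sqm X)) has_vector_derivative (Sqm X * exp (t *\<^sub>R Sqm X))) (at t within S)"
    by (rule has_vector_derivative_at_within[OF exp_scaleR_has_vector_derivative_left])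
  from bounded_linear.has_vector_derivative[OF bounded_linear_mat_of this]
  show ?thesis by (simp add: mexp_eq Sqm_simps times_sqm.rep_eq Sqm_inverse)
qed

lemma mexp_commute: "X ** mexp (t *\<^sub>R X) = mexp (t *\<^sub>R X) ** X"
  for X :: "'a::{real_normed_field,euclidean_space}^'m^'m"
proof -
  have "exp (t *\<^sub>R Sqm X) * Sqm X = Sqm X * exp (t *\<^sub>R Sqm X)"
    by (rule exp_times_scaleR_commute)
  then have "mat_of (exp (t *\<^sub>R Sqm X) * Sqm X) = mat_of (Sqm X * exp (t *\<^sub>R Sqm X))" by simp
  then show ?thesis by (simp add: mexp_eq Sqm_simps times_sqm.rep_eq Sqm_inverse)
qed

lemma mexp_deriv': "((\<lambda>t. mexp (t *\<^sub>R X)) has_vector_derivative (mexp (t *\<^sub>R X) ** X)) (at t within S)"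
  for X :: "'a::{real_normed_field,euclidean_space}^'m^'m"
  using mexp_deriv by (simp add: mexp_commute)

lemma mexp_continuous: "continuous_on S (\<lambda>t. mexp (t *\<^sub>R X))"
  for X :: "'a::{real_normed_field,euclidean_space}^'m^'m"
  by (intro continuous_at_imp_continuous_on ballI has_vector_derivative_continuous[OF mexp_deriv])

lemma mexp_conj:
  fixes A A' X :: "'a::{real_normed_field,euclidean_space}^'m^'m"
  assumes "A ** A' = mat 1" "A' ** A = mat 1"
  shows "A ** mexp X ** A' = mexp (A ** X ** A')"
proof -
  define a a' x where "a = Sqm A" and "a' = Sqm A'" and "x = Sqm X"
  have a: "a * a' = 1" "a' * a = 1"
    using assms by (simp_all add: a_def a'_def flip: Sqm_simps)
  have p: "a * x ^ k * a' = (a * x * a') ^ k" for k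
  proof (induction k)
    case (Suc k)
    have "(a * x * a') * (a * x ^ k * a') = a * x * (a' * a) * x ^ k * a'" by (simp only: mult.assoc)
    also have "\<dots> = a * x ^ Suc k * a'" by (simp add: a mult.assoc)
    finally have "a * x ^ Suc k * a' = (a * x * a') * (a * x ^ k * a')" by simp
    then show ?case by (simp add: Suc.IH)
  qed (use a in simp)
  have bl: "bounded_linear (\<lambda>y. a * y * a')"
    by (intro bounded_linear_intros)
  have "a * exp x * a' = (\<Sum>k. a * (x ^ k /\<^sub>R fact k) * a')"
    unfolding exp_def by (rule bounded_linear.suminf[OF bl]) (rule summable_exp_generic)
  also have "\<dots> = exp (a * x * a')" by (simp add: exp_def p)
  finally have "mat_of (a * exp x * a') = mat_of (exp (a * x * a'))" by simp
  then show ?thesis by (simp add: mexp_eq Sqm_simps times_sqm.rep_eq Sqm_inverse a_def a'_def x_def)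
qed

lemma mexp_unique:
  fixes X Y :: "'a::{real_normed_field,euclidean_space}^'m^'m"
  assumes "\<forall>\<^sub>F t in at 0. mexp (t *\<^sub>R X) = mexp (t *\<^sub>R Y)"
  shows "X = Y"
proof -
  have "((\<lambda>t. mexp (t *\<^sub>R X)) has_vector_derivative X) (at 0)" using mexp_deriv[of X 0 UNIV] by simp
  then have "((\<lambda>t. mexp (t *\<^sub>R Y)) has_vector_derivative X) (at 0)"
    unfolding has_vector_derivative_def
    by (rule has_derivative_transform_eventually) (use assms in auto)
  moreover have "((\<lambda>t. mexp (t *\<^sub>R Y)) has_vector_derivative Y) (at 0)"
    using mexp_deriv[of Y 0 UNIV] by simp
  ultimately show ?thesis by (rule vector_derivative_unique_at)
qed


lemma derivative_zero_constant_on_real: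
  fixes f :: "real \<Rightarrow> 'a::real_normed_vector"
  assumes "\<And>t. (f has_vector_derivative 0) (at t)"
  shows "f t = f s"
proof -
  have "(f has_derivative (\<lambda>h. 0)) (at x within UNIV)" for x
    using assms[of x] by (simp add: has_vector_derivative_def)
  then obtain c where "\<And>x. f x = c"
    using has_derivative_zero_constant[of UNIV f] by auto
  then show ?thesis by simp
qed

lemma has_vector_derivative_translate:
  assumes "(f has_vector_derivative D) (at (t + s))"
  shows "((\<lambda>s. f (t + s)) has_vector_derivative D) (at s)" "((\<lambda>t. f (t + s)) has_vector_derivative D) (at t)"
proof -
  have "((\<lambda>s. t + s) has_vector_derivative 0 + 1) (at s)" "((\<lambda>t. t + s) has_vector_derivative 1 + 0) (at t)"
    by (intro has_vector_derivative_add has_vector_derivative_const has_vector_derivative_id)+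
  from vector_diff_chain_at[OF this(1) assms] vector_diff_chain_at[OF this(2) assms] show
    "((\<lambda>s. f (t + s)) has_vector_derivative D) (at s)" "((\<lambda>t. f (t + s)) has_vector_derivative D) (at t)"
    by (simp_all add: o_def)
qed

lemma vector_derivative_quotient_tendsto:
  assumes "(f has_vector_derivative f') (at x)"
  shows "((\<lambda>h. (f (x + h) - f x) /\<^sub>R h) \<longlongrightarrow> f') (at 0)"
proof -
  have "((\<lambda>h. norm (f (x + h) - f x - h *\<^sub>R f') / norm h) \<longlongrightarrow> 0) (at 0)"
    using assms unfolding has_vector_derivative_def has_derivative_at by blast
  then have "((\<lambda>h. (f (x + h) - f x) /\<^sub>R h - f') \<longlongrightarrow> 0) (at 0)"
  proof (rule Lim_null_comparison[rotated])
    have "norm ((f (x + h) - f x) /\<^sub>R h - f') \<le> norm (f (x + h) - f x - h *\<^sub>R f') / norm h" if "h \<noteq> 0" for h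
    proof -
      have "(f (x + h) - f x) /\<^sub>R h - f' = (f (x + h) - f x - h *\<^sub>R f') /\<^sub>R h"
        using that by (simp add: scaleR_diff_right)
      then show ?thesis by (simp add: divide_inverse_commute)
    qed
    then show "\<forall>\<^sub>F h in at 0. norm ((f (x + h) - f x) /\<^sub>R h - f') \<le> norm (f (x + h) - f x - h *\<^sub>R f') / norm h"
      by (auto simp: eventually_at_filter)
  qed
  then show ?thesis by (simp add: LIM_zero_iff)
qed

lemma Ad_deriv:
  fixes X Y :: "'a::{real_normed_field,euclidean_space}^'m^'m"
  shows "((\<lambda>t. mexp (t *\<^sub>R X) ** Y ** mexp (- t *\<^sub>R X)) has_vector_derivative
    mexp (t *\<^sub>R X) ** (X ** Y - Y ** X) ** mexp (- t *\<^sub>R X)) (at t)"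
proof -
  have m: "((\<lambda>t. mexp (- t *\<^sub>R X)) has_vector_derivative (- (X ** mexp (- t *\<^sub>R X)))) (at t)"
    using mexp_deriv[of "- X" t UNIV] by (simp add: matmul.minus_left)
  have "((\<lambda>t. mexp (t *\<^sub>R X) ** Y) has_vector_derivative mexp (t *\<^sub>R X) ** X ** Y) (at t)"
    by (rule bounded_linear.has_vector_derivative[OF matmul.bounded_linear_left mexp_deriv'])
  from matmul.has_vector_derivative[OF this m] show ?thesis
    by (simp add: matmul.diff_left matmul.diff_right matmul.minus_right matmul_assoc)
qed

text \<open>\<open>exp (-t X) W exp (t X)\<close> has derivative 0. Conjugation is thus computed by
  exhibiting any curve with the right initial value that solves
  \<open>W' = X W - W X\<close>.\<close>

lemma Ad_eqI:
  fixes X Y :: "'a::{real_normed_field,euclidean_space}^'m^'m" and W :: "real \<Rightarrow> 'a^'m^'m"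
  assumes d: "\<And>t. (W has_vector_derivative (X ** W t - W t ** X)) (at t)" and W0: "W 0 = Y"
  shows "mexp (t *\<^sub>R X) ** Y ** mexp (- t *\<^sub>R X) = W t"
proof -
  define U where "U t = mexp (- t *\<^sub>R X) ** W t ** mexp (t *\<^sub>R X)" for t
  have m: "((\<lambda>t. mexp (- t *\<^sub>R X)) has_vector_derivative (- (mexp (- t *\<^sub>R X) ** X))) (at t)" for t
    using mexp_deriv'[of "- X" t UNIV] by (simp add: matmul.minus_right)
  have "(U has_vector_derivative 0) (at t)" for t
    unfolding U_def
    using matmul.has_vector_derivative[OF matmul.has_vector_derivative[OF m[of t] d[of t]] mexp_deriv[of X t UNIV]]
    by (simp add: matmul.diff_left matmul.diff_right matmul.minus_left matmul.minus_right matmul.add_left matmul_assoc)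
  from derivative_zero_constant_on_real[OF this, of t 0] have U: "U t = Y" by (simp add: U_def W0)
  have "mexp (t *\<^sub>R X) ** U t ** mexp (- t *\<^sub>R X)
      = (mexp (t *\<^sub>R X) ** mexp (- (t *\<^sub>R X))) ** W t ** (mexp (t *\<^sub>R X) ** mexp (- (t *\<^sub>R X)))"
    by (simp add: U_def matmul_assoc)
  then show ?thesis by (simp add: U mexp_minus)
qed

lemma Ad_rotation:
  fixes X Y Z :: "'a::{real_normed_field,euclidean_space}^'m^'m"
  assumes "X ** Y - Y ** X = Z" "X ** Z - Z ** X = - Y"
  shows "mexp (t *\<^sub>R X) ** Y ** mexp (- t *\<^sub>R X) = cos t *\<^sub>R Y + sin t *\<^sub>R Z"
proof (rule Ad_eqI[of "\<lambda>t. cos t *\<^sub>R Y + sin t *\<^sub>R Z"])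
  fix t
  have "X ** (cos t *\<^sub>R Y + sin t *\<^sub>R Z) - (cos t *\<^sub>R Y + sin t *\<^sub>R Z) ** X
      = cos t *\<^sub>R (X ** Y - Y ** X) + sin t *\<^sub>R (X ** Z - Z ** X)"
    by (simp add: matmul.add_left matmul.add_right matmul.scaleR_left matmul.scaleR_right algebra_simps)
  then have e: "X ** (cos t *\<^sub>R Y + sin t *\<^sub>R Z) - (cos t *\<^sub>R Y + sin t *\<^sub>R Z) ** X = - sin t *\<^sub>R Y + cos t *\<^sub>R Z"
    by (simp only: assms) simp
  have "((\<lambda>t. cos t *\<^sub>R Y + sin t *\<^sub>R Z) has_vector_derivative - sin t *\<^sub>R Y + cos t *\<^sub>R Z) (at t)"
    by (auto intro!: derivative_eq_intros)
  then show "((\<lambda>t. cos t *\<^sub>R Y + sin t *\<^sub>R Z) has_vector_derivative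
      X ** (cos t *\<^sub>R Y + sin t *\<^sub>R Z) - (cos t *\<^sub>R Y + sin t *\<^sub>R Z) ** X) (at t)"
    by (simp only: e)
qed simp

lemma Ad_boost:
  fixes X Y Z :: "'a::{real_normed_field,euclidean_space}^'m^'m"
  assumes "X ** Y - Y ** X = Z" "X ** Z - Z ** X = Y"
  shows "mexp (t *\<^sub>R X) ** Y ** mexp (- t *\<^sub>R X) = cosh t *\<^sub>R Y + sinh t *\<^sub>R Z"
proof (rule Ad_eqI[of "\<lambda>t. cosh t *\<^sub>R Y + sinh t *\<^sub>R Z"])
  fix t
  have "X ** (cosh t *\<^sub>R Y + sinh t *\<^sub>R Z) - (cosh t *\<^sub>R Y + sinh t *\<^sub>R Z) ** X
      = cosh t *\<^sub>R (X ** Y - Y ** X) + sinh t *\<^sub>R (X ** Z - Z ** X)"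
    by (simp add: matmul.add_left matmul.add_right matmul.scaleR_left matmul.scaleR_right algebra_simps)
  then have e: "X ** (cosh t *\<^sub>R Y + sinh t *\<^sub>R Z) - (cosh t *\<^sub>R Y + sinh t *\<^sub>R Z) ** X = sinh t *\<^sub>R Y + cosh t *\<^sub>R Z"
    by (simp only: assms) simp
  have "((\<lambda>t. cosh t *\<^sub>R Y + sinh t *\<^sub>R Z) has_vector_derivative sinh t *\<^sub>R Y + cosh t *\<^sub>R Z) (at t)"
    by (auto intro!: derivative_eq_intros)
  then show "((\<lambda>t. cosh t *\<^sub>R Y + sinh t *\<^sub>R Z) has_vector_derivative
      X ** (cosh t *\<^sub>R Y + sinh t *\<^sub>R Z) - (cosh t *\<^sub>R Y + sinh t *\<^sub>R Z) ** X) (at t)"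
    by (simp only: e)
qed simp

lemma continuous_on_det: "continuous_on S (det :: 'a::real_normed_field^'m^'m \<Rightarrow> 'a)"
  unfolding det_def by (intro continuous_intros)

text \<open>A local primitive of \<open>\<gamma>\<close> exhibits \<open>\<gamma>\<close> as a differentiable function.\<close>

lemma one_parameter_subgroup:
  fixes \<gamma> :: "real \<Rightarrow> 'a::{real_normed_field,euclidean_space}^'m^'m"
  assumes e: "e > 0" and c: "continuous_on {-e..e} \<gamma>" and \<gamma>0: "\<gamma> 0 = mat 1"
    and hom: "\<And>s t. \<bar>s\<bar> \<le> e \<Longrightarrow> \<bar>t\<bar> \<le> e \<Longrightarrow> \<bar>s + t\<bar> \<le> e \<Longrightarrow> \<gamma> (s + t) = \<gamma> s ** \<gamma> t"
  shows "\<exists>X. \<forall>\<^sub>F t in at 0. \<gamma> t = mexp (t *\<^sub>R X)"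
proof -
  define \<Gamma> where "\<Gamma> t = integral {-e..t} \<gamma>" for t
  have d\<Gamma>: "(\<Gamma> has_vector_derivative \<gamma> t) (at t)" if "\<bar>t\<bar> < e" for t
  proof -
    have "(\<Gamma> has_vector_derivative \<gamma> t) (at t within {-e..e})"
      unfolding \<Gamma>_def using that by (intro integral_has_vector_derivative[OF c]) auto
    moreover have "at t within {-e..e} = at t" using that by (intro at_within_Icc_at) auto
    ultimately show ?thesis by simp
  qed
  \<comment> \<open>The difference quotients of the primitive tend to
    \<open>\<gamma> 0 = mat 1\<close>, so its increment \<open>A\<close> over a short interval is
    invertible.\<close>
  have "((\<lambda>h. det ((\<Gamma> (0 + h) - \<Gamma> 0) /\<^sub>R h)) \<longlongrightarrow> det (mat 1 :: 'a^'m^'m)) (at 0)"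
    using vector_derivative_quotient_tendsto[OF d\<Gamma>[of 0]] e continuous_on_det[of UNIV]
    by (intro isCont_tendsto_compose[of _ det]) (auto simp: \<gamma>0 continuous_on_eq_continuous_at)
  then have "\<forall>\<^sub>F h in at 0. det ((\<Gamma> (0 + h) - \<Gamma> 0) /\<^sub>R h) \<noteq> 0"
    by (rule tendsto_imp_eventually_ne) simp
  then obtain r where r: "r > 0" "\<And>h. h \<noteq> 0 \<Longrightarrow> \<bar>h\<bar> < r \<Longrightarrow> det ((\<Gamma> h - \<Gamma> 0) /\<^sub>R h) \<noteq> 0"
    unfolding eventually_at by (auto simp: dist_norm)
  define h where "h = e / 2"
  have h: "0 < h" "e = 2 * h" using e by (auto simp: h_def)
  define \<delta> where "\<delta> = min r h / 2"
  have \<delta>: "0 < \<delta>" "\<delta> < r" "\<delta> < h" using r(1) h by (auto simp: \<delta>_def)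
  define A where "A = \<Gamma> \<delta> - \<Gamma> 0"
  have "invertible (A /\<^sub>R \<delta>)" using r(2)[of \<delta>] \<delta> by (simp add: invertible_det_nz A_def)
  then obtain A0 where "(A /\<^sub>R \<delta>) ** A0 = mat 1" unfolding invertible_def by blast
  then have "A ** (A0 /\<^sub>R \<delta>) = mat 1" by (simp add: matmul.scaleR_left matmul.scaleR_right)
  then obtain A' where A': "A ** A' = mat 1" by blast
  \<comment> \<open>The integral of \<open>\<gamma> (t + s) = \<gamma> t ** \<gamma> s\<close> over
    \<open>s\<close> in \<open>[0, \<delta>]\<close>. Dividing by \<open>A\<close> writes
    \<open>\<gamma>\<close> in terms of its differentiable primitive.\<close>
  have key: "\<Gamma> (t + \<delta>) - \<Gamma> t = \<gamma> t ** A" if t: "\<bar>t\<bar> < h" for t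
  proof -
    have "((\<lambda>s. \<Gamma> (t + s) - \<gamma> t ** \<Gamma> s) has_vector_derivative 0) (at s within {0..\<delta>})" if s: "s \<in> {0..\<delta>}" for s
    proof -
      have ts: "\<bar>t + s\<bar> < e" "\<bar>s\<bar> < e" using t s \<delta> h by auto
      have "((\<lambda>s. \<Gamma> (t + s)) has_vector_derivative \<gamma> (t + s)) (at s)"
        by (rule has_vector_derivative_translate[OF d\<Gamma>[OF ts(1)]])
      moreover have "((\<lambda>s. \<gamma> t ** \<Gamma> s) has_vector_derivative \<gamma> t ** \<gamma> s) (at s)"
        by (rule bounded_linear.has_vector_derivative[OF matmul.bounded_linear_right d\<Gamma>[OF ts(2)]])
      ultimately have "((\<lambda>s. \<Gamma> (t + s) - \<gamma> t ** \<Gamma> s) has_vector_derivative \<gamma> (t + s) - \<gamma> t ** \<gamma> s) (at s)"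
        by (rule has_vector_derivative_diff)
      moreover have "\<gamma> (t + s) = \<gamma> t ** \<gamma> s" using ts t h by (intro hom) auto
      ultimately show ?thesis by (simp add: has_vector_derivative_at_within)
    qed
    then obtain c where "\<And>s. s \<in> {0..\<delta>} \<Longrightarrow> \<Gamma> (t + s) - \<gamma> t ** \<Gamma> s = c"
      using has_vector_derivative_zero_constant[of "{0..\<delta>}" "\<lambda>s. \<Gamma> (t + s) - \<gamma> t ** \<Gamma> s"] by auto
    from this[of 0] this[of \<delta>] \<delta> show ?thesis by (simp add: A_def matmul.diff_right algebra_simps)
  qed
  define X where "X = (\<gamma> \<delta> - mat 1) ** A'"
  have d\<gamma>: "(\<gamma> has_vector_derivative \<gamma> t ** X) (at t)" if t: "\<bar>t\<bar> < h" for t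
  proof -
    have ts: "\<bar>t + \<delta>\<bar> < e" "\<bar>t\<bar> < e" using t \<delta> h by auto
    have "((\<lambda>t. \<Gamma> (t + \<delta>)) has_vector_derivative \<gamma> (t + \<delta>)) (at t)"
      by (rule has_vector_derivative_translate[OF d\<Gamma>[OF ts(1)]])
    then have "((\<lambda>t. (\<Gamma> (t + \<delta>) - \<Gamma> t) ** A') has_vector_derivative (\<gamma> (t + \<delta>) - \<gamma> t) ** A') (at t)"
      by (intro bounded_linear.has_vector_derivative[OF matmul.bounded_linear_left] has_vector_derivative_diff d\<Gamma>[OF ts(2)])
    moreover have "\<gamma> (t + \<delta>) = \<gamma> t ** \<gamma> \<delta>" using ts t \<delta> h by (intro hom) auto
    ultimately have d: "((\<lambda>t. (\<Gamma> (t + \<delta>) - \<Gamma> t) ** A') has_vector_derivative \<gamma> t ** X) (at t)"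
      by (simp add: X_def matmul.diff_left matmul.diff_right matmul_assoc)
    have "(\<Gamma> (s + \<delta>) - \<Gamma> s) ** A' = \<gamma> s" if "s \<in> {-h<..<h}" for s
      using key[of s] that by (auto simp: matmul_assoc A' abs_less_iff)
    then show ?thesis
      using has_vector_derivative_transform_within_open[OF d, of "{-h<..<h}" \<gamma>] t
      by (auto simp: abs_less_iff)
  qed
  have "\<gamma> t = mexp (t *\<^sub>R X)" if t: "t \<in> {-h<..<h}" for t
  proof -
    have "((\<lambda>t. \<gamma> t ** mexp (t *\<^sub>R (- X))) has_vector_derivative 0) (at s within {-h<..<h})" if s: "s \<in> {-h<..<h}" for s
    proof -
      have "\<bar>s\<bar> < h" using s by (simp add: abs_less_iff)
      from matmul.has_vector_derivative[OF d\<gamma>[OF this] mexp_deriv[of "- X" s UNIV]] show ?thesis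
        by (simp add: matmul.minus_left matmul.minus_right matmul_assoc has_vector_derivative_at_within)
    qed
    then obtain c where c: "\<And>s. s \<in> {-h<..<h} \<Longrightarrow> \<gamma> s ** mexp (s *\<^sub>R (- X)) = c"
      using has_vector_derivative_zero_constant[of "{-h<..<h}" "\<lambda>t. \<gamma> t ** mexp (t *\<^sub>R (- X))"] by auto
    have "c = mat 1" using c[of 0] h by (simp add: \<gamma>0)
    then have "\<gamma> t ** mexp (- (t *\<^sub>R X)) ** mexp (t *\<^sub>R X) = mexp (t *\<^sub>R X)" using c[OF t] by simp
    then show ?thesis by (simp add: matmul_assoc mexp_minus)
  qed
  then show ?thesis
    unfolding eventually_at using h by (intro exI[of _ X] exI[of _ h]) (auto simp: dist_norm abs_less_iff)
qed

subsection \<open>The Lie product formula\<close>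

lemma norm_power_diff_le:
  fixes x y :: "'a::real_normed_algebra_1"
  assumes "norm x \<le> M" "norm y \<le> M" "1 \<le> M"
  shows "norm (x ^ n - y ^ n) \<le> real n * M ^ n * norm (x - y)"
proof (induction n)
  case (Suc n)
  have "x ^ Suc n - y ^ Suc n = x * (x ^ n - y ^ n) + (x - y) * y ^ n" by (simp add: algebra_simps)
  then have "norm (x ^ Suc n - y ^ Suc n) \<le> norm x * norm (x ^ n - y ^ n) + norm (x - y) * norm (y ^ n)"
    by (metis norm_triangle_le add_mono norm_mult_ineq)
  also have "\<dots> \<le> M * (real n * M ^ n * norm (x - y)) + norm (x - y) * M ^ Suc n"
  proof (intro add_mono mult_mono Suc.IH assms)
    have "norm (y ^ n) \<le> norm y ^ n" by (rule norm_power_ineq)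
    also have "\<dots> \<le> M ^ n" using assms by (intro power_mono) auto
    also have "\<dots> \<le> M ^ Suc n" using assms by (intro power_increasing) auto
    finally show "norm (y ^ n) \<le> M ^ Suc n" .
  qed (use assms in auto)
  also have "\<dots> = real (Suc n) * M ^ Suc n * norm (x - y)" by (simp add: algebra_simps)
  finally show ?case .
qed simp

lemma exp_power_scaleR: "exp A ^ k = exp (real k *\<^sub>R A)" for A :: "'a::{real_normed_algebra_1,banach}"
proof (induction k)
  case (Suc k)
  have "exp (A + real k *\<^sub>R A) = exp A * exp (real k *\<^sub>R A)"
    by (rule exp_add_commuting) simp
  then show ?case by (simp add: Suc.IH scaleR_add_left)
qed simp

text \<open>Uniformity in \<open>k \<le> n\<close> keeps all partial products close to the
  one-parameter group, which matters for maps that are multiplicative only near the identity. A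
  single factor differs from \<open>exp ((a + b) / n)\<close> by \<open>o(1/n)\<close>, and at most
  \<open>n\<close> such errors accumulate.\<close>

lemma lie_product_uniform:
  fixes a b :: "'a::{real_normed_algebra_1,banach}"
  assumes "\<epsilon> > 0"
  shows "\<exists>N. \<forall>n\<ge>N. \<forall>k\<le>n. norm ((exp (a /\<^sub>R real n) * exp (b /\<^sub>R real n)) ^ k - exp ((real k / real n) *\<^sub>R (a + b))) < \<epsilon>"
proof -
  define c where "c = norm a + norm b"
  define h where "h t = exp (t *\<^sub>R a) * exp (t *\<^sub>R b) - exp (t *\<^sub>R (a + b))" for t
  have "(h has_vector_derivative (exp (0 *\<^sub>R a) * (b * exp (0 *\<^sub>R b)) + a * exp (0 *\<^sub>R a) * exp (0 *\<^sub>R b)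
      - (a + b) * exp (0 *\<^sub>R (a + b)))) (at 0)"
    unfolding h_def
    by (intro has_vector_derivative_diff has_vector_derivative_mult exp_scaleR_has_vector_derivative_left)
  then have "(h has_vector_derivative 0) (at 0)" by simp
  from tendsto_norm_zero[OF vector_derivative_quotient_tendsto[OF this]]
  have "((\<lambda>t. norm ((h (0 + t) - h 0) /\<^sub>R t)) \<longlongrightarrow> 0) (at 0)" .
  moreover have "h 0 = 0" by (simp add: h_def)
  ultimately have "((\<lambda>t. norm (h t /\<^sub>R t)) \<longlongrightarrow> 0) (at 0)" by (simp only: add_0_left diff_zero)
  then have "\<forall>\<^sub>F t in at 0. norm (h t /\<^sub>R t) < \<epsilon> / exp c"
    using assms by (intro order_tendstoD) auto
  then obtain r where r: "r > 0" "\<And>t. t \<noteq> 0 \<Longrightarrow> \<bar>t\<bar> < r \<Longrightarrow> norm (h t /\<^sub>R t) < \<epsilon> / exp c"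
    unfolding eventually_at dist_norm real_norm_def diff_zero by blast
  obtain N where N: "1 / r < real N" using reals_Archimedean2 by blast
  show ?thesis
  proof (intro exI[of _ N] allI impI)
    fix n k assume n: "N \<le> n" and k: "k \<le> n"
    have n0: "real n > 0" 
    proof -
      have "0 < 1 / r" using r(1) by simp
      then have "0 < real N" using N by linarith
      then show ?thesis using n by simp
    qed
    define x y M where "x = exp (a /\<^sub>R real n) * exp (b /\<^sub>R real n)" and "y = exp ((a + b) /\<^sub>R real n)" and "M = exp (c / real n)"
    have M: "M \<ge> 1" using n0 by (simp add: M_def c_def)
    have xM: "norm x \<le> M"
    proof -
      have "norm x \<le> exp (norm (a /\<^sub>R real n)) * exp (norm (b /\<^sub>R real n))"
        unfolding x_def by (intro order_trans[OF norm_mult_ineq mult_mono] norm_exp) auto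
      also have "\<dots> = M" using n0 by (simp add: M_def c_def divide_inverse_commute distrib_left flip: exp_add)
      finally show ?thesis .
    qed
    have yM: "norm y \<le> M"
    proof -
      have "norm y \<le> exp (norm ((a + b) /\<^sub>R real n))" unfolding y_def by (rule norm_exp)
      also have "\<dots> \<le> M" using n0 norm_triangle_ineq[of a b]
        by (simp add: M_def c_def divide_inverse_commute mult_left_mono)
      finally show ?thesis .
    qed
    have "norm (x ^ k - y ^ k) \<le> real k * M ^ k * norm (x - y)" by (rule norm_power_diff_le[OF xM yM M])
    also have "\<dots> \<le> real n * exp c * norm (x - y)"
    proof (intro mult_right_mono mult_mono)
      have "M ^ k \<le> M ^ n" using M k by (intro power_increasing)
      also have "\<dots> = exp c" using n0 by (simp add: M_def exp_of_nat_mult[symmetric])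
      finally show "M ^ k \<le> exp c" .
    qed (use k M in auto)
    also have "real n * exp c * norm (x - y) = exp c * norm (h (1 / real n) /\<^sub>R (1 / real n))"
      using n0 by (simp add: h_def x_def y_def inverse_eq_divide)
    also have "\<dots> < exp c * (\<epsilon> / exp c)"
    proof (intro mult_strict_left_mono r(2))
      have "1 / r < real n" using N n by (meson less_le_trans of_nat_le_iff)
      then show "\<bar>1 / real n\<bar> < r" using n0 r(1) by (simp add: field_simps)
    qed (use n0 in auto)
    also have "\<dots> = \<epsilon>" by simp
    finally have "norm (x ^ k - y ^ k) < \<epsilon>" .
    moreover have "y ^ k = exp ((real k / real n) *\<^sub>R (a + b))"
      by (simp add: y_def exp_power_scaleR divide_inverse)
    ultimately show "norm ((exp (a /\<^sub>R real n) * exp (b /\<^sub>R real n)) ^ k - exp ((real k / real n) *\<^sub>R (a + b))) < \<epsilon>"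
      by (simp add: x_def)
  qed
qed

definition mpow :: "'a::{real_normed_field,euclidean_space}^'m^'m \<Rightarrow> nat \<Rightarrow> 'a^'m^'m" where
  "mpow A k = ((**) A ^^ k) (mat 1)"

lemma mpow_0 [simp]: "mpow A 0 = mat 1" and mpow_Suc: "mpow A (Suc k) = A ** mpow A k"
  by (simp_all add: mpow_def)

lemma lie_product_matrix:
  fixes X Y :: "'a::{real_normed_field,euclidean_space}^'m^'m"
  assumes "\<epsilon> > 0"
  shows "\<exists>N. \<forall>n\<ge>N. \<forall>k\<le>n. norm (mpow (mexp (X /\<^sub>R real n) ** mexp (Y /\<^sub>R real n)) k
    - mexp ((real k / real n) *\<^sub>R (X + Y))) < \<epsilon>"
proof -
  obtain K where K: "K > 0" "\<And>x :: ('a,'m) sqm. norm (mat_of x) \<le> norm x * K"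
    using bounded_linear.pos_bounded[OF bounded_linear_mat_of] by blast
  obtain N where N: "\<And>n k. n \<ge> N \<Longrightarrow> k \<le> n \<Longrightarrow> norm ((exp (Sqm X /\<^sub>R real n) * exp (Sqm Y /\<^sub>R real n)) ^ k
      - exp ((real k / real n) *\<^sub>R (Sqm X + Sqm Y))) < \<epsilon> / K"
    using lie_product_uniform[of "\<epsilon> / K" "Sqm X" "Sqm Y"] assms K(1) by auto
  show ?thesis
  proof (intro exI[of _ N] allI impI)
    fix n k assume n: "N \<le> n" "k \<le> n"
    let ?w = "(exp (Sqm X /\<^sub>R real n) * exp (Sqm Y /\<^sub>R real n)) ^ k - exp ((real k / real n) *\<^sub>R (Sqm X + Sqm Y))"
    have "mpow (mexp (X /\<^sub>R real n) ** mexp (Y /\<^sub>R real n)) k - mexp ((real k / real n) *\<^sub>R (X + Y)) = mat_of ?w"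
      by (simp add: mpow_def mexp_eq Sqm_simps minus_sqm.rep_eq mat_of_power times_sqm.rep_eq scaleR_add_right)
    then have "norm (mpow (mexp (X /\<^sub>R real n) ** mexp (Y /\<^sub>R real n)) k - mexp ((real k / real n) *\<^sub>R (X + Y))) \<le> norm ?w * K"
      using K(2)[of ?w] by simp
    also have "\<dots> < \<epsilon> / K * K" using N[OF n] K(1) by (intro mult_strict_right_mono)
    finally show "norm (mpow (mexp (X /\<^sub>R real n) ** mexp (Y /\<^sub>R real n)) k - mexp ((real k / real n) *\<^sub>R (X + Y))) < \<epsilon>"
      using K(1) by simp
  qed
qed

lemma lie_product_tendsto:
  fixes X Y :: "'a::{real_normed_field,euclidean_space}^'m^'m"
  shows "(\<lambda>n. mpow (mexp (X /\<^sub>R real n) ** mexp (Y /\<^sub>R real n)) n) \<longlonglongrightarrow> mexp (X + Y)"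
proof (rule LIMSEQ_I)
  fix \<epsilon> :: real assume "\<epsilon> > 0"
  from lie_product_matrix[OF this, of X Y]
  obtain M where M: "\<And>n k. n \<ge> M \<Longrightarrow> k \<le> n \<Longrightarrow> norm (mpow (mexp (X /\<^sub>R real n) ** mexp (Y /\<^sub>R real n)) k
      - mexp ((real k / real n) *\<^sub>R (X + Y))) < \<epsilon>" by blast
  have "norm (mpow (mexp (X /\<^sub>R real n) ** mexp (Y /\<^sub>R real n)) n - mexp (X + Y)) < \<epsilon>" if "n \<ge> max M 1" for n
  proof -
    have "real n / real n = 1" using that by simp
    with M[of n n] that show ?thesis by (simp only: scaleR_one max.bounded_iff order_refl)
  qed
  then show "\<exists>no. \<forall>n\<ge>no. norm (mpow (mexp (X /\<^sub>R real n) ** mexp (Y /\<^sub>R real n)) n - mexp (X + Y)) < \<epsilon>" by blast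
qed

subsection \<open>Differentials of local homomorphisms\<close>

locale local_hom =
  fixes H V :: "('b::{real_normed_field,euclidean_space}^'l^'l) set"
    and g :: "'b^'l^'l \<Rightarrow> 'a::{real_normed_field,euclidean_space}^'m^'m"
  assumes H_mult: "\<And>x y. x \<in> H \<Longrightarrow> y \<in> H \<Longrightarrow> x ** y \<in> H" and H_one: "mat 1 \<in> H"
    and V_open: "openin (top_of_set H) V" and V_one: "mat 1 \<in> V"
    and g_cont: "continuous_on V g" and g_one: "g (mat 1) = mat 1"
    and g_mult: "\<And>x y. x \<in> V \<Longrightarrow> y \<in> V \<Longrightarrow> x ** y \<in> V \<Longrightarrow> g (x ** y) = g x ** g y"
begin

abbreviation dg where "dg \<equiv> lie_differential g"

lemma V_sub: "V \<subseteq> H" using V_open openin_imp_subset by blast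

lemma V_ball: "x \<in> V \<Longrightarrow> \<exists>e>0. \<forall>y\<in>H. norm (y - x) < e \<longrightarrow> y \<in> V"
  using V_open unfolding openin_euclidean_subtopology_iff dist_norm by blast

lemma curve_in_V:
  assumes "continuous (at 0) c" "c 0 \<in> V" "\<And>t. c t \<in> H"
  shows "\<exists>r>0. \<forall>t::real. \<bar>t\<bar> < r \<longrightarrow> c t \<in> V"
proof -
  obtain e where e: "e > 0" "\<And>y. y \<in> H \<Longrightarrow> norm (y - c 0) < e \<Longrightarrow> y \<in> V"
    using V_ball[OF assms(2)] by blast
  obtain r where "r > 0" "\<And>t. norm (t - 0) < r \<Longrightarrow> norm (c t - c 0) < e"
    using assms(1) e(1) unfolding continuous_at_eps_delta dist_norm by blast
  then show ?thesis using e(2) assms(3) by (intro exI[of _ r]) auto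
qed

lemma lie_algebra_mexp: "Y \<in> lie_algebra H \<Longrightarrow> mexp (t *\<^sub>R Y) \<in> H"
  by (simp add: lie_algebra_def)

lemma exp_in_V: "Y \<in> lie_algebra H \<Longrightarrow> \<exists>r>0. \<forall>t::real. \<bar>t\<bar> < r \<longrightarrow> mexp (t *\<^sub>R Y) \<in> V"
  by (rule curve_in_V) (auto simp: V_one lie_algebra_mexp intro: has_vector_derivative_continuous[OF mexp_deriv])

lemma dg_eqI:
  assumes "\<forall>\<^sub>F t in at 0. g (mexp (t *\<^sub>R Y)) = mexp (t *\<^sub>R X)"
  shows "dg Y = X"
  unfolding lie_differential_def
proof (rule the_equality)
  fix X' assume "\<forall>\<^sub>F t in at 0. g (mexp (t *\<^sub>R Y)) = mexp (t *\<^sub>R X')"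
  with assms have "\<forall>\<^sub>F t in at 0. mexp (t *\<^sub>R X') = mexp (t *\<^sub>R X)" by eventually_elim simp
  then show "X' = X" by (rule mexp_unique)
qed fact

lemma dg_exp:
  assumes Y: "Y \<in> lie_algebra H"
  shows "\<exists>r>0. \<forall>t::real. \<bar>t\<bar> < r \<longrightarrow> mexp (t *\<^sub>R Y) \<in> V \<and> g (mexp (t *\<^sub>R Y)) = mexp (t *\<^sub>R dg Y)"
proof -
  obtain r where r: "r > 0" "\<And>t. \<bar>t\<bar> < r \<Longrightarrow> mexp (t *\<^sub>R Y) \<in> V" using exp_in_V[OF Y] by blast
  define e where "e = r / 2"
  have e: "0 < e" "e < r" using r by (auto simp: e_def)
  have "\<exists>X. \<forall>\<^sub>F t in at 0. g (mexp (t *\<^sub>R Y)) = mexp (t *\<^sub>R X)"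
  proof (rule one_parameter_subgroup[OF e(1)])
    have "continuous_on ((\<lambda>t. mexp (t *\<^sub>R Y)) ` {-e..e}) g"
      by (rule continuous_on_subset[OF g_cont]) (use e r in auto)
    from continuous_on_compose[OF mexp_continuous this]
    show "continuous_on {-e..e} (\<lambda>t. g (mexp (t *\<^sub>R Y)))" by (simp add: o_def)
    show "g (mexp ((s + t) *\<^sub>R Y)) = g (mexp (s *\<^sub>R Y)) ** g (mexp (t *\<^sub>R Y))"
      if "\<bar>s\<bar> \<le> e" "\<bar>t\<bar> \<le> e" "\<bar>s + t\<bar> \<le> e" for s t
      unfolding mexp_add_scaleR using that e r(2)[of s] r(2)[of t] r(2)[of "s + t"]
      by (intro g_mult) (auto simp flip: mexp_add_scaleR)
  qed (simp add: g_one)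
  then have ev: "\<forall>\<^sub>F t in at 0. g (mexp (t *\<^sub>R Y)) = mexp (t *\<^sub>R dg Y)" using dg_eqI by blast
  then obtain r' where r': "r' > 0" "\<And>t. t \<noteq> 0 \<Longrightarrow> \<bar>t\<bar> < r' \<Longrightarrow> g (mexp (t *\<^sub>R Y)) = mexp (t *\<^sub>R dg Y)"
    unfolding eventually_at dist_norm real_norm_def diff_zero by blast
  have "g (mexp (t *\<^sub>R Y)) = mexp (t *\<^sub>R dg Y)" if "\<bar>t\<bar> < r'" for t
    using r'(2)[of t] that by (cases "t = 0") (auto simp: g_one)
  then show ?thesis using r r'(1) by (intro exI[of _ "min r r'"]) auto
qed

lemma dg_eqI':
  assumes "r > 0" "\<And>t. \<bar>t\<bar> < r \<Longrightarrow> g (mexp (t *\<^sub>R Y)) = mexp (t *\<^sub>R X)"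
  shows "dg Y = X"
  using assms by (intro dg_eqI) (auto simp: eventually_at dist_norm intro!: exI[of _ r])

lemma lie_algebra_scaleR: "Y \<in> lie_algebra H \<Longrightarrow> c *\<^sub>R Y \<in> lie_algebra H"
  by (auto simp: lie_algebra_def)

lemma dg_scaleR:
  assumes Y: "Y \<in> lie_algebra H"
  shows "dg (c *\<^sub>R Y) = c *\<^sub>R dg Y"
proof -
  obtain r where r: "r > 0" "\<And>t. \<bar>t\<bar> < r \<Longrightarrow> g (mexp (t *\<^sub>R Y)) = mexp (t *\<^sub>R dg Y)"
    using dg_exp[OF Y] by blast
  show ?thesis
  proof (rule dg_eqI')
    show "r / (\<bar>c\<bar> + 1) > 0" using r(1) by simp
    fix t :: real assume t: "\<bar>t\<bar> < r / (\<bar>c\<bar> + 1)"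
    have "\<bar>t * c\<bar> \<le> \<bar>t\<bar> * (\<bar>c\<bar> + 1)" by (simp add: abs_mult algebra_simps)
    also have "\<dots> < r" using t by (simp add: pos_less_divide_eq add_nonneg_pos)
    finally show "g (mexp (t *\<^sub>R c *\<^sub>R Y)) = mexp (t *\<^sub>R c *\<^sub>R dg Y)" using r(2)[of "t * c"] by simp
  qed
qed

text \<open>\<open>exp (t dg Y)\<close> is the \<open>n\<close>-th power of
  \<open>exp ((t/n) dg Y)\<close>, which for large \<open>n\<close> is a value of
  \<open>g\<close>.\<close>

lemma dg_in:
  assumes Y: "Y \<in> lie_algebra H" and g_in: "\<And>x. x \<in> V \<Longrightarrow> g x \<in> G"
    and G_mult: "\<And>x y. x \<in> G \<Longrightarrow> y \<in> G \<Longrightarrow> x ** y \<in> G"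
  shows "dg Y \<in> lie_algebra G"
  unfolding lie_algebra_def
proof (intro CollectI allI)
  fix t
  obtain r where r: "r > 0" "\<And>t. \<bar>t\<bar> < r \<Longrightarrow> mexp (t *\<^sub>R dg Y) \<in> G"
    using dg_exp[OF Y] g_in by metis
  obtain n where n: "\<bar>t\<bar> / r < real n" using reals_Archimedean2 by blast
  then have n0: "real n > 0" using r(1) by (smt (verit) divide_nonneg_pos abs_ge_zero)
  have "\<bar>t / real n\<bar> < r" using n n0 r(1) by (simp add: field_simps)
  then have s: "mexp ((t / real n) *\<^sub>R dg Y) \<in> G" by (rule r(2))
  have "mexp (real (Suc k) *\<^sub>R (t / real n) *\<^sub>R dg Y) \<in> G" for k
  proof (induction k)
    case (Suc k)
    have "mexp (real (Suc (Suc k)) *\<^sub>R (t / real n) *\<^sub>R dg Y)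
        = mexp ((t / real n) *\<^sub>R dg Y) ** mexp (real (Suc k) *\<^sub>R (t / real n) *\<^sub>R dg Y)"
      using mexp_add_scaleR[of 1 "real (Suc k)" "(t / real n) *\<^sub>R dg Y"] by simp
    then show ?case using G_mult[OF s Suc] by simp
  qed (use s in simp)
  from this[of "n - 1"] n0 show "mexp (t *\<^sub>R dg Y) \<in> G" by simp
qed

lemma mpow_in_H: "A \<in> H \<Longrightarrow> mpow A k \<in> H"
  by (induction k) (auto simp: mpow_Suc H_mult H_one)

text \<open>\<open>g\<close> is applied to the products of the Lie product formula. It is
  multiplicative along them because all partial products lie in \<open>V\<close>, and its continuity
  gives the limit.\<close>

lemma dg_add:
  assumes Y: "Y \<in> lie_algebra H" and Z: "Z \<in> lie_algebra H" and YZ: "Y + Z \<in> lie_algebra H"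
  shows "dg (Y + Z) = dg Y + dg Z"
proof -
  obtain e where e: "e > 0" "\<And>y. y \<in> H \<Longrightarrow> norm (y - mat 1) < e \<Longrightarrow> y \<in> V"
    using V_ball[OF V_one] by blast
  have cont: "continuous (at 0) (\<lambda>t. mexp (t *\<^sub>R (Y + Z)))"
    by (rule has_vector_derivative_continuous[OF mexp_deriv])
  have e2: "0 < e / 2" using e(1) by simp
  obtain r0 where r0: "r0 > 0" "\<And>t. \<bar>t\<bar> < r0 \<Longrightarrow> norm (mexp (t *\<^sub>R (Y + Z)) - mat 1) < e / 2"
    using continuous_at_eps_delta[THEN iffD1, OF cont, rule_format, OF e2] unfolding dist_norm by auto
  obtain rY where rY: "rY > 0" "\<And>t. \<bar>t\<bar> < rY \<Longrightarrow> mexp (t *\<^sub>R Y) \<in> V \<and> g (mexp (t *\<^sub>R Y)) = mexp (t *\<^sub>R dg Y)"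
    using dg_exp[OF Y] by blast
  obtain rZ where rZ: "rZ > 0" "\<And>t. \<bar>t\<bar> < rZ \<Longrightarrow> mexp (t *\<^sub>R Z) \<in> V \<and> g (mexp (t *\<^sub>R Z)) = mexp (t *\<^sub>R dg Z)"
    using dg_exp[OF Z] by blast
  obtain rS where rS: "rS > 0" "\<And>t. \<bar>t\<bar> < rS \<Longrightarrow> mexp (t *\<^sub>R (Y + Z)) \<in> V \<and> g (mexp (t *\<^sub>R (Y + Z))) = mexp (t *\<^sub>R dg (Y + Z))"
    using dg_exp[OF YZ] by blast
  define r where "r = min (min r0 rS) (min rY rZ)"
  have r: "r > 0" "r \<le> r0" "r \<le> rY" "r \<le> rZ" "r \<le> rS" using r0(1) rY(1) rZ(1) rS(1) by (auto simp: r_def)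
  have "mexp (t *\<^sub>R dg (Y + Z)) = mexp (t *\<^sub>R (dg Y + dg Z))" if t: "\<bar>t\<bar> < r" for t
  proof -
    define x where "x n = mexp (t *\<^sub>R Y /\<^sub>R real n) ** mexp (t *\<^sub>R Z /\<^sub>R real n)" for n
    define w where "w n = mexp (t *\<^sub>R dg Y /\<^sub>R real n) ** mexp (t *\<^sub>R dg Z /\<^sub>R real n)" for n
    have sm: "\<bar>t / real n\<bar> < r" for n
    proof (cases "n = 0")
      case False
      then have "\<bar>t / real n\<bar> \<le> \<bar>t\<bar>" by (simp add: divide_le_eq mult_left_le_one_le abs_mult) (simp add: mult_le_cancel_left1)
      then show ?thesis using t by linarith
    qed (use r in simp)
    have xH: "x n \<in> H" for n
      unfolding x_def using lie_algebra_mexp[OF Y, of "t / real n"] lie_algebra_mexp[OF Z, of "t / real n"]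
      by (intro H_mult) (simp_all add: divide_inverse mult.commute)
    obtain N where N: "\<And>n k. n \<ge> N \<Longrightarrow> k \<le> n \<Longrightarrow> norm (mpow (x n) k - mexp ((real k / real n) *\<^sub>R (t *\<^sub>R Y + t *\<^sub>R Z))) < e / 2"
      using lie_product_matrix[OF e2, of "t *\<^sub>R Y" "t *\<^sub>R Z"] unfolding x_def by blast
    have inV: "mpow (x n) k \<in> V" if n: "n \<ge> N" "k \<le> n" "n \<ge> 1" for n k
    proof (rule e(2)[OF mpow_in_H[OF xH]])
      have "\<bar>real k / real n * t\<bar> \<le> \<bar>t\<bar>"
      proof -
        have "\<bar>real k / real n * t\<bar> = real k / real n * \<bar>t\<bar>" by (simp add: abs_mult)
        also have "\<dots> \<le> 1 * \<bar>t\<bar>" using n by (intro mult_right_mono) auto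
        finally show ?thesis by simp
      qed
      then have "norm (mexp ((real k / real n * t) *\<^sub>R (Y + Z)) - mat 1) < e / 2" using t r by (intro r0(2)) auto
      then have "norm (mexp ((real k / real n) *\<^sub>R (t *\<^sub>R Y + t *\<^sub>R Z)) - mat 1) < e / 2"
        by (simp add: scaleR_add_right)
      with N[OF n(1,2)] show "norm (mpow (x n) k - mat 1) < e" by norm
    qed
    have gw: "g (mpow (x n) k) = mpow (w n) k" if n: "n \<ge> N" "k \<le> n" "n \<ge> 1" for n k
      using n(2)
    proof (induction k)
      case (Suc k)
      have x1: "x n \<in> V" using inV[of n 1] n by (simp add: mpow_Suc)
      have "g (x n) = w n"
      proof -
        have "mexp (t *\<^sub>R Y /\<^sub>R real n) \<in> V \<and> g (mexp (t *\<^sub>R Y /\<^sub>R real n)) = mexp (t *\<^sub>R dg Y /\<^sub>R real n)"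
          using rY(2)[of "t / real n"] sm[of n] r by (simp add: divide_inverse mult.commute)
        moreover have "mexp (t *\<^sub>R Z /\<^sub>R real n) \<in> V \<and> g (mexp (t *\<^sub>R Z /\<^sub>R real n)) = mexp (t *\<^sub>R dg Z /\<^sub>R real n)"
          using rZ(2)[of "t / real n"] sm[of n] r by (simp add: divide_inverse mult.commute)
        ultimately show ?thesis using g_mult x1 unfolding x_def w_def by metis
      qed
      moreover have "g (mpow (x n) (Suc k)) = g (x n) ** g (mpow (x n) k)"
        unfolding mpow_Suc using x1 inV[of n k] inV[of n "Suc k"] n Suc.prems by (intro g_mult) (auto simp: mpow_Suc)
      ultimately show ?case using Suc by (simp add: mpow_Suc)
    qed (simp add: g_one)
    have xlim: "(\<lambda>n. mpow (x n) n) \<longlonglongrightarrow> mexp (t *\<^sub>R (Y + Z))"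
      using lie_product_tendsto[of "t *\<^sub>R Y" "t *\<^sub>R Z"] by (simp only: x_def scaleR_add_right)
    have xV: "\<forall>\<^sub>F n in sequentially. mpow (x n) n \<in> V"
      using inV by (intro eventually_sequentiallyI[of "max N 1"]) auto
    have tV: "mexp (t *\<^sub>R (Y + Z)) \<in> V" "g (mexp (t *\<^sub>R (Y + Z))) = mexp (t *\<^sub>R dg (Y + Z))"
      using rS(2)[of t] t r by auto
    have "(\<lambda>n. g (mpow (x n) n)) \<longlonglongrightarrow> mexp (t *\<^sub>R dg (Y + Z))"
      using continuous_on_tendsto_compose[OF g_cont xlim tV(1) xV] by (simp only: tV(2))
    moreover have "\<forall>\<^sub>F n in sequentially. g (mpow (x n) n) = mpow (w n) n"
      using gw by (intro eventually_sequentiallyI[of "max N 1"]) auto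
    ultimately have l1: "(\<lambda>n. mpow (w n) n) \<longlonglongrightarrow> mexp (t *\<^sub>R dg (Y + Z))"
      by (rule Lim_transform_eventually)
    have l2: "(\<lambda>n. mpow (w n) n) \<longlonglongrightarrow> mexp (t *\<^sub>R (dg Y + dg Z))"
      using lie_product_tendsto[of "t *\<^sub>R dg Y" "t *\<^sub>R dg Z"] by (simp only: w_def scaleR_add_right)
    show ?thesis by (rule LIMSEQ_unique[OF l1 l2])
  qed
  then have "\<forall>\<^sub>F t in at 0. mexp (t *\<^sub>R dg (Y + Z)) = mexp (t *\<^sub>R (dg Y + dg Z))"
    unfolding eventually_at dist_norm using r(1) by (intro exI[of _ r]) auto
  then show ?thesis by (rule mexp_unique)
qed

text \<open>Near the identity \<open>g\<close> carries conjugation by \<open>exp (s Y)\<close> to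
  conjugation by its image. For fixed \<open>s\<close> the range of the inner parameter
  \<open>t\<close> may shrink, since \<open>dg\<close> depends only on arbitrarily small
  \<open>t\<close>.\<close>

lemma dg_Ad:
  assumes Y: "Y \<in> lie_algebra H" and Z: "Z \<in> lie_algebra H"
  shows "\<exists>r>0. \<forall>s::real. \<bar>s\<bar> < r \<longrightarrow>
    dg (mexp (s *\<^sub>R Y) ** Z ** mexp (- s *\<^sub>R Y)) = mexp (s *\<^sub>R dg Y) ** dg Z ** mexp (- s *\<^sub>R dg Y)"
proof -
  obtain r where r: "r > 0" "\<And>t. \<bar>t\<bar> < r \<Longrightarrow> mexp (t *\<^sub>R Y) \<in> V \<and> g (mexp (t *\<^sub>R Y)) = mexp (t *\<^sub>R dg Y)"
    using dg_exp[OF Y] by blast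
  obtain rZ where rZ: "rZ > 0" "\<And>t. \<bar>t\<bar> < rZ \<Longrightarrow> mexp (t *\<^sub>R Z) \<in> V \<and> g (mexp (t *\<^sub>R Z)) = mexp (t *\<^sub>R dg Z)"
    using dg_exp[OF Z] by blast
  have "dg (mexp (s *\<^sub>R Y) ** Z ** mexp (- s *\<^sub>R Y)) = mexp (s *\<^sub>R dg Y) ** dg Z ** mexp (- s *\<^sub>R dg Y)" if s: "\<bar>s\<bar> < r" for s
  proof -
    define h h' where "h = mexp (s *\<^sub>R Y)" and "h' = mexp (- s *\<^sub>R Y)"
    have h: "h \<in> V" "h' \<in> V" "g h = mexp (s *\<^sub>R dg Y)" "g h' = mexp (- s *\<^sub>R dg Y)"
      using r(2)[of s] r(2)[of "- s"] s by (auto simp: h_def h'_def)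
    have hh': "h ** h' = mat 1" "h' ** h = mat 1" using mexp_minus[of "s *\<^sub>R Y"] by (simp_all add: h_def h'_def)
    have gg': "mexp (s *\<^sub>R dg Y) ** mexp (- s *\<^sub>R dg Y) = mat 1" "mexp (- s *\<^sub>R dg Y) ** mexp (s *\<^sub>R dg Y) = mat 1"
      using mexp_minus[of "s *\<^sub>R dg Y"] by simp_all
    have c: "continuous (at 0) (\<lambda>t. mexp (t *\<^sub>R Z))"
      by (rule has_vector_derivative_continuous[OF mexp_deriv])
    have hH: "h \<in> H" "h' \<in> H" using h V_sub by auto
    have c1: "continuous (at 0) (\<lambda>t. h ** mexp (t *\<^sub>R Z))"
      by (rule bounded_linear.continuous[OF matmul.bounded_linear_right c])
    have c2: "continuous (at 0) (\<lambda>t. h ** mexp (t *\<^sub>R Z) ** h')"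
      by (rule bounded_linear.continuous[OF matmul.bounded_linear_left c1])
    have hV0: "h ** mexp (0 *\<^sub>R Z) \<in> V" "h ** mexp (0 *\<^sub>R Z) ** h' \<in> V"
      using h V_one by (simp_all add: hh')
    obtain r1 where r1: "r1 > 0" "\<And>t. \<bar>t\<bar> < r1 \<Longrightarrow> h ** mexp (t *\<^sub>R Z) \<in> V"
      using curve_in_V[OF c1 hV0(1)] H_mult[OF hH(1) lie_algebra_mexp[OF Z]] by blast
    obtain r2 where r2: "r2 > 0" "\<And>t. \<bar>t\<bar> < r2 \<Longrightarrow> h ** mexp (t *\<^sub>R Z) ** h' \<in> V"
      using curve_in_V[OF c2 hV0(2)] H_mult[OF H_mult[OF hH(1) lie_algebra_mexp[OF Z]] hH(2)] by blast
    have "dg (h ** Z ** h') = mexp (s *\<^sub>R dg Y) ** dg Z ** mexp (- s *\<^sub>R dg Y)"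
    proof (rule dg_eqI')
      show "min rZ (min r1 r2) > 0" using rZ r1 r2 by simp
      fix t assume t: "\<bar>t\<bar> < min rZ (min r1 r2)"
      have "mexp (t *\<^sub>R (h ** Z ** h')) = h ** mexp (t *\<^sub>R Z) ** h'"
        using mexp_conj[OF hh', of "t *\<^sub>R Z"] by (simp add: matmul.scaleR_left matmul.scaleR_right)
      then have "g (mexp (t *\<^sub>R (h ** Z ** h'))) = g (h ** mexp (t *\<^sub>R Z)) ** g h'"
        using g_mult r1(2)[of t] r2(2)[of t] h t by simp
      also have "\<dots> = mexp (s *\<^sub>R dg Y) ** mexp (t *\<^sub>R dg Z) ** mexp (- s *\<^sub>R dg Y)"
        using g_mult[OF h(1), of "mexp (t *\<^sub>R Z)"] rZ(2)[of t] r1(2)[of t] t h by simp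
      also have "\<dots> = mexp (t *\<^sub>R (mexp (s *\<^sub>R dg Y) ** dg Z ** mexp (- s *\<^sub>R dg Y)))"
        using mexp_conj[OF gg', of "t *\<^sub>R dg Z"] by (simp add: matmul.scaleR_left matmul.scaleR_right)
      finally show "g (mexp (t *\<^sub>R (h ** Z ** h'))) = mexp (t *\<^sub>R (mexp (s *\<^sub>R dg Y) ** dg Z ** mexp (- s *\<^sub>R dg Y)))" .
    qed
    then show ?thesis by (simp add: h_def h'_def)
  qed
  then show ?thesis using r(1) by blast
qed

text \<open>The derivative of \<open>dg_Ad\<close> at 0. The orbit of \<open>Z\<close> stays in the
  plane of \<open>Z\<close> and \<open>W\<close>, so linearity of \<open>dg\<close> carries the
  explicit coefficients over. The pairs \<open>c\<close>, \<open>s\<close> in use are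
  \<open>cos, sin\<close>, then \<open>cosh, sinh\<close>, then \<open>1, t\<close>.\<close>

lemma dg_bracket_aux:
  assumes Y: "Y \<in> lie_algebra H" and Z: "Z \<in> lie_algebra H"
    and c: "c 0 = (1::real)" "(c has_real_derivative 0) (at 0)" and s: "s 0 = (0::real)" "(s has_real_derivative 1) (at 0)"
    and Ad: "\<And>t. mexp (t *\<^sub>R Y) ** Z ** mexp (- t *\<^sub>R Y) = c t *\<^sub>R Z + s t *\<^sub>R W"
    and W: "W \<in> lie_algebra H" and sum: "\<And>a b. a *\<^sub>R Z + b *\<^sub>R W \<in> lie_algebra H"
  shows "dg Y ** dg Z - dg Z ** dg Y = dg W"
proof -
  obtain r where r: "r > 0" "\<And>t. \<bar>t\<bar> < r \<Longrightarrow>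
      dg (mexp (t *\<^sub>R Y) ** Z ** mexp (- t *\<^sub>R Y)) = mexp (t *\<^sub>R dg Y) ** dg Z ** mexp (- t *\<^sub>R dg Y)"
    using dg_Ad[OF Y Z] by blast
  have e: "c t *\<^sub>R dg Z + s t *\<^sub>R dg W = mexp (t *\<^sub>R dg Y) ** dg Z ** mexp (- t *\<^sub>R dg Y)" if "\<bar>t\<bar> < r" for t
    using r(2)[OF that] unfolding Ad
    by (simp add: dg_add lie_algebra_scaleR Z W sum dg_scaleR)
  have "((\<lambda>t. c t *\<^sub>R dg Z + s t *\<^sub>R dg W) has_vector_derivative (c 0 *\<^sub>R 0 + 0 *\<^sub>R dg Z) + (s 0 *\<^sub>R 0 + 1 *\<^sub>R dg W)) (at 0)"
    by (intro has_vector_derivative_add has_vector_derivative_scaleR c s has_vector_derivative_const)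
  then have "((\<lambda>t. c t *\<^sub>R dg Z + s t *\<^sub>R dg W) has_vector_derivative dg W) (at 0)" by simp
  then have "((\<lambda>t. mexp (t *\<^sub>R dg Y) ** dg Z ** mexp (- t *\<^sub>R dg Y)) has_vector_derivative dg W) (at 0)"
    by (rule has_vector_derivative_transform_within_open[of _ _ _ "{-r<..<r}"]) (use r(1) e in \<open>auto simp: abs_less_iff\<close>)
  moreover have "((\<lambda>t. mexp (t *\<^sub>R dg Y) ** dg Z ** mexp (- t *\<^sub>R dg Y)) has_vector_derivative
      (dg Y ** dg Z - dg Z ** dg Y)) (at 0)"
    using Ad_deriv[of "dg Y" "dg Z" 0] by simp
  ultimately show ?thesis using vector_derivative_unique_at by blast
qed

lemma dg_bracket:
  assumes Y: "Y \<in> lie_algebra H" and Z: "Z \<in> lie_algebra H" and W: "W \<in> lie_algebra H"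
    and sum: "\<And>a b. a *\<^sub>R Z + b *\<^sub>R W \<in> lie_algebra H"
    and YZ: "Y ** Z - Z ** Y = W" and "Y ** W - W ** Y = - Z \<or> Y ** W - W ** Y = Z"
  shows "dg Y ** dg Z - dg Z ** dg Y = dg W"
  using assms(6)
proof
  assume "Y ** W - W ** Y = - Z"
  note ad = Ad_rotation[OF YZ this]
  have "(cos has_real_derivative 0) (at 0)" "(sin has_real_derivative 1) (at 0)"
    using DERIV_cos[of 0] DERIV_sin[of 0] by simp_all
  from dg_bracket_aux[OF Y Z _ this(1) _ this(2) ad W sum] show ?thesis by simp
next
  assume "Y ** W - W ** Y = Z"
  note ad = Ad_boost[OF YZ this]
  have "(cosh has_real_derivative 0) (at 0)" "(sinh has_real_derivative 1) (at (0::real))"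
    by (rule derivative_eq_intros refl | simp)+
  from dg_bracket_aux[OF Y Z _ this(1) _ this(2) ad W sum] show ?thesis by simp
qed

lemma dg_commute:
  assumes Y: "Y \<in> lie_algebra H" and Z: "Z \<in> lie_algebra H" and YZ: "Y ** Z = Z ** Y"
  shows "dg Y ** dg Z = dg Z ** dg Y"
proof -
  have "dg Y ** dg Z - dg Z ** dg Y = dg (0 *\<^sub>R Z)"
  proof (rule dg_bracket_aux[OF Y Z, of "\<lambda>_. 1" "\<lambda>t. t"])
    show "mexp (t *\<^sub>R Y) ** Z ** mexp (- t *\<^sub>R Y) = 1 *\<^sub>R Z + t *\<^sub>R 0 *\<^sub>R Z" for t
      using Ad_eqI[of "\<lambda>_. Z" Y Z t] YZ by simp
  qed (use Z lie_algebra_scaleR[OF Z, of 0] in \<open>auto intro!: derivative_eq_intros lie_algebra_scaleR\<close>)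
  then show ?thesis using dg_scaleR[OF Z, of 0] by simp
qed

lemma dg_inj:
  assumes inj: "inj_on g V" and Y: "Y \<in> lie_algebra H" and "dg Y = 0"
  shows "Y = 0"
proof -
  obtain r where r: "r > 0" "\<And>t. \<bar>t\<bar> < r \<Longrightarrow> mexp (t *\<^sub>R Y) \<in> V \<and> g (mexp (t *\<^sub>R Y)) = mexp (t *\<^sub>R dg Y)"
    using dg_exp[OF Y] by blast
  have "mexp (t *\<^sub>R Y) = mexp (t *\<^sub>R 0)" if "\<bar>t\<bar> < r" for t
    using inj_onD[OF inj, of "mexp (t *\<^sub>R Y)" "mat 1"] r(2)[OF that] V_one g_one assms(3) by simp
  then have "\<forall>\<^sub>F t in at 0. mexp (t *\<^sub>R Y) = mexp (t *\<^sub>R 0)"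
    unfolding eventually_at dist_norm using r(1) by (intro exI[of _ r]) auto
  then show ?thesis by (rule mexp_unique)
qed

end

subsection \<open>The subalgebra \<open>so(3,1)\<close>\<close>

definition munit :: "'i \<Rightarrow> 'i \<Rightarrow> real^'i^'i::finite" where
  "munit i j = (\<chi> a b. if a = i \<and> b = j then 1 else 0)"

lemma munit_mult: "munit i j ** munit k l = (if j = k then munit i l else 0)"
proof -
  have "(munit i j ** munit k l) $ a $ b = (if j = k then munit i l else 0) $ a $ b" for a b
  proof -
    have "(\<Sum>c\<in>UNIV. (if a = i \<and> c = j then 1 else (0::real)) * (if c = k \<and> b = l then 1 else 0))
        = (\<Sum>c\<in>UNIV. if c = j then (if a = i \<and> j = k \<and> b = l then 1 else 0) else 0)"
      by (intro sum.cong) auto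
    then show ?thesis by (simp add: munit_def matrix_matrix_mult_def)
  qed
  then show ?thesis by (simp add: vec_eq_iff)
qed

lemma signature_form_entry:
  "(signature_form :: real^('p::finite+'q::finite)^('p+'q)) $ i $ j = (if i = j then (case i of Inl _ \<Rightarrow> 1 | Inr _ \<Rightarrow> -1) else 0)"
  by (simp add: signature_form_def)

lemma signature_form_involution: "signature_form ** signature_form = (mat 1 :: real^('p::finite+'q::finite)^('p+'q))"
proof -
  have "(signature_form ** signature_form :: real^('p+'q)^('p+'q)) $ i $ j = mat 1 $ i $ j" for i j
  proof -
    have "(\<Sum>k\<in>UNIV. (signature_form :: real^('p+'q)^('p+'q)) $ i $ k * signature_form $ k $ j)
        = (\<Sum>k\<in>UNIV. if k = i then (if i = j then 1 else 0) else 0)"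
      by (intro sum.cong) (auto simp: signature_form_entry split: sum.split)
    then show ?thesis by (simp add: matrix_matrix_mult_def mat_def)
  qed
  then show ?thesis by (simp add: vec_eq_iff)
qed

lemma bounded_linear_transpose: "bounded_linear (transpose :: real^'m^'m \<Rightarrow> real^'m^'m)"
proof -
  have "linear (transpose :: real^'m^'m \<Rightarrow> real^'m^'m)"
    by (intro linearI) (auto simp: transpose_def vec_eq_iff)
  then show ?thesis by (simp add: linear_conv_bounded_linear)
qed

text \<open>The form transported along \<open>exp (t X)\<close> has as derivative the transport of
  the infinitesimal condition, so it is constant exactly when that condition holds.\<close>

lemma SO_lie_algebra_iff:
  fixes X :: "real^('p::finite+'q::finite)^('p+'q)"
  shows "X \<in> lie_algebra SO_group \<longleftrightarrow> transpose X ** signature_form + signature_form ** X = 0"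
proof -
  define \<eta> :: "real^('p+'q)^('p+'q)" where "\<eta> = signature_form"
  define U where "U t = transpose (mexp (t *\<^sub>R X)) ** \<eta> ** mexp (t *\<^sub>R X)" for t
  have dU: "(U has_vector_derivative transpose (mexp (t *\<^sub>R X)) ** (transpose X ** \<eta> + \<eta> ** X) ** mexp (t *\<^sub>R X)) (at t)" for t
  proof -
    have "((\<lambda>t. transpose (mexp (t *\<^sub>R X))) has_vector_derivative transpose (X ** mexp (t *\<^sub>R X))) (at t)"
      by (rule bounded_linear.has_vector_derivative[OF bounded_linear_transpose mexp_deriv])
    from bounded_linear.has_vector_derivative[OF matmul.bounded_linear_left this, of \<eta>]
    have "((\<lambda>t. transpose (mexp (t *\<^sub>R X)) ** \<eta>) has_vector_derivative transpose (mexp (t *\<^sub>R X)) ** transpose X ** \<eta>) (at t)"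
      by (simp add: matrix_transpose_mul)
    from matmul.has_vector_derivative[OF this mexp_deriv[of X t UNIV]] show ?thesis
      unfolding U_def by (simp add: matmul.add_left matmul.add_right matmul_assoc add.commute)
  qed
  have U0: "U 0 = \<eta>" by (simp add: U_def)
  show ?thesis
  proof
    assume "X \<in> lie_algebra SO_group"
    then have "U t = \<eta>" for t by (simp add: lie_algebra_def SO_group_def U_def \<eta>_def)
    then have "U = (\<lambda>t. \<eta>)" by auto
    then have "(U has_vector_derivative 0) (at 0)" by simp
    from vector_derivative_unique_at[OF this dU[of 0]] show "transpose X ** signature_form + signature_form ** X = 0"
      by (simp add: \<eta>_def)
  next
    assume "transpose X ** signature_form + signature_form ** X = 0"
    then have "(U has_vector_derivative 0) (at t)" for t using dU[of t] by (simp add: \<eta>_def)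
    from derivative_zero_constant_on_real[OF this, of _ 0] have U: "U t = \<eta>" for t by (simp add: U0)
    have "det \<eta> * det \<eta> = 1" using signature_form_involution[where 'p='p and 'q='q]
      by (metis \<eta>_def det_I det_mul)
    then have "det \<eta> \<noteq> 0" by auto
    have sq: "det (mexp (t *\<^sub>R X)) * det (mexp (t *\<^sub>R X)) = 1" for t
      using arg_cong[OF U[of t], of det] \<open>det \<eta> \<noteq> 0\<close> by (simp add: U_def det_mul)
    \<comment> \<open>The form only gives that the square of the determinant is 1; writing
      \<open>exp (t X)\<close> as a square settles the sign.\<close>
    have "det (mexp (t *\<^sub>R X)) = 1" for t
      using sq[of "t / 2"] mexp_add_scaleR[of "t / 2" "t / 2" X] by (simp add: det_mul)
    then show "X \<in> lie_algebra SO_group"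
      using U by (simp add: lie_algebra_def SO_group_def U_def \<eta>_def)
  qed
qed

lemma SO_lie_algebra_entries:
  fixes X :: "real^('p::finite+'q::finite)^('p+'q)"
  shows "X \<in> lie_algebra SO_group \<longleftrightarrow>
    (\<forall>i j. X $ j $ i * signature_form $ j $ j + signature_form $ i $ i * X $ i $ j = 0)"
proof -
  have "(transpose X ** signature_form + signature_form ** X) $ i $ j
      = X $ j $ i * signature_form $ j $ j + signature_form $ i $ i * X $ i $ j" for i j
  proof -
    have "(\<Sum>k\<in>UNIV. X $ k $ i * signature_form $ k $ j) = (\<Sum>k\<in>UNIV. if k = j then X $ j $ i * signature_form $ j $ j else 0)"
      by (intro sum.cong) (auto simp: signature_form_entry)
    moreover have "(\<Sum>k\<in>UNIV. signature_form $ i $ k * X $ k $ j) = (\<Sum>k\<in>UNIV. if k = i then signature_form $ i $ i * X $ i $ j else 0)"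
      by (intro sum.cong) (auto simp: signature_form_entry)
    ultimately show ?thesis by (simp add: matrix_matrix_mult_def transpose_def)
  qed
  then show ?thesis unfolding SO_lie_algebra_iff by (simp add: vec_eq_iff)
qed

lemma SO_lie_algebra_subspace: "subspace (lie_algebra (SO_group :: (real^('p::finite+'q::finite)^('p+'q)) set))"
proof (rule subspaceI)
  show "0 \<in> lie_algebra (SO_group :: (real^('p+'q)^('p+'q)) set)" by (simp add: SO_lie_algebra_entries)
next
  fix x y :: "real^('p+'q)^('p+'q)" assume "x \<in> lie_algebra SO_group" "y \<in> lie_algebra SO_group"
  then have "(x $ j $ i * signature_form $ j $ j + signature_form $ i $ i * x $ i $ j)
      + (y $ j $ i * signature_form $ j $ j + signature_form $ i $ i * y $ i $ j) = 0" for i j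
    by (simp add: SO_lie_algebra_entries)
  then show "x + y \<in> lie_algebra SO_group" by (simp add: SO_lie_algebra_entries algebra_simps)
next
  fix c and x :: "real^('p+'q)^('p+'q)" assume "x \<in> lie_algebra SO_group"
  then have "c * (x $ j $ i * signature_form $ j $ j + signature_form $ i $ i * x $ i $ j) = 0" for i j
    by (simp add: SO_lie_algebra_entries)
  then show "c *\<^sub>R x \<in> lie_algebra SO_group" by (simp add: SO_lie_algebra_entries algebra_simps)
qed

text \<open>The generator of the rotation that carries axis \<open>a\<close> towards axis
  \<open>b\<close>.\<close>

definition rot :: "3 \<Rightarrow> 3 \<Rightarrow> real^(3+'q::finite)^(3+'q)" where
  "rot a b = munit (Inl b) (Inl a) - munit (Inl a) (Inl b)"

definition boost :: "3 \<Rightarrow> 'q \<Rightarrow> real^(3+'q::finite)^(3+'q)" where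
  "boost a q = munit (Inl a) (Inr q) + munit (Inr q) (Inl a)"

lemma rot_in: "(rot a b :: real^(3+'q::finite)^(3+'q)) \<in> lie_algebra SO_group"
proof -
  have "(rot a b :: real^(3+'q)^(3+'q)) $ j $ i * signature_form $ j $ j + signature_form $ i $ i * rot a b $ i $ j = 0" for i j :: "3+'q"
    by (cases i; cases j) (simp_all add: rot_def munit_def signature_form_entry conj_commute split del: if_split)
  then show ?thesis unfolding SO_lie_algebra_entries by blast
qed

lemma boost_in:
  fixes q :: "'q::finite"
  shows "boost a q \<in> lie_algebra SO_group"
proof -
  have "(boost a q :: real^(3+'q)^(3+'q)) $ j $ i * signature_form $ j $ j + signature_form $ i $ i * boost a q $ i $ j = 0" for i j :: "3+'q"
    by (cases i; cases j) (simp_all add: boost_def munit_def signature_form_entry conj_commute split del: if_split)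
  then show ?thesis unfolding SO_lie_algebra_entries by blast
qed

lemmas rot_boost_in = rot_in boost_in

lemma rot_boost_brackets:
  fixes q :: "'q::finite"
  defines "l1 \<equiv> rot 2 3 :: real^(3+'q)^(3+'q)" and "l2 \<equiv> rot 3 1 :: real^(3+'q)^(3+'q)" and "l3 \<equiv> rot 1 2 :: real^(3+'q)^(3+'q)"
    and "b1 \<equiv> boost 1 q" and "b2 \<equiv> boost 2 q" and "b3 \<equiv> boost 3 q"
  shows "l1 ** l2 - l2 ** l1 = l3" "l2 ** l3 - l3 ** l2 = l1" "l3 ** l1 - l1 ** l3 = l2"
    "l1 ** b1 = b1 ** l1" "l2 ** b2 = b2 ** l2" "l3 ** b3 = b3 ** l3"
    "l1 ** b2 - b2 ** l1 = b3" "l2 ** b3 - b3 ** l2 = b1" "l3 ** b1 - b1 ** l3 = b2"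
    "l1 ** b3 - b3 ** l1 = - b2" "l2 ** b1 - b1 ** l2 = - b3" "l3 ** b2 - b2 ** l3 = - b1"
    "b1 ** b2 - b2 ** b1 = - l3" "b2 ** b3 - b3 ** b2 = - l1" "b3 ** b1 - b1 ** b3 = - l2"
  unfolding assms rot_def boost_def
  by (simp_all add: matmul.add_left matmul.add_right matmul.diff_left matmul.diff_right munit_mult)

lemma so_first_block_iff:
  fixes X :: "real^(3+'q::finite)^(3+'q)"
  shows "X \<in> so_first_block \<longleftrightarrow> (\<exists>a b c. X = a *\<^sub>R rot 2 3 + b *\<^sub>R rot 3 1 + c *\<^sub>R rot 1 2)"
proof
  assume X: "X \<in> so_first_block"
  then have "X \<in> lie_algebra SO_group" and z: "X $ Inl i $ Inr k = 0" "X $ Inr k $ Inl i = 0" "X $ Inr k $ Inr l = 0" for i k l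
    by (auto simp: so_first_block_def so_blocks_def)
  then have a: "X $ Inl j $ Inl i = - X $ Inl i $ Inl j" for i j
    using \<open>X \<in> lie_algebra SO_group\<close>[unfolded SO_lie_algebra_entries, rule_format, of "Inl j" "Inl i"]
    by (simp add: signature_form_entry eq_neg_iff_add_eq_0)
  have d: "X $ Inl i $ Inl i = 0" for i using a[of i i] by simp
  have "X $ i $ j = (X $ Inl 3 $ Inl 2 *\<^sub>R rot 2 3 + X $ Inl 1 $ Inl 3 *\<^sub>R rot 3 1 + X $ Inl 2 $ Inl 1 *\<^sub>R rot 1 2) $ i $ j" for i j :: "3+'q"
  proof (cases i; cases j)
    fix u v assume "i = Inl u" "j = Inl v"
    then show ?thesis
      using exhaust_3[of u] exhaust_3[of v] a[of 1 2] a[of 2 3] a[of 3 1]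
      by (elim disjE) (simp_all add: rot_def munit_def d)
  qed (simp_all add: rot_def munit_def z)
  then have "X = X $ Inl 3 $ Inl 2 *\<^sub>R rot 2 3 + X $ Inl 1 $ Inl 3 *\<^sub>R rot 3 1 + X $ Inl 2 $ Inl 1 *\<^sub>R rot 1 2"
    unfolding vec_eq_iff by blast
  then show "\<exists>a b c. X = a *\<^sub>R rot 2 3 + b *\<^sub>R rot 3 1 + c *\<^sub>R rot 1 2" by blast
next
  assume "\<exists>a b c. X = a *\<^sub>R rot 2 3 + b *\<^sub>R rot 3 1 + c *\<^sub>R rot 1 2"
  then obtain a b c where X: "X = a *\<^sub>R rot 2 3 + b *\<^sub>R rot 3 1 + c *\<^sub>R rot 1 2" by blast
  have "X \<in> lie_algebra SO_group"
    unfolding X by (intro subspace_add[OF SO_lie_algebra_subspace] subspace_scale[OF SO_lie_algebra_subspace] rot_boost_in)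
  then show "X \<in> so_first_block"
    unfolding so_first_block_def so_blocks_def by (auto simp: X rot_def munit_def)
qed

section \<open>Matrix groups and the transport of \<open>so(3,1)\<close> to the Lie algebra of
  \<open>G\<close>\<close>

lemma GL_inv:
  assumes "a ** c = mat 1" "c ** a = mat 1" shows "inv\<^bsub>GL\<^esub> a = c"
  unfolding m_inv_def
proof (rule the_equality)
  show "c \<in> carrier GL \<and> a \<otimes>\<^bsub>GL\<^esub> c = \<one>\<^bsub>GL\<^esub> \<and> c \<otimes>\<^bsub>GL\<^esub> a = \<one>\<^bsub>GL\<^esub>"
    using assms by (auto simp: GL_def invertible_def)
  fix y assume "y \<in> carrier GL \<and> a \<otimes>\<^bsub>GL\<^esub> y = \<one>\<^bsub>GL\<^esub> \<and> y \<otimes>\<^bsub>GL\<^esub> a = \<one>\<^bsub>GL\<^esub>"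
  then have "y = y ** (a ** c)" "y ** a = mat 1" using assms by (simp_all add: GL_def)
  then show "y = c" by (simp only: matrix_mul_assoc) simp
qed

lemma matrix_lie_groupD:
  assumes "matrix_lie_group G"
  shows "x \<in> G \<Longrightarrow> y \<in> G \<Longrightarrow> x ** y \<in> G" "mat 1 \<in> G" "x \<in> G \<Longrightarrow> invertible x"
    "x \<in> G \<Longrightarrow> matrix_inv x \<in> G"
proof -
  interpret subgroup G GL using assms by (simp add: matrix_lie_group_def)
  show "x \<in> G \<Longrightarrow> y \<in> G \<Longrightarrow> x ** y \<in> G" using m_closed[of x y] by (simp add: GL_def)
  show "mat 1 \<in> G" using one_closed by (simp add: GL_def)
  show inv: "x \<in> G \<Longrightarrow> invertible x" for x using subset by (auto simp: GL_def)
  assume x: "x \<in> G"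
  have i: "x ** matrix_inv x = mat 1 \<and> matrix_inv x ** x = mat 1"
    using someI_ex[OF inv[OF x, unfolded invertible_def]] by (simp add: matrix_inv_def)
  have "inv\<^bsub>GL\<^esub> x = matrix_inv x" by (rule GL_inv) (simp_all add: i)
  then show "matrix_inv x \<in> G" using m_inv_closed[OF x] by simp
qed

lemma SO_group_mult:
  assumes "x \<in> SO_group" "y \<in> SO_group" shows "x ** y \<in> SO_group"
proof -
  have "transpose (x ** y) ** signature_form ** (x ** y) = transpose y ** (transpose x ** signature_form ** x) ** y"
    by (simp add: matrix_transpose_mul matrix_mul_assoc)
  then show ?thesis using assms by (simp add: SO_group_def det_mul)
qed

text \<open>A local isomorphism and its inverse take an idempotent value at \<open>mat 1\<close>;
  this makes both preserve the identity.\<close>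

lemma invertible_idempotent:
  fixes x :: "'a::field^'m^'m"
  assumes "invertible x" "x ** x = x" shows "x = mat 1"
proof -
  obtain y where "y ** x = mat 1" using assms(1) by (auto simp: invertible_def)
  then show ?thesis by (metis assms(2) matrix_mul_assoc matrix_mul_lid)
qed

locale so31 =
  fixes L1 L2 L3 B1 B2 B3 :: "complex^'m^'m"
  assumes LL: "L1 ** L2 - L2 ** L1 = L3" "L2 ** L3 - L3 ** L2 = L1" "L3 ** L1 - L1 ** L3 = L2"
    and LB_diag: "L1 ** B1 = B1 ** L1" "L2 ** B2 = B2 ** L2" "L3 ** B3 = B3 ** L3"
    and LB: "L1 ** B2 - B2 ** L1 = B3" "L2 ** B3 - B3 ** L2 = B1" "L3 ** B1 - B1 ** L3 = B2"
      "L1 ** B3 - B3 ** L1 = - B2" "L2 ** B1 - B1 ** L2 = - B3" "L3 ** B2 - B2 ** L3 = - B1"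
    and BB: "B1 ** B2 - B2 ** B1 = - L3" "B2 ** B3 - B3 ** B2 = - L1" "B3 ** B1 - B1 ** B3 = - L2"
    and indep: "a1 *\<^sub>R L1 + a2 *\<^sub>R L2 + a3 *\<^sub>R L3 + b1 *\<^sub>R B1 + b2 *\<^sub>R B2 + b3 *\<^sub>R B3 = 0 \<Longrightarrow>
      a1 = 0 \<and> a2 = 0 \<and> a3 = 0 \<and> b1 = 0 \<and> b2 = 0 \<and> b3 = 0"

text \<open>The differential of the local inverse \<open>g\<close> carries the explicit matrices
  \<open>rot\<close> and \<open>boost\<close> into the Lie algebra of \<open>G\<close>. Since it
  undoes the differential of \<open>f\<close>, it also identifies the part of \<open>\<kk>\<close>
  over the first block with the span of the three rotations.\<close>

lemma so31_subalgebra: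
  fixes G :: "(complex^'m^'m) set" and f :: "complex^'m^'m \<Rightarrow> real^(3+'q::finite)^(3+'q)"
  assumes G: "matrix_lie_group G" and iso: "local_isomorphism G SO_group f"
    and kk: "\<kk> \<subseteq> lie_algebra G" "lie_differential f ` \<kk> = so_blocks"
  obtains L1 L2 L3 B1 B2 B3 where "so31 L1 L2 L3 B1 B2 B3" "{L1,L2,L3,B1,B2,B3} \<subseteq> lie_algebra G"
    "{X \<in> \<kk>. lie_differential f X \<in> so_first_block} = {a *\<^sub>R L1 + b *\<^sub>R L2 + c *\<^sub>R L3 |a b c. True}"
proof -
  let ?SO = "SO_group :: (real^(3+'q)^(3+'q)) set"
  obtain U V g where U: "openin (top_of_set G) U" "mat 1 \<in> U" and V: "openin (top_of_set ?SO) V" "mat 1 \<in> V"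
    and hom: "homeomorphism U V f g"
    and f: "\<And>x y. x \<in> U \<Longrightarrow> y \<in> U \<Longrightarrow> x ** y \<in> U \<Longrightarrow> f (x ** y) = f x ** f y"
    and g: "\<And>x y. x \<in> V \<Longrightarrow> y \<in> V \<Longrightarrow> x ** y \<in> V \<Longrightarrow> g (x ** y) = g x ** g y"
    using iso unfolding local_isomorphism_def by blast
  have UG: "U \<subseteq> G" and VS: "V \<subseteq> ?SO" using U(1) V(1) by (auto dest: openin_imp_subset)
  have fU: "f x \<in> V" "g (f x) = x" if "x \<in> U" for x using hom that by (auto simp: homeomorphism_def)
  have gV: "g y \<in> U" "f (g y) = y" if "y \<in> V" for y using hom that by (auto simp: homeomorphism_def)
  have "invertible (f (mat 1))" using fU(1)[OF U(2)] VS by (auto simp: SO_group_def invertible_det_nz)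
  then have f1: "f (mat 1) = mat 1" by (rule invertible_idempotent) (use f[of "mat 1" "mat 1"] U in simp)
  have "invertible (g (mat 1))" using gV(1)[OF V(2)] UG matrix_lie_groupD(3)[OF G] by blast
  then have g1: "g (mat 1) = mat 1" by (rule invertible_idempotent) (use g[of "mat 1" "mat 1"] V in simp)
  interpret F: local_hom G U f
    by (rule local_hom.intro[OF matrix_lie_groupD(1,2)[OF G] U homeomorphism_cont1[OF hom] f1 f])
  interpret Gh: local_hom ?SO V g
    by (rule local_hom.intro[OF SO_group_mult _ V homeomorphism_cont2[OF hom] g1 g]) (simp_all add: SO_group_def)
  have gG: "g x \<in> G" if "x \<in> V" for x using gV(1)[OF that] UG by blast
  have inj: "inj_on g V" using gV(2) by (metis inj_onI)
  note dg_in = Gh.dg_in[OF _ gG matrix_lie_groupD(1)[OF G]]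
  have dgdf: "lie_differential g (lie_differential f X) = X" if X: "X \<in> lie_algebra G" for X
  proof -
    obtain r where "r > 0" and r: "\<And>t::real. \<bar>t\<bar> < r \<Longrightarrow> mexp (t *\<^sub>R X) \<in> U \<and> f (mexp (t *\<^sub>R X)) = mexp (t *\<^sub>R lie_differential f X)"
      using F.dg_exp[OF X] by blast
    have "g (mexp (t *\<^sub>R lie_differential f X)) = mexp (t *\<^sub>R X)" if "\<bar>t\<bar> < r" for t
      using r[OF that] fU(2) by metis
    then show ?thesis by (rule Gh.dg_eqI'[OF \<open>r > 0\<close>])
  qed
  \<comment> \<open>Any one of the negative coordinates extends the rotations to a copy of
    \<open>so(3,1)\<close>.\<close>
  obtain q :: 'q where True by simp
  note SO_sub = SO_lie_algebra_subspace[where 'p=3 and 'q='q]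
  note S = subspace_add[OF SO_sub] subspace_scale[OF SO_sub] rot_in boost_in subspace_neg[OF SO_sub]
  let ?d = "lie_differential g"
  have neg: "?d (- X) = - ?d X" if "X \<in> lie_algebra ?SO" for X
    using Gh.dg_scaleR[OF that, of "-1"] by simp
  define l1 l2 l3 b1 b2 b3 where l: "l1 = (rot 2 3 :: real^(3+'q)^(3+'q))" "l2 = (rot 3 1 :: real^(3+'q)^(3+'q))" "l3 = (rot 1 2 :: real^(3+'q)^(3+'q))"
    and b: "b1 = boost 1 q" "b2 = boost 2 q" "b3 = boost 3 q"
  have lin: "l1 \<in> lie_algebra ?SO" "l2 \<in> lie_algebra ?SO" "l3 \<in> lie_algebra ?SO"
    "b1 \<in> lie_algebra ?SO" "b2 \<in> lie_algebra ?SO" "b3 \<in> lie_algebra ?SO"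
    by (simp_all add: l b rot_in boost_in)
  note br = rot_boost_brackets(1-3)[where 'q='q, folded l] rot_boost_brackets(4-15)[of q, folded l b]
  have opp: "Y ** W - W ** Y = - (W ** Y - Y ** W)" for Y W :: "real^(3+'q)^(3+'q)" by simp
  have pos: "?d Y ** ?d Z - ?d Z ** ?d Y = ?d W"
    if "Y \<in> lie_algebra ?SO" "Z \<in> lie_algebra ?SO" "W \<in> lie_algebra ?SO"
      "Y ** Z - Z ** Y = W" "Y ** W - W ** Y = - Z \<or> Y ** W - W ** Y = Z" for Y Z W
    by (rule Gh.dg_bracket) (use that S in auto)
  have neg_br: "?d Y ** ?d Z - ?d Z ** ?d Y = - ?d W"
    if "Y \<in> lie_algebra ?SO" "Z \<in> lie_algebra ?SO" "W \<in> lie_algebra ?SO"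
      "Y ** Z - Z ** Y = - W" "Y ** W - W ** Y = - Z \<or> Y ** W - W ** Y = Z" for Y Z W
  proof -
    have "Y ** (- W) - (- W) ** Y = - (Y ** W - W ** Y)" by (simp add: matmul.minus_left matmul.minus_right)
    then have "Y ** (- W) - (- W) ** Y = - Z \<or> Y ** (- W) - (- W) ** Y = Z" by (metis that(5) minus_minus)
    then have "?d Y ** ?d Z - ?d Z ** ?d Y = ?d (- W)"
      by (intro pos that S(5))
    then show ?thesis by (simp only: neg[OF that(3)])
  qed
  have br': "l1 ** l3 - l3 ** l1 = - l2" "l2 ** l1 - l1 ** l2 = - l3" "l3 ** l2 - l2 ** l3 = - l1"
    "b1 ** l3 - l3 ** b1 = - b2" "b2 ** l1 - l1 ** b2 = - b3" "b3 ** l2 - l2 ** b3 = - b1"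
    using br by (metis opp)+
  have d_lin: "?d (a1 *\<^sub>R l1 + a2 *\<^sub>R l2 + a3 *\<^sub>R l3 + c1 *\<^sub>R b1 + c2 *\<^sub>R b2 + c3 *\<^sub>R b3)
      = a1 *\<^sub>R ?d l1 + a2 *\<^sub>R ?d l2 + a3 *\<^sub>R ?d l3 + c1 *\<^sub>R ?d b1 + c2 *\<^sub>R ?d b2 + c3 *\<^sub>R ?d b3" for a1 a2 a3 c1 c2 c3
    by (simp add: Gh.dg_add Gh.dg_scaleR S lin)
  have so: "so31 (?d l1) (?d l2) (?d l3) (?d b1) (?d b2) (?d b3)"
  proof
    show "?d l1 ** ?d l2 - ?d l2 ** ?d l1 = ?d l3" "?d l2 ** ?d l3 - ?d l3 ** ?d l2 = ?d l1"
      "?d l3 ** ?d l1 - ?d l1 ** ?d l3 = ?d l2"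
      "?d l1 ** ?d b2 - ?d b2 ** ?d l1 = ?d b3" "?d l2 ** ?d b3 - ?d b3 ** ?d l2 = ?d b1"
      "?d l3 ** ?d b1 - ?d b1 ** ?d l3 = ?d b2"
      by (rule pos; use lin br br' in simp)+
    show "?d l1 ** ?d b3 - ?d b3 ** ?d l1 = - ?d b2" "?d l2 ** ?d b1 - ?d b1 ** ?d l2 = - ?d b3"
      "?d l3 ** ?d b2 - ?d b2 ** ?d l3 = - ?d b1"
      "?d b1 ** ?d b2 - ?d b2 ** ?d b1 = - ?d l3" "?d b2 ** ?d b3 - ?d b3 ** ?d b2 = - ?d l1"
      "?d b3 ** ?d b1 - ?d b1 ** ?d b3 = - ?d l2"
      by (rule neg_br; use lin br br' in simp)+
    show "?d l1 ** ?d b1 = ?d b1 ** ?d l1" "?d l2 ** ?d b2 = ?d b2 ** ?d l2" "?d l3 ** ?d b3 = ?d b3 ** ?d l3"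
      by (rule Gh.dg_commute; use lin br in simp)+
    fix a1 a2 a3 c1 c2 c3
    assume "a1 *\<^sub>R ?d l1 + a2 *\<^sub>R ?d l2 + a3 *\<^sub>R ?d l3 + c1 *\<^sub>R ?d b1 + c2 *\<^sub>R ?d b2 + c3 *\<^sub>R ?d b3 = 0"
    then have "a1 *\<^sub>R l1 + a2 *\<^sub>R l2 + a3 *\<^sub>R l3 + c1 *\<^sub>R b1 + c2 *\<^sub>R b2 + c3 *\<^sub>R b3 = 0" (is "?X = 0")
      by (intro Gh.dg_inj[OF inj]) (auto simp: d_lin intro!: S lin)
    then have "?X $ i $ j = 0" for i j by simp
    from this[of "Inl 3" "Inl 2"] this[of "Inl 1" "Inl 3"] this[of "Inl 2" "Inl 1"]
      this[of "Inl 1" "Inr q"] this[of "Inl 2" "Inr q"] this[of "Inl 3" "Inr q"]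
    show "a1 = 0 \<and> a2 = 0 \<and> a3 = 0 \<and> c1 = 0 \<and> c2 = 0 \<and> c3 = 0"
      by (simp add: l b rot_def boost_def munit_def)
  qed
  have in_G: "{?d l1, ?d l2, ?d l3, ?d b1, ?d b2, ?d b3} \<subseteq> lie_algebra G"
    using lin dg_in by blast
  have d3: "?d (a *\<^sub>R l1 + b *\<^sub>R l2 + c *\<^sub>R l3) = a *\<^sub>R ?d l1 + b *\<^sub>R ?d l2 + c *\<^sub>R ?d l3" for a b c
    using d_lin[of a b c 0 0 0] by simp
  have "{X \<in> \<kk>. lie_differential f X \<in> so_first_block} = {a *\<^sub>R ?d l1 + b *\<^sub>R ?d l2 + c *\<^sub>R ?d l3 |a b c. True}"
  proof (intro equalityI subsetI)
    fix X assume "X \<in> {X \<in> \<kk>. lie_differential f X \<in> so_first_block}"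
    then obtain a b c where "X \<in> lie_algebra G" "lie_differential f X = a *\<^sub>R l1 + b *\<^sub>R l2 + c *\<^sub>R l3"
      using kk(1) unfolding l so_first_block_iff by blast
    then have "X = a *\<^sub>R ?d l1 + b *\<^sub>R ?d l2 + c *\<^sub>R ?d l3" using dgdf[of X] d3 by simp
    then show "X \<in> {a *\<^sub>R ?d l1 + b *\<^sub>R ?d l2 + c *\<^sub>R ?d l3 |a b c. True}" by blast
  next
    fix X assume "X \<in> {a *\<^sub>R ?d l1 + b *\<^sub>R ?d l2 + c *\<^sub>R ?d l3 |a b c. True}"
    then obtain a b c where X: "X = ?d (a *\<^sub>R l1 + b *\<^sub>R l2 + c *\<^sub>R l3)" unfolding d3 by blast
    have blk: "a *\<^sub>R l1 + b *\<^sub>R l2 + c *\<^sub>R l3 \<in> so_first_block" unfolding l so_first_block_iff by blast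
    then have "a *\<^sub>R l1 + b *\<^sub>R l2 + c *\<^sub>R l3 \<in> lie_differential f ` \<kk>" unfolding kk(2) by (simp add: so_first_block_def)
    then obtain Z where Z: "Z \<in> \<kk>" "lie_differential f Z = a *\<^sub>R l1 + b *\<^sub>R l2 + c *\<^sub>R l3" by fastforce
    then have "X = Z" using dgdf[of Z] kk(1) X by auto
    then show "X \<in> {X \<in> \<kk>. lie_differential f X \<in> so_first_block}" using Z blk by simp
  qed
  then show thesis using that so in_G by blast
qed

subsection \<open>An invariant form\<close>

definition avg :: "real \<Rightarrow> (real \<Rightarrow> real) \<Rightarrow> (real \<Rightarrow> 'v \<Rightarrow> 'v) \<Rightarrow> ('v \<Rightarrow> 'v \<Rightarrow> real) \<Rightarrow> 'v \<Rightarrow> 'v \<Rightarrow> real" where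
  "avg T w k b x y = integral {0..T} (\<lambda>t. w t * b (k t x) (k t y))"

lemma avg_continuous:
  fixes b :: "'v::euclidean_space \<Rightarrow> 'v \<Rightarrow> real" and k :: "real \<Rightarrow> 'v \<Rightarrow> 'v"
  assumes "bounded_bilinear b" "continuous_on {0..T} (\<lambda>t. k t x)" "continuous_on {0..T} (\<lambda>t. k t y)" "continuous_on {0..T} w"
  shows "continuous_on {0..T} (\<lambda>t. w t * b (k t x) (k t y))"
  by (intro continuous_on_mult assms bounded_bilinear.continuous_on[OF assms(1)])

lemma avg_integrable:
  fixes b :: "'v::euclidean_space \<Rightarrow> 'v \<Rightarrow> real" and k :: "real \<Rightarrow> 'v \<Rightarrow> 'v"
  assumes "bounded_bilinear b" "continuous_on {0..T} (\<lambda>t. k t x)" "continuous_on {0..T} (\<lambda>t. k t y)" "continuous_on {0..T} w"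
  shows "(\<lambda>t. w t * b (k t x) (k t y)) integrable_on {0..T}"
  by (rule integrable_continuous_real[OF avg_continuous[OF assms]])

lemma avg_bilinear:
  fixes b :: "'v::euclidean_space \<Rightarrow> 'v \<Rightarrow> real" and k :: "real \<Rightarrow> 'v \<Rightarrow> 'v"
  assumes b: "bounded_bilinear b" and lin: "\<And>t. linear (k t)"
    and k: "\<And>x. continuous_on {0..T} (\<lambda>t. k t x)" and w: "continuous_on {0..T} w"
  shows "bounded_bilinear (avg T w k b)"
proof -
  interpret b: bounded_bilinear b by fact
  have i: "(\<lambda>t. w t * b (k t x) (k t y)) integrable_on {0..T}" for x y by (intro avg_integrable[where w=w and b=b and k=k] b k w)
  have "bilinear (avg T w k b)"
    unfolding bilinear_def
  proof (intro conjI allI linearI)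
    fix x y z :: 'v and c :: real
    show "avg T w k b x (y + z) = avg T w k b x y + avg T w k b x z"
      using integral_add[OF i[of x y] i[of x z]] by (simp add: avg_def linear_add[OF lin] b.add_right distrib_left)
    show "avg T w k b (y + z) x = avg T w k b y x + avg T w k b z x"
      using integral_add[OF i[of y x] i[of z x]] by (simp add: avg_def linear_add[OF lin] b.add_left distrib_left)
    show "avg T w k b x (c *\<^sub>R y) = c *\<^sub>R avg T w k b x y"
      by (simp add: avg_def linear_scale[OF lin] b.scaleR_right mult.left_commute flip: integral_mult_right)
    show "avg T w k b (c *\<^sub>R y) x = c *\<^sub>R avg T w k b y x"
      by (simp add: avg_def linear_scale[OF lin] b.scaleR_left mult.left_commute flip: integral_mult_right)
  qed
  then show ?thesis by (simp add: bilinear_conv_bounded_bilinear)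
qed

lemma avg_sym:
  assumes "\<And>x y. b x y = b y x" shows "avg T w k b x y = avg T w k b y x"
  unfolding avg_def by (simp only: assms[of "k _ x" "k _ y"])

lemma avg_pos:
  fixes b :: "'v::euclidean_space \<Rightarrow> 'v \<Rightarrow> real" and k :: "real \<Rightarrow> 'v \<Rightarrow> 'v"
  assumes b: "bounded_bilinear b" and k: "\<And>x. continuous_on {0..T} (\<lambda>t. k t x)" and w: "continuous_on {0..T} w"
    and pos: "\<And>t. t \<in> {0..T} \<Longrightarrow> 0 \<le> w t" "\<And>x. x \<noteq> 0 \<Longrightarrow> b x x > 0" and inj: "\<And>t. k t x \<noteq> 0"
    and t: "t \<in> {0..T}" "w t > 0" "T > 0"
  shows "avg T w k b x x > 0"
proof -
  have nn: "0 \<le> w t * b (k t x) (k t x)" if "t \<in> {0..T}" for t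
    using pos(1)[OF that] less_imp_le[OF pos(2)[OF inj[of t]]] by simp
  have "avg T w k b x x \<ge> 0" unfolding avg_def
    by (intro integral_nonneg nn avg_integrable[where w=w and b=b and k=k] b k w)
  moreover have "avg T w k b x x \<noteq> 0"
  proof
    assume "avg T w k b x x = 0"
    then have "w t * b (k t x) (k t x) = 0"
      using integral_eq_0_iff[OF avg_continuous[where w=w and b=b and k=k and x=x and y=x, OF b k k w] \<open>T > 0\<close> nn] t(1) by (auto simp: avg_def)
    then show False using t(2) pos(2)[OF inj[of t]] by simp
  qed
  ultimately show ?thesis by simp
qed

abbreviation lmexp :: "complex^'m^'m \<Rightarrow> real \<Rightarrow> complex^'m^'m \<Rightarrow> complex^'m^'m" where
  "lmexp X t x \<equiv> mexp (t *\<^sub>R X) ** x"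

lemma lmexp_linear: "linear (lmexp X t)"
  by (intro linearI) (simp_all add: matmul.add_right matmul.scaleR_right)

lemma lmexp_continuous: "continuous_on S (\<lambda>t. lmexp X t x)"
  by (intro matmul.continuous_on mexp_continuous continuous_on_const)

lemma lmexp_nonzero: assumes "x \<noteq> 0" shows "lmexp X t x \<noteq> 0"
proof
  assume "lmexp X t x = 0"
  then have "mexp (- (t *\<^sub>R X)) ** (mexp (t *\<^sub>R X) ** x) = 0" by (simp add: matmul.zero_right)
  then show False using assms by (simp add: matrix_mul_assoc mexp_minus)
qed

text \<open>The fundamental theorem of calculus for
  \<open>w t * b (exp (t X) x) (exp (t X) x)\<close>; symmetry of \<open>b\<close> merges the two
  terms in which the argument is differentiated.\<close>

lemma avg_by_parts:
  assumes b: "bounded_bilinear b" and sym: "\<And>x y. b x y = b y x" and T: "T \<ge> 0"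
    and w: "\<And>t. (w has_real_derivative w' t) (at t)" and w': "continuous_on {0..T} w'"
  shows "2 * avg T w (lmexp X) b (X ** x) x
    = w T * b (lmexp X T x) (lmexp X T x) - w 0 * b x x - avg T w' (lmexp X) b x x"
proof -
  interpret b: bounded_bilinear b by fact
  have wc: "continuous_on {0..T} w" using w by (intro DERIV_continuous_on) (auto intro: DERIV_subset)
  have d: "((\<lambda>t. lmexp X t x) has_vector_derivative lmexp X t (X ** x)) (at t within {0..T})" for t
    using bounded_linear.has_vector_derivative[OF matmul.bounded_linear_left mexp_deriv'[of X t "{0..T}"], of x]
    by (simp add: matrix_mul_assoc)
  have "((\<lambda>t. w t * b (lmexp X t x) (lmexp X t x)) has_vector_derivative
      w t * (b (lmexp X t x) (lmexp X t (X ** x)) + b (lmexp X t (X ** x)) (lmexp X t x)) + w' t * b (lmexp X t x) (lmexp X t x))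
      (at t within {0..T})" for t
    using has_vector_derivative_mult[OF _ b.has_vector_derivative[OF d d], of w "w' t" t] w[of t]
    by (simp add: has_real_derivative_iff_has_vector_derivative has_vector_derivative_at_within)
  then have "((\<lambda>t. 2 * (w t * b (lmexp X t (X ** x)) (lmexp X t x)) + w' t * b (lmexp X t x) (lmexp X t x)) has_integral
     w T * b (lmexp X T x) (lmexp X T x) - w 0 * b (lmexp X 0 x) (lmexp X 0 x)) {0..T}"
    by (intro fundamental_theorem_of_calculus T) (simp add: sym[of "lmexp X _ x" "lmexp X _ (X ** x)"] algebra_simps)
  moreover note i = avg_integrable[where k="lmexp X", OF b lmexp_continuous lmexp_continuous wc, of "X ** x" x] avg_integrable[where k="lmexp X", OF b lmexp_continuous lmexp_continuous w', of x x]
  have "((\<lambda>t. 2 * (w t * b (lmexp X t (X ** x)) (lmexp X t x)) + w' t * b (lmexp X t x) (lmexp X t x)) has_integral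
     2 * avg T w (lmexp X) b (X ** x) x + avg T w' (lmexp X) b x x) {0..T}"
    unfolding avg_def by (intro has_integral_add has_integral_mult_right integrable_integral i)
  ultimately show ?thesis by (auto dest: has_integral_unique)
qed

lemma Ad_rotation':
  fixes X Y Z :: "'a::{real_normed_field,euclidean_space}^'m^'m"
  assumes "X ** Y - Y ** X = Z" "X ** Z - Z ** X = - Y"
  shows "mexp (t *\<^sub>R X) ** Y = (cos t *\<^sub>R Y + sin t *\<^sub>R Z) ** mexp (t *\<^sub>R X)"
proof -
  have "mexp (t *\<^sub>R X) ** Y ** mexp (- t *\<^sub>R X) ** mexp (t *\<^sub>R X) = (cos t *\<^sub>R Y + sin t *\<^sub>R Z) ** mexp (t *\<^sub>R X)"
    by (simp only: Ad_rotation[OF assms])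
  then show ?thesis using mexp_minus(2)[of "t *\<^sub>R X"] by (simp add: matmul_assoc)
qed

context so31 begin

lemma LL_opp: "L2 ** L1 - L1 ** L2 = - L3" "L3 ** L2 - L2 ** L3 = - L1" "L1 ** L3 - L3 ** L1 = - L2"
  using LL by (metis minus_diff_eq)+

lemma brackets_opp: "B2 ** L1 - L1 ** B2 = - B3" "B3 ** L2 - L2 ** B3 = - B1" "B1 ** L3 - L3 ** B1 = - B2"
  "B3 ** L1 - L1 ** B3 = B2" "B1 ** L2 - L2 ** B1 = B3" "B2 ** L3 - L3 ** B2 = B1"
  "B2 ** B1 - B1 ** B2 = L3" "B3 ** B2 - B2 ** B3 = L1" "B1 ** B3 - B3 ** B1 = L2"
  using LB BB by (metis minus_diff_eq minus_minus)+

text \<open>Conjugation by \<open>exp (2 pi L3)\<close> fixes \<open>L2\<close>, while conjugation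
  by \<open>exp (pi L2)\<close> turns \<open>exp (2 pi L3)\<close> into its inverse. As the two
  elements commute, the latter is its own inverse. The period \<open>4 pi\<close> allows for spin
  coverings.\<close>

lemma periodic: "mexp ((4 * pi) *\<^sub>R L3) = mat 1"
proof -
  define e where "e = mexp ((2 * pi) *\<^sub>R L3)"
  have inv: "e ** mexp (- ((2 * pi) *\<^sub>R L3)) = mat 1" "mexp (- ((2 * pi) *\<^sub>R L3)) ** e = mat 1"
    unfolding e_def by (rule mexp_minus)+
  have "e ** L2 ** mexp (- ((2 * pi) *\<^sub>R L3)) = L2"
    using Ad_rotation[of L3 L2 "- L1" "2 * pi"] LL LL_opp by (simp add: e_def matmul.minus_left matmul.minus_right)
  then have "e ** (pi *\<^sub>R L2) ** mexp (- ((2 * pi) *\<^sub>R L3)) = pi *\<^sub>R L2" by (simp add: matmul.scaleR_left matmul.scaleR_right)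
  with mexp_conj[OF inv, of "pi *\<^sub>R L2"]
  have "e ** mexp (pi *\<^sub>R L2) ** mexp (- ((2 * pi) *\<^sub>R L3)) = mexp (pi *\<^sub>R L2)" by simp
  then have com: "e ** mexp (pi *\<^sub>R L2) = mexp (pi *\<^sub>R L2) ** e"
    by (metis inv(2) matrix_mul_assoc matrix_mul_rid)
  have "mexp (pi *\<^sub>R L2) ** L3 ** mexp (- (pi *\<^sub>R L2)) = - L3"
    using Ad_rotation[of L2 L3 L1 pi] LL LL_opp by simp
  then have "mexp (pi *\<^sub>R L2) ** ((2 * pi) *\<^sub>R L3) ** mexp (- (pi *\<^sub>R L2)) = - ((2 * pi) *\<^sub>R L3)"
    by (simp add: matmul.scaleR_left matmul.scaleR_right)
  with mexp_conj[OF mexp_minus, of "pi *\<^sub>R L2" "(2 * pi) *\<^sub>R L3"]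
  have "mexp (pi *\<^sub>R L2) ** e ** mexp (- (pi *\<^sub>R L2)) = mexp (- ((2 * pi) *\<^sub>R L3))" by (simp add: e_def)
  then have "e = mexp (- ((2 * pi) *\<^sub>R L3))"
    using mexp_minus(1)[of "pi *\<^sub>R L2"] by (simp flip: com) (simp add: matmul_assoc)
  then have "e ** e = mat 1" using inv by metis
  then show ?thesis using mexp_add_scaleR[of "2 * pi" "2 * pi" L3] by (simp add: e_def)
qed

text \<open>The form is an average over Euler angles. Its infinitesimal invariance suffices below, and this
  follows from integrations by parts in one angle at a time.\<close>

lemma invariant_form:
  obtains b :: "complex^'m^'m \<Rightarrow> complex^'m^'m \<Rightarrow> real"
  where "bounded_bilinear b" "\<And>x y. b x y = b y x" "\<And>x. x \<noteq> 0 \<Longrightarrow> b x x > 0"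
    "\<And>x. b (L1 ** x) x = 0" "\<And>x. b (L2 ** x) x = 0" "\<And>x. b (L3 ** x) x = 0"
proof -
  define b0 :: "complex^'m^'m \<Rightarrow> complex^'m^'m \<Rightarrow> real" where "b0 x y = x \<bullet> y" for x y
  define b1 where "b1 = avg (4 * pi) (\<lambda>_. 1) (lmexp L3) b0"
  define b2 where "b2 = avg pi sin (lmexp L2) b1"
  \<comment> \<open>In Euler angles Haar measure has density \<open>sin\<close>; \<open>c\<close>
    carries the derivative of this density. It measures how far \<open>b2\<close> is from invariance
    under \<open>L1\<close> and \<open>L2\<close>, and the last average cancels it.\<close>
  define c where "c = avg pi cos (lmexp L2) b1"
  define b3 where "b3 = avg (4 * pi) (\<lambda>_. 1) (lmexp L3) b2"
  note cont = continuous_on_const continuous_on_sin[OF continuous_on_id] continuous_on_cos[OF continuous_on_id]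
  have b0: "bounded_bilinear b0" "\<And>x y. b0 x y = b0 y x" "\<And>x. x \<noteq> 0 \<Longrightarrow> b0 x x > 0"
    unfolding b0_def by (auto simp: bounded_bilinear_inner inner_commute)
  have b1: "bounded_bilinear b1" "\<And>x y. b1 x y = b1 y x" "\<And>x. x \<noteq> 0 \<Longrightarrow> b1 x x > 0"
    unfolding b1_def
    by (rule avg_bilinear[where k="lmexp _", OF b0(1) lmexp_linear lmexp_continuous cont(1)],
        rule avg_sym[OF b0(2)],
        rule avg_pos[where t=0 and k="lmexp _", OF b0(1) lmexp_continuous cont(1)], auto simp: b0 lmexp_nonzero)
  have b2: "bounded_bilinear b2" "\<And>x y. b2 x y = b2 y x" "\<And>x. x \<noteq> 0 \<Longrightarrow> b2 x x > 0"
    unfolding b2_def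
    by (rule avg_bilinear[where k="lmexp _", OF b1(1) lmexp_linear lmexp_continuous cont(2)],
        rule avg_sym[OF b1(2)],
        rule avg_pos[where t="pi/2" and k="lmexp _", OF b1(1) lmexp_continuous cont(2)], auto simp: b1 lmexp_nonzero sin_ge_zero)
  have c: "bounded_bilinear c" "\<And>x y. c x y = c y x"
    unfolding c_def
    by (rule avg_bilinear[where k="lmexp _", OF b1(1) lmexp_linear lmexp_continuous cont(3)],
        rule avg_sym[OF b1(2)])
  have b3: "bounded_bilinear b3" "\<And>x y. b3 x y = b3 y x" "\<And>x. x \<noteq> 0 \<Longrightarrow> b3 x x > 0"
    unfolding b3_def
    by (rule avg_bilinear[where k="lmexp _", OF b2(1) lmexp_linear lmexp_continuous cont(1)],
        rule avg_sym[OF b2(2)],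
        rule avg_pos[where t=0 and k="lmexp _", OF b2(1) lmexp_continuous cont(1)], auto simp: b2 lmexp_nonzero)
  interpret b1: bounded_bilinear b1 by (rule b1)
  interpret b2: bounded_bilinear b2 by (rule b2)
  interpret b3: bounded_bilinear b3 by (rule b3)
  have avg0: "avg T (\<lambda>_. 0) k b x y = 0" for T k x y and b :: "complex^'m^'m \<Rightarrow> complex^'m^'m \<Rightarrow> real" by (simp add: avg_def)
  have b1L3: "b1 (L3 ** z) z = 0" for z
    using avg_by_parts[OF b0(1,2), of "4*pi" "\<lambda>_. 1" "\<lambda>_. 0" L3 z] by (simp add: b1_def periodic avg0)
  have b3L3: "b3 (L3 ** z) z = 0" for z
    using avg_by_parts[OF b2(1,2), of "4*pi" "\<lambda>_. 1" "\<lambda>_. 0" L3 z] by (simp add: b3_def periodic avg0)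
  have b2L2: "b2 (L2 ** y) y = - c y y / 2" for y
    using avg_by_parts[OF b1(1,2), of pi sin cos L2 y] by (simp add: b2_def c_def continuous_on_cos)
  have b2L1: "b2 (L1 ** y) y = c (L3 ** y) y" for y
    unfolding b2_def c_def avg_def
  proof (rule integral_cong)
    fix t
    let ?E = "mexp (t *\<^sub>R L2)" let ?z = "?E ** y"
    have "?E ** (L1 ** y) = (cos t *\<^sub>R L1 - sin t *\<^sub>R L3) ** ?z"
      using Ad_rotation'[of L2 L1 "- L3" t] LL LL_opp by (simp add: matmul.minus_left matmul.minus_right matrix_mul_assoc)
    moreover have "?E ** (L3 ** y) = (cos t *\<^sub>R L3 + sin t *\<^sub>R L1) ** ?z"
      using Ad_rotation'[of L2 L3 L1 t] LL LL_opp by (simp add: matrix_mul_assoc)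
    ultimately have "sin t * b1 (?E ** (L1 ** y)) ?z = sin t * cos t * b1 (L1 ** ?z) ?z"
      "cos t * b1 (?E ** (L3 ** y)) ?z = sin t * cos t * b1 (L1 ** ?z) ?z"
      by (simp_all add: matmul.add_left matmul.diff_left matmul.scaleR_left b1.add_left b1.diff_left b1.scaleR_left b1L3)
    then show "sin t * b1 (?E ** (L1 ** y)) ?z = cos t * b1 (?E ** (L3 ** y)) ?z" by (simp only:)
  qed
  \<comment> \<open>Under \<open>exp (t L3)\<close> the operator \<open>L2\<close> turns into
    \<open>cos t L2 - sin t L1\<close>. The two defects add up to \<open>-1/2\<close> times the
    derivative of \<open>sin t * c\<close>, whose integral over the period is 0.\<close>
  have b3L2: "b3 (L2 ** x) x = 0" for x
  proof -
    have "b3 (L2 ** x) x = integral {0..4*pi} (\<lambda>t. (- 1/2) * (cos t * c (lmexp L3 t x) (lmexp L3 t x)) + (- 1) * (sin t * c (lmexp L3 t (L3 ** x)) (lmexp L3 t x)))"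
      unfolding b3_def avg_def
    proof (rule integral_cong)
      fix t
      let ?E = "mexp (t *\<^sub>R L3)" let ?y = "?E ** x"
      have "?E ** (L2 ** x) = (cos t *\<^sub>R L2 - sin t *\<^sub>R L1) ** ?y"
        using Ad_rotation'[of L3 L2 "- L1" t] LL LL_opp by (simp add: matmul.minus_left matmul.minus_right matrix_mul_assoc)
      moreover have "?E ** (L3 ** x) = L3 ** ?y" by (metis matrix_mul_assoc mexp_commute)
      ultimately show "1 * b2 (?E ** (L2 ** x)) ?y = (- 1/2) * (cos t * c ?y ?y) + (- 1) * (sin t * c (?E ** (L3 ** x)) ?y)"
        by (simp add: matmul.diff_left matmul.scaleR_left b2.diff_left b2.scaleR_left b2L1 b2L2)
    qed
    also have "\<dots> = (- 1/2) * avg (4*pi) cos (lmexp L3) c x x + (- 1) * avg (4*pi) sin (lmexp L3) c (L3 ** x) x"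
      unfolding avg_def
      by (intro integral_unique has_integral_add has_integral_mult_right integrable_integral
          avg_integrable[where k="lmexp _", OF c(1) lmexp_continuous lmexp_continuous cont(2)] avg_integrable[where k="lmexp _", OF c(1) lmexp_continuous lmexp_continuous cont(3)])
    also have "\<dots> = 0"
      using avg_by_parts[OF c, of "4*pi" sin cos L3 x] by (simp add: continuous_on_cos)
    finally show ?thesis .
  qed
  have skew: "b3 (Z ** x) y = - b3 x (Z ** y)" if "\<And>x. b3 (Z ** x) x = 0" for Z x y
    using that[of "x + y"] that[of x] that[of y]
    by (simp add: matmul.add_right b3.add_left b3.add_right b3(2)[of x "Z ** y"])
  have b3L1: "b3 (L1 ** x) x = 0" for x
  proof -
    have "L1 ** x = L2 ** (L3 ** x) - L3 ** (L2 ** x)"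
      by (simp add: matrix_mul_assoc flip: matmul.diff_left LL(2))
    then show ?thesis using skew[OF b3L2, of "L3 ** x" x] skew[OF b3L3, of "L2 ** x" x] b3(2)[of "L3 ** x" "L2 ** x"]
      by (simp add: b3.diff_left)
  qed
  show thesis by (rule that[OF b3 b3L1 b3L2 b3L3])
qed

text \<open>A rotation by \<open>pi\<close> conjugates each of the six generators to its negative,
  so the determinant of \<open>exp (s X)\<close> equals its own inverse.\<close>

lemma det_mexp_abs:
  assumes "X \<in> {L1, L2, L3, B1, B2, B3}"
  shows "cmod (det (mexp (s *\<^sub>R X))) = 1"
proof -
  obtain Y Z where YZ: "Y ** X - X ** Y = Z" "Y ** Z - Z ** Y = - X"
  proof -
    have neg: "Y ** (- Z) - (- Z) ** Y = - (Y ** Z - Z ** Y)" for Y Z :: "complex^'m^'m"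
      by (simp add: matmul.minus_left matmul.minus_right)
    consider "X = L1" | "X = L2" | "X = L3" | "X = B1" | "X = B2" | "X = B3" using assms by blast
    then show thesis
    proof cases
      case 1 show thesis by (rule that[of L2 "- L3"]) (simp_all only: 1 neg LL LL_opp)
    next
      case 2 show thesis by (rule that[of L3 "- L1"]) (simp_all only: 2 neg LL LL_opp)
    next
      case 3 show thesis by (rule that[of L1 "- L2"]) (simp_all only: 3 neg LL LL_opp)
    next
      case 4 show thesis by (rule that[of L2 "- B3"]) (simp_all only: 4 neg LB)
    next
      case 5 show thesis by (rule that[of L3 "- B1"]) (simp_all only: 5 neg LB)
    next
      case 6 show thesis by (rule that[of L1 "- B2"]) (simp_all only: 6 neg LB minus_minus)
    qed
  qed
  have "mexp (pi *\<^sub>R Y) ** X ** mexp (- (pi *\<^sub>R Y)) = - X"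
    using Ad_rotation[OF YZ, of pi] by simp
  then have "mexp (pi *\<^sub>R Y) ** (s *\<^sub>R X) ** mexp (- (pi *\<^sub>R Y)) = - (s *\<^sub>R X)"
    by (simp add: matmul.scaleR_left matmul.scaleR_right)
  with mexp_conj[OF mexp_minus, of "pi *\<^sub>R Y" "s *\<^sub>R X"]
  have "mexp (pi *\<^sub>R Y) ** mexp (s *\<^sub>R X) ** mexp (- (pi *\<^sub>R Y)) = mexp (- (s *\<^sub>R X))" by simp
  from arg_cong[OF this, of det]
  have "det (mexp (pi *\<^sub>R Y)) * det (mexp (s *\<^sub>R X)) * det (mexp (- (pi *\<^sub>R Y))) = det (mexp (- (s *\<^sub>R X)))"
    by (simp only: det_mul)
  moreover have "det (mexp (pi *\<^sub>R Y)) * det (mexp (- (pi *\<^sub>R Y))) = 1"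
    using arg_cong[OF mexp_minus(1)[of "pi *\<^sub>R Y"], of det] by (simp add: det_mul)
  moreover have "det (mexp (s *\<^sub>R X)) * det (mexp (- (s *\<^sub>R X))) = 1"
    using arg_cong[OF mexp_minus(1)[of "s *\<^sub>R X"], of det] by (simp add: det_mul)
  moreover have "d * d = 1" if "p * d * p' = d'" "p * p' = 1" "d * d' = 1" for p d p' d' :: complex
    using that by (metis mult.assoc mult.commute mult_1)
  ultimately have "det (mexp (s *\<^sub>R X)) * det (mexp (s *\<^sub>R X)) = 1" by blast
  from arg_cong[OF this, of cmod] have "(cmod (det (mexp (s *\<^sub>R X))))\<^sup>2 = 1" by (simp add: norm_mult power2_eq_square)
  then have "cmod (det (mexp (s *\<^sub>R X))) = 1 \<or> cmod (det (mexp (s *\<^sub>R X))) = - 1" by (simp only: power2_eq_1_iff)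
  then show ?thesis using norm_ge_zero[of "det (mexp (s *\<^sub>R X))"] by linarith
qed

end

subsection \<open>Test functions\<close>

text \<open>For \<open>k = 0\<close> the classical smooth function that is flat at 0. The powers of
  \<open>1/s\<close> make the family closed under differentiation up to linear combinations.\<close>

definition eta :: "nat \<Rightarrow> real \<Rightarrow> real" where
  "eta k s = (if s > 0 then inverse s ^ k * exp (- inverse s) else 0)"

lemma eta_nonneg: "eta k s \<ge> 0" by (simp add: eta_def)

text \<open>One term of the exponential series at \<open>u = 1/h\<close> dominates
  \<open>u ^ (k + 2)\<close>. Quadratic smallness at 0 gives the derivative 0 there.\<close>

lemma eta_bound: "\<bar>eta k h\<bar> \<le> fact (k + 2) * h\<^sup>2"
proof (cases "h > 0")
  case True
  define u where "u = inverse h"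
  have u: "u > 0" using True by (simp add: u_def)
  have "u ^ (k + 2) / fact (k + 2) \<le> exp u"
  proof -
    have "(\<Sum>n\<in>{k+2}. u ^ n / fact n) \<le> exp u"
      using sum_le_suminf[OF summable_exp_generic[of u], of "{k+2}"] u
      by (simp add: exp_def divide_inverse_commute)
    then show ?thesis by simp
  qed
  then have "u ^ (k + 2) \<le> fact (k + 2) * exp u" by (simp add: pos_divide_le_eq mult.commute)
  then have "u ^ k * u\<^sup>2 * exp (- u) \<le> fact (k + 2)"
    by (simp add: exp_minus field_simps power2_eq_square)
  then have "u ^ k * exp (- u) \<le> fact (k + 2) * h\<^sup>2"
    using True by (simp add: u_def field_simps power2_eq_square)
  then show ?thesis using True by (simp add: eta_def u_def)
qed (simp add: eta_def)

lemma eta_deriv: "(eta k has_real_derivative eta (k + 2) s - k * eta (k + 1) s) (at s)"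
proof -
  consider "s > 0" | "s < 0" | "s = 0" by linarith
  then show ?thesis
  proof cases
    case 1
    have "((\<lambda>s. inverse s ^ k * exp (- inverse s)) has_real_derivative eta (k + 2) s - k * eta (k + 1) s) (at s)"
    proof -
      have F: "((\<lambda>u. u ^ k * exp (- u)) has_real_derivative (real k * u ^ (k - 1) - u ^ k) * exp (- u)) (at u)" for u :: real
        by (auto intro!: derivative_eq_intros simp: algebra_simps)
      have "(inverse has_real_derivative - (inverse s ^ 2)) (at s)"
        using DERIV_inverse[of s UNIV] 1 by (simp add: power2_eq_square)
      from DERIV_chain2[OF F this]
      have "((\<lambda>s. inverse s ^ k * exp (- inverse s)) has_real_derivative
          (real k * inverse s ^ (k - 1) - inverse s ^ k) * exp (- inverse s) * - (inverse s ^ 2)) (at s)" .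
      moreover have "(real k * u ^ (k - 1) - u ^ k) * e * - (u ^ 2) = u ^ (k + 2) * e - real k * (u ^ (k + 1) * e)" for u e :: real
        by (cases k) (simp_all add: algebra_simps power2_eq_square)
      ultimately show ?thesis using 1 by (simp only: eta_def if_True)
    qed
    then show ?thesis
      by (rule has_field_derivative_transform_within_open[where S="{0<..}"]) (use 1 in \<open>auto simp: eta_def\<close>)
  next
    case 2
    have "((\<lambda>s. 0) has_real_derivative eta (k + 2) s - k * eta (k + 1) s) (at s)" using 2 by (simp add: eta_def)
    then show ?thesis
      by (rule has_field_derivative_transform_within_open[where S="{..<0}"]) (use 2 in \<open>auto simp: eta_def\<close>)
  next
    case 3
    have "((\<lambda>h. eta k h / h) \<longlongrightarrow> 0) (at 0)"
    proof (rule Lim_null_comparison)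
      have "norm (eta k h / h) \<le> fact (k + 2) * \<bar>h\<bar>" for h
      proof (cases "h = 0")
        case False
        have "\<bar>eta k h\<bar> \<le> (fact (k + 2) * \<bar>h\<bar>) * \<bar>h\<bar>"
          using eta_bound[of k h] by (simp only: mult.assoc flip: abs_mult power2_eq_square) simp
        then show ?thesis using False by (simp only: real_norm_def abs_divide pos_divide_le_eq zero_less_abs_iff not_False_eq_True)
      qed simp
      then show "\<forall>\<^sub>F h in at 0. norm (eta k h / h) \<le> fact (k + 2) * \<bar>h\<bar>" by (intro always_eventually allI)
      have "((\<lambda>h. fact (k + 2) * \<bar>h\<bar>) \<longlongrightarrow> fact (k + 2) * \<bar>0::real\<bar>) (at 0)" by (intro tendsto_intros)
      then show "((\<lambda>h. fact (k + 2) * \<bar>h\<bar>) \<longlongrightarrow> (0::real)) (at 0)" by (simp only: abs_zero mult_zero_right)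
    qed
    then show ?thesis using 3 by (simp add: has_field_derivative_iff eta_def)
  qed
qed

text \<open>Derivatives along linear vector fields \<open>x \<mapsto> A x\<close> are the relevant
  ones, because translation by \<open>exp (s X)\<close> moves \<open>x\<close> with velocity
  \<open>X ** x\<close>.\<close>

lemma real_polynomial_function_derivative:
  fixes p :: "'v::euclidean_space \<Rightarrow> real"
  assumes "real_polynomial_function p"
  obtains p' where "\<And>x. (p has_derivative p' x) (at x)"
    "\<And>A :: 'v \<Rightarrow> 'v. bounded_linear A \<Longrightarrow> real_polynomial_function (\<lambda>x. p' x (A x))"
proof -
  have "\<exists>p'. (\<forall>x. (p has_derivative p' x) (at x)) \<and>
    (\<forall>A :: 'v \<Rightarrow> 'v. bounded_linear A \<longrightarrow> real_polynomial_function (\<lambda>x. p' x (A x)))"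
    using assms
  proof induction
    case (linear f)
    then show ?case
      by (intro exI[of _ "\<lambda>x. f"]) (auto intro: bounded_linear_imp_has_derivative bounded_linear_compose)
  next
    case (const c)
    show ?case by (intro exI[of _ "\<lambda>x h. 0"]) auto
  next
    case (add f g)
    then obtain f' g' where "\<And>x. (f has_derivative f' x) (at x)" "\<And>x. (g has_derivative g' x) (at x)"
      "\<And>A. bounded_linear A \<Longrightarrow> real_polynomial_function (\<lambda>x. f' x (A x))"
      "\<And>A. bounded_linear A \<Longrightarrow> real_polynomial_function (\<lambda>x. g' x (A x))" by metis
    then show ?case
      by (intro exI[of _ "\<lambda>x h. f' x h + g' x h"] conjI allI impI has_derivative_add
          real_polynomial_function.intros(3)) simp_all
  next
    case (mult f g)
    then obtain f' g' where "\<And>x. (f has_derivative f' x) (at x)" "\<And>x. (g has_derivative g' x) (at x)"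
      "\<And>A. bounded_linear A \<Longrightarrow> real_polynomial_function (\<lambda>x. f' x (A x))"
      "\<And>A. bounded_linear A \<Longrightarrow> real_polynomial_function (\<lambda>x. g' x (A x))" by metis
    then show ?case using mult.hyps
      by (intro exI[of _ "\<lambda>x h. f x * g' x h + f' x h * g x"] conjI allI impI has_derivative_mult
          real_polynomial_function.intros(3) real_polynomial_function.intros(4)) simp_all
  qed
  then show thesis using that by blast
qed

lemma polynomial_bilinear:
  fixes b :: "'v::euclidean_space \<Rightarrow> 'v \<Rightarrow> real"
  assumes "bounded_bilinear b"
  shows "real_polynomial_function (\<lambda>x. b x x)"
proof -
  interpret bounded_bilinear b by fact
  have "b x x = (\<Sum>e\<in>Basis. (x \<bullet> e) * b x e)" for x
    using arg_cong[OF euclidean_representation[of x, symmetric], of "b x"] by (simp add: sum_right scaleR_right)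
  moreover have "real_polynomial_function (\<lambda>x. \<Sum>e\<in>Basis. (x \<bullet> e) * b x e)"
    by (intro real_polynomial_function_sum real_polynomial_function.intros(4) real_polynomial_function.intros(1)
        bounded_linear_inner_left bounded_linear_left) simp
  ultimately show ?thesis by simp
qed

inductive_set Phi :: "('v::euclidean_space \<Rightarrow> real) \<Rightarrow> real \<Rightarrow> ('v \<Rightarrow> real) set" for q :: "'v \<Rightarrow> real" and R :: real where
  base: "real_polynomial_function p \<Longrightarrow> (\<lambda>x. p x * eta k (R - q x)) \<in> Phi q R"
| add: "f \<in> Phi q R \<Longrightarrow> g \<in> Phi q R \<Longrightarrow> (\<lambda>x. f x + g x) \<in> Phi q R"

lemma Phi_zero: "f \<in> Phi q R \<Longrightarrow> q x \<ge> R \<Longrightarrow> f x = 0"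
  by (induction rule: Phi.induct) (auto simp: eta_def)

lemma Phi_base_deriv:
  fixes p q :: "'v::euclidean_space \<Rightarrow> real"
  assumes "(p has_derivative p' x) (at x)" "(q has_derivative q' x) (at x)"
  shows "((\<lambda>x. p x * eta k (R - q x)) has_derivative (\<lambda>h. p' x h * eta k (R - q x)
      + (k * p x * q' x h * eta (k + 1) (R - q x) + (- p x * q' x h) * eta (k + 2) (R - q x)))) (at x)"
proof -
  have "((\<lambda>x. R - q x) has_derivative (\<lambda>h. 0 - q' x h)) (at x)"
    by (intro has_derivative_diff has_derivative_const assms)
  from has_derivative_compose[OF this eta_deriv[of k "R - q x", unfolded has_field_derivative_def]]
  have "((\<lambda>x. eta k (R - q x)) has_derivative (\<lambda>h. (eta (k + 2) (R - q x) - k * eta (k + 1) (R - q x)) * (0 - q' x h))) (at x)" .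
  from has_derivative_mult[OF assms(1) this] show ?thesis
    by (rule has_derivative_eq_rhs) (auto simp: algebra_simps)
qed

lemma Phi_derivative:
  fixes q :: "'v::euclidean_space \<Rightarrow> real"
  assumes q: "real_polynomial_function q" and f: "f \<in> Phi q R"
  obtains f' where "\<And>x. (f has_derivative f' x) (at x)"
    "\<And>A :: 'v \<Rightarrow> 'v. bounded_linear A \<Longrightarrow> (\<lambda>x. f' x (A x)) \<in> Phi q R"
proof -
  obtain q' where q': "\<And>x. (q has_derivative q' x) (at x)"
    "\<And>A :: 'v \<Rightarrow> 'v. bounded_linear A \<Longrightarrow> real_polynomial_function (\<lambda>x. q' x (A x))"
    using real_polynomial_function_derivative[OF q] by blast
  have "\<exists>f'. (\<forall>x. (f has_derivative f' x) (at x)) \<and>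
    (\<forall>A :: 'v \<Rightarrow> 'v. bounded_linear A \<longrightarrow> (\<lambda>x. f' x (A x)) \<in> Phi q R)"
    using f
  proof induction
    case (base p k)
    obtain p' where p': "\<And>x. (p has_derivative p' x) (at x)"
      "\<And>A :: 'v \<Rightarrow> 'v. bounded_linear A \<Longrightarrow> real_polynomial_function (\<lambda>x. p' x (A x))"
      using real_polynomial_function_derivative[OF base] by blast
    have "(\<lambda>x. p' x (A x) * eta k (R - q x) + (k * p x * q' x (A x) * eta (k + 1) (R - q x)
        + (- p x * q' x (A x)) * eta (k + 2) (R - q x))) \<in> Phi q R" if "bounded_linear A" for A :: "'v \<Rightarrow> 'v"
      by (intro Phi.intros p'(2) that real_polynomial_function.intros(4) q'(2) base
          real_polynomial_function.intros(2) real_polynomial_function_minus)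
    then show ?case
      by (intro exI[of _ "\<lambda>x h. p' x h * eta k (R - q x)
      + (k * p x * q' x h * eta (k + 1) (R - q x) + (- p x * q' x h) * eta (k + 2) (R - q x))"]
          conjI allI impI Phi_base_deriv p'(1) q'(1))
  next
    case (add f g)
    obtain f' where f': "\<And>x. (f has_derivative f' x) (at x)"
      "\<And>A :: 'v \<Rightarrow> 'v. bounded_linear A \<Longrightarrow> (\<lambda>x. f' x (A x)) \<in> Phi q R" using add.IH(1) by blast
    obtain g' where g': "\<And>x. (g has_derivative g' x) (at x)"
      "\<And>A :: 'v \<Rightarrow> 'v. bounded_linear A \<Longrightarrow> (\<lambda>x. g' x (A x)) \<in> Phi q R" using add.IH(2) by blast
    show ?case
      by (intro exI[of _ "\<lambda>x h. f' x h + g' x h"] conjI allI impI has_derivative_add Phi.add f' g')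
  qed
  then show thesis using that by blast
qed

inductive_set comb :: "('v \<Rightarrow> real) set \<Rightarrow> ('v \<Rightarrow> real) set" for S where
  zero: "(\<lambda>x. 0) \<in> comb S"
| base: "s \<in> S \<Longrightarrow> s \<in> comb S"
| add: "f \<in> comb S \<Longrightarrow> g \<in> comb S \<Longrightarrow> (\<lambda>x. f x + g x) \<in> comb S"
| scale: "f \<in> comb S \<Longrightarrow> (\<lambda>x. c * f x) \<in> comb S"

lemma comb_mono: "f \<in> comb S \<Longrightarrow> S \<subseteq> T \<Longrightarrow> f \<in> comb T"
  by (induction rule: comb.induct) (auto intro: comb.intros)

lemma comb_sum:
  assumes "\<And>i. i \<in> I \<Longrightarrow> f i \<in> comb S" shows "(\<lambda>x. \<Sum>i\<in>I. c i * f i x) \<in> comb S"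
  using assms
proof (induction I rule: infinite_finite_induct)
  case (insert j I)
  then have "(\<lambda>x. c j * f j x + (\<Sum>i\<in>I. c i * f i x)) \<in> comb S" by (intro comb.add comb.scale) simp_all
  then show ?case using insert by simp
qed (simp_all add: comb.zero)

lemma comb_mult:
  assumes "f \<in> comb S" "g \<in> comb T" shows "(\<lambda>x. f x * g x) \<in> comb {\<lambda>x. s x * t x |s t. s \<in> S \<and> t \<in> T}" (is "_ \<in> comb ?P")
  using assms(1)
proof induction
  case (base s)
  show ?case using assms(2)
  proof induction
    case (base t) then show ?case using \<open>s \<in> S\<close> by (auto intro: comb.base)
  next
    case (add f g) from comb.add[OF add.IH] show ?case by (simp add: distrib_left)
  next
    case (scale f c) from comb.scale[OF scale.IH, of c] show ?case by (simp add: mult.left_commute)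
  qed (auto intro: comb.zero)
next
  case (add f f') from comb.add[OF add.IH] show ?case by (simp add: distrib_right)
next
  case (scale f c) from comb.scale[OF scale.IH, of c] show ?case by (simp add: mult.assoc)
qed (auto intro: comb.zero)

text \<open>Linear vector fields do not raise the degree, so every polynomial lies in a
  finite-dimensional space stable under all of them. The induction follows the formation of the
  polynomial; for a product, the pairwise products of the two spanning sets serve.\<close>

lemma polynomial_finite_dimensional:
  fixes p :: "'v::euclidean_space \<Rightarrow> real"
  assumes "real_polynomial_function p"
  shows "\<exists>S. finite S \<and> (\<forall>s\<in>S. real_polynomial_function s) \<and> p \<in> comb S \<and>
    (\<forall>s\<in>S. \<exists>s'. (\<forall>x. (s has_derivative s' x) (at x)) \<and>
      (\<forall>A. bounded_linear A \<longrightarrow> (\<lambda>x. s' x (A x)) \<in> comb S))"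
  using assms
proof induction
  case (linear f)
  define S where "S = (\<lambda>b x. x \<bullet> b) ` (Basis :: 'v set)"
  have lin: "g \<in> comb S" if "bounded_linear g" for g
  proof -
    have "g = (\<lambda>x. \<Sum>b\<in>Basis. g b * (x \<bullet> b))"
    proof
      fix x
      show "g x = (\<Sum>b\<in>Basis. g b * (x \<bullet> b))"
        using arg_cong[OF euclidean_representation[of x, symmetric], of g] that
        by (simp add: bounded_linear.linear linear_sum linear_scale mult.commute)
    qed
    also have "\<dots> \<in> comb S"
      by (intro comb_sum comb.base) (simp add: S_def)
    finally show ?thesis .
  qed
  show ?case
  proof (intro exI[of _ S] conjI ballI)
    fix s assume "s \<in> S"
    then have s: "bounded_linear s" by (auto simp: S_def intro: bounded_linear_inner_left)
    then show "real_polynomial_function s" by (rule real_polynomial_function.intros(1))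
    show "\<exists>s'. (\<forall>x. (s has_derivative s' x) (at x)) \<and> (\<forall>A. bounded_linear A \<longrightarrow> (\<lambda>x. s' x (A x)) \<in> comb S)"
      by (intro exI[of _ "\<lambda>x. s"] conjI allI impI bounded_linear_imp_has_derivative s lin)
        (rule bounded_linear_compose[OF s])
  qed (auto simp: S_def intro: lin[OF linear, unfolded S_def])
next
  case (const c)
  have "(\<lambda>x. c) \<in> comb {\<lambda>x::'v. 1}" using comb.scale[OF comb.base, of "\<lambda>x. 1" "{\<lambda>x::'v. 1}" c] by simp
  then show ?case
    by (intro exI[of _ "{\<lambda>x. 1}"]) (auto intro: comb.zero intro!: exI[of _ "\<lambda>x h. 0"])
next
  case (add f g)
  from add.IH(1) obtain S where S: "finite S" "\<forall>s\<in>S. real_polynomial_function s" "f \<in> comb S"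
      "\<forall>s\<in>S. \<exists>s'. (\<forall>x. (s has_derivative s' x) (at x)) \<and> (\<forall>A. bounded_linear A \<longrightarrow> (\<lambda>x. s' x (A x)) \<in> comb S)" by blast
  from add.IH(2) obtain T where T: "finite T" "\<forall>s\<in>T. real_polynomial_function s" "g \<in> comb T"
      "\<forall>s\<in>T. \<exists>s'. (\<forall>x. (s has_derivative s' x) (at x)) \<and> (\<forall>A. bounded_linear A \<longrightarrow> (\<lambda>x. s' x (A x)) \<in> comb T)"
    by blast
  show ?case
  proof (intro exI[of _ "S \<union> T"] conjI ballI)
    fix s assume "s \<in> S \<union> T"
    then consider "s \<in> S" | "s \<in> T" by blast
    then show "\<exists>s'. (\<forall>x. (s has_derivative s' x) (at x)) \<and> (\<forall>A. bounded_linear A \<longrightarrow> (\<lambda>x. s' x (A x)) \<in> comb (S \<union> T))"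
    proof cases
      case 1
      with S(4) obtain s' where "\<forall>x. (s has_derivative s' x) (at x)" "\<forall>A. bounded_linear A \<longrightarrow> (\<lambda>x. s' x (A x)) \<in> comb S" by blast
      then show ?thesis by (intro exI[of _ s'] conjI allI impI comb_mono[OF _ Un_upper1]) simp_all
    next
      case 2
      with T(4) obtain s' where "\<forall>x. (s has_derivative s' x) (at x)" "\<forall>A. bounded_linear A \<longrightarrow> (\<lambda>x. s' x (A x)) \<in> comb T" by blast
      then show ?thesis by (intro exI[of _ s'] conjI allI impI comb_mono[OF _ Un_upper2]) simp_all
    qed
    show "real_polynomial_function s" using \<open>s \<in> S \<union> T\<close> S(2) T(2) by blast
  next
    show "(\<lambda>x. f x + g x) \<in> comb (S \<union> T)"
      by (rule comb.add[OF comb_mono[OF S(3)] comb_mono[OF T(3)]]) simp_all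
  qed (use S T in simp)
next
  case (mult f g)
  from mult.IH(1) obtain S where S: "finite S" "\<forall>s\<in>S. real_polynomial_function s" "f \<in> comb S"
      "\<forall>s\<in>S. \<exists>s'. (\<forall>x. (s has_derivative s' x) (at x)) \<and> (\<forall>A. bounded_linear A \<longrightarrow> (\<lambda>x. s' x (A x)) \<in> comb S)" by blast
  from mult.IH(2) obtain T where T: "finite T" "\<forall>s\<in>T. real_polynomial_function s" "g \<in> comb T"
      "\<forall>s\<in>T. \<exists>s'. (\<forall>x. (s has_derivative s' x) (at x)) \<and> (\<forall>A. bounded_linear A \<longrightarrow> (\<lambda>x. s' x (A x)) \<in> comb T)"
    by blast
  let ?P = "{\<lambda>x. s x * t x |s t. s \<in> S \<and> t \<in> T}"
  have "?P = (\<lambda>(s, t) x. s x * t x) ` (S \<times> T)" by auto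
  then have "finite ?P" using S(1) T(1) by simp
  show ?case
  proof (intro exI[of _ ?P] conjI ballI)
    fix r assume "r \<in> ?P"
    then obtain s t where st: "s \<in> S" "t \<in> T" "r = (\<lambda>x. s x * t x)" by blast
    then show "real_polynomial_function r" using S(2) T(2) by auto
    obtain s' where s': "\<And>x. (s has_derivative s' x) (at x)" "\<And>A. bounded_linear A \<Longrightarrow> (\<lambda>x. s' x (A x)) \<in> comb S"
      using S(4) st(1) by blast
    obtain t' where t': "\<And>x. (t has_derivative t' x) (at x)" "\<And>A. bounded_linear A \<Longrightarrow> (\<lambda>x. t' x (A x)) \<in> comb T"
      using T(4) st(2) by blast
    have "(\<lambda>x. s x * t' x (A x) + s' x (A x) * t x) \<in> comb ?P" if "bounded_linear A" for A
      by (intro comb.add comb_mult comb.base[OF st(1)] comb.base[OF st(2)] s'(2) t'(2) that)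
    then show "\<exists>s'. (\<forall>x. (r has_derivative s' x) (at x)) \<and> (\<forall>A. bounded_linear A \<longrightarrow> (\<lambda>x. s' x (A x)) \<in> comb ?P)"
      unfolding st(3) using has_derivative_mult[OF s'(1) t'(1)]
      by (intro exI[of _ "\<lambda>x h. s x * t' x h + s' x h * t x"]) blast
  next
    show "(\<lambda>x. f x * g x) \<in> comb ?P" by (rule comb_mult[OF S(3) T(3)])
  qed (rule \<open>finite ?P\<close>)
qed

subsection \<open>Smoothed vectors\<close>

lemma unitaryD:
  assumes "unitary T"
  shows "T (x + y) = T x + T y" "T (scaleC a x) = scaleC a (T x)" "T (r *\<^sub>R x) = r *\<^sub>R T x"
    "cinner (T x) (T y) = cinner x y" "T x \<bullet> T y = x \<bullet> y" "norm (T x) = norm x" "surj T" "T (x - y) = T x - T y" "T 0 = 0"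
    "bounded_linear T"
proof -
  show add: "T (x + y) = T x + T y" for x y using assms by (simp add: unitary_def complex_linear_on_def)
  show sc: "T (scaleC a x) = scaleC a (T x)" for a x using assms by (simp add: unitary_def complex_linear_on_def)
  show scR: "T (r *\<^sub>R x) = r *\<^sub>R T x" for r x using sc[of "complex_of_real r" x] by (simp add: scaleC_of_real)
  show ci: "cinner (T x) (T y) = cinner x y" for x y using assms by (simp add: unitary_def)
  show i: "T x \<bullet> T y = x \<bullet> y" for x y using ci[of x y] by (metis Re_cinner)
  show n: "norm (T x) = norm x" for x by (simp add: norm_eq_sqrt_inner i)
  show "surj T" using assms by (simp add: unitary_def)
  show lin: "bounded_linear T" by (rule bounded_linear_intro[where K=1]) (simp_all add: add scR n)
  interpret bounded_linear T by (rule lin)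
  show "T (x - y) = T x - T y" "T 0 = 0" by (rule diff, rule zero)
qed

locale rep = so31 L1 L2 L3 B1 B2 B3
  for L1 L2 L3 B1 B2 B3 :: "complex^'m^'m" +
  fixes G :: "(complex^'m^'m) set" and \<mu> and \<pi> :: "complex^'m^'m \<Rightarrow> 'h::complex_hilbert_space \<Rightarrow> 'h"
    and b :: "complex^'m^'m \<Rightarrow> complex^'m^'m \<Rightarrow> real"
  assumes G: "matrix_lie_group G" and rep: "unitary_rep G \<pi>" and haar: "haar_measure G \<mu>"
    and in_G: "{L1, L2, L3, B1, B2, B3} \<subseteq> lie_algebra G"
    and b: "bounded_bilinear b" and b_sym: "\<And>x y. b x y = b y x" and b_pos: "\<And>x. x \<noteq> 0 \<Longrightarrow> b x x > 0"
    and b_L: "\<And>x. b (L1 ** x) x = 0" "\<And>x. b (L2 ** x) x = 0" "\<And>x. b (L3 ** x) x = 0"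
begin

lemmas G_mult = matrix_lie_groupD(1)[OF G]
lemmas G_one = matrix_lie_groupD(2)[OF G]

lemma pi_unitary: "a \<in> G \<Longrightarrow> unitary (\<pi> a)" using rep by (simp add: unitary_rep_def)
lemmas pi_simps = pi_unitary[THEN unitaryD(1)] pi_unitary[THEN unitaryD(2)] pi_unitary[THEN unitaryD(3)]
  pi_unitary[THEN unitaryD(4)] pi_unitary[THEN unitaryD(5)] pi_unitary[THEN unitaryD(6)] pi_unitary[THEN unitaryD(8)]
  pi_unitary[THEN unitaryD(9)]

lemma pi_mult: "a \<in> G \<Longrightarrow> c \<in> G \<Longrightarrow> \<pi> (a ** c) v = \<pi> a (\<pi> c v)" using rep by (simp add: unitary_rep_def)
lemma pi_continuous: "continuous_on G (\<lambda>a. \<pi> a v)" using rep by (simp add: unitary_rep_def)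

lemma pi_one: "\<pi> (mat 1) v = v"
proof -
  have "norm (\<pi> (mat 1) (\<pi> (mat 1) v - v)) = 0"
    using pi_mult[OF G_one G_one, of v] by (simp add: pi_simps G_one)
  then have "norm (\<pi> (mat 1) v - v) = 0" by (simp only: pi_simps(6) G_one)
  then show ?thesis by simp
qed

lemma exp_in: "X \<in> lie_algebra G \<Longrightarrow> mexp (t *\<^sub>R X) \<in> G" by (simp add: lie_algebra_def)

lemma pi_adjoint:
  assumes "a \<in> G" "c \<in> G" "a ** c = mat 1"
  shows "cinner (\<pi> c x) y = cinner x (\<pi> a y)" "\<pi> c x \<bullet> y = x \<bullet> \<pi> a y"
  using pi_simps(4)[OF assms(1), of "\<pi> c x" y] pi_simps(5)[OF assms(1), of "\<pi> c x" y]
  by (simp_all add: assms pi_one flip: pi_mult)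

lemma space_mu: "space \<mu> = G" and sets_mu: "sets \<mu> = sets (restrict_space borel G)"
proof -
  show "sets \<mu> = sets (restrict_space borel G)" using haar by (simp add: haar_measure_def)
  from sets_eq_imp_space_eq[OF this] show "space \<mu> = G" by (simp add: space_restrict_space)
qed

lemma measurable_G: "continuous_on G f \<Longrightarrow> f \<in> borel_measurable \<mu>"
  by (subst measurable_cong_sets[OF sets_mu refl]) (rule borel_measurable_continuous_on_restrict)

lemma borel_measurable_G: "f \<in> borel_measurable borel \<Longrightarrow> f \<in> borel_measurable \<mu>"
  by (subst measurable_cong_sets[OF sets_mu refl]) (rule measurable_restrict_space1)

lemma translate_measurable:
  assumes "a \<in> G" shows "(**) a \<in> measurable \<mu> \<mu>"
proof -
  have "(**) a \<in> borel_measurable \<mu>"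
    by (rule measurable_G) (intro matmul.continuous_on continuous_intros)
  then have "(**) a \<in> measurable \<mu> (restrict_space borel G)"
    by (rule measurable_restrict_space2[rotated]) (use assms G_mult in \<open>auto simp: space_mu\<close>)
  then show ?thesis by (subst measurable_cong_sets[OF refl sets_mu])
qed

lemma
  fixes f :: "complex^'m^'m \<Rightarrow> 'c::{banach, second_countable_topology}"
  assumes a: "a \<in> G"
  shows integral_translate: "f \<in> borel_measurable \<mu> \<Longrightarrow> (LINT x|\<mu>. f (a ** x)) = (LINT x|\<mu>. f x)"
    and integrable_translate: "integrable \<mu> f \<Longrightarrow> integrable \<mu> (\<lambda>x. f (a ** x))"
proof -
  have d: "distr \<mu> \<mu> ((**) a) = \<mu>" using haar a by (simp add: haar_measure_def)
  show "f \<in> borel_measurable \<mu> \<Longrightarrow> (LINT x|\<mu>. f (a ** x)) = (LINT x|\<mu>. f x)"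
    using integral_distr[OF translate_measurable[OF a], of f] by (simp add: d)
  show "integrable \<mu> f \<Longrightarrow> integrable \<mu> (\<lambda>x. f (a ** x))"
    using integrable_distr[OF translate_measurable[OF a], of f] by (simp add: d)
qed

text \<open>The integral of \<open>f x\<close> times \<open>\<pi> x v\<close>, defined weakly by the
  Riesz representation. Real inner products suffice since \<open>f\<close> is real.\<close>

definition I :: "(complex^'m^'m \<Rightarrow> real) \<Rightarrow> 'h \<Rightarrow> 'h" where
  "I f v = (SOME y. \<forall>w. (LINT x|\<mu>. f x * (\<pi> x v \<bullet> w)) = y \<bullet> w)"

lemma coeff_measurable: "(\<lambda>x. \<pi> x v \<bullet> w) \<in> borel_measurable \<mu>"
  by (intro measurable_G continuous_intros pi_continuous)

lemma coeff_integrable: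
  assumes "integrable \<mu> f" shows "integrable \<mu> (\<lambda>x. f x * (\<pi> x v \<bullet> w))"
proof (rule Bochner_Integration.integrable_bound)
  show "integrable \<mu> (\<lambda>x. f x * (norm v * norm w))" using assms by simp
  show "(\<lambda>x. f x * (\<pi> x v \<bullet> w)) \<in> borel_measurable \<mu>"
    using coeff_measurable assms by (intro borel_measurable_times) auto
  show "AE x in \<mu>. norm (f x * (\<pi> x v \<bullet> w)) \<le> norm (f x * (norm v * norm w))"
  proof (intro AE_I2)
    fix x assume "x \<in> space \<mu>"
    then have "\<bar>\<pi> x v \<bullet> w\<bar> \<le> norm v * norm w" using Cauchy_Schwarz_ineq2[of "\<pi> x v" w] by (simp add: space_mu pi_simps)
    then show "norm (f x * (\<pi> x v \<bullet> w)) \<le> norm (f x * (norm v * norm w))"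
      by (simp add: abs_mult mult_left_mono)
  qed
qed

lemma coeff_bound:
  assumes "integrable \<mu> f"
  shows "\<bar>LINT x|\<mu>. f x * (\<pi> x v \<bullet> w)\<bar> \<le> (LINT x|\<mu>. \<bar>f x\<bar>) * norm v * norm w"
proof -
  have "\<bar>LINT x|\<mu>. f x * (\<pi> x v \<bullet> w)\<bar> \<le> (LINT x|\<mu>. \<bar>f x * (\<pi> x v \<bullet> w)\<bar>)" by (rule integral_abs_bound)
  also have "\<dots> \<le> (LINT x|\<mu>. \<bar>f x\<bar> * (norm v * norm w))"
  proof (rule integral_mono)
    show "integrable \<mu> (\<lambda>x. \<bar>f x * (\<pi> x v \<bullet> w)\<bar>)" "integrable \<mu> (\<lambda>x. \<bar>f x\<bar> * (norm v * norm w))"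
      using coeff_integrable[OF assms] assms by auto
    fix x assume "x \<in> space \<mu>"
    then have "\<bar>\<pi> x v \<bullet> w\<bar> \<le> norm v * norm w" using Cauchy_Schwarz_ineq2[of "\<pi> x v" w] by (simp add: space_mu pi_simps)
    then show "\<bar>f x * (\<pi> x v \<bullet> w)\<bar> \<le> \<bar>f x\<bar> * (norm v * norm w)" by (simp add: abs_mult mult_left_mono)
  qed
  finally show ?thesis by (simp add: mult.assoc)
qed

lemma I_inner:
  assumes f: "integrable \<mu> f"
  shows "I f v \<bullet> w = (LINT x|\<mu>. f x * (\<pi> x v \<bullet> w))"
proof -
  have "bounded_linear (\<lambda>w. LINT x|\<mu>. f x * (\<pi> x v \<bullet> w))"
  proof (rule bounded_linear_intro)
    show "(LINT x|\<mu>. f x * (\<pi> x v \<bullet> (y + z))) = (LINT x|\<mu>. f x * (\<pi> x v \<bullet> y)) + (LINT x|\<mu>. f x * (\<pi> x v \<bullet> z))" for y z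
      using coeff_integrable[OF f] by (simp add: inner_add_right distrib_left)
    show "(LINT x|\<mu>. f x * (\<pi> x v \<bullet> (r *\<^sub>R y))) = r *\<^sub>R (LINT x|\<mu>. f x * (\<pi> x v \<bullet> y))" for r y
      using integral_mult_right_zero[of \<mu> r "\<lambda>x. f x * (\<pi> x v \<bullet> y)"] by (simp add: mult.left_commute)
    show "norm (LINT x|\<mu>. f x * (\<pi> x v \<bullet> w)) \<le> norm w * ((LINT x|\<mu>. \<bar>f x\<bar>) * norm v)" for w
      using coeff_bound[OF f, of v w] by (simp add: mult.commute)
  qed
  then have "\<forall>w. (LINT x|\<mu>. f x * (\<pi> x v \<bullet> w)) = I f v \<bullet> w"
    unfolding I_def by (rule someI_ex[OF riesz_representation])
  then show ?thesis by metis
qed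

lemma I_norm:
  assumes f: "integrable \<mu> f" shows "norm (I f v) \<le> (LINT x|\<mu>. \<bar>f x\<bar>) * norm v"
proof (cases "I f v = 0")
  case False
  have "norm (I f v) * norm (I f v) \<le> ((LINT x|\<mu>. \<bar>f x\<bar>) * norm v) * norm (I f v)"
    using coeff_bound[OF f, of v "I f v"] I_inner[OF f, of v "I f v"]
    by (simp add: dot_square_norm power2_eq_square)
  then show ?thesis using False by (simp add: mult_le_cancel_right)
qed simp

lemma eqI_inner: "(\<And>w. x \<bullet> w = y \<bullet> w) \<Longrightarrow> x = (y :: 'h)"
  by (metis inner_eq_zero_iff inner_diff_left right_minus_eq)

lemma I_add: "integrable \<mu> f \<Longrightarrow> integrable \<mu> g \<Longrightarrow> I (\<lambda>x. f x + g x) v = I f v + I g v"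
  by (rule eqI_inner) (simp add: I_inner inner_add_left coeff_integrable distrib_right)

lemma I_scale: "integrable \<mu> f \<Longrightarrow> I (\<lambda>x. c * f x) v = c *\<^sub>R I f v"
  by (rule eqI_inner) (simp add: I_inner mult.assoc)

lemma inner_scaleC_left: "scaleC a (x::'h) \<bullet> y = x \<bullet> scaleC (cnj a) y"
  by (simp add: cinner_scaleC_left cinner_scaleC_right flip: Re_cinner)

lemma I_scaleC:
  assumes "integrable \<mu> f" shows "I f (scaleC a v) = scaleC a (I f v)"
proof (rule eqI_inner)
  fix w
  have "(LINT x|\<mu>. f x * (\<pi> x (scaleC a v) \<bullet> w)) = (LINT x|\<mu>. f x * (\<pi> x v \<bullet> scaleC (cnj a) w))"
    by (rule Bochner_Integration.integral_cong) (simp_all add: space_mu pi_simps inner_scaleC_left)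
  then show "I f (scaleC a v) \<bullet> w = scaleC a (I f v) \<bullet> w" by (simp add: I_inner assms inner_scaleC_left)
qed

lemma I_translate:
  assumes f: "integrable \<mu> f" and g: "g \<in> G" "g' \<in> G" "g ** g' = mat 1" "g' ** g = mat 1"
  shows "\<pi> g (I f v) = I (\<lambda>x. f (g' ** x)) v"
proof (rule eqI_inner)
  fix w
  note fi = integrable_translate[OF g(2) f]
  have "I (\<lambda>x. f (g' ** x)) v \<bullet> w = (LINT x|\<mu>. f (g' ** x) * (\<pi> x v \<bullet> w))" by (rule I_inner[OF fi])
  also have "\<dots> = (LINT x|\<mu>. f (g' ** (g ** x)) * (\<pi> (g ** x) v \<bullet> w))"
    by (rule integral_translate[OF g(1), symmetric]) (use coeff_integrable[OF fi] in auto)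
  also have "\<dots> = (LINT x|\<mu>. f x * (\<pi> x v \<bullet> \<pi> g' w))"
  proof (rule Bochner_Integration.integral_cong[OF refl])
    fix x assume "x \<in> space \<mu>"
    then show "f (g' ** (g ** x)) * (\<pi> (g ** x) v \<bullet> w) = f x * (\<pi> x v \<bullet> \<pi> g' w)"
      by (simp add: space_mu pi_mult g pi_adjoint[OF g(2,1,4)] matrix_mul_assoc)
  qed
  also have "\<dots> = \<pi> g (I f v) \<bullet> w" by (simp add: I_inner[OF f] pi_adjoint[OF g(2,1,4)])
  finally show "\<pi> g (I f v) \<bullet> w = I (\<lambda>x. f (g' ** x)) v \<bullet> w" by simp
qed

definition q where "q x = b x x"
text \<open>The summand 1 puts the identity into the interior \<open>q < R\<close>.\<close>

definition R where "R = q (mat 1) + 1"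
text \<open>\<open>G\<close> is closed only among invertible matrices, so a bound on
  \<open>q\<close> alone would let its elements approach a singular matrix; the bound on the
  determinant prevents this.\<close>

definition iota :: "complex^'m^'m \<Rightarrow> real" where "iota x = (if cmod (det x) \<ge> 1/2 then 1 else 0)"
text \<open>A compact neighbourhood of the identity in \<open>G\<close> that carries every test
  function.\<close>

definition C0 where "C0 = {x \<in> G. q x \<le> R \<and> cmod (det x) \<ge> 1/2}"

lemma q_polynomial: "real_polynomial_function q"
  unfolding q_def by (rule polynomial_bilinear[OF b])

lemma q_continuous: "continuous_on S q"
  unfolding q_def by (intro bounded_bilinear.continuous_on[OF b] continuous_on_id)

lemma q_bounds: obtains c where "c > 0" "\<And>x. c * (norm x)\<^sup>2 \<le> q x"
proof -
  interpret b: bounded_bilinear b by (rule b)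
  have "sphere (0 :: complex^'m^'m) 1 \<noteq> {}" by simp
  then obtain z where z: "z \<in> sphere 0 1" "\<And>y. y \<in> sphere 0 1 \<Longrightarrow> q z \<le> q y"
    using continuous_attains_inf[OF compact_sphere _ q_continuous] by blast
  have "z \<noteq> 0" using z(1) by auto
  then have pos: "q z > 0" unfolding q_def by (rule b_pos)
  have "q z * (norm x)\<^sup>2 \<le> q x" for x
  proof (cases "x = 0")
    case True then show ?thesis by (simp add: q_def b.zero_left)
  next
    case False
    have "q z \<le> q (x /\<^sub>R norm x)" using False by (intro z(2)) simp
    also have "\<dots> = q x / (norm x)\<^sup>2" by (simp add: q_def b.scaleR_left b.scaleR_right power2_eq_square divide_inverse_commute)
    finally show ?thesis using False by (simp add: pos_le_divide_eq)
  qed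
  with pos show thesis by (rule that)
qed

lemma compact_C0: "compact C0" and C0_sub: "C0 \<subseteq> G"
proof -
  show "C0 \<subseteq> G" by (auto simp: C0_def)
  obtain F where F: "closed F" "G = {x. invertible x} \<inter> F"
    using G by (auto simp: matrix_lie_group_def closedin_closed GL_def)
  have eq: "C0 = F \<inter> {x. q x \<le> R} \<inter> {x. 1/2 \<le> cmod (det x)}"
  proof -
    have "x \<in> G \<longleftrightarrow> det x \<noteq> 0 \<and> x \<in> F" for x
      by (subst F(2)) (simp add: invertible_det_nz)
    moreover have "det x \<noteq> 0" if "1/2 \<le> cmod (det x)" for x :: "complex^'m^'m" using that by force
    ultimately show ?thesis unfolding C0_def by blast
  qed
  obtain c where c: "c > 0" "\<And>x. c * (norm x)\<^sup>2 \<le> q x" using q_bounds by blast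
  have "closed {x. q x \<le> R}" by (intro closed_Collect_le q_continuous continuous_on_const)
  moreover have "closed {x :: complex^'m^'m. 1/2 \<le> cmod (det x)}"
    by (intro closed_Collect_le continuous_on_const continuous_on_norm continuous_on_det)
  ultimately have "closed C0" unfolding eq using F(1) by (intro closed_Int)
  moreover have "bounded C0"
  proof (rule boundedI)
    fix x assume "x \<in> C0"
    then have "c * (norm x)\<^sup>2 \<le> R" using c(2)[of x] by (auto simp: C0_def)
    then have "(norm x)\<^sup>2 \<le> R / c" using c(1) by (simp add: pos_le_divide_eq mult.commute)
    then show "norm x \<le> sqrt (R / c)" by (rule real_le_rsqrt)
  qed
  ultimately show "compact C0" by (simp add: compact_eq_bounded_closed)
qed

lemma emeasure_compact: "compact C \<Longrightarrow> C \<subseteq> G \<Longrightarrow> emeasure \<mu> C < \<infinity>"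
  using haar by (simp add: haar_measure_def)

lemma compact_sets: "compact C \<Longrightarrow> C \<subseteq> G \<Longrightarrow> C \<in> sets \<mu>"
  unfolding sets_mu sets_restrict_space
  by (rule image_eqI[of _ _ C]) (simp_all add: Int_absorb1 borel_closed compact_imp_closed)

definition psi where "psi \<phi> x = iota x * \<phi> x"

lemma psi_support: "\<phi> \<in> Phi q R \<Longrightarrow> x \<in> G \<Longrightarrow> x \<notin> C0 \<Longrightarrow> psi \<phi> x = 0"
  using Phi_zero[of \<phi> q R x] by (auto simp: C0_def psi_def iota_def)

lemma Phi_continuous: "\<phi> \<in> Phi q R \<Longrightarrow> continuous_on S \<phi>"
proof -
  assume "\<phi> \<in> Phi q R"
  obtain f' where "\<And>x. (\<phi> has_derivative f' x) (at x)"
    by (rule Phi_derivative[OF q_polynomial \<open>\<phi> \<in> Phi q R\<close>]) blast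
  then show ?thesis by (intro continuous_at_imp_continuous_on ballI has_derivative_continuous)
qed

lemma psi_bounded:
  assumes "\<phi> \<in> Phi q R" obtains M where "M \<ge> 0" "\<And>x. x \<in> G \<Longrightarrow> \<bar>psi \<phi> x\<bar> \<le> M"
proof -
  have "bounded (\<phi> ` C0)"
    by (intro compact_imp_bounded compact_continuous_image Phi_continuous[OF assms] compact_C0)
  then obtain M where M: "\<And>x. x \<in> C0 \<Longrightarrow> \<bar>\<phi> x\<bar> \<le> M" by (auto simp: bounded_iff)
  have "\<bar>psi \<phi> x\<bar> \<le> \<bar>M\<bar>" if "x \<in> G" for x
  proof (cases "x \<in> C0")
    case True then show ?thesis using M[OF True] by (auto simp: psi_def iota_def)
  qed (simp add: psi_support[OF assms that])
  then show thesis by (intro that[of "\<bar>M\<bar>"]) auto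
qed

lemma iota_measurable: "iota \<in> borel_measurable borel"
proof -
  have "closed {x :: complex^'m^'m. 1/2 \<le> cmod (det x)}"
    by (intro closed_Collect_le continuous_on_const continuous_on_norm continuous_on_det)
  then have "{x :: complex^'m^'m. 1/2 \<le> cmod (det x)} \<in> sets borel" by (rule borel_closed)
  then have "(indicator {x :: complex^'m^'m. 1/2 \<le> cmod (det x)} :: _ \<Rightarrow> real) \<in> borel_measurable borel" by simp
  moreover have "iota = indicator {x :: complex^'m^'m. 1/2 \<le> cmod (det x)}" by (auto simp: iota_def indicator_def)
  ultimately show ?thesis by simp
qed

lemma psi_measurable: "\<phi> \<in> Phi q R \<Longrightarrow> psi \<phi> \<in> borel_measurable \<mu>"
  unfolding psi_def
  by (intro borel_measurable_times borel_measurable_G[OF iota_measurable] measurable_G Phi_continuous)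

lemma bounded_support_integrable:
  assumes f: "f \<in> borel_measurable \<mu>" and C: "compact C" "C \<subseteq> G"
    and M: "\<And>x. x \<in> G \<Longrightarrow> \<bar>f x\<bar> \<le> M * indicator C x"
  shows "integrable \<mu> (f :: _ \<Rightarrow> real)"
proof (rule Bochner_Integration.integrable_bound[OF _ f])
  show "integrable \<mu> (\<lambda>x. M * indicator C x :: real)"
    by (intro integrable_mult_right integrable_real_indicator compact_sets emeasure_compact C)
  show "AE x in \<mu>. norm (f x) \<le> norm (M * indicator C x :: real)"
    using M by (intro AE_I2) (force simp: space_mu)
qed

lemma psi_integrable: "\<phi> \<in> Phi q R \<Longrightarrow> integrable \<mu> (psi \<phi>)"
proof -
  assume p: "\<phi> \<in> Phi q R"
  obtain M where "\<And>x. x \<in> G \<Longrightarrow> \<bar>psi \<phi> x\<bar> \<le> M" using psi_bounded[OF p] by blast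
  then show ?thesis
    by (intro bounded_support_integrable[OF psi_measurable[OF p] compact_C0 C0_sub, of M])
      (auto simp: indicator_def psi_support[OF p])
qed

definition J where "J \<phi> v = I (psi \<phi>) v"

lemma J_add: "\<phi> \<in> Phi q R \<Longrightarrow> \<phi>' \<in> Phi q R \<Longrightarrow> J (\<lambda>x. \<phi> x + \<phi>' x) v = J \<phi> v + J \<phi>' v"
  using I_add[OF psi_integrable psi_integrable, of \<phi> \<phi>' v] by (simp add: J_def psi_def[abs_def] distrib_left)

lemma J_scale: "\<phi> \<in> Phi q R \<Longrightarrow> J (\<lambda>x. c * \<phi> x) v = c *\<^sub>R J \<phi> v"
  using I_scale[OF psi_integrable, of \<phi> c v] by (simp add: J_def psi_def[abs_def] mult.left_commute)

lemma J_scaleC: "\<phi> \<in> Phi q R \<Longrightarrow> J \<phi> (scaleC a v) = scaleC a (J \<phi> v)"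
  by (simp add: J_def I_scaleC psi_integrable)

text \<open>For \<open>X \<in> E\<close>, translation by \<open>exp (t X)\<close> preserves the cutoff \<open>iota\<close>, which makes the support of the
  test functions compact in \<open>G\<close>.\<close>

definition E where "E = {X \<in> lie_algebra G. \<forall>s. cmod (det (mexp (s *\<^sub>R X))) = 1}"

lemma basis_E: "L1 \<in> E" "L2 \<in> E" "L3 \<in> E" "B1 \<in> E" "B2 \<in> E" "B3 \<in> E"
  using in_G det_mexp_abs by (auto simp: E_def)

lemma E_G: "X \<in> E \<Longrightarrow> mexp (t *\<^sub>R X) \<in> G" by (simp add: E_def exp_in)

lemma E_iota: "X \<in> E \<Longrightarrow> iota (mexp (t *\<^sub>R X) ** x) = iota x"
  by (simp add: E_def iota_def det_mul norm_mult)

text \<open>Smoothing is bounded by the \<open>L\<^sup>1\<close> norm of the test function, so it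
  suffices that difference quotients of the translated test function converge in
  \<open>L\<^sup>1\<close>. The mean value theorem and a common compact support provide the
  majorant. The minus sign comes from the inverse in left translation.\<close>

lemma J_derivative:
  assumes X: "X \<in> E" and \<phi>: "\<phi> \<in> Phi q R" and d: "\<And>x. (\<phi> has_derivative \<phi>' x) (at x)"
    and \<phi>': "(\<lambda>x. \<phi>' x (X ** x)) \<in> Phi q R"
  shows "((\<lambda>s. \<pi> (mexp (s *\<^sub>R X)) (J \<phi> v)) has_vector_derivative - J (\<lambda>x. \<phi>' x (X ** x)) v) (at 0)"
proof -
  define D where "D = psi (\<lambda>x. \<phi>' x (X ** x))"
  define f where "f = psi \<phi>"
  define F where "F s x = f (mexp ((- s) *\<^sub>R X) ** x)" for s x
  have fi: "integrable \<mu> f" and Di: "integrable \<mu> D" by (simp_all add: f_def D_def psi_integrable \<phi> \<phi>')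
  have gG: "mexp (s *\<^sub>R X) \<in> G" for s by (rule E_G[OF X])
  have inv: "mexp (s *\<^sub>R X) ** mexp ((- s) *\<^sub>R X) = mat 1" "mexp ((- s) *\<^sub>R X) ** mexp (s *\<^sub>R X) = mat 1" for s
    using mexp_minus[of "s *\<^sub>R X"] by simp_all
  have Fi: "integrable \<mu> (F s)" for s unfolding F_def by (rule integrable_translate[OF gG fi])
  have tr: "\<pi> (mexp (s *\<^sub>R X)) (J \<phi> v) = I (F s) v" for s
    using I_translate[OF fi gG gG inv] by (simp add: J_def f_def F_def[abs_def])
  have dF: "((\<lambda>s. F s x) has_real_derivative - D (mexp ((- s) *\<^sub>R X) ** x)) (at s)" for s x
  proof -
    have "((\<lambda>s. mexp (s *\<^sub>R (- X)) ** x) has_vector_derivative (- X) ** (mexp (s *\<^sub>R (- X)) ** x)) (at s)"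
      using bounded_linear.has_vector_derivative[OF matmul.bounded_linear_left mexp_deriv[of "- X" s UNIV], of x]
      by (simp add: matrix_mul_assoc)
    from has_derivative_compose[OF this[unfolded has_vector_derivative_def] d]
    have "((\<lambda>s. \<phi> (mexp ((- s) *\<^sub>R X) ** x)) has_derivative
        (\<lambda>h. \<phi>' (mexp ((- s) *\<^sub>R X) ** x) (h *\<^sub>R ((- X) ** (mexp ((- s) *\<^sub>R X) ** x))))) (at s)" by simp
    then have "((\<lambda>s. \<phi> (mexp ((- s) *\<^sub>R X) ** x)) has_real_derivative
        - \<phi>' (mexp ((- s) *\<^sub>R X) ** x) (X ** (mexp ((- s) *\<^sub>R X) ** x))) (at s)"
      unfolding has_field_derivative_def
    proof (rule has_derivative_eq_rhs)
      have "linear (\<phi>' y)" for y using has_derivative_bounded_linear[OF d] bounded_linear.linear by blast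
      then show "(\<lambda>h. \<phi>' (mexp ((- s) *\<^sub>R X) ** x) (h *\<^sub>R ((- X) ** (mexp ((- s) *\<^sub>R X) ** x))))
        = (*) (- \<phi>' (mexp ((- s) *\<^sub>R X) ** x) (X ** (mexp ((- s) *\<^sub>R X) ** x)))"
        by (intro ext) (simp add: matmul.minus_left linear_scale linear_neg)
    qed
    from DERIV_cmult[OF this, of "iota x"] show ?thesis
      by (simp add: F_def f_def D_def psi_def E_iota[OF X] del: scaleR_minus_left)
  qed
  obtain M where M: "M \<ge> 0" "\<And>x. x \<in> G \<Longrightarrow> \<bar>D x\<bar> \<le> M" using psi_bounded[OF \<phi>'] unfolding D_def by blast
  \<comment> \<open>Contains the supports of all translates with
    \<open>\<bar>s\<bar> \<le> 1\<close>.\<close>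
  define C1 where "C1 = (\<lambda>(s, c). mexp (s *\<^sub>R X) ** c) ` ({-1..1} \<times> C0)"
  have C1: "compact C1" "C1 \<subseteq> G"
  proof -
    have "continuous_on ({-1..1} \<times> C0) (\<lambda>z. mexp (fst z *\<^sub>R X) ** snd z)"
      by (intro matmul.continuous_on continuous_on_snd continuous_on_id continuous_on_compose2[OF mexp_continuous[of UNIV X] continuous_on_fst[OF continuous_on_id]]) auto
    then show "compact C1" unfolding C1_def case_prod_unfold
      by (intro compact_continuous_image compact_Times compact_Icc compact_C0)
    show "C1 \<subseteq> G" unfolding C1_def using gG G_mult C0_sub by auto
  qed
  have supp: "F s x = 0" if "x \<in> G" "x \<notin> C1" "\<bar>s\<bar> \<le> 1" for s x
  proof -
    have "mexp ((- s) *\<^sub>R X) ** x \<notin> C0"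
    proof
      assume "mexp ((- s) *\<^sub>R X) ** x \<in> C0"
      then have "mexp (s *\<^sub>R X) ** (mexp ((- s) *\<^sub>R X) ** x) \<in> C1" unfolding C1_def using that(3) by force
      then show False using that(2) by (simp add: matrix_mul_assoc inv del: scaleR_minus_left)
    qed
    then show ?thesis unfolding F_def f_def by (intro psi_support[OF \<phi>] G_mult gG that(1))
  qed
  define Q where "Q s x = (F s x - F 0 x) / s + D x" for s x
  have Qi: "integrable \<mu> (Q s)" for s unfolding Q_def using Fi Di by auto
  have F0: "F 0 = f" by (auto simp: F_def)
  have Qb: "\<bar>Q s x\<bar> \<le> 2 * M * indicator C1 x" if "x \<in> G" "\<bar>s\<bar> \<le> 1" "s \<noteq> 0" for s x
  proof (cases "x \<in> C1")
    case False
    have "C0 \<subseteq> C1" unfolding C1_def by (force intro: image_eqI[of _ _ "(0, _)"])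
    then have "D x = 0" using False psi_support[OF \<phi>' that(1)] unfolding D_def by blast
    then show ?thesis using False supp[OF that(1) False] that(2) by (simp add: Q_def)
  next
    case True
    have "\<bar>F s x - F 0 x\<bar> \<le> M * \<bar>s - 0\<bar>"
    proof -
      have "norm (F s x - F 0 x) \<le> M * norm (s - 0)"
        by (rule field_differentiable_bound[of UNIV "\<lambda>s. F s x" "\<lambda>s. - D (mexp ((- s) *\<^sub>R X) ** x)"])
          (use dF M(2)[OF G_mult[OF gG that(1)]] in \<open>simp_all del: scaleR_minus_left\<close>)
      then show ?thesis by simp
    qed
    then have "\<bar>(F s x - F 0 x) / s\<bar> \<le> M" using that(3) by (simp add: pos_divide_le_eq)
    then have "\<bar>Q s x\<bar> \<le> M + M" unfolding Q_def using M(2)[OF that(1)] by linarith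
    then show ?thesis using True by simp
  qed
  have lim: "((\<lambda>s. LINT x|\<mu>. \<bar>Q s x\<bar>) \<longlongrightarrow> 0) (at 0)"
  proof (rule tendsto_at_iff_sequentially[THEN iffD2])
    show "\<forall>S. (\<forall>i. S i \<in> UNIV - {0}) \<longrightarrow> S \<longlonglongrightarrow> 0 \<longrightarrow> ((\<lambda>s. LINT x|\<mu>. \<bar>Q s x\<bar>) \<circ> S) \<longlonglongrightarrow> 0"
    proof (intro allI impI)
      fix S :: "nat \<Rightarrow> real" assume S: "\<forall>i. S i \<in> UNIV - {0}" "S \<longlonglongrightarrow> 0"
      then have S0: "S i \<noteq> 0" for i by auto
      \<comment> \<open>Agrees with \<open>S\<close> from some index on, and makes the majorant
        valid for every index.\<close>
      define S' where "S' i = (if \<bar>S i\<bar> \<le> 1 then S i else 1)" for i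
      have ev: "\<forall>\<^sub>F i in sequentially. S' i = S i"
        using tendstoD[OF S(2), of 1] by (auto simp: S'_def elim!: eventually_mono)
      have S'b: "\<bar>S' i\<bar> \<le> 1" "S' i \<noteq> 0" for i using S0 by (auto simp: S'_def)
      have S'l: "S' \<longlonglongrightarrow> 0" by (subst tendsto_cong[OF ev]) (rule S(2))
      have "(\<lambda>i. LINT x|\<mu>. \<bar>Q (S' i) x\<bar>) \<longlonglongrightarrow> (LINT x|\<mu>. 0)"
      proof (rule integral_dominated_convergence)
        show "integrable \<mu> (\<lambda>x. 2 * M * indicator C1 x :: real)"
          by (intro integrable_mult_right integrable_real_indicator compact_sets emeasure_compact C1)
        show "AE x in \<mu>. (\<lambda>i. \<bar>Q (S' i) x\<bar>) \<longlonglongrightarrow> 0"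
        proof (intro AE_I2)
          fix x assume "x \<in> space \<mu>"
          have "((\<lambda>h. (F h x - F 0 x) / h) \<longlongrightarrow> - D x) (at 0)"
            using dF[of x 0] by (simp add: has_field_derivative_iff)
          moreover have "filterlim S' (at 0) sequentially"
            using S'l S'b(2) by (intro filterlim_atI) auto
          ultimately have "(\<lambda>i. (F (S' i) x - F 0 x) / S' i) \<longlonglongrightarrow> - D x" by (rule filterlim_compose)
          from tendsto_rabs_zero[OF tendsto_add[OF this tendsto_const[of "D x"], simplified]]
          show "(\<lambda>i. \<bar>Q (S' i) x\<bar>) \<longlonglongrightarrow> 0" by (simp add: Q_def)
        qed
        show "AE x in \<mu>. norm \<bar>Q (S' i) x\<bar> \<le> 2 * M * indicator C1 x" for i
          using Qb[OF _ S'b] by (intro AE_I2) (simp add: space_mu)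
      qed (use Qi in auto)
      then have "(\<lambda>i. LINT x|\<mu>. \<bar>Q (S' i) x\<bar>) \<longlonglongrightarrow> 0" by simp
      moreover have "\<forall>\<^sub>F i in sequentially. (LINT x|\<mu>. \<bar>Q (S' i) x\<bar>) = (LINT x|\<mu>. \<bar>Q (S i) x\<bar>)"
        using ev by (auto elim!: eventually_mono)
      ultimately show "((\<lambda>s. LINT x|\<mu>. \<bar>Q s x\<bar>) \<circ> S) \<longlonglongrightarrow> 0"
        unfolding o_def by (rule Lim_transform_eventually)
    qed
  qed
  have quot: "(I (F s) v - I (F 0) v) /\<^sub>R s - (- I D v) = I (Q s) v" for s
  proof -
    have "I (Q s) v = I (\<lambda>x. inverse s * F s x + (- inverse s) * F 0 x + D x) v"
      by (rule arg_cong[of _ _ "\<lambda>f. I f v"]) (auto simp: Q_def divide_inverse_commute right_diff_distrib)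
    also have "\<dots> = inverse s *\<^sub>R I (F s) v + (- inverse s) *\<^sub>R I (F 0) v + I D v"
    proof -
      have "integrable \<mu> (\<lambda>x. inverse s * F s x)" "integrable \<mu> (\<lambda>x. (- inverse s) * F 0 x)" using Fi by (auto intro!: integrable_mult_right)
      then show ?thesis using Di Fi by (simp only: I_add I_scale Bochner_Integration.integrable_add)
    qed
    finally show ?thesis by (simp add: scaleR_diff_right)
  qed
  have "((\<lambda>s. (I (F s) v - I (F 0) v) /\<^sub>R s - (- I D v)) \<longlongrightarrow> 0) (at 0)"
  proof (rule Lim_null_comparison)
    show "\<forall>\<^sub>F s in at 0. norm ((I (F s) v - I (F 0) v) /\<^sub>R s - (- I D v)) \<le> (LINT x|\<mu>. \<bar>Q s x\<bar>) * norm v"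
      unfolding quot by (intro always_eventually allI I_norm Qi)
    show "((\<lambda>s. (LINT x|\<mu>. \<bar>Q s x\<bar>) * norm v) \<longlongrightarrow> 0) (at 0)" by (rule tendsto_mult_left_zero[OF lim])
  qed
  then have "((\<lambda>s. norm (I (F s) v - I (F 0) v - s *\<^sub>R (- I D v)) / norm s) \<longlongrightarrow> 0) (at 0)"
  proof (rule Lim_transform_eventually[OF tendsto_norm_zero])
    show "\<forall>\<^sub>F s in at 0. norm ((I (F s) v - I (F 0) v) /\<^sub>R s - (- I D v)) = norm (I (F s) v - I (F 0) v - s *\<^sub>R (- I D v)) / norm s"
      unfolding eventually_at
    proof (intro exI[of _ 1] conjI ballI impI)
      fix s :: real assume "s \<noteq> 0 \<and> dist s 0 < 1"
      then have "(I (F s) v - I (F 0) v) /\<^sub>R s - (- I D v) = (I (F s) v - I (F 0) v - s *\<^sub>R (- I D v)) /\<^sub>R s"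
        by (simp add: scaleR_diff_right scaleR_add_right)
      then show "norm ((I (F s) v - I (F 0) v) /\<^sub>R s - (- I D v)) = norm (I (F s) v - I (F 0) v - s *\<^sub>R (- I D v)) / norm s"
        by (simp only: norm_scaleR) (simp add: divide_inverse_commute)
    qed simp
  qed
  then have "((\<lambda>s. I (F s) v) has_vector_derivative - I D v) (at 0)"
    unfolding has_vector_derivative_def has_derivative_at
    using bounded_linear_scaleR_left[of "- I D v"] by (simp del: scaleR_minus_right)
  then show ?thesis unfolding tr by (simp add: J_def D_def)
qed

end

section \<open>Differentiable vectors and the derived action of the Lie algebra\<close>

context rep begin

text \<open>A Garding space for the test functions \<open>Phi\<close>; it is stable under
  \<open>dpi X\<close> for \<open>X \<in> E\<close> because \<open>Phi\<close> is stable under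
  linear vector fields.\<close>

definition YY where "YY = span {J \<phi> v |\<phi> v. \<phi> \<in> Phi q R}"

lemma YY_subspace: "subspace YY" by (simp add: YY_def)
lemma J_in: "\<phi> \<in> Phi q R \<Longrightarrow> J \<phi> v \<in> YY" unfolding YY_def by (intro span_base) blast

lemma YY_induct:
  assumes "y \<in> YY" "subspace {y. P y}" "\<And>\<phi> v. \<phi> \<in> Phi q R \<Longrightarrow> P (J \<phi> v)"
  shows "P y"
  using span_induct[of y "{J \<phi> v |\<phi> v. \<phi> \<in> Phi q R}" P] assms unfolding YY_def by blast

lemma YY_complex: "complex_subspace YY"
  unfolding complex_subspace_def
proof (intro conjI allI ballI)
  show "subspace YY" by (rule YY_subspace)
  fix a y assume "y \<in> YY"
  then show "scaleC a y \<in> YY"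
  proof (rule YY_induct)
    show "subspace {y. scaleC a y \<in> YY}"
      using YY_subspace by (auto simp: subspace_def scaleC.add_right scaleC.scaleR_right scaleC.zero_right)
  next
    fix \<phi> v assume "\<phi> \<in> Phi q R"
    then show "scaleC a (J \<phi> v) \<in> YY" by (simp add: J_in flip: J_scaleC)
  qed
qed

definition dpi where "dpi X y = vector_derivative (\<lambda>s. \<pi> (mexp (s *\<^sub>R X)) y) (at 0)"

lemma dpi_eqI: "((\<lambda>s. \<pi> (mexp (s *\<^sub>R X)) y) has_vector_derivative z) (at 0) \<Longrightarrow> dpi X y = z"
  unfolding dpi_def by (rule vector_derivative_at)

lemma dpi_J:
  assumes "X \<in> E" "\<phi> \<in> Phi q R" "\<And>x. (\<phi> has_derivative \<phi>' x) (at x)" "(\<lambda>x. \<phi>' x (X ** x)) \<in> Phi q R"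
  shows "dpi X (J \<phi> v) = - J (\<lambda>x. \<phi>' x (X ** x)) v"
  by (rule dpi_eqI[OF J_derivative[OF assms]])

lemma dpi_deriv_in:
  assumes X: "X \<in> E" and y: "y \<in> YY"
  shows "((\<lambda>s. \<pi> (mexp (s *\<^sub>R X)) y) has_vector_derivative dpi X y) (at 0) \<and> dpi X y \<in> YY"
proof -
  have "\<exists>z\<in>YY. ((\<lambda>s. \<pi> (mexp (s *\<^sub>R X)) y) has_vector_derivative z) (at 0)" (is "?P y")
    using y
  proof (rule YY_induct)
    show "subspace {y. ?P y}"
    proof (rule subspaceI)
      show "0 \<in> {y. ?P y}" using subspace_0[OF YY_subspace] by (auto simp: pi_simps E_G[OF X] intro!: bexI[of _ 0])
    next
      fix y z assume "y \<in> {y. ?P y}" "z \<in> {y. ?P y}"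
      then obtain y' z' where "y' \<in> YY" "z' \<in> YY" "((\<lambda>s. \<pi> (mexp (s *\<^sub>R X)) y) has_vector_derivative y') (at 0)"
        "((\<lambda>s. \<pi> (mexp (s *\<^sub>R X)) z) has_vector_derivative z') (at 0)" by blast
      then show "y + z \<in> {y. ?P y}"
        using subspace_add[OF YY_subspace] has_vector_derivative_add by (fastforce simp: pi_simps E_G[OF X])
    next
      fix c y assume "y \<in> {y. ?P y}"
      then obtain y' where y': "y' \<in> YY" "((\<lambda>s. \<pi> (mexp (s *\<^sub>R X)) y) has_vector_derivative y') (at 0)" by blast
      from bounded_linear.has_vector_derivative[OF bounded_linear_scaleR_right this(2), of c]
      show "c *\<^sub>R y \<in> {y. ?P y}" using subspace_scale[OF YY_subspace y'(1), of c] by (auto simp: pi_simps E_G[OF X])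
    qed
  next
    fix \<phi> v assume \<phi>: "\<phi> \<in> Phi q R"
    obtain \<phi>' where d: "\<And>x. (\<phi> has_derivative \<phi>' x) (at x)" "\<And>A :: complex^'m^'m \<Rightarrow> complex^'m^'m. bounded_linear A \<Longrightarrow> (\<lambda>x. \<phi>' x (A x)) \<in> Phi q R"
      by (rule Phi_derivative[OF q_polynomial \<phi>]) blast
    note d2 = d(2)[OF matmul.bounded_linear_right[of X]]
    show "?P (J \<phi> v)"
      using J_derivative[OF X \<phi> d(1) d2, of v] subspace_neg[OF YY_subspace J_in[OF d2, of v]] by blast
  qed
  then show ?thesis using dpi_eqI by auto
qed

lemmas dpi_deriv = dpi_deriv_in[THEN conjunct1]
lemmas dpi_in = dpi_deriv_in[THEN conjunct2]

lemma dpi_operator: assumes X: "X \<in> E" shows "operator_on YY (dpi X)"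
  unfolding operator_on_def complex_linear_on_def
proof (intro conjI ballI allI)
  fix x y assume "x \<in> YY" "y \<in> YY"
  from has_vector_derivative_add[OF dpi_deriv[OF X this(1)] dpi_deriv[OF X this(2)]]
  show "dpi X (x + y) = dpi X x + dpi X y" by (intro dpi_eqI) (simp add: pi_simps E_G[OF X])
next
  fix a x assume "x \<in> YY"
  from bounded_linear.has_vector_derivative[OF scaleC.bounded_linear_right dpi_deriv[OF X this], of a]
  show "dpi X (scaleC a x) = scaleC a (dpi X x)" by (intro dpi_eqI) (simp add: pi_simps E_G[OF X])
qed (rule dpi_in[OF X])

lemma dpi_real_linear:
  assumes X: "X \<in> E"
  shows "x \<in> YY \<Longrightarrow> y \<in> YY \<Longrightarrow> dpi X (x + y) = dpi X x + dpi X y" "x \<in> YY \<Longrightarrow> dpi X (c *\<^sub>R x) = c *\<^sub>R dpi X x"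
    "dpi X 0 = 0"
proof -
  note op = dpi_operator[OF X, unfolded operator_on_def complex_linear_on_def]
  show "x \<in> YY \<Longrightarrow> y \<in> YY \<Longrightarrow> dpi X (x + y) = dpi X x + dpi X y" using op by blast
  show c: "x \<in> YY \<Longrightarrow> dpi X (c *\<^sub>R x) = c *\<^sub>R dpi X x" for c x
    using op by (metis scaleC_of_real)
  show "dpi X 0 = 0" using c[of 0 0] subspace_0[OF YY_subspace] by simp
qed

text \<open>Linearity in the Lie algebra element is read off from the linearity of the derivative of
  a test function. The combination \<open>Z\<close> is required to lie in \<open>E\<close> because
  \<open>E\<close> constrains determinants along the whole one-parameter group of
  \<open>Z\<close>.\<close>

lemma dpi_combination:
  assumes E: "X \<in> E" "Y \<in> E" "Z \<in> E" and Z: "Z = r *\<^sub>R X + t *\<^sub>R Y" and y: "y \<in> YY"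
  shows "dpi Z y = r *\<^sub>R dpi X y + t *\<^sub>R dpi Y y"
proof -
  have "y \<in> YY \<and> dpi Z y = r *\<^sub>R dpi X y + t *\<^sub>R dpi Y y"
    using y
  proof (rule YY_induct)
    show "subspace {y. y \<in> YY \<and> dpi Z y = r *\<^sub>R dpi X y + t *\<^sub>R dpi Y y}"
      by (rule subspaceI) (auto simp: dpi_real_linear[OF E(1)] dpi_real_linear[OF E(2)] dpi_real_linear[OF E(3)]
          subspace_0[OF YY_subspace] subspace_add[OF YY_subspace] subspace_scale[OF YY_subspace]
          scaleR_add_right mult.commute)
  next
    fix \<phi> v assume \<phi>: "\<phi> \<in> Phi q R"
    obtain \<phi>' where d: "\<And>x. (\<phi> has_derivative \<phi>' x) (at x)" "\<And>A :: complex^'m^'m \<Rightarrow> complex^'m^'m. bounded_linear A \<Longrightarrow> (\<lambda>x. \<phi>' x (A x)) \<in> Phi q R"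
      by (rule Phi_derivative[OF q_polynomial \<phi>]) blast
    note d2 = d(2)[OF matmul.bounded_linear_right]
    have sc: "(\<lambda>x. c * f x) \<in> Phi q R" if "f \<in> Phi q R" for c f
      using that
    proof induction
      case (base p k)
      have "(\<lambda>x. (c * p x) * eta k (R - q x)) \<in> Phi q R"
        by (intro Phi.base real_polynomial_function.intros(4)[OF real_polynomial_function.intros(2) base])
      then show ?case by (simp add: mult.assoc)
    next
      case (add f g) from Phi.add[OF add.IH] show ?case by (simp add: distrib_left)
    qed
    have "\<phi>' x (Z ** x) = r * \<phi>' x (X ** x) + t * \<phi>' x (Y ** x)" for x
      using has_derivative_bounded_linear[OF d(1)[of x], THEN bounded_linear.linear]
      by (simp add: Z matmul.add_left matmul.scaleR_left linear_add linear_scale)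
    then have "J (\<lambda>x. \<phi>' x (Z ** x)) v = r *\<^sub>R J (\<lambda>x. \<phi>' x (X ** x)) v + t *\<^sub>R J (\<lambda>x. \<phi>' x (Y ** x)) v"
      by (simp add: J_add J_scale sc d2)
    then show "J \<phi> v \<in> YY \<and> dpi Z (J \<phi> v) = r *\<^sub>R dpi X (J \<phi> v) + t *\<^sub>R dpi Y (J \<phi> v)"
      by (simp add: dpi_J[OF _ \<phi> d(1) d2] E J_in[OF \<phi>])
  qed
  then show ?thesis by blast
qed

lemma E_conj:
  assumes g: "g \<in> G" "g' \<in> G" "g ** g' = mat 1" "g' ** g = mat 1" and Y: "Y \<in> E"
  shows "g ** Y ** g' \<in> E" "mexp (s *\<^sub>R (g ** Y ** g')) = g ** mexp (s *\<^sub>R Y) ** g'"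
proof -
  show e: "mexp (s *\<^sub>R (g ** Y ** g')) = g ** mexp (s *\<^sub>R Y) ** g'" for s
    using mexp_conj[OF g(3,4), of "s *\<^sub>R Y"] by (simp add: matmul.scaleR_left matmul.scaleR_right)
  have "det g * det g' = 1" using arg_cong[OF g(3), of det] by (simp add: det_mul)
  then have "cmod (det g) * cmod (det g') = 1" by (metis norm_mult norm_one)
  then have "cmod (det (g ** mexp (s *\<^sub>R Y) ** g')) = 1" for s
    using Y by (simp add: det_mul norm_mult E_def)
  then show "g ** Y ** g' \<in> E" using Y g G_mult by (auto simp: E_def lie_algebra_def e)
qed

text \<open>Skew-symmetry (\<open>g = 1\<close>), the commutation relations (\<open>g = exp (s X)\<close>, differentiated at \<open>s = 0\<close>) and
  the relations for \<open>g = exp (t B\<^sub>3)\<close> are all instances of this identity.\<close>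

lemma dpi_weak:
  assumes g: "g \<in> G" "g' \<in> G" "g ** g' = mat 1" "g' ** g = mat 1" and Y: "Y \<in> E" and yw: "y \<in> YY" "w \<in> YY"
  shows "cinner (\<pi> g (dpi Y y)) w = - cinner (\<pi> g y) (dpi (g ** Y ** g') w)"
proof -
  define Z where "Z = g ** Y ** g'"
  have Z: "Z \<in> E" unfolding Z_def by (rule E_conj(1)[OF g Y])
  have "((\<lambda>s. cinner (\<pi> g (\<pi> (mexp (s *\<^sub>R Y)) y)) w) has_vector_derivative cinner (\<pi> g (dpi Y y)) w) (at 0)"
    by (rule bounded_linear.has_vector_derivative[OF cinner.bounded_linear_left
        bounded_linear.has_vector_derivative[OF unitaryD(10)[OF pi_unitary[OF g(1)]] dpi_deriv[OF Y yw(1)]]])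
  moreover have "cinner (\<pi> g (\<pi> (mexp (s *\<^sub>R Y)) y)) w = cinner (\<pi> g y) (\<pi> (mexp ((- s) *\<^sub>R Z)) w)" for s
  proof -
    have "\<pi> g (\<pi> (mexp (s *\<^sub>R Y)) y) = \<pi> (mexp (s *\<^sub>R Z)) (\<pi> g y)"
      using E_conj(2)[OF g Y, of s] by (simp add: Z_def E_G Y g G_mult matmul_assoc flip: pi_mult)
    then show ?thesis using mexp_minus[of "s *\<^sub>R Z"]
      by (simp add: pi_adjoint(1)[OF E_G[OF Z, of "- s", simplified] E_G[OF Z, of s]])
  qed
  moreover have "((\<lambda>s. cinner (\<pi> g y) (\<pi> (mexp ((- s) *\<^sub>R Z)) w)) has_vector_derivative cinner (\<pi> g y) (- dpi Z w)) (at 0)"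
  proof (rule bounded_linear.has_vector_derivative[OF cinner.bounded_linear_right])
    have "(uminus has_vector_derivative (- 1 :: real)) (at 0)"
      using has_vector_derivative_minus[OF has_vector_derivative_id] by simp
    from vector_diff_chain_at[OF this, of "\<lambda>s. \<pi> (mexp (s *\<^sub>R Z)) w" "dpi Z w"] dpi_deriv[OF Z yw(2)]
    show "((\<lambda>s. \<pi> (mexp ((- s) *\<^sub>R Z)) w) has_vector_derivative - dpi Z w) (at 0)" by (simp add: o_def)
  qed
  ultimately have "cinner (\<pi> g (dpi Y y)) w = cinner (\<pi> g y) (- dpi Z w)"
    by (simp only: vector_derivative_unique_at)
  then show ?thesis by (simp add: Z_def cinner.minus_right)
qed

lemma dpi_skew: "X \<in> E \<Longrightarrow> y \<in> YY \<Longrightarrow> w \<in> YY \<Longrightarrow> cinner (dpi X y) w = - cinner y (dpi X w)"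
  using dpi_weak[OF G_one G_one, of X y w] by (simp add: pi_one)

text \<open>The difference of the two vectors lies in \<open>YY\<close> and can be tested against
  itself; identities on \<open>YY\<close> may therefore be proved weakly, against \<open>YY\<close>
  alone.\<close>

lemma YY_separates:
  assumes "u \<in> YY" "u' \<in> YY" "\<And>w. w \<in> YY \<Longrightarrow> cinner u w = cinner u' w"
  shows "u = u'"
proof -
  have "cinner (u - u') (u - u') = 0"
    using assms(3)[of "u - u'"] subspace_diff[OF YY_subspace assms(1,2)] by (simp add: cinner.diff_left)
  then show ?thesis by (simp add: cinner_eq_zero_iff)
qed

lemma dpi_commutator:
  assumes E: "X \<in> E" "Y \<in> E" "Z \<in> E"
    and Ad: "\<And>s. mexp (s *\<^sub>R X) ** Y ** mexp (- s *\<^sub>R X) = c s *\<^sub>R Y + d s *\<^sub>R Z"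
    and c: "c 0 = 1" "(c has_real_derivative 0) (at 0)" and d: "d 0 = 0" "(d has_real_derivative r) (at 0)"
    and y: "y \<in> YY"
  shows "dpi X (dpi Y y) = dpi Y (dpi X y) + r *\<^sub>R dpi Z y"
proof (rule YY_separates)
  show "dpi X (dpi Y y) \<in> YY" by (intro dpi_in E y)
  show "dpi Y (dpi X y) + r *\<^sub>R dpi Z y \<in> YY"
    by (intro dpi_in E y subspace_add[OF YY_subspace] subspace_scale[OF YY_subspace])
  fix w assume w: "w \<in> YY"
  have "cinner (\<pi> (mexp (s *\<^sub>R X)) (dpi Y y)) w
      = - cinner (\<pi> (mexp (s *\<^sub>R X)) y) (c s *\<^sub>R dpi Y w + d s *\<^sub>R dpi Z w)" for s
  proof -
    note g = E_G[OF E(1), of s] E_G[OF E(1), of "- s"] mexp_minus[of "s *\<^sub>R X", folded scaleR_minus_left]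
    have "dpi (c s *\<^sub>R Y + d s *\<^sub>R Z) w = c s *\<^sub>R dpi Y w + d s *\<^sub>R dpi Z w"
      by (rule dpi_combination[OF E(2,3) _ refl w]) (use E_conj(1)[OF g E(2)] in \<open>simp only: Ad\<close>)
    then show ?thesis using dpi_weak[OF g E(2) y w] by (simp only: Ad)
  qed
  moreover have "((\<lambda>s. cinner (\<pi> (mexp (s *\<^sub>R X)) (dpi Y y)) w) has_vector_derivative cinner (dpi X (dpi Y y)) w) (at 0)"
    by (rule bounded_linear.has_vector_derivative[OF cinner.bounded_linear_left dpi_deriv[OF E(1) dpi_in[OF E(2) y]]])
  moreover have "((\<lambda>s. - cinner (\<pi> (mexp (s *\<^sub>R X)) y) (c s *\<^sub>R dpi Y w + d s *\<^sub>R dpi Z w)) has_vector_derivative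
      - (cinner y (r *\<^sub>R dpi Z w) + cinner (dpi X y) (dpi Y w))) (at 0)"
  proof -
    have "((\<lambda>s. c s *\<^sub>R dpi Y w + d s *\<^sub>R dpi Z w) has_vector_derivative r *\<^sub>R dpi Z w) (at 0)"
      using has_vector_derivative_add[OF has_vector_derivative_scaleR[OF c(2) has_vector_derivative_const, of "dpi Y w"]
          has_vector_derivative_scaleR[OF d(2) has_vector_derivative_const, of "dpi Z w"]] by simp
    from has_vector_derivative_minus[OF cinner.has_vector_derivative[OF dpi_deriv[OF E(1) y] this]]
    show ?thesis by (simp add: c d pi_one)
  qed
  ultimately have "cinner (dpi X (dpi Y y)) w = - (cinner y (r *\<^sub>R dpi Z w) + cinner (dpi X y) (dpi Y w))"
    by (simp only: vector_derivative_unique_at)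
  also have "\<dots> = cinner (dpi Y (dpi X y) + r *\<^sub>R dpi Z y) w"
    using dpi_skew[OF E(2) dpi_in[OF E(1) y] w] dpi_skew[OF E(3) y w]
    by (simp add: cinner.add_left cinner.scaleR_left cinner.scaleR_right)
  finally show "cinner (dpi X (dpi Y y)) w = cinner (dpi Y (dpi X y) + r *\<^sub>R dpi Z y) w" .
qed

lemma dpi_commute:
  assumes E: "X \<in> E" "Y \<in> E" and XY: "X ** Y = Y ** X" and y: "y \<in> YY"
  shows "dpi X (dpi Y y) = dpi Y (dpi X y)"
proof -
  have "mexp (s *\<^sub>R X) ** Y ** mexp (- s *\<^sub>R X) = 1 *\<^sub>R Y + 0 *\<^sub>R Y" for s
    by (rule Ad_eqI[of "\<lambda>s. 1 *\<^sub>R Y + 0 *\<^sub>R Y"]) (simp_all add: XY)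
  from dpi_commutator[OF E(1,2,2) this _ _ _ _ y, of 0] show ?thesis by simp
qed

lemma dpi_rotation:
  assumes E: "X \<in> E" "Y \<in> E" "Z \<in> E" and XY: "X ** Y - Y ** X = r *\<^sub>R Z" "X ** Z - Z ** X = (- r) *\<^sub>R Y" "r * r = 1"
    and y: "y \<in> YY"
  shows "dpi X (dpi Y y) = dpi Y (dpi X y) + r *\<^sub>R dpi Z y"
proof -
  have "X ** (r *\<^sub>R Z) - (r *\<^sub>R Z) ** X = r *\<^sub>R (X ** Z - Z ** X)"
    by (simp add: matmul.scaleR_left matmul.scaleR_right scaleR_diff_right)
  then have "X ** (r *\<^sub>R Z) - (r *\<^sub>R Z) ** X = - Y" using XY by simp
  from Ad_rotation[OF XY(1) this]
  have Ad: "mexp (s *\<^sub>R X) ** Y ** mexp (- s *\<^sub>R X) = cos s *\<^sub>R Y + (r * sin s) *\<^sub>R Z" for s by (simp add: mult.commute)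
  show ?thesis
    by (rule dpi_commutator[OF E Ad _ _ _ _ y]) (auto intro!: derivative_eq_intros)
qed

lemma dpi_boost:
  assumes E: "X \<in> E" "Y \<in> E" "Z \<in> E" and XY: "X ** Y - Y ** X = r *\<^sub>R Z" "X ** Z - Z ** X = r *\<^sub>R Y" "r * r = 1"
    and y: "y \<in> YY"
  shows "dpi X (dpi Y y) = dpi Y (dpi X y) + r *\<^sub>R dpi Z y"
proof -
  have "X ** (r *\<^sub>R Z) - (r *\<^sub>R Z) ** X = r *\<^sub>R (X ** Z - Z ** X)"
    by (simp add: matmul.scaleR_left matmul.scaleR_right scaleR_diff_right)
  then have "X ** (r *\<^sub>R Z) - (r *\<^sub>R Z) ** X = Y" using XY by simp
  from Ad_boost[OF XY(1) this]
  have Ad: "mexp (s *\<^sub>R X) ** Y ** mexp (- s *\<^sub>R X) = cosh s *\<^sub>R Y + (r * sinh s) *\<^sub>R Z" for s by (simp add: mult.commute)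
  show ?thesis
    by (rule dpi_commutator[OF E Ad _ _ _ _ y]) (auto intro!: derivative_eq_intros)
qed

sublocale M: su2_module YY "dpi L1" "dpi L2" "dpi L3"
proof
  fix x assume x: "x \<in> YY"
  show "dpi L2 (dpi L1 x) = dpi L1 (dpi L2 x) - dpi L3 x"
    using dpi_rotation[OF basis_E(2,1,3), of "- 1" x] x by (simp add: LL LL_opp)
  show "dpi L3 (dpi L1 x) = dpi L1 (dpi L3 x) + dpi L2 x"
    using dpi_rotation[OF basis_E(3,1,2), of 1 x] x by (simp add: LL LL_opp)
  show "dpi L3 (dpi L2 x) = dpi L2 (dpi L3 x) - dpi L1 x"
    using dpi_rotation[OF basis_E(3,2,1), of "- 1" x] x by (simp add: LL LL_opp)
qed (use YY_complex dpi_operator dpi_skew basis_E in blast)+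

lemma dpi_BL:
  assumes x: "x \<in> YY"
  shows "dpi B1 (dpi L1 x) = dpi L1 (dpi B1 x)" "dpi B1 (dpi L2 x) = dpi L2 (dpi B1 x) + dpi B3 x"
    "dpi B1 (dpi L3 x) = dpi L3 (dpi B1 x) - dpi B2 x" "dpi B2 (dpi L1 x) = dpi L1 (dpi B2 x) - dpi B3 x"
    "dpi B2 (dpi L2 x) = dpi L2 (dpi B2 x)" "dpi B2 (dpi L3 x) = dpi L3 (dpi B2 x) + dpi B1 x"
    "dpi B3 (dpi L1 x) = dpi L1 (dpi B3 x) + dpi B2 x" "dpi B3 (dpi L2 x) = dpi L2 (dpi B3 x) - dpi B1 x"
    "dpi B3 (dpi L3 x) = dpi L3 (dpi B3 x)"
    "dpi B2 (dpi B1 x) = dpi B1 (dpi B2 x) + dpi L3 x"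
    "dpi B3 (dpi B1 x) = dpi B1 (dpi B3 x) - dpi L2 x" "dpi B3 (dpi B2 x) = dpi B2 (dpi B3 x) + dpi L1 x"
  using dpi_commute[OF basis_E(1,4) LB_diag(1) x] dpi_commute[OF basis_E(2,5) LB_diag(2) x] dpi_commute[OF basis_E(3,6) LB_diag(3) x]
    dpi_boost[OF basis_E(4,2,6), of 1 x] dpi_boost[OF basis_E(4,3,5), of "- 1" x]
    dpi_boost[OF basis_E(5,1,6), of "- 1" x] dpi_boost[OF basis_E(5,3,4), of 1 x]
    dpi_boost[OF basis_E(6,1,5), of 1 x] dpi_boost[OF basis_E(6,2,4), of "- 1" x]
    dpi_boost[OF basis_E(5,4,3), of 1 x] dpi_boost[OF basis_E(6,4,2), of "- 1" x] dpi_boost[OF basis_E(6,5,1), of 1 x]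
  by (simp_all add: x brackets_opp BB)

lemma A_deriv:
  assumes X: "X \<in> E" and x: "x \<in> YY"
  shows "((\<lambda>t. \<pi> (mexp (t *\<^sub>R X)) x) has_vector_derivative \<pi> (mexp (t *\<^sub>R X)) (dpi X x)) (at t)"
proof -
  have "((\<lambda>s. \<pi> (mexp (t *\<^sub>R X)) (\<pi> (mexp (s *\<^sub>R X)) x)) has_vector_derivative \<pi> (mexp (t *\<^sub>R X)) (dpi X x)) (at (t + - t))"
    using bounded_linear.has_vector_derivative[OF unitaryD(10)[OF pi_unitary[OF E_G[OF X]]] dpi_deriv[OF X x]] by simp
  from has_vector_derivative_translate(2)[OF this]
  have "((\<lambda>r. \<pi> (mexp (t *\<^sub>R X)) (\<pi> (mexp ((r + - t) *\<^sub>R X)) x)) has_vector_derivative \<pi> (mexp (t *\<^sub>R X)) (dpi X x)) (at t)" .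
  moreover have "\<pi> (mexp (t *\<^sub>R X)) (\<pi> (mexp ((r + - t) *\<^sub>R X)) x) = \<pi> (mexp (r *\<^sub>R X)) x" for r
    using mexp_add_scaleR[of t "r + - t" X] by (simp add: E_G[OF X] flip: pi_mult)
  ultimately show ?thesis by simp
qed

lemma A_L:
  assumes x: "x \<in> YY" and y: "y \<in> YY"
  shows "- cinner (\<pi> (mexp (t *\<^sub>R B3)) x) (dpi L1 y) = cinner (\<pi> (mexp (t *\<^sub>R B3)) (cosh t *\<^sub>R dpi L1 x - sinh t *\<^sub>R dpi B2 x)) y"
    "- cinner (\<pi> (mexp (t *\<^sub>R B3)) x) (dpi L2 y) = cinner (\<pi> (mexp (t *\<^sub>R B3)) (cosh t *\<^sub>R dpi L2 x + sinh t *\<^sub>R dpi B1 x)) y"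
proof -
  let ?g = "mexp (t *\<^sub>R B3)" and ?g' = "mexp ((- t) *\<^sub>R B3)"
  note g = E_G[OF basis_E(6), of t] E_G[OF basis_E(6), of "- t"] mexp_minus[of "t *\<^sub>R B3", folded scaleR_minus_left]
  have weak: "- cinner (\<pi> ?g x) (dpi Z y) = cinner (\<pi> ?g (r *\<^sub>R dpi Z x + u *\<^sub>R dpi W x)) y"
    if "?g' ** Z ** ?g = r *\<^sub>R Z + u *\<^sub>R W" "Z \<in> E" "W \<in> E" for Z W r u
  proof -
    have E: "r *\<^sub>R Z + u *\<^sub>R W \<in> E" using E_conj(1)[OF g(2,1,4,3) that(2)] by (simp only: that(1))
    have "?g ** (?g' ** Z ** ?g) ** ?g' = (?g ** ?g') ** Z ** (?g ** ?g')" by (simp only: matrix_mul_assoc)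
    then have "?g ** (r *\<^sub>R Z + u *\<^sub>R W) ** ?g' = Z" by (simp only: that(1) g(3) matrix_mul_lid matrix_mul_rid)
    with dpi_weak[OF g E x y] dpi_combination[OF that(2,3) E refl x] show ?thesis by simp
  qed
  show "- cinner (\<pi> ?g x) (dpi L1 y) = cinner (\<pi> ?g (cosh t *\<^sub>R dpi L1 x - sinh t *\<^sub>R dpi B2 x)) y"
    using weak[OF _ basis_E(1,5), of "cosh t" "- sinh t"] Ad_boost[OF brackets_opp(4,8), of "- t"] by simp
  have "B3 ** (- B1) - (- B1) ** B3 = L2" using brackets_opp(9) by (simp add: matmul.minus_left matmul.minus_right)
  from Ad_boost[OF brackets_opp(2) this, of "- t"]
  show "- cinner (\<pi> ?g x) (dpi L2 y) = cinner (\<pi> ?g (cosh t *\<^sub>R dpi L2 x + sinh t *\<^sub>R dpi B1 x)) y"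
    using weak[OF _ basis_E(2,4), of "cosh t" "sinh t"] by simp
qed

text \<open>Finiteness of the highest weight spaces is the one input left open here; admissibility
  supplies it in \<open>hw_findim\<close>.\<close>

lemma lorentz_module:
  assumes "\<And>d. \<exists>N. findim N (M.hw d)"
  shows "lorentz_module YY (dpi L1) (dpi L2) (dpi L3) (dpi B1) (dpi B2) (dpi B3) (\<lambda>t. \<pi> (mexp (t *\<^sub>R B3)))"
proof
  show "\<And>d. \<exists>N. findim N (M.hw d)" by (rule assms)
  show "\<And>t. operator_on UNIV (\<pi> (mexp (t *\<^sub>R B3)))"
    using pi_unitary[OF E_G[OF basis_E(6)]] by (simp add: operator_on_def unitary_def)
  show "\<pi> (mexp (0 *\<^sub>R B3)) x = x" for x by (simp add: pi_one)
  show "((\<lambda>t. cinner (\<pi> (mexp (t *\<^sub>R B3)) x) y) has_vector_derivative cinner (\<pi> (mexp (t *\<^sub>R B3)) (dpi B3 x)) y) (at t)"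
    if "x \<in> YY" for x y t
    by (rule bounded_linear.has_vector_derivative[OF cinner.bounded_linear_left A_deriv[OF basis_E(6) that]])
qed (rule dpi_operator dpi_skew dpi_BL A_L basis_E | assumption)+

end

section \<open>Highest weight vectors among the smoothed vectors\<close>

context rep begin

text \<open>Translates of a null neighbourhood of the identity are null and cover \<open>G\<close>;
  by the Lindelof property countably many of them do, so \<open>G\<close> itself would be
  null.\<close>

lemma neighbourhood_not_null:
  assumes U: "openin (top_of_set G) U" "mat 1 \<in> U"
  shows "emeasure \<mu> U \<noteq> 0"
proof
  assume null: "emeasure \<mu> U = 0"
  have meas: "V \<in> sets \<mu>" if V: "openin (top_of_set G) V" for V
  proof -
    obtain O' where O': "open O'" "V = G \<inter> O'" using V unfolding openin_open by blast
    show ?thesis unfolding sets_mu sets_restrict_space by (rule image_eqI[of _ _ O'], rule O'(2), rule borel_open[OF O'(1)])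
  qed
  define W where "W a = {x \<in> G. matrix_inv a ** x \<in> U}" for a
  have inv: "matrix_inv a \<in> G" "matrix_inv a ** a = mat 1" if "a \<in> G" for a
    using matrix_lie_groupD(4)[OF G that] someI_ex[OF matrix_lie_groupD(3)[OF G that, unfolded invertible_def]]
    by (simp_all add: matrix_inv_def)
  have W: "openin (top_of_set G) (W a)" "emeasure \<mu> (W a) = 0" "a \<in> W a" if a: "a \<in> G" for a
  proof -
    have W_eq: "W a = G \<inter> (**) (matrix_inv a) -` U" by (auto simp: W_def)
    have "continuous_on G ((**) (matrix_inv a))" by (intro matmul.continuous_on continuous_intros)
    then show "openin (top_of_set G) (W a)" unfolding W_eq
      by (rule continuous_openin_preimage[OF _ _ U(1)]) (use G_mult inv(1)[OF a] in auto)
    have "emeasure (distr \<mu> \<mu> ((**) (matrix_inv a))) U = emeasure \<mu> (W a)"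
      by (subst emeasure_distr[OF translate_measurable[OF inv(1)[OF a]] meas[OF U(1)]]) (simp add: W_eq space_mu Int_commute)
    then show "emeasure \<mu> (W a) = 0" using haar inv(1)[OF a] null by (simp add: haar_measure_def)
    show "a \<in> W a" using a inv(2)[OF a] U(2) by (simp add: W_def)
  qed
  obtain F where F: "F \<subseteq> W ` G" "countable F" "\<Union>F = \<Union>(W ` G)"
    using Lindelof_openin[of "W ` G" G] W(1) by auto
  have "\<Union>(W ` G) = G" using W(3) by (auto simp: W_def)
  moreover have "(\<Union>V\<in>F. V) \<in> null_sets \<mu>"
    by (rule null_sets_UN'[OF F(2)]) (use F(1) W(1,2) meas in \<open>auto simp: null_sets_def\<close>)
  ultimately have "emeasure \<mu> G = 0" using F(3) by (simp add: null_sets_def)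
  then show False using haar by (simp add: haar_measure_def)
qed

text \<open>Rotations do not differentiate a function of \<open>q\<close>, so with the cutoff fixed
  as \<open>eta 0\<close> only the polynomial factor changes under \<open>so(3)\<close>.\<close>

definition bump where "bump p x = p x * eta 0 (R - q x)"

lemma bump_Phi: "real_polynomial_function p \<Longrightarrow> bump p \<in> Phi q R"
  unfolding bump_def by (rule Phi.base)

lemma coeff_continuous: "continuous_on S (\<lambda>x. \<pi> x v \<bullet> w)" if "S \<subseteq> G"
  by (intro continuous_intros continuous_on_subset[OF pi_continuous that])

text \<open>Suppose every polynomial gave 0. Let \<open>h\<close> be the diagonal coefficient of
  \<open>v\<close>. With weight \<open>W\<close>, \<open>h\<close> would be orthogonal to all
  polynomials, hence by Weierstrass approximation on \<open>C0\<close> to itself; but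
  \<open>h\<close> is positive near the identity.\<close>

lemma exists_smoothed_nonzero:
  assumes v: "(v :: 'h) \<noteq> 0"
  shows "\<exists>p. real_polynomial_function p \<and> J (bump p) v \<noteq> 0"
proof (rule ccontr)
  assume "\<not> ?thesis"
  then have zero: "J (bump p) v = 0" if "real_polynomial_function p" for p using that by blast
  define W where "W = psi (bump (\<lambda>x. 1))"
  define h where "h x = \<pi> x v \<bullet> v" for x
  have one: "real_polynomial_function (\<lambda>x::complex^'m^'m. 1)" by (rule real_polynomial_function.intros(2))
  have W0: "W x \<ge> 0" for x by (simp add: W_def psi_def bump_def iota_def eta_nonneg)
  have Wi: "integrable \<mu> W" unfolding W_def by (rule psi_integrable[OF bump_Phi[OF one]])
  have hb: "\<bar>h x\<bar> \<le> (norm v)\<^sup>2" if "x \<in> G" for x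
    using Cauchy_Schwarz_ineq2[of "\<pi> x v" v] that by (simp add: h_def pi_simps power2_eq_square)
  have hm: "h \<in> borel_measurable \<mu>" unfolding h_def by (rule coeff_measurable)
  have Whi: "integrable \<mu> (\<lambda>x. W x * h x)" unfolding h_def by (rule coeff_integrable[OF Wi])
  have Wh2i: "integrable \<mu> (\<lambda>x. W x * (h x)\<^sup>2)"
  proof (rule Bochner_Integration.integrable_bound)
    show "integrable \<mu> (\<lambda>x. W x * ((norm v)\<^sup>2)\<^sup>2)" using Wi by simp
    show "(\<lambda>x. W x * (h x)\<^sup>2) \<in> borel_measurable \<mu>" using Wi hm by auto
    show "AE x in \<mu>. norm (W x * (h x)\<^sup>2) \<le> norm (W x * ((norm v)\<^sup>2)\<^sup>2)"
    proof (intro AE_I2)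
      fix x assume "x \<in> space \<mu>"
      then have "(h x)\<^sup>2 \<le> ((norm v)\<^sup>2)\<^sup>2" using hb[of x] by (intro power2_le_iff_abs_le[THEN iffD2]) (auto simp: space_mu)
      then show "norm (W x * (h x)\<^sup>2) \<le> norm (W x * ((norm v)\<^sup>2)\<^sup>2)" using W0[of x] by (simp add: abs_mult mult_left_mono)
    qed
  qed
  define K where "K = (LINT x|\<mu>. W x * \<bar>h x\<bar>)"
  have Wabs: "integrable \<mu> (\<lambda>x. W x * \<bar>h x\<bar>)"
    using integrable_abs[OF Whi] by (rule back_subst[where P="integrable \<mu>"]) (auto simp: abs_mult W0)
  have small: "(LINT x|\<mu>. W x * (h x)\<^sup>2) \<le> e * K" if "e > 0" for e
  proof -
    obtain p where p: "real_polynomial_function p" "\<And>x. x \<in> C0 \<Longrightarrow> \<bar>h x - p x\<bar> < e"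
      using Stone_Weierstrass_real_polynomial_function[OF compact_C0 coeff_continuous[OF C0_sub] \<open>e > 0\<close>, of v v] by (auto simp: h_def)
    have eq: "psi (bump p) x = W x * p x" for x by (simp add: W_def psi_def bump_def)
    have pi: "integrable \<mu> (\<lambda>x. psi (bump p) x * h x)"
      unfolding h_def by (rule coeff_integrable[OF psi_integrable[OF bump_Phi[OF p(1)]]])
    have "(LINT x|\<mu>. psi (bump p) x * h x) = 0"
      using I_inner[OF psi_integrable[OF bump_Phi[OF p(1)]], of v v] zero[OF p(1)] by (simp add: J_def h_def)
    then have "(LINT x|\<mu>. W x * (h x)\<^sup>2) = (LINT x|\<mu>. W x * (h x)\<^sup>2 - psi (bump p) x * h x)"
      using Wh2i pi by simp
    also have "\<dots> \<le> (LINT x|\<mu>. e * (W x * \<bar>h x\<bar>))"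
    proof (rule integral_mono)
      show "integrable \<mu> (\<lambda>x. W x * (h x)\<^sup>2 - psi (bump p) x * h x)" using Wh2i pi by simp
      show "integrable \<mu> (\<lambda>x. e * (W x * \<bar>h x\<bar>))" using Wabs by simp
      fix x assume "x \<in> space \<mu>"
      then have x: "x \<in> G" by (simp add: space_mu)
      show "W x * (h x)\<^sup>2 - psi (bump p) x * h x \<le> e * (W x * \<bar>h x\<bar>)"
      proof (cases "x \<in> C0")
        case True
        have "(h x - p x) * h x \<le> \<bar>h x - p x\<bar> * \<bar>h x\<bar>" using abs_ge_self[of "(h x - p x) * h x"] by (simp only: abs_mult)
        also have "\<dots> \<le> e * \<bar>h x\<bar>" using p(2)[OF True] by (intro mult_right_mono) auto
        finally have "W x * ((h x - p x) * h x) \<le> W x * (e * \<bar>h x\<bar>)" by (rule mult_left_mono[OF _ W0])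
        then show ?thesis by (simp add: eq algebra_simps power2_eq_square)
      next
        case False
        then have "W x = 0" unfolding W_def by (rule psi_support[OF bump_Phi[OF one] x])
        then show ?thesis by (simp add: eq)
      qed
    qed
    finally show ?thesis by (simp add: K_def)
  qed
  have "(LINT x|\<mu>. W x * (h x)\<^sup>2) \<le> 0"
  proof (rule ccontr)
    assume "\<not> (LINT x|\<mu>. W x * (h x)\<^sup>2) \<le> 0"
    then have pos: "(LINT x|\<mu>. W x * (h x)\<^sup>2) > 0" by simp
    have "K \<ge> 0" unfolding K_def by (intro integral_nonneg_AE AE_I2 mult_nonneg_nonneg W0) simp
    then have "(LINT x|\<mu>. W x * (h x)\<^sup>2) / (2 * (K + 1)) * K < (LINT x|\<mu>. W x * (h x)\<^sup>2)"
      using pos by (simp add: divide_simps)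
    then show False using small[of "(LINT x|\<mu>. W x * (h x)\<^sup>2) / (2 * (K + 1))"] pos \<open>K \<ge> 0\<close> by simp
  qed
  then have "(LINT x|\<mu>. W x * (h x)\<^sup>2) = 0"
    by (intro antisym integral_nonneg_AE AE_I2 mult_nonneg_nonneg W0) simp_all
  then have ae: "AE x in \<mu>. W x * (h x)\<^sup>2 = 0"
    using integral_nonneg_eq_0_iff_AE[OF Wh2i] W0 by simp
  define U where "U = {x \<in> G. q x < R} \<inter> {x \<in> G. 1/2 < cmod (det x)} \<inter> {x \<in> G. 0 < (h x)\<^sup>2}"
  have o: "openin (top_of_set G) {x \<in> G. f x < g x}" if "continuous_on G f" "continuous_on G g" for f g :: "_ \<Rightarrow> real"
  proof -
    have "{x \<in> G. f x < g x} = G \<inter> (\<lambda>x. g x - f x) -` {0<..}" by auto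
    then show ?thesis using continuous_openin_preimage_gen[OF continuous_on_diff[OF that(2,1)], of "{0<..}"] by simp
  qed
  have hc: "continuous_on G h" unfolding h_def by (rule coeff_continuous) simp
  have "openin (top_of_set G) U" unfolding U_def
    by (intro openin_Int o q_continuous continuous_on_const continuous_on_norm continuous_on_det continuous_on_power hc)
  moreover have "mat 1 \<in> U" using v by (simp add: U_def G_one h_def pi_one R_def)
  ultimately have "emeasure \<mu> U \<noteq> 0" by (rule neighbourhood_not_null)
  moreover have "U \<subseteq> {x \<in> space \<mu>. W x * (h x)\<^sup>2 \<noteq> 0}"
    by (auto simp: U_def space_mu W_def psi_def bump_def iota_def eta_def)
  moreover have N: "{x \<in> space \<mu>. W x * (h x)\<^sup>2 \<noteq> 0} \<in> sets \<mu>"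
  proof -
    have "{x \<in> space \<mu>. W x * (h x)\<^sup>2 \<noteq> 0} = (\<lambda>x. W x * (h x)\<^sup>2) -` (- {0}) \<inter> space \<mu>" by blast
    then show ?thesis using measurable_sets[OF borel_measurable_integrable[OF Wh2i], of "- {0}"] by (simp only: borel_open open_Compl closed_singleton)
  qed
  moreover have "emeasure \<mu> {x \<in> space \<mu>. W x * (h x)\<^sup>2 \<noteq> 0} = 0"
    by (rule AE_iff_measurable[OF N refl, THEN iffD1, OF ae])
  ultimately show False using emeasure_mono[of U "{x \<in> space \<mu>. W x * (h x)\<^sup>2 \<noteq> 0}" \<mu>] by (metis le_zero_eq)
qed

text \<open>\<open>q\<close> is invariant under \<open>X\<close>, so the derivative falls on the
  polynomial alone.\<close>

lemma dpi_bump: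
  assumes X: "X \<in> E" "\<And>x. b (X ** x) x = 0" and p: "real_polynomial_function p" and d: "\<And>x. (p has_derivative p' x) (at x)"
    and p': "real_polynomial_function (\<lambda>x. p' x (X ** x))"
  shows "dpi X (J (bump p) v) = - J (bump (\<lambda>x. p' x (X ** x))) v"
proof -
  have q': "(q has_derivative (\<lambda>h. b x h + b h x)) (at x)" for x
    using bounded_bilinear.FDERIV[OF b has_derivative_ident has_derivative_ident] by (simp add: q_def[abs_def])
  define \<phi>' where "\<phi>' x h = p' x h * eta 0 (R - q x)
      + (real 0 * p x * (b x h + b h x) * eta (0 + 1) (R - q x) + (- p x * (b x h + b h x)) * eta (0 + 2) (R - q x))" for x h
  have "(bump p has_derivative \<phi>' x) (at x)" for x
    unfolding bump_def \<phi>'_def by (rule Phi_base_deriv[OF d q'])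
  moreover have "\<phi>' x (X ** x) = bump (\<lambda>x. p' x (X ** x)) x" for x
    using X(2) b_sym[of x "X ** x"] by (simp add: \<phi>'_def bump_def)
  ultimately show ?thesis
    using dpi_J[OF X(1) bump_Phi[OF p], of \<phi>' v] bump_Phi[OF p'] by simp
qed

text \<open>The polynomial factor stays in a finite-dimensional space under the rotations, so the
  vectors smoothed with it span a finite-dimensional \<open>so(3)\<close>-module.\<close>

lemma highest_weight_vector:
  assumes v: "(v :: 'h) \<noteq> 0"
  shows "\<exists>d. \<exists>y\<in>M.hw d. y \<noteq> 0"
proof -
  obtain p where p: "real_polynomial_function p" "J (bump p) v \<noteq> 0" using exists_smoothed_nonzero[OF v] by blast
  from polynomial_finite_dimensional[OF p(1)]
  obtain S where S1: "finite S" and S2: "\<forall>s\<in>S. real_polynomial_function s" and S3: "p \<in> comb S"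
    and S4: "\<forall>s\<in>S. \<exists>s'. (\<forall>x. (s has_derivative s' x) (at x)) \<and>
      (\<forall>A. bounded_linear A \<longrightarrow> (\<lambda>x. s' x (A x)) \<in> comb S)"
    by (elim exE conjE)
  note S = S1 S2[rule_format] S3
  define T where "T s = J (bump s) v" for s
  define V where "V = {\<Sum>s\<in>S. scaleC (a s) (T s) |a. True}"
  have V_I: "(\<Sum>s\<in>S. scaleC (a s) (T s)) \<in> V" for a unfolding V_def by (intro CollectI exI[of _ a]) simp
  have V_add: "x + y \<in> V" if x: "x \<in> V" and y: "y \<in> V" for x y
  proof -
    obtain a where "x = (\<Sum>s\<in>S. scaleC (a s) (T s))" using x unfolding V_def by blast
    moreover obtain c where "y = (\<Sum>s\<in>S. scaleC (c s) (T s))" using y unfolding V_def by blast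
    ultimately have "x + y = (\<Sum>s\<in>S. scaleC (a s + c s) (T s))" by (simp add: scaleC.add_left sum.distrib)
    then show ?thesis by (simp only: V_I)
  qed
  have V_scale: "scaleC c x \<in> V" if x: "x \<in> V" for c x
  proof -
    obtain a where "x = (\<Sum>s\<in>S. scaleC (a s) (T s))" using x unfolding V_def by blast
    then have "scaleC c x = (\<Sum>s\<in>S. scaleC (c * a s) (T s))" by (simp add: scaleC.sum_right scaleC_scaleC)
    then show ?thesis by (simp only: V_I)
  qed
  have V_0: "0 \<in> V" using V_I[of "\<lambda>_. 0"] by (simp add: scaleC.zero_left)
  have V: "complex_subspace V"
    unfolding complex_subspace_def
  proof (intro conjI allI ballI V_scale subspaceI V_0 V_add)
    fix c x assume "x \<in> V" then show "c *\<^sub>R x \<in> V" using V_scale[of x "complex_of_real c"] by (simp add: scaleC_of_real)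
  qed
  have V_base: "T s \<in> V" if "s \<in> S" for s
  proof -
    have "(\<Sum>s'\<in>S. scaleC (if s' = s then 1 else 0) (T s')) = (\<Sum>s'\<in>S. if s' = s then T s else 0)"
      using scaleC_of_real[of 1] by (intro sum.cong) (auto simp: scaleC.zero_left)
    then show ?thesis using V_I[of "\<lambda>s'. if s' = s then 1 else 0"] S(1) that by simp
  qed
  have comb: "real_polynomial_function f \<and> T f \<in> V" if "f \<in> comb S" for f
    using that
  proof induction
    case zero
    have "bump (\<lambda>x. 0) = (\<lambda>x. 0 * bump (\<lambda>x. 0) x)" by (simp add: bump_def[abs_def])
    then have "T (\<lambda>x. 0) = 0 *\<^sub>R J (bump (\<lambda>x. 0)) v"
      using J_scale[OF bump_Phi[OF real_polynomial_function.intros(2)], of 0 0 v] by (simp add: T_def)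
    then show ?case using V_0 real_polynomial_function.intros(2)[of 0] by simp
  next
    case (base s) then show ?case using V_base S(2) by blast
  next
    case (add f g)
    have "T (\<lambda>x. f x + g x) = T f + T g"
      using J_add[OF bump_Phi bump_Phi, of f g v] add.IH by (simp add: T_def bump_def[abs_def] distrib_right)
    then show ?case using V_add add.IH real_polynomial_function.intros(3)[of f g] by simp
  next
    case (scale f c)
    have "T (\<lambda>x. c * f x) = scaleC (complex_of_real c) (T f)"
      using J_scale[OF bump_Phi, of f c v] scale.IH by (simp add: T_def bump_def[abs_def] mult.assoc scaleC_of_real)
    then show ?case using V_scale scale.IH real_polynomial_function.intros(4)[OF real_polynomial_function.intros(2), of f c] by simp
  qed
  have T_YY: "T s \<in> YY" if "s \<in> S" for s unfolding T_def by (rule J_in[OF bump_Phi[OF S(2)[OF that]]])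
  have V_YY: "V \<subseteq> YY" unfolding V_def
    using T_YY by (auto intro!: complex_subspace_sum[OF YY_complex] complex_subspace_scaleC[OF YY_complex] simp: T_YY)
  have V_dpi: "dpi X x \<in> V" if X: "X \<in> E" "\<And>x. b (X ** x) x = 0" and x: "x \<in> V" for X x
  proof -
    have base: "dpi X (T s) \<in> V" if s: "s \<in> S" for s
    proof -
      obtain s' where s': "\<And>x. (s has_derivative s' x) (at x)" "\<And>A. bounded_linear A \<Longrightarrow> (\<lambda>x. s' x (A x)) \<in> comb S"
        using bspec[OF S4 s] by blast
      note c = comb[OF s'(2)[OF matmul.bounded_linear_right[of X]]]
      have "dpi X (T s) = - T (\<lambda>x. s' x (X ** x))"
        unfolding T_def by (rule dpi_bump[OF X S(2)[OF s] s'(1) c[THEN conjunct1]])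
      then show ?thesis using complex_subspace_minus[OF V c[THEN conjunct2]] by simp
    qed
    obtain a where "x = (\<Sum>s\<in>S. scaleC (a s) (T s))" using x unfolding V_def by blast
    then have "dpi X x = (\<Sum>s\<in>S. scaleC (a s) (dpi X (T s)))"
      using complex_linear_on_sum[OF YY_complex _ T_YY, of "dpi X" S "\<lambda>s. s" a] dpi_operator[OF X(1)]
      by (simp add: operator_on_def)
    then show ?thesis using base by (simp add: complex_subspace_sum[OF V] V_scale)
  qed
  note dL = V_dpi[OF basis_E(1) b_L(1)] V_dpi[OF basis_E(2) b_L(2)] V_dpi[OF basis_E(3) b_L(3)]
  show ?thesis
  proof (rule M.highest_weight_exists[OF V V_YY])
    fix x assume "x \<in> V"
    then show "M.J3 x \<in> V" "M.Jp x \<in> V"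
      unfolding M.J3_def M.Jp_def by (auto intro!: complex_subspace_diff[OF V] V_scale dL)
  next
    show "findim (card S) V" unfolding V_def by (rule findim_spanI[OF S(1), where b=T]) simp
    show "T p \<in> V" using comb[OF S(3)] by blast
    show "T p \<noteq> 0" using p(2) by (simp add: T_def)
  qed
qed

end

subsection \<open>Finiteness of the highest weight spaces\<close>

text \<open>Gronwall's argument: the sum of the squared moduli starts at 0 and grows at most by the
  factor \<open>exp (2 C s)\<close>.\<close>

lemma linear_ode_zero:
  fixes f :: "'i \<Rightarrow> real \<Rightarrow> complex"
  assumes I: "finite I" and d: "\<And>i s. i \<in> I \<Longrightarrow> (f i has_vector_derivative (\<Sum>j\<in>I. c i j * f j s)) (at s)"
    and f0: "\<And>i. i \<in> I \<Longrightarrow> f i 0 = 0" and i: "i \<in> I" and s: "s \<ge> 0"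
  shows "f i s = 0"
proof -
  define C where "C = (\<Sum>i\<in>I. \<Sum>j\<in>I. cmod (c i j))"
  define e where "e s = (\<Sum>i\<in>I. f i s \<bullet> f i s)" for s
  define g where "g s = exp (- (2 * C) * s) * e s" for s
  have e_nonneg: "e s \<ge> 0" for s unfolding e_def by (intro sum_nonneg) simp
  have le: "f i s \<bullet> f i s \<le> e s" if "i \<in> I" for i s
    unfolding e_def by (rule member_le_sum[OF that _ I]) simp
  define e' where "e' s = (\<Sum>i\<in>I. 2 * (f i s \<bullet> (\<Sum>j\<in>I. c i j * f j s)))" for s
  have de: "(e has_vector_derivative e' s) (at s)" for s
    unfolding e_def e'_def
  proof (rule has_vector_derivative_sum)
    fix i assume "i \<in> I"
    from bounded_bilinear.has_vector_derivative[OF bounded_bilinear_inner d[OF this] d[OF this], of s]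
    show "((\<lambda>s. f i s \<bullet> f i s) has_vector_derivative 2 * (f i s \<bullet> (\<Sum>j\<in>I. c i j * f j s))) (at s)"
      by (simp add: inner_commute)
  qed
  have e'_le: "e' s \<le> 2 * C * e s" for s
  proof -
    have "f i s \<bullet> (\<Sum>j\<in>I. c i j * f j s) \<le> (\<Sum>j\<in>I. cmod (c i j)) * e s" if i: "i \<in> I" for i
    proof -
      have "f i s \<bullet> (c i j * f j s) \<le> cmod (c i j) * e s" if j: "j \<in> I" for j
      proof -
        have "cmod (f i s) * cmod (f j s) \<le> sqrt (e s) * sqrt (e s)"
          using le[OF i, of s] le[OF j, of s] by (intro mult_mono) (simp_all add: norm_eq_sqrt_inner e_nonneg)
        then have "cmod (f i s) * cmod (f j s) \<le> e s" using e_nonneg by simp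
        then have "cmod (c i j) * (cmod (f i s) * cmod (f j s)) \<le> cmod (c i j) * e s" by (rule mult_left_mono) simp
        moreover have "f i s \<bullet> (c i j * f j s) \<le> cmod (f i s) * (cmod (c i j) * cmod (f j s))"
          using norm_cauchy_schwarz[of "f i s" "c i j * f j s"] by (simp add: norm_mult)
        ultimately show ?thesis by (simp add: mult.left_commute)
      qed
      then show ?thesis unfolding inner_sum_right sum_distrib_right by (rule sum_mono)
    qed
    then have "e' s \<le> (\<Sum>i\<in>I. 2 * ((\<Sum>j\<in>I. cmod (c i j)) * e s))"
      unfolding e'_def by (intro sum_mono mult_left_mono) simp_all
    then show ?thesis by (simp add: C_def sum_distrib_left sum_distrib_right mult.assoc)
  qed
  have dg: "(g has_real_derivative exp (- (2 * C) * s) * (e' s - 2 * C * e s)) (at s)" for s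
    unfolding g_def using de[of s]
    by (auto intro!: derivative_eq_intros simp: has_real_derivative_iff_has_vector_derivative[symmetric] algebra_simps)
  have "g s \<le> g 0"
  proof (rule DERIV_nonpos_imp_nonincreasing[OF s])
    fix t :: real
    have "exp (- (2 * C) * t) * (e' t - 2 * C * e t) \<le> 0" using e'_le[of t] by (intro mult_nonneg_nonpos) simp_all
    then show "\<exists>y. (g has_real_derivative y) (at t) \<and> y \<le> 0" using dg[of t] by blast
  qed
  also have "g 0 = 0" by (simp add: g_def e_def f0)
  finally have "e s \<le> 0" by (simp add: g_def mult_le_0_iff not_le)
  then have "f i s \<bullet> f i s \<le> 0" using le[OF i, of s] by simp
  then have "f i s \<bullet> f i s = 0" using inner_ge_zero[of "f i s"] by linarith
  then show ?thesis by (simp only: inner_eq_zero_iff)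
qed

text \<open>The span is the fixed point set of the continuous projection \<open>Q\<close> given by
  Fourier coefficients.\<close>

lemma closed_orthogonal_span:
  fixes u :: "'i \<Rightarrow> 'h::complex_hilbert_space"
  assumes I: "finite I" and orth: "\<And>i j. i \<in> I \<Longrightarrow> j \<in> I \<Longrightarrow> i \<noteq> j \<Longrightarrow> cinner (u i) (u j) = 0"
    and nz: "\<And>i. i \<in> I \<Longrightarrow> u i \<noteq> 0"
  shows "closed {\<Sum>i\<in>I. scaleC (a i) (u i) |a. True}"
proof -
  define Q where "Q x = (\<Sum>i\<in>I. scaleC (cinner x (u i) / cinner (u i) (u i)) (u i))" for x
  have "{\<Sum>i\<in>I. scaleC (a i) (u i) |a. True} = {x. Q x = x}"
  proof (intro equalityI subsetI)
    fix x assume "x \<in> {\<Sum>i\<in>I. scaleC (a i) (u i) |a. True}"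
    then obtain a where x: "x = (\<Sum>i\<in>I. scaleC (a i) (u i))" by blast
    have "cinner x (u i) = a i * cinner (u i) (u i)" if i: "i \<in> I" for i
    proof -
      have "cinner x (u i) = (\<Sum>j\<in>I. if j = i then a i * cinner (u i) (u i) else 0)"
        unfolding x cinner.sum_left by (intro sum.cong) (auto simp: cinner_scaleC_left orth i)
      then show ?thesis using I i by simp
    qed
    then have "Q x = (\<Sum>i\<in>I. scaleC (a i) (u i))"
      unfolding Q_def by (intro sum.cong) (simp_all add: cinner_eq_zero_iff nz)
    then show "x \<in> {x. Q x = x}" by (simp only: x[symmetric] mem_Collect_eq)
  next
    fix x assume "x \<in> {x. Q x = x}"
    then have "Q x = x" by simp
    moreover have "Q x \<in> {\<Sum>i\<in>I. scaleC (a i) (u i) |a. True}" 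
      unfolding Q_def by (intro CollectI exI[of _ "\<lambda>i. cinner x (u i) / cinner (u i) (u i)"] conjI refl TrueI)
    ultimately show "x \<in> {\<Sum>i\<in>I. scaleC (a i) (u i) |a. True}" by (simp only:)
  qed
  moreover have "continuous_on UNIV Q"
    unfolding Q_def divide_inverse
    by (intro continuous_on_sum scaleC.continuous_on cinner.continuous_on continuous_on_mult continuous_on_const continuous_on_id)
  ultimately show ?thesis by (simp add: closed_Collect_eq)
qed

section \<open>Spans of weight strings and invariant forms on them\<close>

context su2_module begin

definition wspan :: "nat \<Rightarrow> 'h \<Rightarrow> 'h set" where
  "wspan d x = {\<Sum>n\<le>d. scaleC (a n) (wt x n) |a. True}"

lemma wspanI: "(\<Sum>n\<le>d. scaleC (a n) (wt x n)) \<in> wspan d x"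
  unfolding wspan_def by blast

lemma wspanE: assumes "y \<in> wspan d x" obtains a where "y = (\<Sum>n\<le>d. scaleC (a n) (wt x n))"
  using assms unfolding wspan_def by blast

lemma wspan_subspace: "complex_subspace (wspan d x)"
proof (rule complex_subspaceI)
  show "0 \<in> wspan d x" using wspanI[of "\<lambda>_. 0" x d] by simp
next
  fix y z assume "y \<in> wspan d x" "z \<in> wspan d x"
  then obtain a c where "y = (\<Sum>n\<le>d. scaleC (a n) (wt x n))" "z = (\<Sum>n\<le>d. scaleC (c n) (wt x n))" by (metis wspanE)
  then have "y + z = (\<Sum>n\<le>d. scaleC (a n + c n) (wt x n))" by (simp add: scaleC_add_left sum.distrib)
  then show "y + z \<in> wspan d x" by (simp only: wspanI)
next
  fix r y assume "y \<in> wspan d x"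
  then obtain a where "y = (\<Sum>n\<le>d. scaleC (a n) (wt x n))" by (metis wspanE)
  then have "scaleC r y = (\<Sum>n\<le>d. scaleC (r * a n) (wt x n))" by (simp add: scaleC_sum_right scaleC_scaleC)
  then show "scaleC r y \<in> wspan d x" by (simp only: wspanI)
qed

lemma wt_wspan: assumes "x \<in> hw d" shows "wt x n \<in> wspan d x"
proof (cases "n \<le> d")
  case True
  have "(\<Sum>k\<le>d. scaleC (if k = n then 1 else 0) (wt x k)) = (\<Sum>k\<le>d. if k = n then wt x n else 0)"
    by (intro sum.cong) auto
  then show ?thesis using wspanI[of "\<lambda>k. if k = n then 1 else 0" x d] True by simp
next
  case False
  then show ?thesis using wt_vanish[OF assms] complex_subspace_0[OF wspan_subspace] by simp
qed

lemma L_wspan: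
  assumes x: "x \<in> hw d"
  shows "L1 (wt x n) \<in> wspan d x" "L2 (wt x n) \<in> wspan d x" "L3 (wt x n) \<in> wspan d x"
proof -
  have J: "J3 (wt x n) \<in> wspan d x" "Jp (wt x n) \<in> wspan d x" "Jm (wt x n) \<in> wspan d x"
    unfolding J3_wt[OF x] Jp_wt[OF x] wt_Suc[symmetric]
    by (intro complex_subspace_scaleC[OF wspan_subspace] complex_subspace_scaleR[OF wspan_subspace] wt_wspan x)+
  have "wt x n \<in> Y" using x by (simp add: hw_def)
  then show "L1 (wt x n) \<in> wspan d x" "L2 (wt x n) \<in> wspan d x" "L3 (wt x n) \<in> wspan d x"
    unfolding L_from_J[OF \<open>wt x n \<in> Y\<close>]
    by (intro complex_subspace_scaleC[OF wspan_subspace] complex_subspace_add[OF wspan_subspace] complex_subspace_diff[OF wspan_subspace] J)+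
qed

text \<open>Schur's lemma in explicit form: the form \<open>cinner (P y) z\<close> is invariant, so
  different weights are orthogonal for it, and its values descend from the highest weight by the
  factors \<open>cf\<close>. It is applied with \<open>P\<close> an orthogonal projection and,
  through \<open>invariant_form_wspan\<close>, also with the identity.\<close>

lemma invariant_form_wt:
  fixes P :: "'h \<Rightarrow> 'h"
  assumes P: "\<And>y z. P (y + z) = P y + P z" "\<And>a y. P (scaleC a y) = scaleC a (P y)"
    and PL: "\<And>y z. y \<in> Y \<Longrightarrow> z \<in> Y \<Longrightarrow> cinner (P (L1 y)) z = - cinner (P y) (L1 z)"
      "\<And>y z. y \<in> Y \<Longrightarrow> z \<in> Y \<Longrightarrow> cinner (P (L2 y)) z = - cinner (P y) (L2 z)"
      "\<And>y z. y \<in> Y \<Longrightarrow> z \<in> Y \<Longrightarrow> cinner (P (L3 y)) z = - cinner (P y) (L3 z)"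
    and x: "x \<in> hw d" "x' \<in> hw d"
  shows "n \<noteq> k \<Longrightarrow> cinner (P (wt x n)) (wt x' k) = 0"
    and "cinner (P (wt x n)) (wt x' n) = of_real (\<Prod>i<n. cf d (Suc i)) * cinner (P x) x'"
proof -
  have xY: "x \<in> Y" "x' \<in> Y" using x by (auto simp: hw_def)
  assume nk: "n \<noteq> k"
  have "cinner (P (J3 (wt x n))) (wt x' k) = cinner (P (wt x n)) (J3 (wt x' k))"
    unfolding J3_def by (simp add: P PL xY cinner_scaleC_left cinner_scaleC_right)
  then have "(complex_of_real ((real d - 2 * real n) / 2) - complex_of_real ((real d - 2 * real k) / 2)) * cinner (P (wt x n)) (wt x' k) = 0"
    by (simp add: J3_wt[OF x(1)] J3_wt[OF x(2)] P cinner_scaleC_left cinner_scaleC_right left_diff_distrib)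
  moreover have "complex_of_real ((real d - 2 * real n) / 2) \<noteq> complex_of_real ((real d - 2 * real k) / 2)"
    unfolding of_real_eq_iff using nk by simp
  ultimately show "cinner (P (wt x n)) (wt x' k) = 0" by simp
next
  have xY: "x \<in> Y" "x' \<in> Y" using x by (auto simp: hw_def)
  show "cinner (P (wt x n)) (wt x' n) = of_real (\<Prod>i<n. cf d (Suc i)) * cinner (P x) x'"
  proof (induction n)
    case (Suc n)
    have "cinner (P (wt x (Suc n))) (wt x' (Suc n)) = cinner (P (wt x n)) (Jp (wt x' (Suc n)))"
      unfolding wt_Suc[of x] Jm_def Jp_def
      using wt_in[OF xY(1), of n] wt_in[OF xY(2), of "Suc n"]
      by (simp add: P PL xY cinner_scaleC_left cinner_scaleC_right cinner.add_left cinner.diff_right)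
    also have "\<dots> = of_real (cf d (Suc n)) * cinner (P (wt x n)) (wt x' n)"
      unfolding Jp_wt[OF x(2)] by (simp add: cinner_real_scaleR_right)
    finally show ?case using Suc.IH by (simp add: mult_ac)
  qed simp
qed

lemma invariant_form_wspan:
  fixes P :: "'h \<Rightarrow> 'h"
  assumes P: "\<And>y z. P (y + z) = P y + P z" "\<And>a y. P (scaleC a y) = scaleC a (P y)"
    and PL: "\<And>y z. y \<in> Y \<Longrightarrow> z \<in> Y \<Longrightarrow> cinner (P (L1 y)) z = - cinner (P y) (L1 z)"
      "\<And>y z. y \<in> Y \<Longrightarrow> z \<in> Y \<Longrightarrow> cinner (P (L2 y)) z = - cinner (P y) (L2 z)"
      "\<And>y z. y \<in> Y \<Longrightarrow> z \<in> Y \<Longrightarrow> cinner (P (L3 y)) z = - cinner (P y) (L3 z)"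
    and x: "x \<in> hw d"
  shows "cinner (P (\<Sum>n\<le>d. scaleC (a n) (wt x n))) (\<Sum>n\<le>d. scaleC (c n) (wt x n))
    = (\<Sum>n\<le>d. a n * cnj (c n) * of_real (\<Prod>i<n. cf d (Suc i))) * cinner (P x) x"
proof -
  have P0: "P 0 = 0" using P(2)[of 0 0] by simp
  have Ps: "P (\<Sum>n\<in>I. scaleC (a n) (wt x n)) = (\<Sum>n\<in>I. scaleC (a n) (P (wt x n)))" if "finite I" for I
    using that by (induction I rule: finite_induct) (simp_all add: P P0)
  have "cinner (P (\<Sum>n\<le>d. scaleC (a n) (wt x n))) (\<Sum>n\<le>d. scaleC (c n) (wt x n))
      = (\<Sum>n\<le>d. \<Sum>k\<le>d. a n * (cnj (c k) * cinner (P (wt x n)) (wt x k)))"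
    unfolding Ps[OF finite_atMost] cinner.sum_left
    by (simp add: cinner.sum_right cinner_scaleC_left cinner_scaleC_right sum_distrib_left mult.left_commute)
  also have "\<dots> = (\<Sum>n\<le>d. \<Sum>k\<le>d. if k = n then a n * cnj (c n) * of_real (\<Prod>i<n. cf d (Suc i)) * cinner (P x) x else 0)"
    by (intro sum.cong refl) (auto simp: invariant_form_wt[OF P PL x x])
  also have "\<dots> = (\<Sum>n\<le>d. a n * cnj (c n) * of_real (\<Prod>i<n. cf d (Suc i))) * cinner (P x) x"
    by (simp add: sum_distrib_right)
  finally show ?thesis .
qed

end

text \<open>Since \<open>S\<close> is closed under negation, inverses of the generators are
  generators, which removes the case of inverses from the induction.\<close>

lemma generate_exp_induct:
  fixes S :: "(complex^'m^'m) set"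
  assumes "k \<in> generate GL (mexp ` S)" and S: "\<And>Z. Z \<in> S \<Longrightarrow> - Z \<in> S"
    and "P (mat 1)" "\<And>Z. Z \<in> S \<Longrightarrow> P (mexp Z)" "\<And>a c. P a \<Longrightarrow> P c \<Longrightarrow> P (a ** c)"
  shows "P k"
  using assms(1)
proof induction
  case one then show ?case using assms(3) by (simp add: GL_def)
next
  case (incl h) then show ?case using assms(4) by blast
next
  case (inv h)
  then obtain Z where Z: "Z \<in> S" "h = mexp Z" by blast
  have "inv\<^bsub>GL\<^esub> h = mexp (- Z)" unfolding Z(2) by (rule GL_inv) (rule mexp_minus)+
  then show ?case using assms(4) S Z(1) by simp
next
  case (eng h1 h2) then show ?case using assms(5)[of h1 h2] by (simp add: GL_def)
qed

context rep begin

abbreviation LL_span where "LL_span \<equiv> {a *\<^sub>R L1 + b *\<^sub>R L2 + c *\<^sub>R L3 |a b c. True}"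

text \<open>The one-parameter group of \<open>Z\<close> preserves \<open>b\<close>, hence is bounded, and so are the powers of its
  determinants.\<close>

lemma LL_span_E:
  assumes Z: "Z \<in> lie_algebra G" "Z = a1 *\<^sub>R L1 + a2 *\<^sub>R L2 + a3 *\<^sub>R L3"
  shows "Z \<in> E"
proof -
  interpret b: bounded_bilinear b by (rule b)
  have bZ: "b (Z ** x) x = 0" for x
    by (simp add: Z(2) matmul.add_left matmul.scaleR_left b.add_left b.scaleR_left b_L)
  have "((\<lambda>s. q (mexp (s *\<^sub>R Z))) has_vector_derivative 0) (at s)" for s
    using b.has_vector_derivative[OF mexp_deriv[of Z s UNIV] mexp_deriv[of Z s UNIV]]
    by (simp add: q_def bZ b_sym[of "mexp (s *\<^sub>R Z)" "Z ** mexp (s *\<^sub>R Z)"])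
  from derivative_zero_constant_on_real[OF this, of _ 0] have q1: "q (mexp (s *\<^sub>R Z)) = q (mat 1)" for s by simp
  obtain c where c: "c > 0" "\<And>x. c * (norm x)\<^sup>2 \<le> q x" using q_bounds by blast
  define K where "K = {x :: complex^'m^'m. norm x \<le> sqrt (q (mat 1) / c)}"
  have inK: "mexp (s *\<^sub>R Z) \<in> K" for s
    using c(2)[of "mexp (s *\<^sub>R Z)"] c(1) by (simp add: K_def q1 real_le_rsqrt pos_le_divide_eq mult.commute)
  have "compact K" unfolding K_def using compact_cball[of "0 :: complex^'m^'m" "sqrt (q (mat 1) / c)"] by (simp add: cball_def)
  then have "bounded (det ` K)" by (intro compact_imp_bounded compact_continuous_image continuous_on_det)
  then obtain B where B: "\<And>x. x \<in> K \<Longrightarrow> cmod (det x) \<le> B" by (auto simp: bounded_iff)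
  have pow: "det (mexp (s *\<^sub>R Z)) ^ n = det (mexp ((real n * s) *\<^sub>R Z))" for s n
  proof (induction n)
    case (Suc n)
    have "mexp ((real (Suc n) * s) *\<^sub>R Z) = mexp (s *\<^sub>R Z) ** mexp ((real n * s) *\<^sub>R Z)"
      using mexp_add_scaleR[of s "real n * s" Z] by (simp add: distrib_right)
    then show ?case using Suc.IH by (simp add: det_mul)
  qed simp
  have le1: "cmod (det (mexp (s *\<^sub>R Z))) \<le> 1" for s
  proof (rule ccontr)
    assume "\<not> cmod (det (mexp (s *\<^sub>R Z))) \<le> 1"
    then obtain n where "B < cmod (det (mexp (s *\<^sub>R Z))) ^ n" using real_arch_pow[of "cmod (det (mexp (s *\<^sub>R Z)))" B] by auto
    then show False using B[OF inK, of "real n * s"] by (simp add: norm_power[symmetric] pow)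
  qed
  have "cmod (det (mexp (s *\<^sub>R Z))) = 1" for s
  proof (rule ccontr)
    assume "cmod (det (mexp (s *\<^sub>R Z))) \<noteq> 1"
    then have lt: "cmod (det (mexp (s *\<^sub>R Z))) < 1" using le1[of s] by simp
    have "det (mexp (s *\<^sub>R Z)) * det (mexp ((- s) *\<^sub>R Z)) = 1"
      using arg_cong[OF mexp_minus(1)[of "s *\<^sub>R Z"], of det] by (simp add: det_mul)
    then have "cmod (det (mexp (s *\<^sub>R Z))) * cmod (det (mexp ((- s) *\<^sub>R Z))) = 1" by (metis norm_mult norm_one)
    moreover have "cmod (det (mexp (s *\<^sub>R Z))) * cmod (det (mexp ((- s) *\<^sub>R Z))) \<le> cmod (det (mexp (s *\<^sub>R Z))) * 1"
      by (intro mult_left_mono le1) simp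
    ultimately show False using lt by linarith
  qed
  then show ?thesis using Z(1) by (simp add: E_def)
qed

end

section \<open>Irreducible constituents of the restriction to \<open>K\<close>\<close>

locale rep_K = rep L1 L2 L3 B1 B2 B3 G \<mu> \<pi> b
  for L1 L2 L3 B1 B2 B3 :: "complex^'m^'m" and G :: "(complex^'m^'m) set" and \<mu>
    and \<pi> :: "complex^'m^'m \<Rightarrow> 'h::complex_hilbert_space \<Rightarrow> 'h" and b +
  fixes K :: "(complex^'m^'m) set"
  assumes K: "K = generate GL (mexp ` {a *\<^sub>R L1 + b *\<^sub>R L2 + c *\<^sub>R L3 |a b c. True})"
    and span_G: "a1 *\<^sub>R L1 + a2 *\<^sub>R L2 + a3 *\<^sub>R L3 \<in> lie_algebra G"
begin

lemma span_E: "a1 *\<^sub>R L1 + a2 *\<^sub>R L2 + a3 *\<^sub>R L3 \<in> E"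
  by (rule LL_span_E[OF span_G refl])

lemma exp_K: "mexp (a1 *\<^sub>R L1 + a2 *\<^sub>R L2 + a3 *\<^sub>R L3) \<in> K"
  unfolding K by (rule generate.incl) blast

lemma K_induct [consumes 1, case_names one exp mult]:
  assumes "k \<in> K" "P (mat 1)"
    and exp: "\<And>a1 a2 a3. P (mexp (a1 *\<^sub>R L1 + a2 *\<^sub>R L2 + a3 *\<^sub>R L3))" and "\<And>a c. P a \<Longrightarrow> P c \<Longrightarrow> P (a ** c)"
  shows "P k"
proof (rule generate_exp_induct[where P=P, OF assms(1)[unfolded K] _ assms(2) _ assms(4)])
  fix Z assume "Z \<in> LL_span"
  then obtain a1 a2 a3 where Z: "Z = a1 *\<^sub>R L1 + a2 *\<^sub>R L2 + a3 *\<^sub>R L3" by blast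
  then have "- Z = (- a1) *\<^sub>R L1 + (- a2) *\<^sub>R L2 + (- a3) *\<^sub>R L3" by simp
  then show "- Z \<in> LL_span" by blast
  show "P (mexp Z)" unfolding Z by (rule exp)
qed

lemma K_G: "k \<in> K \<Longrightarrow> k \<in> G"
  by (induction rule: K_induct) (use G_one G_mult exp_in[OF span_G, of 1] in auto)

text \<open>\<open>W\<close> is preserved by each exponential and by its inverse, so unitarity makes
  the exponential preserve the orthogonal complement too.\<close>

lemma proj_commute:
  assumes W: "closed_invariant K \<pi> W" and k: "k \<in> K"
  shows "proj W (\<pi> k y) = \<pi> k (proj W y)"
proof -
  have cW: "complex_subspace W" "closed W" and inv: "\<And>a w. a \<in> K \<Longrightarrow> w \<in> W \<Longrightarrow> \<pi> a w \<in> W"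
    using W by (auto simp: closed_invariant_def)
  have "k \<in> G \<and> (\<forall>y. proj W (\<pi> k y) = \<pi> k (proj W y))"
    using k
  proof (induction rule: K_induct)
    case one then show ?case by (simp add: pi_one G_one)
  next
    case (exp a1 a2 a3)
    let ?Z = "a1 *\<^sub>R L1 + a2 *\<^sub>R L2 + a3 *\<^sub>R L3"
    have g: "mexp ?Z \<in> G" by (rule K_G[OF exp_K])
    have K': "mexp (- ?Z) \<in> K" using exp_K[of "- a1" "- a2" "- a3"] by simp
    have "proj W (\<pi> (mexp ?Z) y) = \<pi> (mexp ?Z) (proj W y)" for y
    proof (rule proj_unique[OF cW])
      show "\<pi> (mexp ?Z) (proj W y) \<in> W" by (rule inv[OF exp_K proj_in[OF cW]])
      fix w assume w: "w \<in> W"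
      have "cinner (\<pi> (mexp ?Z) (y - proj W y)) w = cinner (y - proj W y) (\<pi> (mexp (- ?Z)) w)"
        by (rule pi_adjoint(1)[OF K_G[OF K'] g mexp_minus(2)])
      also have "\<dots> = 0" by (rule proj_orth[OF cW inv[OF K' w]])
      finally show "cinner (\<pi> (mexp ?Z) y - \<pi> (mexp ?Z) (proj W y)) w = 0" by (simp add: pi_simps g)
    qed
    then show ?case using g by blast
  next
    case (mult a c) then show ?case by (simp add: G_mult pi_mult)
  qed
  then show ?thesis by blast
qed

text \<open>The projection of a vector of \<open>YY\<close> may fall outside \<open>YY\<close>, so
  commutation with the Lie algebra is stated weakly; this is the hypothesis on \<open>P\<close> in
  \<open>invariant_form_wt\<close>.\<close>

lemma proj_L:
  assumes W: "closed_invariant K \<pi> W" and X: "X \<in> {L1, L2, L3}" and yz: "y \<in> YY" "z \<in> YY"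
  shows "cinner (proj W (dpi X y)) z = - cinner (proj W y) (dpi X z)"
proof -
  have cW: "complex_subspace W" "closed W" using W by (auto simp: closed_invariant_def)
  have XE: "X \<in> E" using X basis_E by blast
  have XK: "mexp (s *\<^sub>R X) \<in> K" for s
    using X exp_K[of s 0 0] exp_K[of 0 s 0] exp_K[of 0 0 s] by auto
  have "((\<lambda>s. cinner (\<pi> (mexp (s *\<^sub>R X)) y) (proj W z)) has_vector_derivative cinner (dpi X y) (proj W z)) (at 0)"
    by (rule bounded_linear.has_vector_derivative[OF cinner.bounded_linear_left dpi_deriv[OF XE yz(1)]])
  moreover have "cinner (\<pi> (mexp (s *\<^sub>R X)) y) (proj W z) = cinner (proj W y) (\<pi> (mexp ((- s) *\<^sub>R X)) z)" for s
  proof -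
    have "cinner (\<pi> (mexp (s *\<^sub>R X)) y) (proj W z) = cinner (\<pi> (mexp (s *\<^sub>R X)) (proj W y)) z"
      by (simp only: cinner_proj_left[OF cW, symmetric] proj_commute[OF W XK])
    then show ?thesis using mexp_minus[of "s *\<^sub>R X"]
      by (simp add: pi_adjoint(1)[OF E_G[OF XE, of "- s", simplified] E_G[OF XE, of s]])
  qed
  moreover have "((\<lambda>s. cinner (proj W y) (\<pi> (mexp ((- s) *\<^sub>R X)) z)) has_vector_derivative cinner (proj W y) (- dpi X z)) (at 0)"
  proof (rule bounded_linear.has_vector_derivative[OF cinner.bounded_linear_right])
    have "(uminus has_vector_derivative (- 1 :: real)) (at 0)"
      using has_vector_derivative_minus[OF has_vector_derivative_id] by simp
    from vector_diff_chain_at[OF this, of "\<lambda>s. \<pi> (mexp (s *\<^sub>R X)) z" "dpi X z"] dpi_deriv[OF XE yz(2)]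
    show "((\<lambda>s. \<pi> (mexp ((- s) *\<^sub>R X)) z) has_vector_derivative - dpi X z) (at 0)" by (simp add: o_def)
  qed
  ultimately have "cinner (dpi X y) (proj W z) = cinner (proj W y) (- dpi X z)"
    by (simp only: vector_derivative_unique_at)
  then show ?thesis by (simp add: cinner_proj_left[OF cW] cinner.minus_right)
qed

lemma proj_LL:
  assumes "closed_invariant K \<pi> W" "y \<in> YY" "z \<in> YY"
  shows "cinner (proj W (dpi L1 y)) z = - cinner (proj W y) (dpi L1 z)"
    "cinner (proj W (dpi L2 y)) z = - cinner (proj W y) (dpi L2 z)"
    "cinner (proj W (dpi L3 y)) z = - cinner (proj W y) (dpi L3 z)"
  by (simp_all add: proj_L[OF assms(1) _ assms(2,3)])

lemma dpi_span:
  assumes y: "y \<in> YY"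
  shows "dpi (a1 *\<^sub>R L1 + a2 *\<^sub>R L2 + a3 *\<^sub>R L3) y = a1 *\<^sub>R dpi L1 y + a2 *\<^sub>R dpi L2 y + a3 *\<^sub>R dpi L3 y"
proof -
  have "a1 *\<^sub>R L1 + a2 *\<^sub>R L2 \<in> E" using span_E[of a1 a2 0] by simp
  from dpi_combination[OF this basis_E(3) span_E[of a1 a2 a3] _ y, of 1 a3] dpi_combination[OF basis_E(1,2) this refl y]
  show ?thesis by simp
qed

lemma wt_YY: "x \<in> M.hw d \<Longrightarrow> M.wt x n \<in> YY" by (auto simp: M.hw_def)

lemma weight_factor_pos: "n \<le> d \<Longrightarrow> (\<Prod>i<n. M.cf d (Suc i)) > 0"
  by (intro prod_pos ballI) (auto simp: M.cf_def intro!: mult_pos_pos)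

lemma proj_form_wt:
  assumes W: "closed_invariant K \<pi> W" and x: "x \<in> M.hw d" "x' \<in> M.hw d"
  shows "n \<noteq> k \<Longrightarrow> cinner (proj W (M.wt x n)) (M.wt x' k) = 0"
    and "cinner (proj W (M.wt x n)) (M.wt x' n) = of_real (\<Prod>i<n. M.cf d (Suc i)) * cinner (proj W x) x'"
proof -
  have cW: "complex_subspace W" "closed W" using W by (auto simp: closed_invariant_def)
  have P: "\<And>y z. proj W (y + z) = proj W y + proj W z" "\<And>a y. proj W (scaleC a y) = scaleC a (proj W y)"
    by (rule proj_add[OF cW], rule proj_scaleC[OF cW])
  show "n \<noteq> k \<Longrightarrow> cinner (proj W (M.wt x n)) (M.wt x' k) = 0"
    by (rule M.invariant_form_wt(1)[where P="proj W", OF P proj_LL[OF W] x])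
  show "cinner (proj W (M.wt x n)) (M.wt x' n) = of_real (\<Prod>i<n. M.cf d (Suc i)) * cinner (proj W x) x'"
    by (rule M.invariant_form_wt(2)[where P="proj W", OF P proj_LL[OF W] x])
qed

lemma proj_wt_orth:
  assumes W: "closed_invariant K \<pi> W" and x: "x \<in> M.hw d" and nz: "proj W x \<noteq> 0"
  shows "n \<noteq> k \<Longrightarrow> cinner (proj W (M.wt x n)) (proj W (M.wt x k)) = 0"
    and "n \<le> d \<Longrightarrow> proj W (M.wt x n) \<noteq> 0"
proof -
  have cW: "complex_subspace W" "closed W" using W by (auto simp: closed_invariant_def)
  show "n \<noteq> k \<Longrightarrow> cinner (proj W (M.wt x n)) (proj W (M.wt x k)) = 0"
    unfolding cinner_proj[OF cW] by (rule proj_form_wt(1)[OF W x x])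
  assume n: "n \<le> d"
  have "cinner (proj W x) x \<noteq> 0" by (subst cinner_proj[OF cW, symmetric]) (use nz in \<open>simp add: cinner_eq_zero_iff\<close>)
  moreover have "(\<Prod>i<n. M.cf d (Suc i)) \<noteq> 0" using weight_factor_pos[OF n] by linarith
  ultimately have "cinner (proj W (M.wt x n)) (M.wt x n) \<noteq> 0"
    unfolding proj_form_wt(2)[OF W x x] by (simp only: mult_eq_0_iff of_real_eq_0_iff simp_thms)
  then show "proj W (M.wt x n) \<noteq> 0" by auto
qed

lemma proj_UNIV [simp]: "proj UNIV y = (y :: 'h)"
  by (rule proj_unique) (auto simp: complex_subspace_def)

lemma closed_invariant_UNIV: "closed_invariant K \<pi> UNIV"
  by (auto simp: closed_invariant_def complex_subspace_def)

lemma wspan_closed: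
  assumes W: "closed_invariant K \<pi> W" and x: "x \<in> M.hw d" and nz: "proj W x \<noteq> 0"
  shows "closed (proj W ` M.wspan d x)"
proof -
  have cW: "complex_subspace W" "closed W" using W by (auto simp: closed_invariant_def)
  have lin: "complex_linear_on UNIV (proj W)" by (simp add: complex_linear_on_def proj_add[OF cW] proj_scaleC[OF cW])
  have "proj W ` M.wspan d x = {\<Sum>n\<le>d. scaleC (a n) (proj W (M.wt x n)) |a. True}"
  proof -
    have "proj W (\<Sum>n\<le>d. scaleC (a n) (M.wt x n)) = (\<Sum>n\<le>d. scaleC (a n) (proj W (M.wt x n)))" for a
      using complex_linear_on_sum[OF _ lin, of "{..d}" "M.wt x" a] closed_invariant_UNIV by (simp add: closed_invariant_def)
    then show ?thesis unfolding M.wspan_def by (force simp: image_iff)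
  qed
  also have "closed \<dots>"
    by (rule closed_orthogonal_span) (use proj_wt_orth[OF W x nz] in auto)
  finally show ?thesis .
qed

text \<open>For \<open>w\<close> orthogonal to the span, the coefficients of the moved weight
  vectors against \<open>w\<close> satisfy a linear system with initial value 0, so they vanish.
  Closedness of the span then puts the moved vectors back into it.\<close>

lemma wspan_exp_invariant:
  assumes x: "x \<in> M.hw d" "x \<noteq> 0" and y: "y \<in> M.wspan d x"
  shows "\<pi> (mexp (a1 *\<^sub>R L1 + a2 *\<^sub>R L2 + a3 *\<^sub>R L3)) y \<in> M.wspan d x"
proof -
  define Z where "Z = a1 *\<^sub>R L1 + a2 *\<^sub>R L2 + a3 *\<^sub>R L3"
  have ZE: "Z \<in> E" unfolding Z_def by (rule span_E)
  have g: "mexp (t *\<^sub>R Z) \<in> G" for t by (rule E_G[OF ZE])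
  define F where "F = M.wspan d x"
  have F: "complex_subspace F" "closed F"
    using wspan_closed[OF closed_invariant_UNIV x(1)] x(2) by (simp_all add: F_def M.wspan_subspace)
  have "dpi Z (M.wt x n) \<in> M.wspan d x" for n
    unfolding Z_def dpi_span[OF wt_YY[OF x(1)]]
    by (intro complex_subspace_add[OF M.wspan_subspace] complex_subspace_scaleR[OF M.wspan_subspace] M.L_wspan x)
  then have "\<exists>c. \<forall>n. dpi Z (M.wt x n) = (\<Sum>k\<le>d. scaleC (c n k) (M.wt x k))"
    by (intro choice allI) (auto simp: M.wspan_def)
  then obtain c where c: "\<And>n. dpi Z (M.wt x n) = (\<Sum>k\<le>d. scaleC (c n k) (M.wt x k))" by blast
  have zero: "cinner (\<pi> (mexp Z) (M.wt x n)) w = 0" if w: "\<And>f. f \<in> F \<Longrightarrow> cinner f w = 0" and n: "n \<le> d" for w n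
  proof -
    have "cinner (\<pi> (mexp (1 *\<^sub>R Z)) (M.wt x n)) w = 0"
    proof (rule linear_ode_zero[of "{..d}" "\<lambda>n s. cinner (\<pi> (mexp (s *\<^sub>R Z)) (M.wt x n)) w" c])
      fix n s
      have lin: "complex_linear_on UNIV (\<pi> (mexp (s *\<^sub>R Z)))" using pi_unitary[OF g] by (simp add: unitary_def)
      have "((\<lambda>s. cinner (\<pi> (mexp (s *\<^sub>R Z)) (M.wt x n)) w) has_vector_derivative cinner (\<pi> (mexp (s *\<^sub>R Z)) (dpi Z (M.wt x n))) w) (at s)"
        by (rule bounded_linear.has_vector_derivative[OF cinner.bounded_linear_left A_deriv[OF ZE wt_YY[OF x(1)]]])
      also have "cinner (\<pi> (mexp (s *\<^sub>R Z)) (dpi Z (M.wt x n))) w = (\<Sum>k\<le>d. c n k * cinner (\<pi> (mexp (s *\<^sub>R Z)) (M.wt x k)) w)"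
        using complex_linear_on_sum[OF _ lin, of "{..d}" "M.wt x" "c n"] closed_invariant_UNIV
        by (simp add: c closed_invariant_def cinner.sum_left cinner_scaleC_left)
      finally show "((\<lambda>s. cinner (\<pi> (mexp (s *\<^sub>R Z)) (M.wt x n)) w) has_vector_derivative (\<Sum>k\<le>d. c n k * cinner (\<pi> (mexp (s *\<^sub>R Z)) (M.wt x k)) w)) (at s)" .
    next
      fix n show "cinner (\<pi> (mexp (0 *\<^sub>R Z)) (M.wt x n)) w = 0"
        using w[of "M.wt x n"] M.wt_wspan[OF x(1)] by (simp add: pi_one F_def)
    qed (use n in auto)
    then show ?thesis by simp
  qed
  define u where "u = \<pi> (mexp Z) y"
  have g1: "mexp Z \<in> G" using g[of 1] by simp
  have u0: "cinner u w = 0" if w: "\<And>f. f \<in> F \<Longrightarrow> cinner f w = 0" for w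
  proof -
    obtain a where y': "y = (\<Sum>n\<le>d. scaleC (a n) (M.wt x n))" using y by (rule M.wspanE)
    have lin: "complex_linear_on UNIV (\<pi> (mexp Z))" using pi_unitary[OF g1] by (simp add: unitary_def)
    have "u = (\<Sum>n\<le>d. scaleC (a n) (\<pi> (mexp Z) (M.wt x n)))"
      unfolding u_def y' using complex_linear_on_sum[OF _ lin, of "{..d}" "M.wt x" a] closed_invariant_UNIV
      by (simp add: closed_invariant_def)
    then show ?thesis using zero[OF w] by (simp add: cinner.sum_left cinner_scaleC_left)
  qed
  have orth: "cinner f (u - proj F u) = 0" if "f \<in> F" for f
    using proj_orth[OF F that, of u] by (metis cinner_commute complex_cnj_zero)
  have "cinner (u - proj F u) (u - proj F u) = 0"
    using u0[OF orth] orth[OF proj_in[OF F, of u]] by (simp add: cinner.diff_left[of u])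
  then have "u = proj F u" by (simp add: cinner_eq_zero_iff)
  then show ?thesis using proj_in[OF F, of u] by (simp add: u_def Z_def F_def)
qed

lemma wspan_K_invariant:
  assumes x: "x \<in> M.hw d" "x \<noteq> 0" and k: "k \<in> K"
  shows "y \<in> M.wspan d x \<Longrightarrow> \<pi> k y \<in> M.wspan d x"
proof -
  have "k \<in> G \<and> (\<forall>y\<in>M.wspan d x. \<pi> k y \<in> M.wspan d x)" using k
  proof (induction rule: K_induct)
    case one then show ?case by (simp add: pi_one G_one)
  next
    case (exp a1 a2 a3) then show ?case using wspan_exp_invariant[OF x] K_G[OF exp_K] by blast
  next
    case (mult a c) then show ?case by (auto simp: G_mult pi_mult)
  qed
  then show "y \<in> M.wspan d x \<Longrightarrow> \<pi> k y \<in> M.wspan d x" by blast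
qed

text \<open>The projected string spans a nonzero invariant subspace of \<open>W\<close>. It is
  closed because the projected weight vectors are orthogonal and nonzero.\<close>

lemma irreducible_eq_wspan:
  assumes W: "irreducible_on K \<pi> W" and x: "x \<in> M.hw d" and nz: "proj W x \<noteq> 0"
  shows "proj W ` M.wspan d x = W"
proof -
  have cinv: "closed_invariant K \<pi> W" using W by (simp add: irreducible_on_def)
  then have cW: "complex_subspace W" "closed W" by (auto simp: closed_invariant_def)
  have "x \<noteq> 0" using nz proj_scaleC[OF cW, of 0 0] by auto
  define V where "V = proj W ` M.wspan d x"
  have sub: "complex_subspace V"
  proof (rule complex_subspaceI)
    show "0 \<in> V" unfolding V_def using complex_subspace_0[OF M.wspan_subspace] proj_scaleC[OF cW, of 0 0] by force
  next
    fix y z assume "y \<in> V" "z \<in> V"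
    then show "y + z \<in> V" unfolding V_def
      using complex_subspace_add[OF M.wspan_subspace] by (auto simp flip: proj_add[OF cW])
  next
    fix a y assume "y \<in> V"
    then show "scaleC a y \<in> V" unfolding V_def
      using complex_subspace_scaleC[OF M.wspan_subspace] by (auto simp flip: proj_scaleC[OF cW])
  qed
  have "closed_invariant K \<pi> V"
    unfolding closed_invariant_def
  proof (intro conjI ballI sub)
    show "closed V" unfolding V_def by (rule wspan_closed[OF cinv x nz])
    fix k assume k: "k \<in> K"
    show "\<pi> k ` V \<subseteq> V" unfolding V_def
      using wspan_K_invariant[OF x \<open>x \<noteq> 0\<close> k] by (auto simp flip: proj_commute[OF cinv k])
  qed
  moreover have "V \<subseteq> W" unfolding V_def using proj_in[OF cW] by blast
  moreover have "proj W x \<in> V" unfolding V_def using M.wt_wspan[OF x, of 0] by auto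
  ultimately show ?thesis using W nz unfolding irreducible_on_def V_def by blast
qed

text \<open>By \<open>invariant_form_wspan\<close> both inner products are the same sum of
  coefficients times their values at the highest weight vector.\<close>

lemma proj_wspan_isometry:
  assumes W: "closed_invariant K \<pi> W" and x: "x \<in> M.hw d" and yz: "y \<in> M.wspan d x" "z \<in> M.wspan d x"
  shows "cinner (proj W y) (proj W z) * cinner x x = cinner (proj W x) x * cinner y z"
proof -
  have cW: "complex_subspace W" "closed W" using W by (auto simp: closed_invariant_def)
  obtain a where y: "y = (\<Sum>n\<le>d. scaleC (a n) (M.wt x n))" using yz(1) by (rule M.wspanE)
  obtain c where z: "z = (\<Sum>n\<le>d. scaleC (c n) (M.wt x n))" using yz(2) by (rule M.wspanE)
  have "cinner (proj W y) z = (\<Sum>n\<le>d. a n * cnj (c n) * of_real (\<Prod>i<n. M.cf d (Suc i))) * cinner (proj W x) x"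
    unfolding y z
    by (rule M.invariant_form_wspan[where P="proj W", OF proj_add[OF cW] proj_scaleC[OF cW] proj_LL[OF W] x])
  moreover have "cinner y z = (\<Sum>n\<le>d. a n * cnj (c n) * of_real (\<Prod>i<n. M.cf d (Suc i))) * cinner x x"
    unfolding y z
    by (rule M.invariant_form_wspan[where P="\<lambda>y. y", OF refl refl dpi_skew[OF basis_E(1)] dpi_skew[OF basis_E(2)] dpi_skew[OF basis_E(3)] x])
  ultimately show ?thesis by (simp add: cinner_proj[OF cW])
qed

text \<open>Up to scalars, both projections are isometric on the \<open>K\<close>-type generated by \<open>x\<close>.\<close>

lemma equivalent_constituents:
  assumes W: "irreducible_on K \<pi> W" "irreducible_on K \<pi> W'" and x: "x \<in> M.hw d" and nz: "proj W x \<noteq> 0" "proj W' x \<noteq> 0"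
  shows "equivalent_on K \<pi> W W'"
proof -
  have cinv: "closed_invariant K \<pi> W" "closed_invariant K \<pi> W'" using W by (simp_all add: irreducible_on_def)
  then have cW: "complex_subspace W" "closed W" "complex_subspace W'" "closed W'" by (auto simp: closed_invariant_def)
  define F where "F = M.wspan d x"
  have F: "complex_subspace F" by (simp add: F_def M.wspan_subspace)
  have x0: "x \<noteq> 0" using nz(1) proj_scaleC[OF cW(1,2), of 0 0] by auto
  define r where "r = (norm (proj W x))\<^sup>2" define r' where "r' = (norm (proj W' x))\<^sup>2" define r0 where "r0 = (norm x)\<^sup>2"
  have pos: "r > 0" "r' > 0" "r0 > 0" using nz x0 by (simp_all add: r_def r'_def r0_def)
  have nrm: "cinner (proj W x) x = of_real r" "cinner (proj W' x) x = of_real r'" "cinner x x = of_real r0"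
    unfolding r_def r'_def r0_def cinner_self[symmetric] by (simp_all add: cinner_proj[OF cW(1,2)] cinner_proj[OF cW(3,4)])
  have iso: "cinner (proj W y) (proj W z) = of_real (r / r0) * cinner y z" "cinner (proj W' y) (proj W' z) = of_real (r' / r0) * cinner y z"
    if "y \<in> F" "z \<in> F" for y z
    using proj_wspan_isometry[OF cinv(1) x] proj_wspan_isometry[OF cinv(2) x] that pos by (simp_all add: F_def nrm field_simps)
  have inj: "inj_on (proj W) F" "inj_on (proj W') F"
  proof -
    have *: "y = z" if "y \<in> F" "z \<in> F" "cinner (y - z) (y - z) = 0" for y z using that by (simp add: cinner_eq_zero_iff)
    have dW: "proj W (y - z) = proj W y - proj W z" "proj W' (y - z) = proj W' y - proj W' z" for y z
      using proj_add[OF cW(1,2), of "y - z" z] proj_add[OF cW(3,4), of "y - z" z] by simp_all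
    show "inj_on (proj W) F"
    proof (rule inj_onI)
      fix y z assume yz: "y \<in> F" "z \<in> F" "proj W y = proj W z"
      have "y - z \<in> F" using yz complex_subspace_diff[OF F] by blast
      then show "y = z" using iso(1)[of "y - z" "y - z"] yz pos by (intro *) (simp_all add: dW)
    qed
    show "inj_on (proj W') F"
    proof (rule inj_onI)
      fix y z assume yz: "y \<in> F" "z \<in> F" "proj W' y = proj W' z"
      have "y - z \<in> F" using yz complex_subspace_diff[OF F] by blast
      then show "y = z" using iso(2)[of "y - z" "y - z"] yz pos by (intro *) (simp_all add: dW)
    qed
  qed
  have img: "proj W ` F = W" "proj W' ` F = W'"
    using irreducible_eq_wspan[OF W(1) x nz(1)] irreducible_eq_wspan[OF W(2) x nz(2)] by (simp_all add: F_def)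
  define lift where "lift = inv_into F (proj W)"
  have lift: "lift w \<in> F" "proj W (lift w) = w" if "w \<in> W" for w
    using that inv_into_into[of w "proj W" F] f_inv_into_f[of w "proj W" F] by (simp_all add: lift_def img)
  have lift_eq: "lift (proj W y) = y" if "y \<in> F" for y unfolding lift_def by (rule inv_into_f_f[OF inj(1) that])
  \<comment> \<open>Rescales \<open>proj W'\<close> so that it changes norms by the same factor as
    \<open>proj W\<close>.\<close>
  define c where "c = sqrt (r / r')"
  have c: "c > 0" "c * c * r' = r" using pos by (simp_all add: c_def)
  define T where "T w = c *\<^sub>R proj W' (lift w)" for w
  have TW: "T (proj W y) = c *\<^sub>R proj W' y" if "y \<in> F" for y by (simp add: T_def lift_eq that)
  show ?thesis
    unfolding equivalent_on_def
  proof (intro exI[of _ T] conjI ballI)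
    show "bij_betw T W W'"
    proof -
      have "bij_betw lift W F" using inj_on_imp_bij_betw[OF inj(1)] bij_betw_inv_into unfolding lift_def img by blast
      moreover have "bij_betw (proj W') F W'" using inj_on_imp_bij_betw[OF inj(2)] by (simp only: img)
      moreover have "bij_betw (\<lambda>y. c *\<^sub>R y) W' W'"
      proof (rule bij_betw_byWitness[where f'="\<lambda>y. inverse c *\<^sub>R y"])
        show "(\<lambda>y. c *\<^sub>R y) ` W' \<subseteq> W'" "(\<lambda>y. inverse c *\<^sub>R y) ` W' \<subseteq> W'" using complex_subspace_scaleR[OF cW(3)] by auto
      qed (use c in auto)
      ultimately have "bij_betw ((\<lambda>y. c *\<^sub>R y) \<circ> (proj W' \<circ> lift)) W W'" by (intro bij_betw_trans)
      then show ?thesis by (simp add: T_def[abs_def] o_def)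
    qed
    show "complex_linear_on W T"
      unfolding complex_linear_on_def
    proof (intro conjI ballI allI)
      fix y z assume yz: "y \<in> W" "z \<in> W"
      have "T (proj W (lift y + lift z)) = c *\<^sub>R proj W' (lift y + lift z)"
        by (intro TW complex_subspace_add[OF F] lift yz)
      then show "T (y + z) = T y + T z"
        by (simp add: proj_add[OF cW(1,2)] proj_add[OF cW(3,4)] lift yz T_def[of y] T_def[of z] scaleR_add_right)
    next
      fix a y assume y: "y \<in> W"
      have "T (proj W (scaleC a (lift y))) = c *\<^sub>R proj W' (scaleC a (lift y))"
        by (intro TW complex_subspace_scaleC[OF F] lift y)
      then show "T (scaleC a y) = scaleC a (T y)"
        by (simp add: proj_scaleC[OF cW(1,2)] proj_scaleC[OF cW(3,4)] lift y T_def[of y] scaleC_scaleR)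
    qed
    fix y assume y: "y \<in> W"
    show "cinner (T y) (T z) = cinner y z" if z: "z \<in> W" for z
    proof -
      have "cinner (T y) (T z) = of_real (c * c) * (of_real (r' / r0) * cinner (lift y) (lift z))"
        unfolding T_def cinner_real_scaleR_left cinner_real_scaleR_right iso(2)[OF lift(1)[OF y] lift(1)[OF z]] by simp
      also have "\<dots> = of_real (c * c * r' / r0) * cinner (lift y) (lift z)" by simp
      also have "\<dots> = cinner (proj W (lift y)) (proj W (lift z))" unfolding c(2) by (rule iso(1)[OF lift(1)[OF y] lift(1)[OF z], symmetric])
      finally show ?thesis by (simp add: lift y z)
    qed
  next
    fix k y assume k: "k \<in> K" and y: "y \<in> W"
    have "\<pi> k (lift y) \<in> F" unfolding F_def by (rule wspan_K_invariant[OF x x0 k]) (use lift(1)[OF y] in \<open>simp add: F_def\<close>)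
    from TW[OF this] show "T (\<pi> k y) = \<pi> k (T y)"
      by (simp add: proj_commute[OF cinv(1) k] proj_commute[OF cinv(2) k] lift y T_def[of y] pi_simps K_G[OF k])
  qed
qed

text \<open>The summands on which \<open>hw d\<close> does not project to 0 are all equivalent,
  hence finite in number by admissibility. One functional for each of them is enough to separate
  \<open>hw d\<close>.\<close>

lemma hw_findim:
  assumes adm: "admissible_restriction K \<pi>"
  shows "\<exists>N. findim N (M.hw d)"
proof -
  from adm[unfolded admissible_restriction_def]
  obtain \<W> where irr': "\<forall>W\<in>\<W>. irreducible_on K \<pi> W" and dense: "closure (span (\<Union>\<W>)) = UNIV"
    and fin': "\<forall>W\<in>\<W>. finite {W' \<in> \<W>. equivalent_on K \<pi> W W'}"
    by (elim exE conjE)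
  note irr = irr'[rule_format] and fin = fin'[rule_format]
  have cinv: "closed_invariant K \<pi> W" if "W \<in> \<W>" for W using irr[OF that] by (simp add: irreducible_on_def)
  have cW: "complex_subspace W" "closed W" if "W \<in> \<W>" for W using cinv[OF that] by (auto simp: closed_invariant_def)
  define \<S> where "\<S> = {W \<in> \<W>. \<exists>x\<in>M.hw d. proj W x \<noteq> 0}"
  have "finite \<S>"
  proof (cases "\<S> = {}")
    case False
    then obtain W where W: "W \<in> \<S>" by blast
    have "equivalent_on K \<pi> W W'" if W': "W' \<in> \<S>" for W'
    proof -
      obtain x y where xy: "x \<in> M.hw d" "y \<in> M.hw d" "proj W x \<noteq> 0" "proj W' y \<noteq> 0" using W W' by (auto simp: \<S>_def)
      have WW: "W \<in> \<W>" "W' \<in> \<W>" using W W' by (auto simp: \<S>_def)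
      have xy_in: "x + y \<in> M.hw d" using xy complex_subspace_add[OF M.hw_subspace] by blast
      \<comment> \<open>If neither \<open>x\<close> nor \<open>y\<close> has nonzero projections to
        both summands, their sum has.\<close>
      have "\<exists>z\<in>M.hw d. proj W z \<noteq> 0 \<and> proj W' z \<noteq> 0"
      proof (cases "proj W' x \<noteq> 0 \<or> proj W y \<noteq> 0")
        case True then show ?thesis using xy by blast
      next
        case False
        then show ?thesis using xy xy_in by (intro bexI[of _ "x + y"]) (simp_all add: proj_add[OF cW] WW)
      qed
      then show ?thesis using equivalent_constituents[OF irr irr] WW by blast
    qed
    then have "\<S> \<subseteq> {W' \<in> \<W>. equivalent_on K \<pi> W W'}" by (auto simp: \<S>_def)
    then show ?thesis using fin[of W] W finite_subset by (auto simp: \<S>_def)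
  qed simp
  have "\<forall>W\<in>\<S>. \<exists>x. x \<in> M.hw d \<and> proj W x \<noteq> 0" by (auto simp: \<S>_def)
  then obtain h where h: "\<And>W. W \<in> \<S> \<Longrightarrow> h W \<in> M.hw d \<and> proj W (h W) \<noteq> 0" by metis
  have "findim (card \<S>) (M.hw d)"
  proof (rule findim_functionalsI[OF M.hw_subspace \<open>finite \<S>\<close>, of d "\<lambda>W. proj W (h W)"])
    fix x assume x: "x \<in> M.hw d" and z: "\<And>W. W \<in> \<S> \<Longrightarrow> cinner x (proj W (h W)) = 0"
    have P0: "proj W x = 0" if W: "W \<in> \<W>" for W
    proof (cases "W \<in> \<S>")
      case False then show ?thesis using W x by (auto simp: \<S>_def)
    next
      case True
      note hW = h[OF True]
      \<comment> \<open>The single condition at the highest weight suffices, since the lower weight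
        vectors of the string are orthogonal to the projection of \<open>x\<close> anyway; together
        they control all of \<open>W\<close>.\<close>
      have wt0: "cinner (proj W x) (M.wt (h W) n) = 0" for n
      proof (cases "n = 0")
        case True then show ?thesis using z[OF \<open>W \<in> \<S>\<close>] by (simp add: cinner_proj_left[OF cW[OF W]])
      next
        case False then show ?thesis using proj_form_wt(1)[OF cinv[OF W] x hW[THEN conjunct1], of 0 n] by simp
      qed
      have "proj W x \<in> proj W ` M.wspan d (h W)"
        using irreducible_eq_wspan[OF irr[OF W] hW[THEN conjunct1] hW[THEN conjunct2]] proj_in[OF cW[OF W]] by blast
      then obtain a where a: "proj W x = proj W (\<Sum>n\<le>d. scaleC (a n) (M.wt (h W) n))"
        by (auto elim!: M.wspanE)
      have "cinner (proj W x) (proj W x) = cinner (proj W x) (\<Sum>n\<le>d. scaleC (a n) (M.wt (h W) n))"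
        by (subst (2) a) (rule cinner_proj[OF cW[OF W]])
      also have "\<dots> = 0" by (simp add: cinner.sum_right cinner_scaleC_right wt0)
      finally show ?thesis by (simp add: cinner_eq_zero_iff)
    qed
    have "w \<bullet> x = 0" if "w \<in> span (\<Union>\<W>)" for w
      using that
    proof (induction rule: span_induct_alt)
      case (step c w y)
      then obtain W where W: "W \<in> \<W>" "w \<in> W" by blast
      have "cinner (x - proj W x) w = 0" by (rule proj_orth[OF cW[OF W(1)] W(2)])
      then have "x \<bullet> w = 0" using P0[OF W(1)] by (metis Re_cinner diff_zero zero_complex.sel(1))
      moreover have "y \<bullet> x = 0" by (rule step)
      ultimately show ?case by (simp add: inner_add_left inner_commute[of w x])
    qed simp
    then have "span (\<Union>\<W>) \<subseteq> {w. w \<bullet> x = 0}" by (intro subsetI CollectI)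
    moreover have "closed {w. w \<bullet> x = 0}" by (intro closed_Collect_eq continuous_intros)
    ultimately have "closure (span (\<Union>\<W>)) \<subseteq> {w. w \<bullet> x = 0}" by (rule closure_minimal)
    then have "x \<in> {w. w \<bullet> x = 0}" unfolding dense by (rule subsetD) simp
    then show "x = 0" by simp
  qed
  then show ?thesis by blast
qed

end

subsection \<open>Disjoint translates\<close>

lemma cos_ge_half: assumes "0 \<le> x" "x \<le> (1::real)" shows "cos x \<ge> 1/2"
proof -
  have "cos (pi / 3) \<le> cos x" using assms pi_gt3 by (intro cos_monotone_0_pi_le) auto
  then show ?thesis by (simp add: cos_60)
qed

lemma one_minus_cos_ge: assumes "\<bar>x\<bar> \<le> (1::real)" shows "x\<^sup>2 / 4 \<le> 1 - cos x"
proof -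
  have sin: "x / 2 \<le> sin x" if x: "0 \<le> x" "x \<le> 1" for x :: real
  proof -
    have "sin 0 - 0 / 2 \<le> sin x - x / 2"
    proof (rule DERIV_nonneg_imp_nondecreasing[OF x(1)])
      fix u :: real assume "0 \<le> u" "u \<le> x"
      then have "cos u - 1/2 \<ge> 0" using cos_ge_half[of u] x by simp
      moreover have "((\<lambda>u. sin u - u / 2) has_real_derivative cos u - 1/2) (at u)" by (auto intro!: derivative_eq_intros)
      ultimately show "\<exists>y. ((\<lambda>u. sin u - u / 2) has_real_derivative y) (at u) \<and> 0 \<le> y" by blast
    qed
    then show ?thesis by simp
  qed
  have pos: "x\<^sup>2 / 4 \<le> 1 - cos x" if x: "0 \<le> x" "x \<le> 1" for x :: real
  proof -
    have "1 - cos 0 - 0\<^sup>2 / 4 \<le> 1 - cos x - x\<^sup>2 / 4"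
    proof (rule DERIV_nonneg_imp_nondecreasing[OF x(1)])
      fix u :: real assume "0 \<le> u" "u \<le> x"
      then have "sin u - u / 2 \<ge> 0" using sin[of u] x by simp
      moreover have "((\<lambda>u. 1 - cos u - u\<^sup>2 / 4) has_real_derivative sin u - u / 2) (at u)" by (auto intro!: derivative_eq_intros)
      ultimately show "\<exists>y. ((\<lambda>u. 1 - cos u - u\<^sup>2 / 4) has_real_derivative y) (at u) \<and> 0 \<le> y" by blast
    qed
    then show ?thesis by simp
  qed
  show ?thesis using pos[of "\<bar>x\<bar>"] assms by simp
qed

text \<open>Read \<open>s, c\<close> and \<open>s', c'\<close> as sines and cosines of two latitudes
  and \<open>S, C\<close> as those of a difference of longitudes: the right-hand side is the square
  of 1 minus the cosine of the spherical distance.\<close>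

lemma rotation_identity:
  fixes s s' c c' C S :: real
  assumes "s\<^sup>2 + c\<^sup>2 = 1" "s'\<^sup>2 + c'\<^sup>2 = 1" "S\<^sup>2 + C\<^sup>2 = 1"
  shows "(c * c' + s * s' * C - C)\<^sup>2 + (s * S - s' * S)\<^sup>2 = (1 - (s * s' + c * c' * C))\<^sup>2"
  using assms by algebra

text \<open>Angles in \<open>[0, 1]\<close> keep both cosines of latitude at least
  \<open>1/2\<close>, so closeness on the sphere bounds both angle differences; this is how
  \<open>1/4\<close> becomes \<open>1/16\<close> for the longitudes.\<close>

lemma rotation_distance:
  assumes "\<alpha> \<in> {0..1}" "\<alpha>' \<in> {0..1}" "\<beta> \<in> {0..1}" "\<beta>' \<in> {0..1::real}"
    and e: "\<bar>cos \<beta> * cos \<beta>' + sin \<beta> * sin \<beta>' * cos (\<alpha> - \<alpha>') - cos (\<alpha> - \<alpha>')\<bar> \<le> e"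
      "\<bar>sin \<beta> * sin (\<alpha> - \<alpha>') - sin \<beta>' * sin (\<alpha> - \<alpha>')\<bar> \<le> e"
  shows "(\<beta> - \<beta>')\<^sup>2 / 4 + (\<alpha> - \<alpha>')\<^sup>2 / 16 \<le> 2 * e"
proof -
  let ?z = "sin \<beta> * sin \<beta>' + cos \<beta> * cos \<beta>' * cos (\<alpha> - \<alpha>')"
  have e0: "e \<ge> 0" using e(2) by linarith
  have "(1 - ?z)\<^sup>2 = (cos \<beta> * cos \<beta>' + sin \<beta> * sin \<beta>' * cos (\<alpha> - \<alpha>') - cos (\<alpha> - \<alpha>'))\<^sup>2
      + (sin \<beta> * sin (\<alpha> - \<alpha>') - sin \<beta>' * sin (\<alpha> - \<alpha>'))\<^sup>2"
    by (rule rotation_identity[symmetric]) simp_all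
  also have "\<dots> \<le> e\<^sup>2 + e\<^sup>2" by (rule add_mono[OF power2_le_iff_abs_le[THEN iffD2, OF e0 e(1)] power2_le_iff_abs_le[THEN iffD2, OF e0 e(2)]])
  also have "\<dots> \<le> (2 * e)\<^sup>2" by (simp add: power2_eq_square)
  finally have "1 - ?z \<le> 2 * e" by (rule power2_le_imp_le) (use e0 in simp)
  moreover have "1 - ?z = (1 - cos (\<beta> - \<beta>')) + cos \<beta> * cos \<beta>' * (1 - cos (\<alpha> - \<alpha>'))"
    unfolding cos_diff[of \<beta> \<beta>'] by (simp add: right_diff_distrib)
  moreover have "(\<beta> - \<beta>')\<^sup>2 / 4 \<le> 1 - cos (\<beta> - \<beta>')" using assms(1-4) by (intro one_minus_cos_ge) auto
  moreover have "(1/4) * ((\<alpha> - \<alpha>')\<^sup>2 / 4) \<le> cos \<beta> * cos \<beta>' * (1 - cos (\<alpha> - \<alpha>'))"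
  proof (rule mult_mono)
    have c: "1/2 \<le> cos \<beta>" "1/2 \<le> cos \<beta>'" using assms(3,4) cos_ge_half by auto
    have "(1/2) * (1/2) \<le> cos \<beta> * cos \<beta>'" by (rule mult_mono[OF c]) (use c in simp_all)
    then show "1/4 \<le> cos \<beta> * cos \<beta>'" by simp
    then show "0 \<le> cos \<beta> * cos \<beta>'" by simp
    show "(\<alpha> - \<alpha>')\<^sup>2 / 4 \<le> 1 - cos (\<alpha> - \<alpha>')" using assms(1-4) by (intro one_minus_cos_ge) auto
  qed simp
  ultimately show ?thesis by simp
qed

definition Adm :: "complex^'m^'m \<Rightarrow> real \<Rightarrow> complex^'m^'m \<Rightarrow> complex^'m^'m" where
  "Adm X t Y = mexp (t *\<^sub>R X) ** Y ** mexp (- t *\<^sub>R X)"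

lemma Adm_linear: "Adm X t (Y + Z) = Adm X t Y + Adm X t Z" "Adm X t (Y - Z) = Adm X t Y - Adm X t Z"
  "Adm X t (r *\<^sub>R Y) = r *\<^sub>R Adm X t Y" "Adm X t (- Y) = - Adm X t Y"
  by (simp_all add: Adm_def matmul.add_left matmul.add_right matmul.diff_left matmul.diff_right
      matmul.scaleR_left matmul.scaleR_right matmul.minus_left matmul.minus_right)

lemma Adm_fixed: assumes "X ** Y = Y ** X" shows "Adm X t Y = Y"
  unfolding Adm_def by (rule Ad_eqI[of "\<lambda>_. Y"]) (simp_all add: assms)

lemma Adm_add: "Adm X s (Adm X t Y) = Adm X (s + t) Y"
proof -
  have e: "- (s + t) = - t + - s" by simp
  show ?thesis unfolding Adm_def e mexp_add_scaleR[of s t] mexp_add_scaleR[of "- t" "- s"] by (simp add: matrix_mul_assoc)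
qed

context so31 begin

lemma comm_neg: "X ** Y - Y ** X = Z \<Longrightarrow> X ** (- Y) - (- Y) ** X = - (Z :: complex^'m^'m)"
  by (drule sym) (simp add: matmul.minus_left matmul.minus_right)

lemma Adm_L1: "Adm L1 s L1 = L1" "Adm L1 s B2 = cos s *\<^sub>R B2 + sin s *\<^sub>R B3" "Adm L1 s L3 = cos s *\<^sub>R L3 - sin s *\<^sub>R L2"
  using Ad_rotation[OF LB(1) LB(4), of s] Ad_rotation[OF LL_opp(3) comm_neg[OF LL(1)], of s]
  by (simp_all add: Adm_fixed) (simp_all add: Adm_def)

lemma Adm_L2: "Adm L2 s L2 = L2" "Adm L2 s B2 = B2" "Adm L2 s L1 = cos s *\<^sub>R L1 - sin s *\<^sub>R L3"
  "Adm L2 s L3 = cos s *\<^sub>R L3 + sin s *\<^sub>R L1" "Adm L2 s B3 = cos s *\<^sub>R B3 + sin s *\<^sub>R B1"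
  using Ad_rotation[OF LL_opp(1) comm_neg[OF LL(2)], of s] Ad_rotation[OF LL(2) LL_opp(1), of s]
    Ad_rotation[OF LB(2) LB(5), of s]
  by (simp_all add: Adm_fixed LB_diag) (simp_all add: Adm_def)

lemma Adm_B3: "Adm B3 s L1 = cosh s *\<^sub>R L1 + sinh s *\<^sub>R B2" "Adm B3 s B2 = cosh s *\<^sub>R B2 + sinh s *\<^sub>R L1"
  "Adm B3 s L2 = cosh s *\<^sub>R L2 - sinh s *\<^sub>R B1" "Adm B3 s B1 = cosh s *\<^sub>R B1 - sinh s *\<^sub>R L2"
  "Adm B3 s L3 = L3" "Adm B3 s B3 = B3"
proof -
  have "B3 ** (- B1) - (- B1) ** B3 = L2" "B3 ** (- L2) - (- L2) ** B3 = B1"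
    using comm_neg[OF BB(3)] comm_neg[OF brackets_opp(2)] by simp_all
  then show "Adm B3 s L1 = cosh s *\<^sub>R L1 + sinh s *\<^sub>R B2" "Adm B3 s B2 = cosh s *\<^sub>R B2 + sinh s *\<^sub>R L1"
    "Adm B3 s L2 = cosh s *\<^sub>R L2 - sinh s *\<^sub>R B1" "Adm B3 s B1 = cosh s *\<^sub>R B1 - sinh s *\<^sub>R L2"
    using Ad_boost[OF brackets_opp(4,8), of s] Ad_boost[OF brackets_opp(8,4), of s]
      Ad_boost[OF brackets_opp(2), of s] Ad_boost[OF BB(3), of s] by (simp_all add: Adm_def)
qed (simp_all add: Adm_fixed LB_diag)

text \<open>A root vector: \<open>B3\<close> brackets \<open>L1\<close> to \<open>B2\<close> and
  \<open>B2\<close> to \<open>L1\<close>, so conjugation by \<open>exp (s B3)\<close> multiplies the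
  sum by \<open>exp s\<close>.\<close>

definition EE where "EE = L1 + B2"

lemma Adm_B3_EE: "Adm B3 (- t) EE = exp (- t) *\<^sub>R EE"
proof -
  have "cosh t - sinh t = exp (- t)" by (rule cosh_minus_sinh)
  then have "exp (- t) *\<^sub>R EE = (cosh t - sinh t) *\<^sub>R L1 + (cosh t - sinh t) *\<^sub>R B2" by (simp add: EE_def scaleR_add_right)
  then show ?thesis by (simp add: EE_def Adm_linear Adm_B3 scaleR_diff_left)
qed

lemma Adm_k_EE: "Adm L1 \<alpha> (Adm L2 \<beta> EE)
  = cos \<beta> *\<^sub>R L1 + (sin \<beta> * sin \<alpha>) *\<^sub>R L2 + (- sin \<beta> * cos \<alpha>) *\<^sub>R L3 + 0 *\<^sub>R B1 + cos \<alpha> *\<^sub>R B2 + sin \<alpha> *\<^sub>R B3"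
  by (simp add: EE_def Adm_linear Adm_L1 Adm_L2 scaleR_diff_right)

lemma Adm_h_EE: "Adm B3 (- t) (Adm L2 (- \<beta>') (Adm L1 \<delta> (Adm L2 \<beta> EE)))
  = ((cos \<beta> * cos \<beta>' + sin \<beta> * sin \<beta>' * cos \<delta>) * cosh t - cos \<delta> * sinh t) *\<^sub>R L1
  + (sin \<beta> * sin \<delta> * cosh t - sin \<beta>' * sin \<delta> * sinh t) *\<^sub>R L2
  + (cos \<beta> * sin \<beta>' - sin \<beta> * cos \<delta> * cos \<beta>') *\<^sub>R L3
  + (- (sin \<beta>' * sin \<delta>) * cosh t + sin \<beta> * sin \<delta> * sinh t) *\<^sub>R B1
  + (cos \<delta> * cosh t - (cos \<beta> * cos \<beta>' + sin \<beta> * sin \<beta>' * cos \<delta>) * sinh t) *\<^sub>R B2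
  + (sin \<delta> * cos \<beta>') *\<^sub>R B3"
  unfolding Adm_k_EE by (simp add: Adm_linear Adm_L2 Adm_B3 algebra_simps)

text \<open>An injective linear map on a finite-dimensional space is bounded below; injectivity is
  the independence of the generators.\<close>

lemma coefficient_bound:
  "\<exists>\<kappa>>0. \<forall>a1 a2 a3 b1 b2 b3 n. n = norm (a1 *\<^sub>R L1 + a2 *\<^sub>R L2 + a3 *\<^sub>R L3 + b1 *\<^sub>R B1 + b2 *\<^sub>R B2 + b3 *\<^sub>R B3)
    \<longrightarrow> \<bar>a1\<bar> \<le> \<kappa> * n \<and> \<bar>a2\<bar> \<le> \<kappa> * n \<and> \<bar>b1\<bar> \<le> \<kappa> * n \<and> \<bar>b2\<bar> \<le> \<kappa> * n"
proof -
  define f where "f = (\<lambda>(a1, a2, a3, b1, b2, b3). a1 *\<^sub>R L1 + a2 *\<^sub>R L2 + a3 *\<^sub>R L3 + b1 *\<^sub>R B1 + b2 *\<^sub>R B2 + b3 *\<^sub>R B3)"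
  have lin: "linear f" by (rule linearI) (auto simp: f_def algebra_simps)
  have "inj f"
    unfolding linear_injective_0[OF lin]
  proof (intro allI impI)
    fix z assume "f z = 0"
    then show "z = 0" unfolding f_def by (cases z) (use indep in \<open>force simp: zero_prod_def\<close>)
  qed
  then obtain B where B: "B > 0" "\<And>z. B * norm z \<le> norm (f z)" using linear_inj_bounded_below_pos[OF lin] by blast
  show ?thesis
  proof (intro exI[of _ "inverse B"] conjI allI impI)
    fix a1 a2 a3 b1 b2 b3 n assume n: "n = norm (a1 *\<^sub>R L1 + a2 *\<^sub>R L2 + a3 *\<^sub>R L3 + b1 *\<^sub>R B1 + b2 *\<^sub>R B2 + b3 *\<^sub>R B3)"
    define z where "z = (a1, a2, a3, b1, b2, b3)"
    have "norm z \<le> inverse B * n" using B(2)[of z] B(1) by (simp add: z_def f_def n field_simps)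
    moreover have "\<bar>a1\<bar> \<le> norm z" using norm_fst_le[of a1 "(a2, a3, b1, b2, b3)"] by (simp add: z_def)
    moreover have "\<bar>a2\<bar> \<le> norm z"
      using norm_fst_le[of a2 "(a3, b1, b2, b3)"] norm_snd_le[of "(a2, a3, b1, b2, b3)" a1] by (simp add: z_def)
    moreover have "\<bar>b1\<bar> \<le> norm z" "\<bar>b2\<bar> \<le> norm z"
      using norm_fst_le[of b1 "(b2, b3)"] norm_fst_le[of b2 b3] norm_snd_le[of "(b2, b3)" b1] norm_snd_le[of "(b1, b2, b3)" a3]
        norm_snd_le[of "(a3, b1, b2, b3)" a2] norm_snd_le[of "(a2, a3, b1, b2, b3)" a1] by (simp_all add: z_def)
    ultimately show "\<bar>a1\<bar> \<le> inverse B * n" "\<bar>a2\<bar> \<le> inverse B * n" "\<bar>b1\<bar> \<le> inverse B * n" "\<bar>b2\<bar> \<le> inverse B * n"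
      by linarith+
  qed (use B in simp)
qed

end

context rep begin

abbreviation kk where "kk \<alpha> \<beta> \<equiv> mexp (\<alpha> *\<^sub>R L1) ** mexp (\<beta> *\<^sub>R L2)"
abbreviation ki where "ki \<alpha> \<beta> \<equiv> mexp (- \<beta> *\<^sub>R L2) ** mexp (- \<alpha> *\<^sub>R L1)"
abbreviation aa where "aa t \<equiv> mexp (t *\<^sub>R B3)"

lemma exp_inv: "mexp (t *\<^sub>R X) ** mexp (- t *\<^sub>R X) = mat 1" "mexp (- t *\<^sub>R X) ** mexp (t *\<^sub>R X) = (mat 1 :: complex^'m^'m)"
  using mexp_minus[of "t *\<^sub>R X"] by simp_all

lemma cancel_left: "u ** v = mat 1 \<Longrightarrow> u ** (v ** w) = (w :: complex^'m^'m)"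
  by (simp add: matrix_mul_assoc)

lemma kk_inv: "kk \<alpha> \<beta> ** ki \<alpha> \<beta> = mat 1" "ki \<alpha> \<beta> ** kk \<alpha> \<beta> = mat 1"
  by (simp_all add: matmul_assoc cancel_left[OF exp_inv(1)] cancel_left[OF exp_inv(2)] exp_inv del: scaleR_minus_left)

lemma kk_G: "kk \<alpha> \<beta> \<in> G" "ki \<alpha> \<beta> \<in> G" and aa_G: "aa t \<in> G"
  by (intro G_mult E_G basis_E)+

lemma inverse_G:
  assumes "c \<in> G" shows "c ** matrix_inv c = mat 1" "matrix_inv c ** c = mat 1" "matrix_inv c \<in> G"
  using someI_ex[OF matrix_lie_groupD(3)[OF G assms, unfolded invertible_def]] matrix_lie_groupD(4)[OF G assms]
  by (simp_all add: matrix_inv_def)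

text \<open>\<open>norm (c ** u)\<close> has a positive minimum over \<open>c \<in> C0\<close> and
  unit \<open>u\<close>; evaluate it at the normalized inverse of \<open>c\<close>.\<close>

lemma C0_inverse_bounded: obtains \<rho> where "\<And>c. c \<in> C0 \<Longrightarrow> norm (matrix_inv c) \<le> \<rho>"
proof -
  define f where "f = (\<lambda>z :: (complex^'m^'m) \<times> (complex^'m^'m). norm (fst z ** snd z))"
  have "mat 1 \<in> C0" by (simp add: C0_def G_one R_def)
  then have ne: "C0 \<times> sphere (0 :: complex^'m^'m) 1 \<noteq> {}" by auto
  have "continuous_on (C0 \<times> sphere 0 1) f"
    unfolding f_def by (intro continuous_on_norm matmul.continuous_on continuous_on_fst continuous_on_snd continuous_on_id)
  from continuous_attains_inf[OF compact_Times[OF compact_C0 compact_sphere] ne this]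
  obtain z where z: "z \<in> C0 \<times> sphere 0 1" and min: "\<And>y. y \<in> C0 \<times> sphere 0 1 \<Longrightarrow> f z \<le> f y" by blast
  have "fst z \<in> C0" "norm (snd z) = 1" using z by auto
  then have "fst z \<in> G" using C0_sub by blast
  have "f z \<noteq> 0"
  proof
    assume "f z = 0"
    then have "matrix_inv (fst z) ** (fst z ** snd z) = 0" by (simp add: f_def matmul.zero_right)
    then have "snd z = 0" by (simp only: cancel_left[OF inverse_G(2)[OF \<open>fst z \<in> G\<close>]])
    then show False using \<open>norm (snd z) = 1\<close> by simp
  qed
  then have pos: "f z > 0" by (simp add: f_def)
  have "norm (matrix_inv c) \<le> norm (mat 1 :: complex^'m^'m) / f z" if c: "c \<in> C0" for c
  proof (cases "matrix_inv c = 0")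
    case False
    have cG: "c \<in> G" using c C0_sub by blast
    define u where "u = matrix_inv c /\<^sub>R norm (matrix_inv c)"
    have "f z \<le> f (c, u)" using False c by (intro min) (simp add: u_def)
    also have "f (c, u) = norm (mat 1 :: complex^'m^'m) / norm (matrix_inv c)"
      using False inverse_G(1)[OF cG] by (simp add: f_def u_def matmul.scaleR_right divide_inverse_commute)
    finally show ?thesis using pos False by (simp add: field_simps)
  qed (use pos in simp)
  then show thesis by (rule that)
qed

text \<open>Letting the inverse of \<open>c\<close> vary independently in a ball turns this into a
  continuous function on a compact set.\<close>

lemma conj_bounded:
  fixes P P' :: "(complex^'m^'m) set"
  assumes P: "compact P" "compact P'"
  shows "\<exists>\<Gamma>>0. \<forall>p\<in>P. \<forall>c\<in>C0. \<forall>p'\<in>P'. norm (p ** matrix_inv c ** EE ** c ** p') \<le> \<Gamma>"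
proof -
  obtain \<rho> where \<rho>: "\<And>c. c \<in> C0 \<Longrightarrow> norm (matrix_inv c) \<le> \<rho>" using C0_inverse_bounded by blast
  define f where "f = (\<lambda>z :: (complex^'m^'m) \<times> (complex^'m^'m) \<times> (complex^'m^'m) \<times> (complex^'m^'m).
    fst z ** fst (snd z) ** EE ** fst (snd (snd z)) ** snd (snd (snd z)))"
  have "continuous_on (P \<times> cball 0 \<rho> \<times> C0 \<times> P') f"
    unfolding f_def by (intro matmul.continuous_on continuous_on_fst continuous_on_snd continuous_on_id continuous_on_const)
  then have "bounded (f ` (P \<times> cball 0 \<rho> \<times> C0 \<times> P'))"
    by (intro compact_imp_bounded compact_continuous_image compact_Times P compact_C0 compact_cball)
  then obtain \<Gamma> where \<Gamma>: "\<Gamma> > 0" "\<And>y. y \<in> f ` (P \<times> cball 0 \<rho> \<times> C0 \<times> P') \<Longrightarrow> norm y \<le> \<Gamma>"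
    unfolding bounded_pos by blast
  show ?thesis
  proof (intro exI[of _ \<Gamma>] conjI ballI \<Gamma>(1))
    fix p c p' assume "p \<in> P" "c \<in> C0" "p' \<in> P'"
    then have "(p, matrix_inv c, c, p') \<in> P \<times> cball 0 \<rho> \<times> C0 \<times> P'" using \<rho> by simp
    from \<Gamma>(2)[OF imageI[OF this]] show "norm (p ** matrix_inv c ** EE ** c ** p') \<le> \<Gamma>" by (simp add: f_def)
  qed
qed

lemma conj_at: "mexp (- t *\<^sub>R B3) ** EE ** aa t = exp (- t) *\<^sub>R EE"
  using Adm_B3_EE[of t] by (simp add: Adm_def)

text \<open>If two translates meet, then \<open>h = k'\<inverse> k\<close> satisfies \<open>Ad (a\<^sub>t\<inverse> h) EE = exp (-t) Ad (c' c\<inverse>) EE\<close>. The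
  component of \<open>Ad h EE\<close> that \<open>Ad (a\<^sub>t\<inverse>)\<close> expands has length \<open>1 - cos \<theta>\<close>, where \<open>\<theta>\<close> is the angle by
  which \<open>h\<close> moves the third axis; so \<open>\<theta>\<close> is at most of order \<open>exp (-t)\<close>.\<close>

lemma separation:
  "\<exists>D>0. \<forall>t \<alpha> \<alpha>' \<beta> \<beta>' c c'. \<alpha> \<in> {0..1} \<longrightarrow> \<alpha>' \<in> {0..1} \<longrightarrow> \<beta> \<in> {0..1} \<longrightarrow> \<beta>' \<in> {0..1} \<longrightarrow> c \<in> C0 \<longrightarrow> c' \<in> C0 \<longrightarrow>
    kk \<alpha> \<beta> ** aa t ** c = kk \<alpha>' \<beta>' ** aa t ** c' \<longrightarrow> (\<beta> - \<beta>')\<^sup>2 / 4 + (\<alpha> - \<alpha>')\<^sup>2 / 16 \<le> D * (exp (- t))\<^sup>2"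
proof -
  obtain \<kappa> where \<kappa>0: "\<kappa> > 0" and \<kappa>': "\<forall>a1 a2 a3 b1 b2 b3 n. n = norm (a1 *\<^sub>R L1 + a2 *\<^sub>R L2 + a3 *\<^sub>R L3 + b1 *\<^sub>R B1 + b2 *\<^sub>R B2 + b3 *\<^sub>R B3)
    \<longrightarrow> \<bar>a1\<bar> \<le> \<kappa> * n \<and> \<bar>a2\<bar> \<le> \<kappa> * n \<and> \<bar>b1\<bar> \<le> \<kappa> * n \<and> \<bar>b2\<bar> \<le> \<kappa> * n"
    using coefficient_bound by (elim exE conjE)
  note \<kappa> = \<kappa>0 \<kappa>'[rule_format]
  obtain \<rho> where \<rho>: "\<And>c. c \<in> C0 \<Longrightarrow> norm (matrix_inv c) \<le> \<rho>" using C0_inverse_bounded by blast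
  obtain \<Gamma> where \<Gamma>0: "\<Gamma> > 0" and \<Gamma>': "\<forall>p\<in>C0. \<forall>c\<in>C0. \<forall>p'\<in>cball (0 :: complex^'m^'m) \<rho>. norm (p ** matrix_inv c ** EE ** c ** p') \<le> \<Gamma>"
    using conj_bounded[OF compact_C0 compact_cball[of 0 \<rho>]] by (elim exE conjE)
  note \<Gamma> = \<Gamma>0 \<Gamma>'[rule_format]
  show ?thesis
  proof (intro exI[of _ "4 * (\<kappa> * \<Gamma>)"] conjI allI impI)
    show "4 * (\<kappa> * \<Gamma>) > 0" using \<kappa>(1) \<Gamma>(1) by simp
    fix t \<alpha> \<alpha>' \<beta> \<beta>' c c'
    assume ab: "\<alpha> \<in> {0..1}" "\<alpha>' \<in> {0..1}" "\<beta> \<in> {0..1}" "\<beta>' \<in> {0..1::real}" and c: "c \<in> C0" "c' \<in> C0"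
      and eq: "kk \<alpha> \<beta> ** aa t ** c = kk \<alpha>' \<beta>' ** aa t ** c'"
    have cG: "c \<in> G" "c' \<in> G" using c C0_sub by auto
    let ?d = "matrix_inv c" and ?d' = "matrix_inv c'"
    let ?a' = "mexp (- t *\<^sub>R B3)"
    define V where "V = Adm B3 (- t) (Adm L2 (- \<beta>') (Adm L1 (\<alpha> - \<alpha>') (Adm L2 \<beta> EE)))"
    have V: "V = exp (- t) *\<^sub>R (c' ** ?d ** EE ** c ** ?d')"
    proof -
      have "V = Adm B3 (- t) (Adm L2 (- \<beta>') (Adm L1 (- \<alpha>') (Adm L1 \<alpha> (Adm L2 \<beta> EE))))"
        by (simp add: V_def Adm_add)
      also have "\<dots> = (?a' ** ki \<alpha>' \<beta>' ** kk \<alpha> \<beta>) ** EE ** (ki \<alpha> \<beta> ** kk \<alpha>' \<beta>' ** aa t)"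
        unfolding Adm_def by (simp only: minus_minus matrix_mul_assoc)
      also have "?a' ** ki \<alpha>' \<beta>' ** kk \<alpha> \<beta> = c' ** ?d ** ?a'"
      proof -
        have "?a' ** ki \<alpha>' \<beta>' ** kk \<alpha> \<beta> = ?a' ** (ki \<alpha>' \<beta>' ** (kk \<alpha> \<beta> ** aa t ** c)) ** ?d ** ?a'"
          by (simp only: matmul_assoc cancel_left[OF inverse_G(1)[OF cG(1)]] exp_inv matrix_mul_rid)
        also have "ki \<alpha>' \<beta>' ** (kk \<alpha> \<beta> ** aa t ** c) = aa t ** c'"
          unfolding eq by (simp only: matrix_mul_assoc kk_inv[unfolded matrix_mul_assoc] matrix_mul_lid)
        also have "?a' ** (aa t ** c') = c'" by (rule cancel_left[OF exp_inv(2)])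
        finally show ?thesis .
      qed
      also have "ki \<alpha> \<beta> ** kk \<alpha>' \<beta>' ** aa t = aa t ** c ** ?d'"
      proof -
        have "ki \<alpha> \<beta> ** kk \<alpha>' \<beta>' ** aa t = ki \<alpha> \<beta> ** (kk \<alpha>' \<beta>' ** aa t ** c') ** ?d'"
          by (simp only: matmul_assoc inverse_G(1)[OF cG(2)] matrix_mul_rid)
        also have "ki \<alpha> \<beta> ** (kk \<alpha>' \<beta>' ** aa t ** c') = aa t ** c"
          unfolding eq[symmetric] by (simp only: matrix_mul_assoc kk_inv[unfolded matrix_mul_assoc] matrix_mul_lid)
        finally show ?thesis .
      qed
      also have "c' ** ?d ** ?a' ** EE ** (aa t ** c ** ?d') = c' ** ?d ** (?a' ** EE ** aa t) ** c ** ?d'"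
        by (simp only: matrix_mul_assoc)
      finally show ?thesis unfolding conj_at by (simp only: matmul.scaleR_left matmul.scaleR_right)
    qed
    have nV: "norm V \<le> exp (- t) * \<Gamma>"
      unfolding V norm_scaleR using \<Gamma>(2)[OF c(2,1)] \<rho>[OF c(2)] by simp
    define \<delta> where "\<delta> = \<alpha> - \<alpha>'"
    define h11 where "h11 = cos \<beta> * cos \<beta>' + sin \<beta> * sin \<beta>' * cos \<delta>"
    have small: "\<bar>w\<bar> \<le> 2 * (\<kappa> * \<Gamma>) * (exp (- t))\<^sup>2" if "exp t * w = p + r" "\<bar>p\<bar> \<le> \<kappa> * norm V" "\<bar>r\<bar> \<le> \<kappa> * norm V" for w p r
    proof -
      have "exp t * \<bar>w\<bar> \<le> 2 * (\<kappa> * norm V)" using that abs_mult[of "exp t" w] by simp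
      also have "\<dots> \<le> 2 * (\<kappa> * (exp (- t) * \<Gamma>))" using nV \<kappa>(1) by simp
      finally have "exp (- t) * (exp t * \<bar>w\<bar>) \<le> exp (- t) * (2 * (\<kappa> * (exp (- t) * \<Gamma>)))" by (rule mult_left_mono) simp
      moreover have "exp (- t) * (exp t * \<bar>w\<bar>) = \<bar>w\<bar>" by (simp add: mult.assoc[symmetric] flip: exp_add)
      moreover have "exp (- t) * (2 * (\<kappa> * (exp (- t) * \<Gamma>))) = 2 * (\<kappa> * \<Gamma>) * (exp (- t))\<^sup>2"
        by (simp add: power2_eq_square)
      ultimately show ?thesis by (simp only:)
    qed
    have es: "exp t = cosh t + sinh t" by (simp add: cosh_plus_sinh)
    have "norm V = norm ((h11 * cosh t - cos \<delta> * sinh t) *\<^sub>R L1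
      + (sin \<beta> * sin \<delta> * cosh t - sin \<beta>' * sin \<delta> * sinh t) *\<^sub>R L2
      + (cos \<beta> * sin \<beta>' - sin \<beta> * cos \<delta> * cos \<beta>') *\<^sub>R L3
      + (- (sin \<beta>' * sin \<delta>) * cosh t + sin \<beta> * sin \<delta> * sinh t) *\<^sub>R B1
      + (cos \<delta> * cosh t - h11 * sinh t) *\<^sub>R B2 + (sin \<delta> * cos \<beta>') *\<^sub>R B3)"
      unfolding V_def h11_def \<delta>_def by (rule arg_cong[OF Adm_h_EE])
    note co4 = \<kappa>(2)[OF this]
    note co = co4[THEN conjunct1] co4[THEN conjunct2, THEN conjunct2, THEN conjunct2]
      co4[THEN conjunct2, THEN conjunct1] co4[THEN conjunct2, THEN conjunct2, THEN conjunct1]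
    \<comment> \<open>The coefficient of \<open>L1\<close> minus that of \<open>B2\<close>, and the
      coefficient of \<open>L2\<close> plus that of \<open>B1\<close>, carry a factor
      \<open>exp t\<close>. As \<open>V\<close> is of size \<open>exp (-t)\<close>, the remaining
      factors are of size \<open>exp (-2t)\<close>.\<close>
    have "\<bar>h11 - cos \<delta>\<bar> \<le> 2 * (\<kappa> * \<Gamma>) * (exp (- t))\<^sup>2"
      by (rule small[OF _ co(1), of _ "- (cos \<delta> * cosh t - h11 * sinh t)"]) (use co(2) in \<open>simp_all add: es algebra_simps\<close>)
    moreover have "\<bar>sin \<beta> * sin \<delta> - sin \<beta>' * sin \<delta>\<bar> \<le> 2 * (\<kappa> * \<Gamma>) * (exp (- t))\<^sup>2"
      by (rule small[OF _ co(3) co(4)]) (simp add: es algebra_simps)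
    ultimately have "(\<beta> - \<beta>')\<^sup>2 / 4 + (\<alpha> - \<alpha>')\<^sup>2 / 16 \<le> 2 * (2 * (\<kappa> * \<Gamma>) * (exp (- t))\<^sup>2)"
      unfolding h11_def \<delta>_def by (intro rotation_distance ab)
    then show "(\<beta> - \<beta>')\<^sup>2 / 4 + (\<alpha> - \<alpha>')\<^sup>2 / 16 \<le> 4 * (\<kappa> * \<Gamma>) * (exp (- t))\<^sup>2" by simp
  qed
qed

text \<open>If \<open>k a\<^sub>t c = x\<close>, then
  \<open>Ad k EE = exp (-t) Ad (x c\<inverse>) EE\<close> is of size \<open>exp (-t)\<close>; but
  its coefficient at \<open>L1\<close> is \<open>cos \<beta>\<close>, at least
  \<open>1/2\<close>.\<close>

lemma escape:
  assumes x: "x \<in> G"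
  shows "\<forall>\<^sub>F t in at_top. \<forall>\<alpha>. \<forall>\<beta>\<in>{0..1}. \<forall>c\<in>C0. kk \<alpha> \<beta> ** aa t ** c \<noteq> x"
proof -
  obtain \<kappa> where \<kappa>0: "\<kappa> > 0" and \<kappa>': "\<forall>a1 a2 a3 b1 b2 b3 n. n = norm (a1 *\<^sub>R L1 + a2 *\<^sub>R L2 + a3 *\<^sub>R L3 + b1 *\<^sub>R B1 + b2 *\<^sub>R B2 + b3 *\<^sub>R B3)
    \<longrightarrow> \<bar>a1\<bar> \<le> \<kappa> * n \<and> \<bar>a2\<bar> \<le> \<kappa> * n \<and> \<bar>b1\<bar> \<le> \<kappa> * n \<and> \<bar>b2\<bar> \<le> \<kappa> * n"
    using coefficient_bound by (elim exE conjE)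
  note \<kappa> = \<kappa>0 \<kappa>'[rule_format]
  have cs: "compact {x}" "compact {matrix_inv x}" by simp_all
  obtain \<Gamma> where \<Gamma>0: "\<Gamma> > 0" and \<Gamma>': "\<forall>p\<in>{x}. \<forall>c\<in>C0. \<forall>p'\<in>{matrix_inv x}. norm (p ** matrix_inv c ** EE ** c ** p') \<le> \<Gamma>"
    using conj_bounded[OF cs] by (elim exE conjE)
  note \<Gamma> = \<Gamma>0 \<Gamma>'[rule_format]
  have "exp t \<le> 2 * (\<kappa> * \<Gamma>)" if \<beta>: "\<beta> \<in> {0..1}" and c: "c \<in> C0" and eq: "kk \<alpha> \<beta> ** aa t ** c = x" for t \<alpha> \<beta> c
  proof -
    have cG: "c \<in> G" using c C0_sub by auto
    let ?d = "matrix_inv c" and ?x' = "matrix_inv x" and ?a' = "mexp (- t *\<^sub>R B3)"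
    have "Adm L1 \<alpha> (Adm L2 \<beta> EE) = kk \<alpha> \<beta> ** EE ** ki \<alpha> \<beta>" unfolding Adm_def by (simp only: matrix_mul_assoc)
    also have "kk \<alpha> \<beta> = x ** ?d ** ?a'"
      unfolding eq[symmetric] by (simp only: matmul_assoc cancel_left[OF inverse_G(1)[OF cG]] exp_inv matrix_mul_rid)
    also have "ki \<alpha> \<beta> = aa t ** c ** ?x'"
    proof -
      have "ki \<alpha> \<beta> = ki \<alpha> \<beta> ** (x ** ?x')" by (simp only: inverse_G(1)[OF x] matrix_mul_rid)
      also have "\<dots> = ki \<alpha> \<beta> ** kk \<alpha> \<beta> ** aa t ** c ** ?x'" unfolding eq[symmetric] by (simp only: matrix_mul_assoc)
      finally show ?thesis by (simp only: kk_inv matrix_mul_lid)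
    qed
    also have "x ** ?d ** ?a' ** EE ** (aa t ** c ** ?x') = x ** ?d ** (?a' ** EE ** aa t) ** c ** ?x'"
      by (simp only: matrix_mul_assoc)
    finally have V: "Adm L1 \<alpha> (Adm L2 \<beta> EE) = exp (- t) *\<^sub>R (x ** ?d ** EE ** c ** ?x')"
      unfolding conj_at by (simp only: matmul.scaleR_left matmul.scaleR_right)
    have "norm (Adm L1 \<alpha> (Adm L2 \<beta> EE)) \<le> exp (- t) * \<Gamma>"
      unfolding V norm_scaleR using \<Gamma>(2)[OF _ c] by simp
    then have "\<kappa> * norm (Adm L1 \<alpha> (Adm L2 \<beta> EE)) \<le> \<kappa> * (exp (- t) * \<Gamma>)" using \<kappa>(1) by simp
    moreover have "\<bar>cos \<beta>\<bar> \<le> \<kappa> * norm (Adm L1 \<alpha> (Adm L2 \<beta> EE))"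
      by (rule \<kappa>(2)[OF arg_cong[OF Adm_k_EE, of norm], THEN conjunct1])
    moreover have "1/2 \<le> cos \<beta>" using cos_ge_half \<beta> by auto
    ultimately have "1/2 \<le> \<kappa> * (exp (- t) * \<Gamma>)" by linarith
    then show ?thesis by (simp add: exp_minus field_simps)
  qed
  moreover have "\<forall>\<^sub>F t in at_top. exp t > 2 * (\<kappa> * \<Gamma>)"
    using filterlim_at_top_dense[THEN iffD1, OF exp_at_top] by blast
  ultimately show ?thesis by (auto elim!: eventually_mono simp: not_less[symmetric])
qed

end

subsection \<open>Decay of matrix coefficients\<close>

context rep_K begin

lemma kk_K: "kk \<alpha> \<beta> \<in> K"
proof -
  have mult: "a ** c \<in> K" if "a \<in> K" "c \<in> K" for a c
    using generate.eng[of a GL "mexp ` LL_span" c] that by (simp add: K GL_def)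
  show ?thesis using mult[OF exp_K[of \<alpha> 0 0] exp_K[of 0 \<beta> 0]] by simp
qed

lemma wspan_closed_invariant:
  assumes x: "x \<in> M.hw d" "x \<noteq> 0" shows "closed_invariant K \<pi> (M.wspan d x)"
  using wspan_closed[OF closed_invariant_UNIV x(1)] x(2) wspan_K_invariant[OF x]
  by (auto simp: closed_invariant_def M.wspan_subspace)

text \<open>Parseval for the orthogonal weight vectors. It shows that the squared norm of a
  projected orbit is a finite sum of squared coefficients, hence integrable over
  \<open>G\<close>.\<close>

lemma norm_proj_wspan:
  assumes x: "x \<in> M.hw d" "x \<noteq> 0"
  shows "(norm (proj (M.wspan d x) z))\<^sup>2 = (\<Sum>n\<le>d. (cmod (cinner z (M.wt x n)))\<^sup>2 / (norm (M.wt x n))\<^sup>2)"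
proof -
  let ?e = "M.wt x"
  have F: "complex_subspace (M.wspan d x)" "closed (M.wspan d x)"
    using wspan_closed_invariant[OF x] by (auto simp: closed_invariant_def)
  have nz: "?e n \<noteq> 0" if "n \<le> d" for n using M.wt_nonzero[OF x(1) x(2) that] .
  define p where "p = (\<Sum>n\<le>d. scaleC (cinner z (?e n) / cinner (?e n) (?e n)) (?e n))"
  have pe: "cinner p (?e n) = cinner z (?e n)" if n: "n \<le> d" for n
  proof -
    have "cinner p (?e n) = (\<Sum>k\<le>d. if k = n then cinner z (?e n) else 0)"
      unfolding p_def cinner.sum_left
      by (intro sum.cong) (auto simp: cinner_scaleC_left M.wt_orth[OF x(1) x(1)] nz cinner_eq_zero_iff)
    then show ?thesis using n by simp
  qed
  have "proj (M.wspan d x) z = p"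
  proof (rule proj_unique[OF F])
    show "p \<in> M.wspan d x" unfolding p_def by (rule M.wspanI)
    fix w assume "w \<in> M.wspan d x"
    then obtain a where w: "w = (\<Sum>n\<le>d. scaleC (a n) (?e n))" by (rule M.wspanE)
    show "cinner (z - p) w = 0" unfolding w by (simp add: cinner.sum_right cinner_scaleC_right cinner.diff_left pe)
  qed
  then have "complex_of_real ((norm (proj (M.wspan d x) z))\<^sup>2) = cinner p z"
    using cinner_proj[OF F, of z z] by (simp add: cinner_self del: of_real_power)
  also have "cinner p z = (\<Sum>n\<le>d. complex_of_real ((cmod (cinner z (?e n)))\<^sup>2 / (norm (?e n))\<^sup>2))"
    unfolding p_def cinner.sum_left
  proof (rule sum.cong[OF refl])
    fix n
    have "cinner z (?e n) * cinner (?e n) z = complex_of_real ((cmod (cinner z (?e n)))\<^sup>2)"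
      using complex_norm_square[of "cinner z (?e n)"] cinner_commute[of "?e n" z] by simp
    then show "cinner (scaleC (cinner z (?e n) / cinner (?e n) (?e n)) (?e n)) z = complex_of_real ((cmod (cinner z (?e n)))\<^sup>2 / (norm (?e n))\<^sup>2)"
      by (simp add: cinner_scaleC_left cinner_self)
  qed
  also have "\<dots> = complex_of_real (\<Sum>n\<le>d. (cmod (cinner z (?e n)))\<^sup>2 / (norm (?e n))\<^sup>2)" by (simp only: of_real_sum)
  finally show ?thesis by (simp only: of_real_eq_iff)
qed

text \<open>By left invariance of \<open>\<mu>\<close> and invariance of \<open>S\<close> under
  \<open>K\<close>, each of the \<open>(m t)\<^sup>2\<close> translates of \<open>C0\<close> carries
  the same integral of \<open>S\<close>. The translates are disjoint and eventually avoid every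
  point, so by dominated convergence even the sum of these integrals tends to 0.\<close>

lemma C0_indicator_integral_decay:
  fixes S :: "complex^'m^'m \<Rightarrow> real"
  assumes S: "integrable \<mu> S" "\<And>g. S g \<ge> 0" and inv: "\<And>k g. k \<in> K \<Longrightarrow> g \<in> G \<Longrightarrow> S (k ** g) = S g"
  shows "((\<lambda>t. (exp t)\<^sup>2 * (LINT z|\<mu>. indicator C0 z * S (aa t ** z))) \<longlongrightarrow> 0) at_top"
proof -
  obtain D where D: "D > 0" and sep': "\<forall>t \<alpha> \<alpha>' \<beta> \<beta>' c c'. \<alpha> \<in> {0..1} \<longrightarrow> \<alpha>' \<in> {0..1} \<longrightarrow> \<beta> \<in> {0..1} \<longrightarrow> \<beta>' \<in> {0..1} \<longrightarrow> c \<in> C0 \<longrightarrow> c' \<in> C0 \<longrightarrow>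
    kk \<alpha> \<beta> ** aa t ** c = kk \<alpha>' \<beta>' ** aa t ** c' \<longrightarrow> (\<beta> - \<beta>')\<^sup>2 / 4 + (\<alpha> - \<alpha>')\<^sup>2 / 16 \<le> D * (exp (- t))\<^sup>2"
    using separation by (elim exE conjE)
  note sep = sep'[rule_format]
  \<comment> \<open>Distinct points of a grid of spacing \<open>r * exp (-t)\<close> with
    \<open>r\<^sup>2 > 16 D\<close> violate the bound of \<open>separation\<close>;
    \<open>m t\<close> counts the grid points used for each of the two angles.\<close>
  define r where "r = sqrt (16 * D) + 1"
  have r: "r > 0" "r\<^sup>2 > 16 * D"
  proof -
    show "r > 0" using D by (simp add: r_def add_nonneg_pos)
    have "(sqrt (16 * D))\<^sup>2 < r\<^sup>2" unfolding r_def using D by (intro power_strict_mono) auto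
    then show "r\<^sup>2 > 16 * D" using D by simp
  qed
  define m where "m t = nat \<lfloor>exp t / r\<rfloor>" for t
  define gr where "gr t i = real i * (r * exp (- t))" for t and i :: nat
  have gr01: "gr t i \<in> {0..1}" if "i < m t" for t i
  proof -
    have "real i \<le> exp t / r" using that r(1) unfolding m_def by linarith
    then have "real i * (r * exp (- t)) \<le> (exp t / r) * (r * exp (- t))" using r(1) by (intro mult_right_mono) auto
    also have "\<dots> = 1" using r(1) by (simp add: exp_minus field_simps)
    finally show ?thesis using r(1) by (simp add: gr_def)
  qed
  have gr_apart: "r\<^sup>2 * (exp (- t))\<^sup>2 \<le> (gr t i - gr t j)\<^sup>2" if "i \<noteq> j" for t i j
  proof -
    have "1 \<le> \<bar>real i - real j\<bar>" using that by linarith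
    then have "1\<^sup>2 \<le> \<bar>real i - real j\<bar>\<^sup>2" by (intro power_mono) auto
    then have "1 * (r * exp (- t))\<^sup>2 \<le> (real i - real j)\<^sup>2 * (r * exp (- t))\<^sup>2" by (intro mult_right_mono) auto
    then show ?thesis by (simp add: gr_def power_mult_distrib flip: left_diff_distrib)
  qed
  define I where "I t = {..<m t} \<times> {..<m t}" for t
  define g where "g t p = kk (gr t (fst p)) (gr t (snd p)) ** aa t" for t p
  define gi where "gi t p = mexp (- t *\<^sub>R B3) ** ki (gr t (fst p)) (gr t (snd p))" for t p
  have gG: "g t p \<in> G" "gi t p \<in> G" for t p
    unfolding g_def gi_def by (intro G_mult kk_G aa_G E_G basis_E)+
  have ginv: "g t p ** gi t p = mat 1" "gi t p ** g t p = mat 1" for t p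
  proof -
    have "g t p ** gi t p = kk (gr t (fst p)) (gr t (snd p)) ** (aa t ** (mexp (- t *\<^sub>R B3) ** ki (gr t (fst p)) (gr t (snd p))))"
      unfolding g_def gi_def by (simp only: matrix_mul_assoc)
    then show "g t p ** gi t p = mat 1" by (simp only: cancel_left[OF exp_inv(1)] kk_inv)
    have "gi t p ** g t p = mexp (- t *\<^sub>R B3) ** (ki (gr t (fst p)) (gr t (snd p)) ** (kk (gr t (fst p)) (gr t (snd p)) ** aa t))"
      unfolding g_def gi_def by (simp only: matrix_mul_assoc)
    then show "gi t p ** g t p = mat 1" by (simp only: cancel_left[OF kk_inv(2)] exp_inv)
  qed
  have undo: "z = g t p ** (gi t p ** z)" for t p and z :: "complex^'m^'m" by (simp only: cancel_left[OF ginv(1)])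
  have disj: "p = p'" if p: "p \<in> I t" "p' \<in> I t" and z: "gi t p ** z \<in> C0" "gi t p' ** z \<in> C0" for t p p' z
  proof (rule ccontr)
    assume "p \<noteq> p'"
    have "g t p ** (gi t p ** z) = g t p' ** (gi t p' ** z)" using undo[of z t p] undo[of z t p'] by simp
    then have "(gr t (snd p) - gr t (snd p'))\<^sup>2 / 4 + (gr t (fst p) - gr t (fst p'))\<^sup>2 / 16 \<le> D * (exp (- t))\<^sup>2"
      unfolding g_def by (intro sep[OF _ _ _ _ z] gr01) (use p in \<open>auto simp: I_def\<close>)
    moreover have "r\<^sup>2 * (exp (- t))\<^sup>2 \<le> (gr t (snd p) - gr t (snd p'))\<^sup>2 \<or> r\<^sup>2 * (exp (- t))\<^sup>2 \<le> (gr t (fst p) - gr t (fst p'))\<^sup>2"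
      using gr_apart[of "fst p" "fst p'" t] gr_apart[of "snd p" "snd p'" t] \<open>p \<noteq> p'\<close> by (metis prod.expand)
    moreover have "16 * D * (exp (- t))\<^sup>2 < r\<^sup>2 * (exp (- t))\<^sup>2" using r(2) by (intro mult_strict_right_mono) auto
    moreover have "0 \<le> (gr t (snd p) - gr t (snd p'))\<^sup>2" "0 \<le> (gr t (fst p) - gr t (fst p'))\<^sup>2" by simp_all
    ultimately show False by linarith
  qed
  \<comment> \<open>By disjointness this is the indicator function of the union of the
    translates.\<close>
  define \<xi> where "\<xi> t z = (\<Sum>p\<in>I t. indicator C0 (gi t p ** z) :: real)" for t z
  have fin: "finite (I t)" for t by (simp add: I_def)
  have \<xi>0: "\<xi> t z \<ge> 0" for t z unfolding \<xi>_def by (intro sum_nonneg) simp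
  have \<xi>1: "\<xi> t z \<le> 1" for t z
  proof (cases "\<exists>p\<in>I t. gi t p ** z \<in> C0")
    case True
    then obtain p where p: "p \<in> I t" "gi t p ** z \<in> C0" by blast
    have "\<xi> t z = (\<Sum>p'\<in>I t. if p' = p then 1 else 0)"
      unfolding \<xi>_def
    proof (rule sum.cong[OF refl])
      fix p' assume "p' \<in> I t"
      then show "indicator C0 (gi t p' ** z) = (if p' = p then 1 else (0::real))"
        using disj[of p' t p z] p by (cases "p' = p") (auto simp: indicator_def)
    qed
    also have "\<dots> \<le> 1" using fin by (subst sum.delta) auto
    finally show ?thesis .
  next
    case False
    then have "\<xi> t z = 0" unfolding \<xi>_def by (intro sum.neutral) (auto simp: indicator_def)
    then show ?thesis by simp
  qed
  have \<xi>_lim: "((\<lambda>t. \<xi> t z) \<longlongrightarrow> 0) at_top" if z: "z \<in> G" for z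
  proof (rule tendsto_eventually)
    show "\<forall>\<^sub>F t in at_top. \<xi> t z = 0"
      using escape[OF z]
    proof (rule eventually_mono)
      fix t assume e: "\<forall>\<alpha>. \<forall>\<beta>\<in>{0..1}. \<forall>c\<in>C0. kk \<alpha> \<beta> ** aa t ** c \<noteq> z"
      have "gi t p ** z \<notin> C0" if p: "p \<in> I t" for p
      proof
        assume c: "gi t p ** z \<in> C0"
        have "gr t (snd p) \<in> {0..1}" by (rule gr01) (use p in \<open>auto simp: I_def\<close>)
        with e c have "g t p ** (gi t p ** z) \<noteq> z" unfolding g_def by blast
        then show False using undo[of z t p] by simp
      qed
      then show "\<xi> t z = 0" unfolding \<xi>_def by (intro sum.neutral) (auto simp: indicator_def)
    qed
  qed
  have Cm: "(indicator C0 :: _ \<Rightarrow> real) \<in> borel_measurable \<mu>"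
    using compact_sets[OF compact_C0 C0_sub] by simp
  have Cgm: "(\<lambda>z. indicator C0 (gi t p ** z) :: real) \<in> borel_measurable \<mu>" for t p
    using measurable_compose[OF translate_measurable[OF gG(2)] Cm] by simp
  have Sm: "S \<in> borel_measurable \<mu>" using S(1) by simp
  have CSi: "integrable \<mu> (\<lambda>z. indicator C0 (gi t p ** z) * S z)" for t p
    by (rule Bochner_Integration.integrable_bound[OF S(1)])
      (use Cgm Sm in \<open>auto intro!: AE_I2 simp: indicator_def\<close>)
  define A where "A t = (LINT z|\<mu>. indicator C0 z * S (aa t ** z))" for t
  have A_eq: "A t = (LINT z|\<mu>. indicator C0 (gi t p ** z) * S z)" for t p
  proof -
    have "(LINT z|\<mu>. indicator C0 (gi t p ** z) * S z) = (LINT z|\<mu>. indicator C0 (gi t p ** (g t p ** z)) * S (g t p ** z))"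
      by (rule integral_translate[OF gG(1), symmetric]) (use Cgm Sm in auto)
    also have "\<dots> = A t" unfolding A_def
    proof (rule Bochner_Integration.integral_cong[OF refl])
      fix z assume "z \<in> space \<mu>"
      then have zG: "aa t ** z \<in> G" by (simp add: space_mu G_mult aa_G)
      have "S (g t p ** z) = S (kk (gr t (fst p)) (gr t (snd p)) ** (aa t ** z))"
        unfolding g_def by (simp only: matrix_mul_assoc)
      also have "\<dots> = S (aa t ** z)" by (rule inv[OF kk_K zG])
      finally show "indicator C0 (gi t p ** (g t p ** z)) * S (g t p ** z) = indicator C0 z * S (aa t ** z)"
        by (simp only: cancel_left[OF ginv(2)])
    qed
    finally show ?thesis by simp
  qed
  have A0: "A t \<ge> 0" for t unfolding A_def by (intro integral_nonneg_AE AE_I2) (simp add: S(2) indicator_def)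
  have sumA: "(real (m t))\<^sup>2 * A t = (LINT z|\<mu>. \<xi> t z * S z)" for t
  proof -
    have "(LINT z|\<mu>. \<xi> t z * S z) = (LINT z|\<mu>. (\<Sum>p\<in>I t. indicator C0 (gi t p ** z) * S z))"
      by (simp add: \<xi>_def sum_distrib_right)
    also have "\<dots> = (\<Sum>p\<in>I t. (LINT z|\<mu>. indicator C0 (gi t p ** z) * S z))"
      by (rule Bochner_Integration.integral_sum[OF CSi])
    also have "\<dots> = (\<Sum>p\<in>I t. A t)" by (rule sum.cong[OF refl A_eq[symmetric]])
    finally show ?thesis by (simp add: I_def power2_eq_square)
  qed
  have lim: "((\<lambda>t. LINT z|\<mu>. \<xi> t z * S z) \<longlongrightarrow> (LINT z|\<mu>. 0)) at_top"
  proof (rule integral_dominated_convergence_at_top[where w=S])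
    show "(\<lambda>z. \<xi> t z * S z) \<in> borel_measurable \<mu>" for t
      unfolding \<xi>_def by (intro borel_measurable_times borel_measurable_sum Cgm Sm)
    show "AE z in \<mu>. ((\<lambda>t. \<xi> t z * S z) \<longlongrightarrow> 0) at_top"
      by (intro AE_I2 tendsto_mult_left_zero \<xi>_lim) (simp add: space_mu)
    show "\<forall>\<^sub>F t in at_top. AE z in \<mu>. norm (\<xi> t z * S z) \<le> S z"
      using \<xi>0 \<xi>1 S(2) by (intro always_eventually allI AE_I2) (simp add: abs_mult mult_left_le_one_le)
  qed (use S(1) in simp_all)
  \<comment> \<open>The factor \<open>2 r\<close> pays for the rounding in \<open>m t\<close>, which
    is at least \<open>exp t / (2 r)\<close> once \<open>exp t > 2 r\<close>.\<close>
  have "((\<lambda>t. (2 * r)\<^sup>2 * (LINT z|\<mu>. \<xi> t z * S z)) \<longlongrightarrow> 0) at_top"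
    using tendsto_mult_right_zero[of "\<lambda>t. LINT z|\<mu>. \<xi> t z * S z" at_top "(2 * r)\<^sup>2"] lim by simp
  then have "((\<lambda>t. (exp t)\<^sup>2 * A t) \<longlongrightarrow> 0) at_top"
  proof (rule Lim_null_comparison[rotated])
    have "\<forall>\<^sub>F t in at_top. exp t > 2 * r"
      using filterlim_at_top_dense[THEN iffD1, OF exp_at_top] by blast
    then show "\<forall>\<^sub>F t in at_top. norm ((exp t)\<^sup>2 * A t) \<le> (2 * r)\<^sup>2 * (LINT z|\<mu>. \<xi> t z * S z)"
    proof (rule eventually_mono)
      fix t :: real assume "exp t > 2 * r"
      then have "2 < exp t / r" using r(1) by (simp add: pos_less_divide_eq)
      moreover have "w / 2 \<le> real (nat \<lfloor>w\<rfloor>)" if "2 < w" for w :: real using that by linarith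
      ultimately have "(exp t / r) / 2 \<le> real (m t)" unfolding m_def by blast
      then have "exp t \<le> (2 * r) * real (m t)" using r(1) by (simp add: field_simps)
      then have "(exp t)\<^sup>2 \<le> ((2 * r) * real (m t))\<^sup>2" by (intro power_mono) auto
      then have "(exp t)\<^sup>2 * A t \<le> ((2 * r) * real (m t))\<^sup>2 * A t" by (rule mult_right_mono[OF _ A0])
      also have "\<dots> = (2 * r)\<^sup>2 * ((real (m t))\<^sup>2 * A t)" by (simp only: power_mult_distrib mult.assoc)
      finally show "norm ((exp t)\<^sup>2 * A t) \<le> (2 * r)\<^sup>2 * (LINT z|\<mu>. \<xi> t z * S z)" using A0 by (simp add: sumA)
    qed
  qed
  then show ?thesis unfolding A_def .
qed

text \<open>The norm of the projection to a \<open>K\<close>-invariant subspace does not change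
  under left translation by \<open>K\<close>, as an individual coefficient would; so its square
  \<open>S\<close> is a legitimate input for \<open>C0_indicator_integral_decay\<close>, and it
  dominates the coefficient.\<close>

lemma smoothed_coefficient_decay:
  assumes sq: "\<And>v w. integrable \<mu> (\<lambda>a. (cmod (cinner (\<pi> a v) w))\<^sup>2)"
    and x: "x \<in> M.hw d" "x \<noteq> 0" and \<phi>: "\<phi> \<in> Phi q R" and e: "e \<in> M.wspan d x"
  shows "((\<lambda>t. exp t * (\<pi> (aa t) (J \<phi> v) \<bullet> e)) \<longlongrightarrow> 0) at_top"
proof -
  define F where "F = M.wspan d x"
  have cinv: "closed_invariant K \<pi> F" unfolding F_def by (rule wspan_closed_invariant[OF x])
  then have F: "complex_subspace F" "closed F" by (auto simp: closed_invariant_def)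
  define S where "S g = (norm (proj F (\<pi> g v)))\<^sup>2" for g
  have Si: "integrable \<mu> S"
    unfolding S_def F_def norm_proj_wspan[OF x] by (intro Bochner_Integration.integrable_sum integrable_divide_zero sq)
  have S0: "S g \<ge> 0" for g by (simp add: S_def)
  have Sinv: "S (k ** g) = S g" if "k \<in> K" "g \<in> G" for k g
    using that by (simp add: S_def pi_mult K_G proj_commute[OF cinv] pi_simps)
  define A where "A t = (LINT z|\<mu>. indicator C0 z * S (aa t ** z))" for t
  have A: "((\<lambda>t. (exp t)\<^sup>2 * A t) \<longlongrightarrow> 0) at_top"
    unfolding A_def by (rule C0_indicator_integral_decay[OF Si S0 Sinv])
  obtain M where M: "M \<ge> 0" "\<And>z. z \<in> G \<Longrightarrow> \<bar>psi \<phi> z\<bar> \<le> M" by (rule psi_bounded[OF \<phi>]) blast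
  define V where "V = measure \<mu> C0"
  have Ci: "integrable \<mu> (indicator C0 :: _ \<Rightarrow> real)"
    by (intro integrable_real_indicator compact_sets emeasure_compact compact_C0 C0_sub)
  have V: "(LINT z|\<mu>. indicator C0 z) = V" "V \<ge> 0"
    using C0_sub by (simp_all add: V_def space_mu Int_absorb2)
  have CSi: "integrable \<mu> (\<lambda>z. indicator C0 z * S (aa t ** z))" for t
  proof (rule Bochner_Integration.integrable_bound[OF integrable_translate[OF aa_G Si, of t]])
    show "(\<lambda>z. indicator C0 z * S (aa t ** z)) \<in> borel_measurable \<mu>"
      using Ci integrable_translate[OF aa_G Si, of t] by (intro borel_measurable_times) auto
  qed (auto intro!: AE_I2 simp: indicator_def)
  \<comment> \<open>The coefficient is controlled by the square root of \<open>S\<close>. The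
    inequality \<open>u \<le> \<epsilon> + u\<^sup>2 / \<epsilon>\<close> with
    \<open>u = exp t * sqrt S\<close> passes to \<open>S\<close>, and the constant
    \<open>\<epsilon>\<close> is integrated over the compact set \<open>C0\<close> only.\<close>
  have bound: "\<bar>exp t * (\<pi> (aa t) (J \<phi> v) \<bullet> e)\<bar> \<le> M * norm e * (\<epsilon> * V + (exp t)\<^sup>2 * A t / \<epsilon>)" if \<epsilon>: "\<epsilon> > 0" for t \<epsilon>
  proof -
    have tr: "integrable \<mu> (\<lambda>z. psi \<phi> z * (\<pi> z v \<bullet> \<pi> (aa (- t)) e))" by (rule coeff_integrable[OF psi_integrable[OF \<phi>]])
    have "\<pi> (aa t) (J \<phi> v) \<bullet> e = J \<phi> v \<bullet> \<pi> (aa (- t)) e"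
      by (rule pi_adjoint(2)[OF aa_G aa_G]) (rule exp_inv(2))
    also have "\<dots> = (LINT z|\<mu>. psi \<phi> z * (\<pi> z v \<bullet> \<pi> (aa (- t)) e))"
      unfolding J_def by (rule I_inner[OF psi_integrable[OF \<phi>]])
    finally have "\<bar>exp t * (\<pi> (aa t) (J \<phi> v) \<bullet> e)\<bar> = \<bar>LINT z|\<mu>. exp t * (psi \<phi> z * (\<pi> z v \<bullet> \<pi> (aa (- t)) e))\<bar>" by simp
    also have "\<dots> \<le> (LINT z|\<mu>. \<bar>exp t * (psi \<phi> z * (\<pi> z v \<bullet> \<pi> (aa (- t)) e))\<bar>)" by (rule integral_abs_bound)
    also have "\<dots> \<le> (LINT z|\<mu>. M * norm e * (\<epsilon> * indicator C0 z + ((exp t)\<^sup>2 / \<epsilon>) * (indicator C0 z * S (aa t ** z))))"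
    proof (rule integral_mono)
      show "integrable \<mu> (\<lambda>z. \<bar>exp t * (psi \<phi> z * (\<pi> z v \<bullet> \<pi> (aa (- t)) e))\<bar>)" using tr by simp
      show "integrable \<mu> (\<lambda>z. M * norm e * (\<epsilon> * indicator C0 z + ((exp t)\<^sup>2 / \<epsilon>) * (indicator C0 z * S (aa t ** z))))"
        by (intro integrable_mult_right Bochner_Integration.integrable_add Ci CSi)
      fix z assume "z \<in> space \<mu>"
      then have z: "z \<in> G" by (simp add: space_mu)
      show "\<bar>exp t * (psi \<phi> z * (\<pi> z v \<bullet> \<pi> (aa (- t)) e))\<bar> \<le> M * norm e * (\<epsilon> * indicator C0 z + ((exp t)\<^sup>2 / \<epsilon>) * (indicator C0 z * S (aa t ** z)))"
      proof (cases "z \<in> C0")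
        case False then show ?thesis using psi_support[OF \<phi> z] by simp
      next
        case True
        define s where "s = norm (proj F (\<pi> (aa t ** z) v))"
        have "\<pi> z v \<bullet> \<pi> (aa (- t)) e = \<pi> (aa t ** z) v \<bullet> e"
          unfolding pi_mult[OF aa_G z] by (rule pi_adjoint(2)[OF aa_G aa_G, symmetric]) (rule exp_inv(2))
        also have "\<dots> = proj F (\<pi> (aa t ** z) v) \<bullet> e"
        proof -
          have "cinner (\<pi> (aa t ** z) v - proj F (\<pi> (aa t ** z) v)) e = 0" by (rule proj_orth[OF F]) (simp add: F_def e)
          then have "(\<pi> (aa t ** z) v - proj F (\<pi> (aa t ** z) v)) \<bullet> e = 0" by (metis Re_cinner zero_complex.sel(1))
          then show ?thesis by (simp add: inner_diff_left)
        qed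
        finally have c: "\<bar>\<pi> z v \<bullet> \<pi> (aa (- t)) e\<bar> \<le> s * norm e" using Cauchy_Schwarz_ineq2 by (simp add: s_def)
        have "\<bar>exp t * (psi \<phi> z * (\<pi> z v \<bullet> \<pi> (aa (- t)) e))\<bar> = exp t * (\<bar>psi \<phi> z\<bar> * \<bar>\<pi> z v \<bullet> \<pi> (aa (- t)) e\<bar>)"
          by (simp add: abs_mult)
        also have "\<dots> \<le> exp t * (M * (s * norm e))" using M(2)[OF z] c M(1) by (intro mult_left_mono mult_mono) auto
        also have "\<dots> = M * norm e * (exp t * s)" by simp
        also have "\<dots> \<le> M * norm e * (\<epsilon> + (exp t * s)\<^sup>2 / \<epsilon>)"
        proof (rule mult_left_mono)
          have "exp t * s \<le> \<epsilon> + (exp t * s)\<^sup>2 / \<epsilon>"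
          proof (cases "exp t * s \<le> \<epsilon>")
            case True then show ?thesis using \<epsilon> by (simp add: add_increasing2)
          next
            case False
            then have "\<epsilon> * (exp t * s) \<le> (exp t * s) * (exp t * s)" using \<epsilon> by (intro mult_right_mono) auto
            then have "exp t * s \<le> (exp t * s)\<^sup>2 / \<epsilon>" using \<epsilon> by (simp only: power2_eq_square pos_le_divide_eq mult.commute)
            then show ?thesis using \<epsilon> by linarith
          qed
          then show "exp t * s \<le> \<epsilon> + (exp t * s)\<^sup>2 / \<epsilon>" .
          show "0 \<le> M * norm e" using M(1) by simp
        qed
        also have "\<dots> = M * norm e * (\<epsilon> * indicator C0 z + ((exp t)\<^sup>2 / \<epsilon>) * (indicator C0 z * S (aa t ** z)))"
          using True by (simp add: S_def s_def power_mult_distrib)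
        finally show ?thesis .
      qed
    qed
    also have "\<dots> = M * norm e * (\<epsilon> * V + ((exp t)\<^sup>2 / \<epsilon>) * A t)"
    proof -
      have "(LINT z|\<mu>. \<epsilon> * indicator C0 z + ((exp t)\<^sup>2 / \<epsilon>) * (indicator C0 z * S (aa t ** z))) = \<epsilon> * V + ((exp t)\<^sup>2 / \<epsilon>) * A t"
        unfolding V(1)[symmetric] A_def
        by (subst Bochner_Integration.integral_add) (intro integrable_mult_right Ci CSi, intro integrable_mult_right Ci CSi, simp only: integral_mult_right_zero)
      then show ?thesis by (simp only: integral_mult_right_zero)
    qed
    finally show ?thesis by simp
  qed
  show ?thesis
  proof (rule tendstoI)
    fix \<delta> :: real assume \<delta>: "\<delta> > 0"
    define H where "H = M * norm e + 1"
    have H: "H > 0" "M * norm e \<le> H" using M(1) by (simp_all add: H_def add_nonneg_pos)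
    \<comment> \<open>Makes the first term of \<open>bound\<close> smaller than
      \<open>\<delta> / 2\<close>; with this \<open>\<epsilon>\<close> fixed, large \<open>t\<close>
      takes care of the second.\<close>
    define \<epsilon> where "\<epsilon> = \<delta> / (2 * H * (V + 1))"
    have \<epsilon>: "\<epsilon> > 0" using \<delta> H V(2) by (simp add: \<epsilon>_def)
    have \<epsilon>V: "H * (\<epsilon> * V) < \<delta> / 2"
    proof -
      have "H * (\<epsilon> * V) = (\<delta> / 2) * (V / (V + 1))" using H(1) by (simp add: \<epsilon>_def)
      also have "\<dots> < (\<delta> / 2) * 1" using \<delta> V(2) by (intro mult_strict_left_mono) auto
      finally show ?thesis by simp
    qed
    have "\<forall>\<^sub>F t in at_top. dist ((exp t)\<^sup>2 * A t) 0 < \<epsilon> * (\<delta> / (2 * H))"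
      using tendstoD[OF A, of "\<epsilon> * (\<delta> / (2 * H))"] \<epsilon> \<delta> H(1) by simp
    then show "\<forall>\<^sub>F t in at_top. dist (exp t * (\<pi> (aa t) (J \<phi> v) \<bullet> e)) 0 < \<delta>"
    proof (rule eventually_mono)
      fix t assume "dist ((exp t)\<^sup>2 * A t) 0 < \<epsilon> * (\<delta> / (2 * H))"
      then have "(exp t)\<^sup>2 * A t \<le> \<epsilon> * (\<delta> / (2 * H))" by simp
      then have "(exp t)\<^sup>2 * A t / \<epsilon> \<le> \<delta> / (2 * H)" using \<epsilon> by (simp only: pos_divide_le_eq mult.commute)
      then have "H * ((exp t)\<^sup>2 * A t / \<epsilon>) \<le> H * (\<delta> / (2 * H))" using H(1) by (intro mult_left_mono) auto
      then have 1: "H * ((exp t)\<^sup>2 * A t / \<epsilon>) \<le> \<delta> / 2" using H(1) by simp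
      have A0: "A t \<ge> 0" unfolding A_def by (intro integral_nonneg_AE AE_I2) (simp add: S0 indicator_def)
      have "\<bar>exp t * (\<pi> (aa t) (J \<phi> v) \<bullet> e)\<bar> \<le> M * norm e * (\<epsilon> * V + (exp t)\<^sup>2 * A t / \<epsilon>)" by (rule bound[OF \<epsilon>])
      also have "\<dots> \<le> H * (\<epsilon> * V + (exp t)\<^sup>2 * A t / \<epsilon>)" using H(2) \<epsilon> V(2) A0 by (intro mult_right_mono) auto
      also have "\<dots> < \<delta>" unfolding distrib_left using 1 \<epsilon>V by linarith
      finally show "dist (exp t * (\<pi> (aa t) (J \<phi> v) \<bullet> e)) 0 < \<delta>" by simp
    qed
  qed
qed

lemma coefficient_decay:
  assumes sq: "\<And>v w. integrable \<mu> (\<lambda>a. (cmod (cinner (\<pi> a v) w))\<^sup>2)"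
    and x: "x \<in> M.hw d" and y: "y \<in> YY"
  shows "((\<lambda>t. exp t *\<^sub>R cinner (\<pi> (aa t) y) (M.wt x n)) \<longlongrightarrow> 0) at_top"
proof (cases "x = 0")
  case True
  then have "M.wt x n = 0" by (induction n) (simp_all add: M.wt_Suc M.Jm_def dpi_real_linear basis_E)
  then show ?thesis by simp
next
  case False
  have real: "((\<lambda>t. exp t * (\<pi> (aa t) y \<bullet> e)) \<longlongrightarrow> 0) at_top" if e: "e \<in> M.wspan d x" for e
    using y
  proof (rule YY_induct)
    show "subspace {y. ((\<lambda>t. exp t * (\<pi> (aa t) y \<bullet> e)) \<longlongrightarrow> 0) at_top}"
    proof (rule subspaceI)
      show "0 \<in> {y. ((\<lambda>t. exp t * (\<pi> (aa t) y \<bullet> e)) \<longlongrightarrow> 0) at_top}" by (simp add: pi_simps aa_G)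
    next
      fix y z assume "y \<in> {y. ((\<lambda>t. exp t * (\<pi> (aa t) y \<bullet> e)) \<longlongrightarrow> 0) at_top}"
        "z \<in> {y. ((\<lambda>t. exp t * (\<pi> (aa t) y \<bullet> e)) \<longlongrightarrow> 0) at_top}"
      then have "((\<lambda>t. exp t * (\<pi> (aa t) y \<bullet> e) + exp t * (\<pi> (aa t) z \<bullet> e)) \<longlongrightarrow> 0) at_top"
        using tendsto_add_zero by blast
      then show "y + z \<in> {y. ((\<lambda>t. exp t * (\<pi> (aa t) y \<bullet> e)) \<longlongrightarrow> 0) at_top}"
        by (simp add: pi_simps aa_G inner_add_left distrib_left)
    next
      fix c y assume "y \<in> {y. ((\<lambda>t. exp t * (\<pi> (aa t) y \<bullet> e)) \<longlongrightarrow> 0) at_top}"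
      then have "((\<lambda>t. c * (exp t * (\<pi> (aa t) y \<bullet> e))) \<longlongrightarrow> 0) at_top"
        using tendsto_mult_right_zero by blast
      then show "c *\<^sub>R y \<in> {y. ((\<lambda>t. exp t * (\<pi> (aa t) y \<bullet> e)) \<longlongrightarrow> 0) at_top}"
        by (simp add: pi_simps aa_G mult.left_commute)
    qed
  next
    fix \<phi> v assume "\<phi> \<in> Phi q R"
    then show "((\<lambda>t. exp t * (\<pi> (aa t) (J \<phi> v) \<bullet> e)) \<longlongrightarrow> 0) at_top"
      by (rule smoothed_coefficient_decay[OF sq x False _ e])
  qed
  have w: "M.wt x n \<in> M.wspan d x" by (rule M.wt_wspan[OF x])
  \<comment> \<open>Pairing with \<open>\<i>\<close> times the weight vector yields the imaginary
    part of the coefficient, so real decay on the whole span is enough.\<close>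
  have iw: "scaleC \<i> (M.wt x n) \<in> M.wspan d x" by (rule complex_subspace_scaleC[OF M.wspan_subspace w])
  have "((\<lambda>t. Complex (exp t * (\<pi> (aa t) y \<bullet> M.wt x n)) (exp t * (\<pi> (aa t) y \<bullet> scaleC \<i> (M.wt x n)))) \<longlongrightarrow> Complex 0 0) at_top"
    by (intro tendsto_Complex real w iw)
  moreover have "Complex (exp t * (\<pi> (aa t) y \<bullet> M.wt x n)) (exp t * (\<pi> (aa t) y \<bullet> scaleC \<i> (M.wt x n)))
      = exp t *\<^sub>R cinner (\<pi> (aa t) y) (M.wt x n)" for t
    by (simp add: complex_eq_iff Re_cinner Im_cinner)
  ultimately show ?thesis by (simp add: Complex_eq)
qed

lemma not_admissible:
  assumes sq: "\<And>v w. integrable \<mu> (\<lambda>a. (cmod (cinner (\<pi> a v) w))\<^sup>2)" and v: "(v :: 'h) \<noteq> 0"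
  shows "\<not> admissible_restriction K \<pi>"
proof
  assume adm: "admissible_restriction K \<pi>"
  interpret L: lorentz_module YY "dpi L1" "dpi L2" "dpi L3" "dpi B1" "dpi B2" "dpi B3" "\<lambda>t. \<pi> (aa t)"
    by (rule lorentz_module) (rule hw_findim[OF adm])
  obtain d y where y: "y \<in> M.hw d" "y \<noteq> 0" using highest_weight_vector[OF v] by blast
  show False
    by (rule L.decay_contradiction[OF y]) (rule coefficient_decay[OF sq])
qed

end

theorem proposition2:
  fixes n :: nat
    and G K\<^sub>1 \<kk> :: "(complex^'m^'m) set"
    and f :: "complex^'m^'m \<Rightarrow> real^(3 + 'q::finite)^(3 + 'q)"
    and \<pi> :: "complex^'m^'m \<Rightarrow> 'h::complex_hilbert_space \<Rightarrow> 'h"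
  assumes "n \<ge> 1" and "CARD('q) = 2 * n"
    and "matrix_lie_group G" and "connected G"
    and "local_isomorphism G SO_group f"
    and "maximal_compactly_embedded (lie_algebra G) \<kk>"
    and "lie_differential f ` \<kk> = so_blocks"
    and "K\<^sub>1 = analytic_subgroup {X \<in> \<kk>. lie_differential f X \<in> so_first_block}"
    and "irreducible_unitary_rep G \<pi>" and "square_integrable_rep G \<pi>"
  shows "\<not> admissible_restriction K\<^sub>1 \<pi>"
proof -
  have sub: "\<kk> \<subseteq> lie_algebra G"
    using assms(6) by (simp add: maximal_compactly_embedded_def compactly_embedded_def lie_subalgebra_def)
  obtain L1 L2 L3 B1 B2 B3 where so: "so31 L1 L2 L3 B1 B2 B3" and in_G: "{L1, L2, L3, B1, B2, B3} \<subseteq> lie_algebra G"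
    and span: "{X \<in> \<kk>. lie_differential f X \<in> so_first_block} = {a *\<^sub>R L1 + b *\<^sub>R L2 + c *\<^sub>R L3 |a b c. True}"
    using so31_subalgebra[OF assms(3,5) sub assms(7)] by blast
  interpret so31 L1 L2 L3 B1 B2 B3 by (rule so)
  obtain \<mu> where haar: "haar_measure G \<mu>" and sq: "\<And>v w. integrable \<mu> (\<lambda>a. (cmod (cinner (\<pi> a v) w))\<^sup>2)"
    using assms(10) by (auto simp: square_integrable_rep_def)
  have rep: "unitary_rep G \<pi>" and irr: "irreducible_on G \<pi> UNIV"
    using assms(9) by (simp_all add: irreducible_unitary_rep_def)
  obtain v :: 'h where v: "v \<noteq> 0" using irr unfolding irreducible_on_def by auto
  obtain b :: "complex^'m^'m \<Rightarrow> complex^'m^'m \<Rightarrow> real" where b: "bounded_bilinear b" "\<And>x y. b x y = b y x" "\<And>x. x \<noteq> 0 \<Longrightarrow> b x x > 0"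
    "\<And>x. b (L1 ** x) x = 0" "\<And>x. b (L2 ** x) x = 0" "\<And>x. b (L3 ** x) x = 0"
    by (rule invariant_form) blast
  have "a1 *\<^sub>R L1 + a2 *\<^sub>R L2 + a3 *\<^sub>R L3 \<in> \<kk>" for a1 a2 a3
    using equalityD2[OF span] by blast
  then have span_G: "a1 *\<^sub>R L1 + a2 *\<^sub>R L2 + a3 *\<^sub>R L3 \<in> lie_algebra G" for a1 a2 a3
    using sub by blast
  have "K\<^sub>1 = generate GL (mexp ` {a *\<^sub>R L1 + b *\<^sub>R L2 + c *\<^sub>R L3 |a b c. True})"
    unfolding assms(8) analytic_subgroup_def span by (rule refl)
  then interpret rep_K L1 L2 L3 B1 B2 B3 G \<mu> \<pi> b K\<^sub>1
    by (intro rep_K.intro rep.intro rep_axioms.intro rep_K_axioms.intro so assms(3) rep haar in_G b span_G)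
  show ?thesis by (rule not_admissible[OF sq v])
qed

end
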